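(* Let the random weights, the activation $\sigma$, the target function, the training data and the test data satisfy the assumptions listed in the context (Gaussian weights, activation assumptions, target assumption, data assumption), suppose $\sigma$ is not a linear function, and let $\lambda\ge0$ be the ridge parameter. Then, for any $\varepsilon\in(0,1/2)$, the difference of test errors satisfies $$\left|\mathcal{L}(\hat f^{(RF)}_\lambda)-\mathcal{L}(\hat f^{(K)}_\lambda)\right|=o\left((n/d_1)^{\frac12-\varepsilon}\right)$$ with probability $1-o(1)$, when $n/d_1\to0$ and $n\to\infty$.
   Context: Weights. $W\in\mathbb{R}^{d_1\times d_0}$ has i.i.d. $\mathcal{N}(0,1)$ entries with rows $\mathbf{w}_i^\top$, independent of everything else. Activation assumptions. $\sigma:\mathbb{R}\to\mathbb{R}$ is Lipschitz with constant $\lambda_\sigma\in(0,\infty)$; for $\xi\sim\mathcal{N}(0,1)$, $\mathbb{E}[\sigma(\xi)]=0$ and $\mathbb{E}[\sigma(\xi)^2]=1$. Moreover, either (1) $\sigma$ is twice differentiable with $\sup_x|\sigma''(x)|\le\lambda_\sigma$, or (2) $\sigma(x)=ax+b$ for $x>0$ and $\sigma(x)=cx+b$ for $x\le0$, with constants $a,b,c\in\mathbb{R}$ such that the two normalizations hold. $(\varepsilon,B)$-orthonormality. A matrix $X=(\mathbf{x}_1,\dots,\mathbf{x}_n)$ is $(\varepsilon,B)$-orthonormal if for all distinct columns $\mathbf{x}_\alpha,\mathbf{x}_\beta$: $|\|\mathbf{x}_\alpha\|-1|\le\varepsilon$, $|\|\mathbf{x}_\beta\|-1|\le\varepsilon$,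 $|\mathbf{x}_\alpha^\top\mathbf{x}_\beta|\le\varepsilon$, and also the sum of $(\|\mathbf{x}_\alpha\|-1)^2$ over all columns is at most $B^2$ and $\|X\|\le B$ (spectral norm). Target assumption. The target function is $f^*(\mathbf{x})=\langle\boldsymbol{\beta}^*,\mathbf{x}\rangle$ with random $\boldsymbol{\beta}^*\sim\mathcal{N}(0,\sigma_{\boldsymbol\beta}^2\mathrm{Id})$ in $\mathbb{R}^{d_0}$, and the training labels are $\mathbf{y}=X^\top\boldsymbol{\beta}^*+\boldsymbol{\epsilon}$, with $\boldsymbol{\epsilon}\sim\mathcal{N}(\mathbf{0},\sigma_{\boldsymbol\epsilon}^2\mathrm{Id})$ in $\mathbb{R}^n$ independent of $\boldsymbol{\beta}^*$. Data assumption. The (deterministic) training data $X=[\mathbf{x}_1,\dots,\mathbf{x}_n]\in\mathbb{R}^{d_0\times n}$ is $(\varepsilon_n,B)$-orthonormal with $B$ a constant and $n\varepsilon_n^4=o(1)$; the random test point $\mathbf{x}\in\mathbb{R}^{d_0}$ is independent of $X$ and $\mathbf{y}$, and $\tilde X:=[\mathbf{x}_1,\dots,\mathbf{x}_n,\mathbf{x}]\in\mathbb{R}^{d_0\times(n+1)}$ is also $(\varepsilon_n,B)$-orthonormal; moreover $\mathbb{E}_{\mathbf{x}}[\mathbf{x}\mathbf{x}^\top]=\frac1{d_0}\mathrm{Id}$. Kernels and predictors. For $\mathbf{x},\mathbf{z}\in\mathbb{R}^{d_0}$, $K_n(\mathbf{x},\mathbf{z}):=\frac1{d_1}\sum_{i=1}^{d_1}\sigma(\langle\mathbf{w}_i,\mathbf{x}\rangle)\sigma(\langle\mathbf{w}_i,\mathbf{z}\rangle)$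 and $K(\mathbf{x},\mathbf{z}):=\mathbb{E}_{\mathbf{w}\sim\mathcal{N}(0,\mathrm{Id})}[\sigma(\langle\mathbf{w},\mathbf{x}\rangle)\sigma(\langle\mathbf{w},\mathbf{z}\rangle)]$. For $k\in\{K_n,K\}$, $k(X,X)=(k(\mathbf{x}_i,\mathbf{x}_j))_{i,j}$ and $k(\mathbf{x},X)=[k(\mathbf{x},\mathbf{x}_1),\dots,k(\mathbf{x},\mathbf{x}_n)]$. Define $$\hat f^{(RF)}_\lambda(\mathbf{x}):=K_n(\mathbf{x},X)(K_n(X,X)+\lambda\mathrm{Id})^{-1}\mathbf{y},\qquad \hat f^{(K)}_\lambda(\mathbf{x}):=K(\mathbf{x},X)(K(X,X)+\lambda\mathrm{Id})^{-1}\mathbf{y}.$$ The test error of a predictor $\hat f$ is $\mathcal{L}(\hat f):=\mathbb{E}_{\mathbf{x}}[|\hat f(\mathbf{x})-f^*(\mathbf{x})|^2]$, the expectation being over the test point only; the probability $1-o(1)$ is over $W,\boldsymbol{\beta}^*,\boldsymbol{\epsilon}$. *)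

theory Defs
  imports "HOL-Probability.Probability" "Jordan_Normal_Form.Gauss_Jordan_Elimination"
begin

text \<open>
  All dimensions vary with the sample size, so vectors and matrices are the carrier-based ones of
  Jordan_Normal_Form; their notation replaces the type-indexed one of HOL-Analysis.
\<close>

unbundle no inner_syntax
unbundle no vec_syntax

type_synonym rvec = "real Matrix.vec"
type_synonym rmat = "real Matrix.mat"

definition enorm :: "rvec \<Rightarrow> real" where
  "enorm v = sqrt (v \<bullet> v)"

definition spectral_norm :: "rmat \<Rightarrow> real" where
  "spectral_norm A = (SUP v \<in> {v \<in> carrier_vec (dim_col A). enorm v \<le> 1}. enorm (A *\<^sub>v v))"

definition orthonormal_within :: "real \<Rightarrow> real \<Rightarrow> rmat \<Rightarrow> bool" where
  "orthonormal_within e B X \<longleftrightarrow>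
     (\<forall>a<dim_col X. \<forall>b<dim_col X. a \<noteq> b \<longrightarrow>
        \<bar>enorm (col X a) - 1\<bar> \<le> e \<and> \<bar>enorm (col X b) - 1\<bar> \<le> e \<and> \<bar>col X a \<bullet> col X b\<bar> \<le> e) \<and>
     (\<Sum>a<dim_col X. (enorm (col X a) - 1)\<^sup>2) \<le> B\<^sup>2 \<and>
     spectral_norm X \<le> B"

definition append_column :: "rmat \<Rightarrow> rvec \<Rightarrow> rmat" where
  "append_column X x = mat_of_cols (dim_row X) (cols X @ [x])"

definition std_normal :: "real measure" where
  "std_normal = density lborel std_normal_density"

text \<open>The law of mean 0 and standard deviation s; defined by scaling so that s = 0 gives the
  point mass at 0.\<close>

definition centered_normal :: "real \<Rightarrow> real measure" where
  "centered_normal s = distr std_normal borel (\<lambda>z. s * z)"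

text \<open>Random vectors and matrices are functions into the Jordan_Normal_Form types, which carry no
  measurable structure; measurability, laws and independence are expressed through the entries.\<close>

definition vec_algebra :: "nat \<Rightarrow> (nat \<Rightarrow> real) measure" where
  "vec_algebra d = (\<Pi>\<^sub>M i\<in>{..<d}. borel)"

definition vec_entries :: "nat \<Rightarrow> rvec \<Rightarrow> nat \<Rightarrow> real" where
  "vec_entries d v = (\<lambda>i\<in>{..<d}. v $ i)"

definition mat_algebra :: "nat \<Rightarrow> nat \<Rightarrow> (nat \<times> nat \<Rightarrow> real) measure" where
  "mat_algebra r c = (\<Pi>\<^sub>M p\<in>{..<r} \<times> {..<c}. borel)"

definition mat_entries :: "nat \<Rightarrow> nat \<Rightarrow> rmat \<Rightarrow> nat \<times> nat \<Rightarrow> real" where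
  "mat_entries r c A = (\<lambda>p\<in>{..<r} \<times> {..<c}. A $$ p)"

definition random_vec :: "'w measure \<Rightarrow> nat \<Rightarrow> ('w \<Rightarrow> rvec) \<Rightarrow> bool" where
  "random_vec M d v \<longleftrightarrow>
     (\<forall>\<omega>\<in>space M. v \<omega> \<in> carrier_vec d) \<and> (\<forall>i<d. (\<lambda>\<omega>. v \<omega> $ i) \<in> borel_measurable M)"

definition gaussian_vec :: "'w measure \<Rightarrow> nat \<Rightarrow> real \<Rightarrow> ('w \<Rightarrow> rvec) \<Rightarrow> bool" where
  "gaussian_vec M d s v \<longleftrightarrow>
     random_vec M d v \<and>
     prob_space.indep_vars M (\<lambda>_. borel) (\<lambda>i \<omega>. v \<omega> $ i) {..<d} \<and>
     (\<forall>i<d. distr M borel (\<lambda>\<omega>. v \<omega> $ i) = centered_normal s)"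

definition gaussian_weights :: "'w measure \<Rightarrow> nat \<Rightarrow> nat \<Rightarrow> ('w \<Rightarrow> rmat) \<Rightarrow> bool" where
  "gaussian_weights M d1 d0 W \<longleftrightarrow>
     (\<forall>\<omega>\<in>space M. W \<omega> \<in> carrier_mat d1 d0) \<and>
     prob_space.indep_vars M (\<lambda>_. borel) (\<lambda>p \<omega>. W \<omega> $$ p) ({..<d1} \<times> {..<d0}) \<and>
     (\<forall>p\<in>{..<d1} \<times> {..<d0}. distr M borel (\<lambda>\<omega>. W \<omega> $$ p) = std_normal)"

definition labels :: "rmat \<Rightarrow> rvec \<Rightarrow> rvec \<Rightarrow> rvec" where
  "labels X \<beta> \<eta> = transpose_mat X *\<^sub>v \<beta> + \<eta>"

definition activation_assumption :: "real \<Rightarrow> (real \<Rightarrow> real) \<Rightarrow> bool" where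
  "activation_assumption l \<sigma> \<longleftrightarrow>
     0 < l \<and> l-lipschitz_on UNIV \<sigma> \<and>
     (\<integral>z. \<sigma> z \<partial>std_normal) = 0 \<and> (\<integral>z. (\<sigma> z)\<^sup>2 \<partial>std_normal) = 1 \<and>
     ((\<exists>\<sigma>' \<sigma>''. \<forall>x. (\<sigma> has_real_derivative \<sigma>' x) (at x) \<and>
          (\<sigma>' has_real_derivative \<sigma>'' x) (at x) \<and> \<bar>\<sigma>'' x\<bar> \<le> l) \<or>
      (\<exists>a b c. \<forall>x. \<sigma> x = (if 0 < x then a * x + b else c * x + b)))"

text \<open>The library's indep_var requires both variables to have the same codomain type.\<close>

definition indep_pair ::
  "'w measure \<Rightarrow> 'a measure \<Rightarrow> ('w \<Rightarrow> 'a) \<Rightarrow> 'b measure \<Rightarrow> ('w \<Rightarrow> 'b) \<Rightarrow> bool" where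
  "indep_pair M S f T g \<longleftrightarrow>
     f \<in> M \<rightarrow>\<^sub>M S \<and> g \<in> M \<rightarrow>\<^sub>M T \<and>
     prob_space.indep_set M
       (sets (vimage_algebra (space M) f S)) (sets (vimage_algebra (space M) g T))"

text \<open>The test point and the labels are only assumed independent of each other, and the weights
  independent of the joint vector of all other random quantities. The second-moment condition
  includes square integrability of the test point: a non-integrable diagonal entry would have
  Bochner integral 0, not 1 / d0.\<close>

definition randomness_assumption ::
  "'w measure \<Rightarrow> nat \<Rightarrow> nat \<Rightarrow> nat \<Rightarrow> real \<Rightarrow> real \<Rightarrow> rmat \<Rightarrow>
   ('w \<Rightarrow> rmat) \<Rightarrow> ('w \<Rightarrow> rvec) \<Rightarrow> ('w \<Rightarrow> rvec) \<Rightarrow> ('w \<Rightarrow> rvec) \<Rightarrow> bool" where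
  "randomness_assumption M n d0 d1 s\<^sub>\<beta> s\<^sub>\<epsilon> X W \<beta> \<eta> x \<longleftrightarrow>
     prob_space M \<and>
     gaussian_weights M d1 d0 W \<and> gaussian_vec M d0 s\<^sub>\<beta> \<beta> \<and> gaussian_vec M n s\<^sub>\<epsilon> \<eta> \<and>
     random_vec M d0 x \<and>
     indep_pair M
       (mat_algebra d1 d0) (\<lambda>\<omega>. mat_entries d1 d0 (W \<omega>))
       (vec_algebra d0 \<Otimes>\<^sub>M vec_algebra n \<Otimes>\<^sub>M vec_algebra d0)
       (\<lambda>\<omega>. (vec_entries d0 (\<beta> \<omega>), vec_entries n (\<eta> \<omega>), vec_entries d0 (x \<omega>))) \<and>
     indep_pair M
       (vec_algebra d0) (\<lambda>\<omega>. vec_entries d0 (\<beta> \<omega>)) (vec_algebra n) (\<lambda>\<omega>. vec_entries n (\<eta> \<omega>)) \<and>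
     indep_pair M
       (vec_algebra d0) (\<lambda>\<omega>. vec_entries d0 (x \<omega>))
       (vec_algebra n) (\<lambda>\<omega>. vec_entries n (labels X (\<beta> \<omega>) (\<eta> \<omega>)))"

definition data_assumption ::
  "'w measure \<Rightarrow> nat \<Rightarrow> nat \<Rightarrow> real \<Rightarrow> real \<Rightarrow> rmat \<Rightarrow> ('w \<Rightarrow> rvec) \<Rightarrow> bool" where
  "data_assumption M n d0 e B X x \<longleftrightarrow>
     X \<in> carrier_mat d0 n \<and> orthonormal_within e B X \<and>
     (AE \<omega> in M. orthonormal_within e B (append_column X (x \<omega>))) \<and>
     Matrix.mat d0 d0 (\<lambda>(i, j). \<integral>\<omega>. x \<omega> $ i * x \<omega> $ j \<partial>M) = (1 / real d0) \<cdot>\<^sub>m 1\<^sub>m d0"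

definition rf_kernel :: "(real \<Rightarrow> real) \<Rightarrow> rmat \<Rightarrow> rvec \<Rightarrow> rvec \<Rightarrow> real" where
  "rf_kernel \<sigma> W x z =
     (1 / real (dim_row W)) * (\<Sum>i<dim_row W. \<sigma> (Matrix.row W i \<bullet> x) * \<sigma> (Matrix.row W i \<bullet> z))"

definition limit_kernel :: "(real \<Rightarrow> real) \<Rightarrow> nat \<Rightarrow> rvec \<Rightarrow> rvec \<Rightarrow> real" where
  "limit_kernel \<sigma> d0 x z =
     (\<integral>w. \<sigma> (Matrix.vec d0 w \<bullet> x) * \<sigma> (Matrix.vec d0 w \<bullet> z) \<partial>(\<Pi>\<^sub>M i\<in>{..<d0}. std_normal))"

definition kernel_matrix :: "(rvec \<Rightarrow> rvec \<Rightarrow> real) \<Rightarrow> rmat \<Rightarrow> rmat" where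
  "kernel_matrix k X = Matrix.mat (dim_col X) (dim_col X) (\<lambda>(i, j). k (col X i) (col X j))"

definition kernel_row :: "(rvec \<Rightarrow> rvec \<Rightarrow> real) \<Rightarrow> rvec \<Rightarrow> rmat \<Rightarrow> rvec" where
  "kernel_row k x X = Matrix.vec (dim_col X) (\<lambda>i. k x (col X i))"

text \<open>Singular matrices get inverse 0. Only ridge parameter 0 can produce a singular matrix
  below, since the kernel matrices are positive semidefinite.\<close>

definition minv :: "rmat \<Rightarrow> rmat" where
  "minv A = (case mat_inverse A of Some C \<Rightarrow> C | None \<Rightarrow> 0\<^sub>m (dim_row A) (dim_col A))"

definition ridge_predictor ::
  "(rvec \<Rightarrow> rvec \<Rightarrow> real) \<Rightarrow> real \<Rightarrow> rmat \<Rightarrow> rvec \<Rightarrow> rvec \<Rightarrow> real" where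
  "ridge_predictor k lam X y x =
     kernel_row k x X \<bullet> (minv (kernel_matrix k X + lam \<cdot>\<^sub>m 1\<^sub>m (dim_col X)) *\<^sub>v y)"

text \<open>Expectation over the test point alone: the predictor f and the target g are held fixed, so in
  the theorem they depend on an outcome that the integral does not range over.\<close>

definition test_error :: "'w measure \<Rightarrow> ('w \<Rightarrow> rvec) \<Rightarrow> (rvec \<Rightarrow> real) \<Rightarrow> (rvec \<Rightarrow> real) \<Rightarrow> real" where
  "test_error M x g f = (\<integral>\<omega>. \<bar>f (x \<omega>) - g (x \<omega>)\<bar>\<^sup>2 \<partial>M)"

definition rf_test_error ::
  "'w measure \<Rightarrow> ('w \<Rightarrow> rvec) \<Rightarrow> (real \<Rightarrow> real) \<Rightarrow> real \<Rightarrow> rmat \<Rightarrow> rmat \<Rightarrow> rvec \<Rightarrow> rvec \<Rightarrow> real" where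
  "rf_test_error M x \<sigma> lam X W \<beta> \<eta> =
     test_error M x (\<lambda>z. \<beta> \<bullet> z) (ridge_predictor (rf_kernel \<sigma> W) lam X (labels X \<beta> \<eta>))"

definition kernel_test_error ::
  "'w measure \<Rightarrow> ('w \<Rightarrow> rvec) \<Rightarrow> (real \<Rightarrow> real) \<Rightarrow> real \<Rightarrow> rmat \<Rightarrow> rvec \<Rightarrow> rvec \<Rightarrow> real" where
  "kernel_test_error M x \<sigma> lam X \<beta> \<eta> =
     test_error M x (\<lambda>z. \<beta> \<bullet> z)
       (ridge_predictor (limit_kernel \<sigma> (dim_row X)) lam X (labels X \<beta> \<eta>))"

end

theory Submission
  imports Defs "Jordan_Normal_Form.Determinant"
begin

text \<open>
  The labels have covariance bounded by a constant and are independent of the weights, so for a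
  fixed test point the mean square difference of the two predictors is bounded by the squared
  distance of their coefficient vectors. That distance is controlled by one linear system whose
  right-hand side consists of n centred empirical means of d1 independent terms, each of mean square
  O(1 / d1), and whose matrix is the empirical kernel matrix. Hence the predictors differ by
  O(n / d1) in mean square, and the test errors by O((n / d1)^(1/2)) in mean. Markov's inequality
  loses an arbitrarily small power.

  This needs a constant lower bound on the spectra of the limit kernel (the part of the
  activation orthogonal to quadratic polynomials is almost uncorrelated over almost orthonormal
  data) and of the empirical kernel (a lower-tail estimate on a lattice, which requires fourth
  moments only). The fourth moments come from the Gaussian Poincare inequality. No estimate on
  the operator norm of the difference of the kernels is used.
\<close>

text \<open>The hypotheses bound inner products of columns by e with n * e^4 tending to 0, so n *
  e^2 may diverge. The degree-k Hermite component of the activation has correlations of order r^k,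
  and with bounded row sums of r^2 its squared off-diagonal entries sum to at most order n *
  e^(2k-2), a bound that is small only from k = 3 on. This is why degrees 1 and 2 are projected out
  before the spectrum is bounded below. The exponent 1/2 comes from (a + b)^2 - b^2 = a^2 + 2ab: the
  difference a of the predictors has mean square of order n / d1, while the error b of the limit
  predictor is merely bounded. Ridge parameter 0 is covered because coercivity comes from the
  kernels alone. The test error integrates over a second outcome, so Tonelli's theorem reduces
  everything to a fixed test point; there the labels are averaged with the weights frozen, and the
  weights afterwards. All constants depend only on \<sigma>, its Lipschitz constant, B and the two
  standard deviations, never on n, d0, d1 or the data.\<close>

lemma prob_space_std_normal: "prob_space std_normal"
  unfolding std_normal_def by (simp add: prob_space_normal_density)

lemma sets_std_normal [simp, measurable_cong]: "sets std_normal = sets borel"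
  and space_std_normal [simp]: "space std_normal = UNIV"
  by (simp_all add: std_normal_def)

interpretation std_normal: prob_space std_normal
  by (rule prob_space_std_normal)

interpretation std_normal_prod: product_prob_space "\<lambda>_::'i. std_normal" UNIV
  by standard

lemma prob_space_gauss: "prob_space (\<Pi>\<^sub>M i\<in>I. std_normal)"
  by (intro prob_space_PiM prob_space_std_normal)

lemma nn_integral_std_normal:
  "f \<in> borel_measurable borel \<Longrightarrow>
    (\<integral>\<^sup>+x. f x \<partial>std_normal) = (\<integral>\<^sup>+x. ennreal (std_normal_density x) * f x \<partial>lborel)"
  unfolding std_normal_def by (subst nn_integral_density) auto

text \<open>The product with the density is a multiple of the normal density of variance 2. Any rate
  below 1/2 would be integrable; 1/4 leaves room for polynomial factors and shifts.\<close>

lemma integrable_std_normal_exp: "integrable std_normal (\<lambda>x. exp (x\<^sup>2 / 4))"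
proof -
  have "std_normal_density x * exp (x\<^sup>2 / 4) = sqrt 2 * normal_density 0 (sqrt 2) x" for x :: real
    by (simp add: normal_density_def real_sqrt_mult field_simps flip: exp_add)
  then show ?thesis
    unfolding std_normal_def by (subst integrable_density) auto
qed

lemma integrable_std_normal_dominated:
  fixes f :: "real \<Rightarrow> real"
  assumes [measurable]: "f \<in> borel_measurable borel" and "\<And>x. \<bar>f x\<bar> \<le> C * exp (x\<^sup>2 / 4)"
  shows "integrable std_normal f"
  by (rule Bochner_Integration.integrable_bound[where f = "\<lambda>x. C * exp (x\<^sup>2 / 4)"])
     (use assms in \<open>auto intro: integrable_std_normal_exp intro!: AE_I2 order.trans[OF _ abs_ge_self]\<close>)

lemma integrable_std_normal_exp_abs: "integrable std_normal (\<lambda>x. exp (c * \<bar>x\<bar>))"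
proof (rule integrable_std_normal_dominated)
  fix x :: real
  have "0 \<le> (c - \<bar>x\<bar> / 2)\<^sup>2" by simp
  then have "c * \<bar>x\<bar> \<le> c\<^sup>2 + x\<^sup>2 / 4"
    by (simp add: power2_eq_square algebra_simps)
  then show "\<bar>exp (c * \<bar>x\<bar>)\<bar> \<le> exp (c\<^sup>2) * exp (x\<^sup>2 / 4)"
    by (simp flip: exp_add)
qed simp

section \<open>A Hardy inequality for the Gaussian measure\<close>

lemma square_integral_le:
  fixes D :: "real \<Rightarrow> real"
  assumes "continuous_on {0..x} D" "0 < x"
  shows "(integral {0..x} D)\<^sup>2 \<le> x * integral {0..x} (\<lambda>s. (D s)\<^sup>2)"
proof -
  define I where "I = integral {0..x} D"
  have i: "D integrable_on {0..x}" "(\<lambda>s. (D s)\<^sup>2) integrable_on {0..x}"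
    using assms(1) by (auto intro!: integrable_continuous_real continuous_intros)
  \<comment> \<open>The integrand is the square of D minus its mean I / x; its nonnegativity is
    Cauchy-Schwarz against the constant 1.\<close>
  have "((\<lambda>s. (D s)\<^sup>2 - 2 * (I / x) * D s + (I / x)\<^sup>2) has_integral
      (integral {0..x} (\<lambda>s. (D s)\<^sup>2) - 2 * (I / x) * I + x * (I / x)\<^sup>2)) {0..x}"
    using i assms(2) has_integral_const_real[of "(I / x)\<^sup>2" 0 x] unfolding I_def
    by (intro has_integral_add has_integral_diff has_integral_mult_right integrable_integral) auto
  then have "0 \<le> integral {0..x} (\<lambda>s. (D s)\<^sup>2) - 2 * (I / x) * I + x * (I / x)\<^sup>2"
  proof (rule has_integral_nonneg)
    fix s
    have "0 \<le> (D s - I / x)\<^sup>2" by simp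
    then show "0 \<le> (D s)\<^sup>2 - 2 * (I / x) * D s + (I / x)\<^sup>2"
      by (simp add: power2_diff algebra_simps)
  qed
  with assms(2) show ?thesis
    unfolding I_def[symmetric] by (simp add: power2_eq_square field_simps)
qed

text \<open>Writing f x - f 0 as an integral and applying Cauchy-Schwarz leaves the tail integral of
  x times the Gaussian density, which is the density itself.\<close>

lemma hardy_gaussian_half:
  fixes f D :: "real \<Rightarrow> real"
  assumes deriv: "\<And>x. (f has_real_derivative D x) (at x)" and cont: "continuous_on UNIV D"
  shows "(\<integral>\<^sup>+x. indicator {0..} x * ennreal ((f x - f 0)\<^sup>2) \<partial>std_normal)
    \<le> (\<integral>\<^sup>+x. indicator {0..} x * ennreal ((D x)\<^sup>2) \<partial>std_normal)"
proof -
  have [measurable]: "D \<in> borel_measurable borel"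
    using cont by (rule borel_measurable_continuous_onI)
  have "continuous_on UNIV f"
    using deriv by (meson DERIV_isCont continuous_at_imp_continuous_on)
  then have [measurable]: "f \<in> borel_measurable borel"
    by (rule borel_measurable_continuous_onI)
  \<comment> \<open>Extended nonnegative values from here on, so that Tonelli applies without
    knowing either side to be finite.\<close>
  define g where "g x s = (if 0 \<le> s \<and> s \<le> x then ennreal ((D s)\<^sup>2) else 0)" for x s
  have step: "ennreal ((f x - f 0)\<^sup>2) \<le> ennreal x * (\<integral>\<^sup>+s. g x s \<partial>lborel)"
    if "0 \<le> x" for x
  proof (cases "x = 0")
    case False
    with that have "0 < x" by simp
    have c: "continuous_on {0..x} D"
      using cont by (rule continuous_on_subset) auto
    have "(D has_integral (f x - f 0)) {0..x}"
      using that deriv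
      by (intro fundamental_theorem_of_calculus)
         (auto simp: has_real_derivative_iff_has_vector_derivative[symmetric] intro: has_field_derivative_at_within)
    then have "(f x - f 0)\<^sup>2 \<le> x * integral {0..x} (\<lambda>s. (D s)\<^sup>2)"
      using square_integral_le[OF c \<open>0 < x\<close>] by (simp add: integral_unique)
    moreover have "(\<integral>\<^sup>+s. g x s \<partial>lborel) = integral {0..x} (\<lambda>s. (D s)\<^sup>2)"
    proof -
      have "((\<lambda>s. (D s)\<^sup>2) has_integral integral {0..x} (\<lambda>s. (D s)\<^sup>2)) {0..x}"
        using c by (intro integrable_integral integrable_continuous_real continuous_intros)
      from nn_integral_has_integral_lebesgue'[OF _ this]
      show ?thesis
        by (auto simp: g_def intro!: nn_integral_cong split: split_indicator elim!: trans[rotated])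
    qed
    moreover have "0 \<le> integral {0..x} (\<lambda>s. (D s)\<^sup>2)"
      by (rule integral_nonneg) (use c in \<open>auto intro!: integrable_continuous_real continuous_intros\<close>)
    ultimately show ?thesis
      using that by (simp add: ennreal_mult[symmetric] ennreal_leI)
  qed simp
  have tail: "(\<integral>\<^sup>+x. (if s \<le> x then ennreal (std_normal_density x) * ennreal x else 0) \<partial>lborel)
      = ennreal (std_normal_density s)" if "0 \<le> s" for s
  proof -
    have lim: "((\<lambda>x::real. - std_normal_density x) \<longlongrightarrow> 0) at_top"
      unfolding std_normal_density_def by real_asymp
    have "(\<integral>\<^sup>+x. ennreal (std_normal_density x * x) * indicator {s..} x \<partial>lborel) = 0 - - std_normal_density s"
    proof (rule nn_integral_FTC_atLeast[OF _ _ _ lim])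
      fix x :: real
      show "((\<lambda>x. - std_normal_density x) has_real_derivative std_normal_density x * x) (at x)"
        unfolding std_normal_density_def
        by (auto intro!: derivative_eq_intros simp: field_simps)
    qed (use that in auto)
    then show ?thesis
      using that
      by (auto simp: ennreal_mult' split: split_indicator intro!: nn_integral_cong elim!: trans[rotated])
  qed
  \<comment> \<open>The joint integrand on 0 \<le> s \<le> x with the weight x * density attached,
    so that integrating over x first produces \<open>tail\<close>.\<close>
  define k where "k x s = (if 0 \<le> s then ennreal ((D s)\<^sup>2) *
    (if s \<le> x then ennreal (std_normal_density x) * ennreal x else 0) else 0)" for x s
  have [measurable]: "case_prod g \<in> borel_measurable (borel \<Otimes>\<^sub>M borel)" "case_prod k \<in> borel_measurable (borel \<Otimes>\<^sub>M borel)"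
    unfolding g_def k_def by measurable
  have "(\<integral>\<^sup>+x. indicator {0..} x * ennreal ((f x - f 0)\<^sup>2) \<partial>std_normal)
      \<le> (\<integral>\<^sup>+x. indicator {0..} x * (ennreal x * (\<integral>\<^sup>+s. g x s \<partial>lborel)) \<partial>std_normal)"
    by (intro nn_integral_mono) (auto split: split_indicator intro: step)
  also have "\<dots> = (\<integral>\<^sup>+x. indicator {0..} x * ennreal (std_normal_density x) * ennreal x * (\<integral>\<^sup>+s. g x s \<partial>lborel) \<partial>lborel)"
    by (subst nn_integral_std_normal) (auto simp: mult_ac)
  also have "\<dots> = (\<integral>\<^sup>+x. \<integral>\<^sup>+s. k x s \<partial>lborel \<partial>lborel)"
  proof (intro nn_integral_cong)
    fix x :: real
    have "k x = (\<lambda>_. 0)" if "\<not> 0 \<le> x"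
      using that by (auto simp: k_def fun_eq_iff)
    then show "indicator {0..} x * ennreal (std_normal_density x) * ennreal x * (\<integral>\<^sup>+s. g x s \<partial>lborel) = (\<integral>\<^sup>+s. k x s \<partial>lborel)"
      by (subst nn_integral_cmult[symmetric])
         (auto intro!: nn_integral_cong split: split_indicator simp: g_def k_def mult_ac)
  qed
  also have "\<dots> = (\<integral>\<^sup>+s. \<integral>\<^sup>+x. k x s \<partial>lborel \<partial>lborel)"
    by (intro lborel_pair.Fubini') measurable
  also have "\<dots> = (\<integral>\<^sup>+s. indicator {0..} s * ennreal ((D s)\<^sup>2) * ennreal (std_normal_density s) \<partial>lborel)"
    by (intro nn_integral_cong) (auto split: split_indicator simp: k_def tail nn_integral_cmult)
  also have "\<dots> = (\<integral>\<^sup>+x. indicator {0..} x * ennreal ((D x)\<^sup>2) \<partial>std_normal)"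
    by (subst nn_integral_std_normal) (auto simp: mult_ac)
  finally show ?thesis .
qed

lemma nn_integral_std_normal_uminus:
  assumes [measurable]: "f \<in> borel_measurable borel"
  shows "(\<integral>\<^sup>+x. f (- x) \<partial>std_normal) = (\<integral>\<^sup>+x. f x \<partial>std_normal)"
  using nn_integral_real_affine[of "\<lambda>x. ennreal (std_normal_density x) * f x" "-1" 0]
  by (subst (1 2) nn_integral_std_normal) (auto simp: normal_density_def)

text \<open>Reflection preserves the Gaussian and carries the negative half line to the positive
  one, where f(-x) has derivative -D(-x).\<close>

lemma hardy_gaussian:
  fixes f D :: "real \<Rightarrow> real"
  assumes deriv: "\<And>x. (f has_real_derivative D x) (at x)" and cont: "continuous_on UNIV D"
  shows "(\<integral>\<^sup>+x. ennreal ((f x - f 0)\<^sup>2) \<partial>std_normal) \<le> (\<integral>\<^sup>+x. ennreal ((D x)\<^sup>2) \<partial>std_normal)"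
proof -
  have [measurable]: "D \<in> borel_measurable borel"
    using cont by (rule borel_measurable_continuous_onI)
  have "continuous_on UNIV f"
    using deriv by (meson DERIV_isCont continuous_at_imp_continuous_on)
  then have [measurable]: "f \<in> borel_measurable borel"
    by (rule borel_measurable_continuous_onI)
  have split: "(\<integral>\<^sup>+x. g x \<partial>std_normal) =
      (\<integral>\<^sup>+x. indicator {0..} x * g x \<partial>std_normal) + (\<integral>\<^sup>+x. indicator {0..} x * g (- x) \<partial>std_normal)"
    if [measurable]: "g \<in> borel_measurable borel" for g :: "real \<Rightarrow> ennreal"
  proof -
    \<comment> \<open>Both half lines contain 0, so the splitting is exact only off this null
      point.\<close>
    have "AE x in std_normal. x \<noteq> 0"
      unfolding std_normal_def by (subst AE_density) (auto intro: AE_mp[OF AE_lborel_singleton[of 0]])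
    then have "(\<integral>\<^sup>+x. g x \<partial>std_normal) = (\<integral>\<^sup>+x. indicator {0..} x * g x + indicator {0..} (- x) * g (- (- x)) \<partial>std_normal)"
      by (intro nn_integral_cong_AE) (auto elim!: eventually_mono split: split_indicator)
    also have "\<dots> = (\<integral>\<^sup>+x. indicator {0..} x * g x \<partial>std_normal) + (\<integral>\<^sup>+x. indicator {0..} (- x) * g (- (- x)) \<partial>std_normal)"
      by (rule nn_integral_add) measurable
    also have "(\<integral>\<^sup>+x. indicator {0..} (- x) * g (- (- x)) \<partial>std_normal) = (\<integral>\<^sup>+x. indicator {0..} x * g (- x) \<partial>std_normal)"
      by (rule nn_integral_std_normal_uminus[of "\<lambda>x. indicator {0..} x * g (- x)"]) measurable
    finally show ?thesis .
  qed
  have 1: "(\<integral>\<^sup>+x. indicator {0..} x * ennreal ((f x - f 0)\<^sup>2) \<partial>std_normal)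
    \<le> (\<integral>\<^sup>+x. indicator {0..} x * ennreal ((D x)\<^sup>2) \<partial>std_normal)"
    by (rule hardy_gaussian_half[OF assms])
  have "(\<integral>\<^sup>+x. indicator {0..} x * ennreal ((f (- x) - f (- 0))\<^sup>2) \<partial>std_normal)
    \<le> (\<integral>\<^sup>+x. indicator {0..} x * ennreal ((- D (- x))\<^sup>2) \<partial>std_normal)"
  proof (rule hardy_gaussian_half)
    show "((\<lambda>x. f (- x)) has_real_derivative - D (- x)) (at x)" for x
      using DERIV_chain2[where f = f and g = uminus and x = x and Db = "- 1" and s = UNIV, OF deriv]
      by (simp add: DERIV_minus[OF DERIV_ident, simplified])
    show "continuous_on UNIV (\<lambda>x. - D (- x))"
      by (intro continuous_intros continuous_on_compose2[OF cont]) auto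
  qed
  then have 2: "(\<integral>\<^sup>+x. indicator {0..} x * ennreal ((f (- x) - f 0)\<^sup>2) \<partial>std_normal)
    \<le> (\<integral>\<^sup>+x. indicator {0..} x * ennreal ((D (- x))\<^sup>2) \<partial>std_normal)"
    by simp
  show ?thesis
    by (subst (1 2) split) (use add_mono[OF 1 2] in auto)
qed

subsection \<open>The Gaussian Poincare inequality\<close>

text \<open>A class closed under sums, products and powers whose measurable members are integrable
  under the product Gaussian over a finite index set. The bound factorizes over coordinates, so
  fixing one of them leaves a bound of the same kind; this is what survives the induction over
  coordinates.\<close>

definition exp_growth :: "nat set \<Rightarrow> ((nat \<Rightarrow> real) \<Rightarrow> real) \<Rightarrow> bool" where
  "exp_growth I F \<longleftrightarrow> (\<exists>C c. 0 \<le> c \<and> (\<forall>w. \<bar>F w\<bar> \<le> C * (\<Prod>i\<in>I. exp (c * \<bar>w i\<bar>))))"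

lemma exp_growth_mult:
  assumes "exp_growth I F" "exp_growth I G"
  shows "exp_growth I (\<lambda>w. F w * G w)"
proof -
  obtain C c where F: "0 \<le> c" "\<And>w. \<bar>F w\<bar> \<le> C * (\<Prod>i\<in>I. exp (c * \<bar>w i\<bar>))"
    using assms(1) by (auto simp: exp_growth_def)
  obtain C' c' where G: "0 \<le> c'" "\<And>w. \<bar>G w\<bar> \<le> C' * (\<Prod>i\<in>I. exp (c' * \<bar>w i\<bar>))"
    using assms(2) by (auto simp: exp_growth_def)
  have "\<bar>F w * G w\<bar> \<le> C * C' * (\<Prod>i\<in>I. exp ((c + c') * \<bar>w i\<bar>))" for w
  proof -
    have "\<bar>F w * G w\<bar> \<le> (C * (\<Prod>i\<in>I. exp (c * \<bar>w i\<bar>))) * (C' * (\<Prod>i\<in>I. exp (c' * \<bar>w i\<bar>)))"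
      unfolding abs_mult by (intro mult_mono F G) (auto intro: order.trans[OF _ F(2)])
    then show ?thesis
      by (simp add: prod.distrib[symmetric] exp_add[symmetric] algebra_simps)
  qed
  with F G show ?thesis
    unfolding exp_growth_def by (intro exI[of _ "C * C'"] exI[of _ "c + c'"]) auto
qed

lemma integrable_gauss_exp_growth:
  assumes "finite I" "F \<in> borel_measurable (\<Pi>\<^sub>M i\<in>I. std_normal)" "exp_growth I F"
  shows "integrable (\<Pi>\<^sub>M i\<in>I. std_normal) F"
proof -
  obtain C c where F: "\<And>w. \<bar>F w\<bar> \<le> C * (\<Prod>i\<in>I. exp (c * \<bar>w i\<bar>))"
    using assms(3) by (auto simp: exp_growth_def)
  have "integrable (\<Pi>\<^sub>M i\<in>I. std_normal) (\<lambda>w. C * (\<Prod>i\<in>I. exp (c * \<bar>w i\<bar>)))"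
    by (intro integrable_mult_right std_normal_prod.product_integrable_prod assms(1) integrable_std_normal_exp_abs)
  then show ?thesis
    by (rule Bochner_Integration.integrable_bound)
       (use assms(2) F in \<open>auto intro!: AE_I2 order.trans[OF _ abs_ge_self]\<close>)
qed

text \<open>Jensen's inequality for the square, with an extended right-hand side that is infinite
  when the square is not integrable.\<close>

lemma (in prob_space) square_expectation_le:
  fixes g :: "'a \<Rightarrow> real"
  assumes [measurable]: "g \<in> borel_measurable M"
  shows "ennreal ((expectation g)\<^sup>2) \<le> (\<integral>\<^sup>+x. ennreal ((g x)\<^sup>2) \<partial>M)"
proof (cases "integrable M (\<lambda>x. (g x)\<^sup>2)")
  case True
  then have "integrable M g"
    by (rule square_integrable_imp_integrable[rotated]) simp
  then have "0 \<le> expectation (\<lambda>x. (g x)\<^sup>2) - (expectation g)\<^sup>2"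
    using True variance_eq[of g] variance_positive[of g] by simp
  with True show ?thesis
    by (subst nn_integral_eq_integral) auto
next
  case False
  then have "(\<integral>\<^sup>+x. ennreal ((g x)\<^sup>2) \<partial>M) = \<infinity>"
    by (auto simp: integrable_iff_bounded not_less top_unique)
  then show ?thesis by simp
qed

lemma (in prob_space) variance_le_square_about:
  fixes g :: "'a \<Rightarrow> real"
  assumes "integrable M g" "integrable M (\<lambda>x. (g x)\<^sup>2)"
  shows "ennreal (expectation (\<lambda>x. (g x)\<^sup>2) - (expectation g)\<^sup>2) \<le> (\<integral>\<^sup>+x. ennreal ((g x - a)\<^sup>2) \<partial>M)"
proof -
  have eq: "(g x - a)\<^sup>2 = (g x)\<^sup>2 - 2 * a * g x + a\<^sup>2" for x
    by (simp add: power2_eq_square algebra_simps)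
  have "expectation (\<lambda>x. (g x - a)\<^sup>2) = expectation (\<lambda>x. (g x)\<^sup>2) - 2 * a * expectation g + a\<^sup>2"
    unfolding eq using assms by (simp add: prob_space)
  moreover have "0 \<le> (expectation g - a)\<^sup>2" by simp
  ultimately have "expectation (\<lambda>x. (g x)\<^sup>2) - (expectation g)\<^sup>2 \<le> expectation (\<lambda>x. (g x - a)\<^sup>2)"
    by (simp add: power2_diff algebra_simps)
  moreover have "integrable M (\<lambda>x. (g x - a)\<^sup>2)"
    unfolding eq using assms by simp
  ultimately show ?thesis
    by (subst nn_integral_eq_integral) (auto intro: ennreal_leI)
qed

text \<open>Induction on the index set: the one-dimensional inequality follows from the Hardy inequality
  above, since the variance is at most the mean square distance to F(w(i := 0)).\<close>

lemma poincare_gauss: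
  assumes "finite I" and F_meas: "F \<in> borel_measurable (\<Pi>\<^sub>M i\<in>I. std_normal)" and "exp_growth I F"
    and "\<And>i w. i \<in> I \<Longrightarrow> ((\<lambda>t. F (w(i := t))) has_real_derivative D i w) (at (w i))"
    and "\<And>i w. i \<in> I \<Longrightarrow> continuous_on UNIV (\<lambda>t. D i (w(i := t)))"
    and "\<And>i. i \<in> I \<Longrightarrow> D i \<in> borel_measurable (\<Pi>\<^sub>M i\<in>I. std_normal)"
  shows "ennreal ((\<integral>w. (F w)\<^sup>2 \<partial>(\<Pi>\<^sub>M i\<in>I. std_normal)) - (\<integral>w. F w \<partial>(\<Pi>\<^sub>M i\<in>I. std_normal))\<^sup>2)
    \<le> (\<Sum>i\<in>I. \<integral>\<^sup>+w. ennreal ((D i w)\<^sup>2) \<partial>(\<Pi>\<^sub>M i\<in>I. std_normal))"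
  using assms
proof (induction I arbitrary: F D rule: finite_induct)
  case empty
  then show ?case
    by (simp add: PiM_empty lebesgue_integral_count_space_finite)
next
  case (insert i I)
  note fun_upd_apply [simp del]
  let ?P = "\<Pi>\<^sub>M i\<in>I. std_normal" and ?Q = "\<Pi>\<^sub>M i\<in>insert i I. std_normal"
  interpret P: prob_space ?P by (rule prob_space_gauss)
  interpret PN: pair_prob_space ?P std_normal ..
  interpret NP: pair_prob_space std_normal ?P ..
  note [measurable] = insert.prems(1)
  have [measurable]: "D k \<in> borel_measurable ?Q" if "k \<in> insert i I" for k
    using insert.prems(5) that by blast
  have upd1 [measurable]: "(\<lambda>p. (fst p)(i := snd p)) \<in> ?P \<Otimes>\<^sub>M std_normal \<rightarrow>\<^sub>M ?Q"
    using measurable_add_dim[of i I "\<lambda>_. std_normal"] by (simp add: case_prod_beta')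
  have upd2 [measurable]: "(\<lambda>x. x(i := t)) \<in> ?P \<rightarrow>\<^sub>M ?Q" for t
    using measurable_compose[OF measurable_Pair[OF measurable_ident measurable_const[of t std_normal ?P]] upd1] by simp
  have upd3 [measurable]: "(\<lambda>p. (snd p)(i := fst p)) \<in> std_normal \<Otimes>\<^sub>M ?P \<rightarrow>\<^sub>M ?Q"
    by (rule measurable_compose[OF _ upd1, where f = "\<lambda>p. (snd p, fst p)", simplified]) measurable
  have swap: "(\<integral>w. G w \<partial>?Q) = (\<integral>t. \<integral>x. G (x(i := t)) \<partial>?P \<partial>std_normal)"
    and int: "integrable std_normal (\<lambda>t. \<integral>x. G (x(i := t)) \<partial>?P)"
    and int_sec: "integrable ?P (\<lambda>x. G (x(i := t)))" "exp_growth I (\<lambda>x. G (x(i := t)))"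
    and exp_int: "\<exists>C c. \<forall>t. \<bar>\<integral>x. G (x(i := t)) \<partial>?P\<bar> \<le> C * exp (c * \<bar>t\<bar>)"
    if G [measurable]: "G \<in> borel_measurable ?Q" and growth: "exp_growth (insert i I) G" for G t
  proof -
    obtain C c where c: "0 \<le> c" "\<And>w. \<bar>G w\<bar> \<le> C * (\<Prod>i\<in>insert i I. exp (c * \<bar>w i\<bar>))"
      using growth by (auto simp: exp_growth_def)
    have prod: "(\<Prod>k\<in>insert i I. exp (c * \<bar>(x(i := t)) k\<bar>)) = exp (c * \<bar>t\<bar>) * (\<Prod>k\<in>I. exp (c * \<bar>x k\<bar>))" for x t
      using insert.hyps by (auto simp: fun_upd_apply intro!: prod.cong)
    have bound: "\<bar>G (x(i := t))\<bar> \<le> C * exp (c * \<bar>t\<bar>) * (\<Prod>k\<in>I. exp (c * \<bar>x k\<bar>))" for x t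
      using c(2)[of "x(i := t)"] unfolding prod by (simp add: mult_ac)
    show g: "exp_growth I (\<lambda>x. G (x(i := t)))" for t
      unfolding exp_growth_def using bound c(1) by blast
    show sec: "integrable ?P (\<lambda>x. G (x(i := t)))" for t
      by (rule integrable_gauss_exp_growth[OF insert.hyps(1) _ g]) measurable
    have iQ: "integrable ?Q G"
      using insert.hyps(1) by (intro integrable_gauss_exp_growth growth) auto
    have "(\<integral>\<^sup>+p. ennreal \<bar>G ((fst p)(i := snd p))\<bar> \<partial>(?P \<Otimes>\<^sub>M std_normal)) = (\<integral>\<^sup>+w. ennreal \<bar>G w\<bar> \<partial>?Q)"
      using std_normal.nn_integral_fst[of "\<lambda>p. ennreal \<bar>G ((fst p)(i := snd p))\<bar>" ?P]
      by (subst std_normal_prod.product_nn_integral_insert[OF insert.hyps]) auto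
    with iQ have iP: "integrable (?P \<Otimes>\<^sub>M std_normal) (\<lambda>p. G ((fst p)(i := snd p)))"
      by (simp add: integrable_iff_bounded)
    have "(\<integral>w. G w \<partial>?Q) = (\<integral>x. \<integral>t. G (x(i := t)) \<partial>std_normal \<partial>?P)"
      by (rule std_normal_prod.product_integral_insert[OF insert.hyps iQ])
    also have "\<dots> = (\<integral>t. \<integral>x. G (x(i := t)) \<partial>?P \<partial>std_normal)"
      using PN.Fubini_integral[of "\<lambda>x t. G (x(i := t))"] iP by (simp add: case_prod_beta')
    finally show "(\<integral>w. G w \<partial>?Q) = (\<integral>t. \<integral>x. G (x(i := t)) \<partial>?P \<partial>std_normal)" .
    show "integrable std_normal (\<lambda>t. \<integral>x. G (x(i := t)) \<partial>?P)"
      using PN.integrable_snd[of "\<lambda>x t. G (x(i := t))"] iP by (simp add: case_prod_beta')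
    show "\<exists>C c. \<forall>t. \<bar>\<integral>x. G (x(i := t)) \<partial>?P\<bar> \<le> C * exp (c * \<bar>t\<bar>)"
    proof (intro exI allI)
      fix t
      have "\<bar>\<integral>x. G (x(i := t)) \<partial>?P\<bar> \<le> (\<integral>x. \<bar>G (x(i := t))\<bar> \<partial>?P)"
        by (rule integral_abs_bound)
      also have "\<dots> \<le> (\<integral>x. C * exp (c * \<bar>t\<bar>) * (\<Prod>k\<in>I. exp (c * \<bar>x k\<bar>)) \<partial>?P)"
        using sec bound insert.hyps(1)
        by (intro integral_mono integrable_abs integrable_mult_right
            std_normal_prod.product_integrable_prod integrable_std_normal_exp_abs) auto
      finally show "\<bar>\<integral>x. G (x(i := t)) \<partial>?P\<bar> \<le> C * (\<integral>x. (\<Prod>k\<in>I. exp (c * \<bar>x k\<bar>)) \<partial>?P) * exp (c * \<bar>t\<bar>)"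
        by (simp add: mult_ac)
    qed
  qed
  have F2: "exp_growth (insert i I) (\<lambda>w. (F w)\<^sup>2)"
    using exp_growth_mult[OF insert.prems(2) insert.prems(2)] by (simp add: power2_eq_square)
  \<comment> \<open>\<open>H\<close> and \<open>V\<close> are the first two moments of F conditional
    on coordinate i. The law of total variance splits the variance of F into the mean of
    \<open>V t - (H t)^2\<close>, left to the induction hypothesis on sections, and the variance of
    \<open>H\<close>.\<close>
  define H where "H t = (\<integral>x. F (x(i := t)) \<partial>?P)" for t
  define V where "V t = (\<integral>x. (F (x(i := t)))\<^sup>2 \<partial>?P)" for t
  have H_int: "integrable std_normal H" and V_int: "integrable std_normal V"
    using int[OF insert.prems(1,2)] int[OF _ F2] unfolding H_def[abs_def] V_def[abs_def] by simp_all
  obtain C c where Hb: "\<And>t. \<bar>H t\<bar> \<le> C * exp (c * \<bar>t\<bar>)"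
    using exp_int[OF insert.prems(1,2)] by (auto simp: H_def)
  have [measurable]: "H \<in> borel_measurable borel"
    using borel_measurable_integrable[OF H_int] by simp
  have H2_int: "integrable std_normal (\<lambda>t. (H t)\<^sup>2)"
  proof (rule Bochner_Integration.integrable_bound)
    show "integrable std_normal (\<lambda>t. C\<^sup>2 * exp (2 * c * \<bar>t\<bar>))"
      by (intro integrable_mult_right integrable_std_normal_exp_abs)
    have "(H t)\<^sup>2 \<le> C\<^sup>2 * exp (2 * c * \<bar>t\<bar>)" for t
      using power_mono[OF Hb[of t], of 2] by (simp add: power_mult_distrib exp_double[symmetric] mult_ac)
    then show "AE t in std_normal. norm ((H t)\<^sup>2) \<le> norm (C\<^sup>2 * exp (2 * c * \<bar>t\<bar>))"
      by simp
  qed measurable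
  have "(\<integral>w. (F w)\<^sup>2 \<partial>?Q) - (\<integral>w. F w \<partial>?Q)\<^sup>2
      = (\<integral>t. V t - (H t)\<^sup>2 \<partial>std_normal) + ((\<integral>t. (H t)\<^sup>2 \<partial>std_normal) - (\<integral>t. H t \<partial>std_normal)\<^sup>2)"
    using swap[OF insert.prems(1,2)] swap[OF _ F2] V_int H2_int
    by (simp add: H_def[symmetric] V_def[symmetric])
  moreover have VH: "0 \<le> V t - (H t)\<^sup>2" for t
    using P.variance_positive[of "\<lambda>x. F (x(i := t))"] P.variance_eq[of "\<lambda>x. F (x(i := t))"]
      int_sec(1)[OF insert.prems(1,2)] int_sec(1)[OF _ F2]
    by (simp add: H_def V_def)
  moreover have "0 \<le> (\<integral>t. (H t)\<^sup>2 \<partial>std_normal) - (\<integral>t. H t \<partial>std_normal)\<^sup>2"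
    using std_normal.variance_positive[of H] std_normal.variance_eq[of H] H_int H2_int by simp
  moreover have "(\<integral>t. (H t)\<^sup>2 \<partial>std_normal) \<le> (\<integral>t. V t \<partial>std_normal)"
    using V_int H2_int VH by (intro integral_mono) auto
  ultimately have "ennreal ((\<integral>w. (F w)\<^sup>2 \<partial>?Q) - (\<integral>w. F w \<partial>?Q)\<^sup>2)
      = (\<integral>\<^sup>+t. ennreal (V t - (H t)\<^sup>2) \<partial>std_normal)
        + ennreal ((\<integral>t. (H t)\<^sup>2 \<partial>std_normal) - (\<integral>t. H t \<partial>std_normal)\<^sup>2)"
    using V_int H2_int by (subst nn_integral_eq_integral) (auto simp: ennreal_plus[symmetric] simp del: ennreal_plus)
  also have "\<dots> \<le> (\<Sum>k\<in>I. \<integral>\<^sup>+w. ennreal ((D k w)\<^sup>2) \<partial>?Q) + (\<integral>\<^sup>+w. ennreal ((D i w)\<^sup>2) \<partial>?Q)"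
  proof (rule add_mono)
    have "(\<integral>\<^sup>+t. ennreal (V t - (H t)\<^sup>2) \<partial>std_normal)
        \<le> (\<integral>\<^sup>+t. (\<Sum>k\<in>I. \<integral>\<^sup>+x. ennreal ((D k (x(i := t)))\<^sup>2) \<partial>?P) \<partial>std_normal)"
    proof (intro nn_integral_mono)
      fix t
      show "ennreal (V t - (H t)\<^sup>2) \<le> (\<Sum>k\<in>I. \<integral>\<^sup>+x. ennreal ((D k (x(i := t)))\<^sup>2) \<partial>?P)"
        unfolding V_def H_def
      proof (rule insert.IH)
        fix k w assume k: "k \<in> I"
        with insert.hyps have ne: "k \<noteq> i" by auto
        show "((\<lambda>s. F (w(k := s, i := t))) has_real_derivative D k (w(i := t))) (at (w k))"
          using insert.prems(3)[of k "w(i := t)"] k ne by (simp add: fun_upd_twist[of k i] fun_upd_apply[of w i t k])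
        show "continuous_on UNIV (\<lambda>s. D k (w(k := s, i := t)))"
          using insert.prems(4)[of k "w(i := t)"] k ne by (simp add: fun_upd_twist[of k i])
      qed (use int_sec(2)[OF insert.prems(1,2)] in auto)
    qed
    also have "\<dots> = (\<Sum>k\<in>I. \<integral>\<^sup>+w. ennreal ((D k w)\<^sup>2) \<partial>?Q)"
      by (subst nn_integral_sum)
         (auto intro!: sum.cong std_normal_prod.product_nn_integral_insert_rev[symmetric] insert.hyps
           P.borel_measurable_nn_integral)
    finally show "(\<integral>\<^sup>+t. ennreal (V t - (H t)\<^sup>2) \<partial>std_normal) \<le> (\<Sum>k\<in>I. \<integral>\<^sup>+w. ennreal ((D k w)\<^sup>2) \<partial>?Q)" .
  next
    have hardy_sec: "(\<integral>\<^sup>+t. ennreal ((F (x(i := t)) - F (x(i := 0)))\<^sup>2) \<partial>std_normal)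
        \<le> (\<integral>\<^sup>+t. ennreal ((D i (x(i := t)))\<^sup>2) \<partial>std_normal)" for x
    proof -
      have "((\<lambda>t. F (x(i := t))) has_real_derivative D i (x(i := t))) (at t)" for t
        using insert.prems(3)[of i "x(i := t)"] by (simp add: fun_upd_apply[of x i t i])
      then show ?thesis
        using insert.prems(4)[of i x] by (intro hardy_gaussian) auto
    qed
    \<comment> \<open>Jensen moves the square inside the integral over the other coordinates, and
      the Hardy inequality then acts on each section; so \<open>H\<close> is never differentiated
      under the integral sign.\<close>
    have "ennreal ((\<integral>t. (H t)\<^sup>2 \<partial>std_normal) - (\<integral>t. H t \<partial>std_normal)\<^sup>2)
        \<le> (\<integral>\<^sup>+t. ennreal ((H t - H 0)\<^sup>2) \<partial>std_normal)"
      by (rule std_normal.variance_le_square_about[OF H_int H2_int])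
    also have "\<dots> \<le> (\<integral>\<^sup>+t. \<integral>\<^sup>+x. ennreal ((F (x(i := t)) - F (x(i := 0)))\<^sup>2) \<partial>?P \<partial>std_normal)"
    proof (intro nn_integral_mono)
      fix t
      have "H t - H 0 = (\<integral>x. F (x(i := t)) - F (x(i := 0)) \<partial>?P)"
        unfolding H_def using int_sec(1)[OF insert.prems(1,2)] by simp
      then show "ennreal ((H t - H 0)\<^sup>2) \<le> (\<integral>\<^sup>+x. ennreal ((F (x(i := t)) - F (x(i := 0)))\<^sup>2) \<partial>?P)"
        using P.square_expectation_le[of "\<lambda>x. F (x(i := t)) - F (x(i := 0))"] by simp
    qed
    also have "\<dots> = (\<integral>\<^sup>+x. \<integral>\<^sup>+t. ennreal ((F (x(i := t)) - F (x(i := 0)))\<^sup>2) \<partial>std_normal \<partial>?P)"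
      by (intro NP.Fubini'[symmetric]) measurable
    also have "\<dots> \<le> (\<integral>\<^sup>+x. \<integral>\<^sup>+t. ennreal ((D i (x(i := t)))\<^sup>2) \<partial>std_normal \<partial>?P)"
      by (intro nn_integral_mono hardy_sec)
    also have "\<dots> = (\<integral>\<^sup>+w. ennreal ((D i w)\<^sup>2) \<partial>?Q)"
      by (subst std_normal_prod.product_nn_integral_insert[OF insert.hyps]) auto
    finally show "ennreal ((\<integral>t. (H t)\<^sup>2 \<partial>std_normal) - (\<integral>t. H t \<partial>std_normal)\<^sup>2)
      \<le> (\<integral>\<^sup>+w. ennreal ((D i w)\<^sup>2) \<partial>?Q)" .
  qed
  finally show ?case
    using insert.hyps by (simp add: add.commute)
qed

subsection \<open>Joint laws of linear forms\<close>

lemma borel_measurable_pair_comp: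
  assumes "case_prod H \<in> borel_measurable (borel \<Otimes>\<^sub>M borel)"
    and "f \<in> borel_measurable M" "g \<in> borel_measurable M"
  shows "(\<lambda>x. H (f x) (g x)) \<in> borel_measurable M"
  using measurable_compose[OF measurable_Pair[OF assms(2,3)] assms(1)] by simp

lemma std_normal_density_rotate:
  assumes "c\<^sup>2 + s\<^sup>2 = (1::real)"
  shows "std_normal_density (c * u + s * v) * std_normal_density (c * v - s * u)
    = std_normal_density u * std_normal_density v"
proof -
  have "(c * u + s * v)\<^sup>2 + (c * v - s * u)\<^sup>2 = (c\<^sup>2 + s\<^sup>2) * (u\<^sup>2 + v\<^sup>2)"
    by (simp add: power2_eq_square algebra_simps)
  then have "(c * u + s * v)\<^sup>2 / 2 + (c * v - s * u)\<^sup>2 / 2 = u\<^sup>2 / 2 + v\<^sup>2 / 2"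
    using assms by simp
  then have "exp (- ((c * u + s * v)\<^sup>2 / 2)) * exp (- ((c * v - s * u)\<^sup>2 / 2)) = exp (- (u\<^sup>2 / 2)) * exp (- (v\<^sup>2 / 2))"
    unfolding exp_add[symmetric] by (simp add: add.commute)
  then show ?thesis
    by (simp add: normal_density_def)
qed

text \<open>The rotation is performed one variable at a time: u = c x - s y at fixed y, then y = - s
  u + c v at fixed u. The Jacobians 1 / |c| and |c| cancel, and the densities agree since a rotation
  preserves u^2 + v^2. Solving for x is where c \<noteq> 0 enters.\<close>

lemma std_normal_rotation_aux:
  fixes H :: "real \<Rightarrow> real \<Rightarrow> ennreal"
  assumes H: "case_prod H \<in> borel_measurable (borel \<Otimes>\<^sub>M borel)"
    and cs: "c\<^sup>2 + s\<^sup>2 = 1" "c \<noteq> 0"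
  shows "(\<integral>\<^sup>+y. \<integral>\<^sup>+x. H (c * x - s * y) (s * x + c * y) \<partial>std_normal \<partial>std_normal)
    = (\<integral>\<^sup>+x. \<integral>\<^sup>+y. H x y \<partial>std_normal \<partial>std_normal)"
proof -
  note [measurable] = borel_measurable_pair_comp[OF H]
  let ?\<phi> = "\<lambda>x. ennreal (std_normal_density x)"
  have inner: "(\<integral>\<^sup>+x. ?\<phi> x * (?\<phi> y * H (c * x - s * y) (s * x + c * y)) \<partial>lborel)
      = (\<integral>\<^sup>+u. ennreal \<bar>1 / c\<bar> * (?\<phi> ((u + s * y) / c) * (?\<phi> y * H u ((s * u + y) / c))) \<partial>lborel)" for y
  proof -
    have "c * (s * y / c + 1 / c * u) - s * y = u" "s * (s * y / c + 1 / c * u) + c * y = (s * u + y) / c"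
      "s * y / c + 1 / c * u = (u + s * y) / c" for u
    proof -
      have "s * (s * y / c + 1 / c * u) + c * y = (s * u + (c\<^sup>2 + s\<^sup>2) * y) / c"
        using cs(2) by (simp add: field_simps power2_eq_square)
      then show "s * (s * y / c + 1 / c * u) + c * y = (s * u + y) / c"
        by (simp only: cs(1) mult_1)
    qed (use cs(2) in \<open>auto simp: field_simps\<close>)
    then show ?thesis
      using cs(2) nn_integral_real_affine[of "\<lambda>x. ?\<phi> x * (?\<phi> y * H (c * x - s * y) (s * x + c * y))" "1 / c" "s * y / c"]
      by (simp add: nn_integral_cmult)
  qed
  have outer: "(\<integral>\<^sup>+y. ennreal \<bar>1 / c\<bar> * (?\<phi> ((u + s * y) / c) * (?\<phi> y * H u ((s * u + y) / c))) \<partial>lborel)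
      = (\<integral>\<^sup>+v. ?\<phi> u * (?\<phi> v * H u v) \<partial>lborel)" for u
  proof -
    have eqs: "(s * u + (- s * u + c * v)) / c = v" "(u + s * (- s * u + c * v)) / c = c * u + s * v" for v
    proof -
      have "(u + s * (- s * u + c * v)) / c = ((c\<^sup>2 + s\<^sup>2) * u + s * (- s * u + c * v)) / c"
        using cs(1) by simp
      also have "\<dots> = c * u + s * v"
        using cs(2) by (simp add: field_simps power2_eq_square)
      finally show "(u + s * (- s * u + c * v)) / c = c * u + s * v" .
    qed (use cs(2) in auto)
    have "(\<integral>\<^sup>+y. ennreal \<bar>1 / c\<bar> * (?\<phi> ((u + s * y) / c) * (?\<phi> y * H u ((s * u + y) / c))) \<partial>lborel)
        = ennreal \<bar>c\<bar> * (\<integral>\<^sup>+v. ennreal \<bar>1 / c\<bar> * (?\<phi> (c * u + s * v) * (?\<phi> (- s * u + c * v) * H u v)) \<partial>lborel)"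
      using nn_integral_real_affine[of "\<lambda>y. ennreal \<bar>1 / c\<bar> * (?\<phi> ((u + s * y) / c) * (?\<phi> y * H u ((s * u + y) / c)))" c "- s * u"]
      unfolding eqs using cs(2) by simp
    also have "\<dots> = (\<integral>\<^sup>+v. ennreal \<bar>c\<bar> * (ennreal \<bar>1 / c\<bar> * (?\<phi> (c * u + s * v) * (?\<phi> (- s * u + c * v) * H u v))) \<partial>lborel)"
      by (rule nn_integral_cmult[symmetric]) measurable
    also have "\<dots> = (\<integral>\<^sup>+v. ?\<phi> u * (?\<phi> v * H u v) \<partial>lborel)"
    proof (intro nn_integral_cong)
      fix v
      have "?\<phi> (c * u + s * v) * ?\<phi> (- s * u + c * v) = ?\<phi> u * ?\<phi> v"
        using std_normal_density_rotate[OF cs(1), of u v] by (simp add: ennreal_mult[symmetric])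
      moreover have "ennreal \<bar>c\<bar> * ennreal \<bar>1 / c\<bar> = 1"
        using cs(2) by (simp add: ennreal_mult[symmetric])
      ultimately show "ennreal \<bar>c\<bar> * (ennreal \<bar>1 / c\<bar> * (?\<phi> (c * u + s * v) * (?\<phi> (- s * u + c * v) * H u v)))
          = ?\<phi> u * (?\<phi> v * H u v)"
        by (metis (no_types, lifting) mult.assoc mult_1)
    qed
    finally show ?thesis .
  qed
  have "(\<integral>\<^sup>+y. \<integral>\<^sup>+x. H (c * x - s * y) (s * x + c * y) \<partial>std_normal \<partial>std_normal)
      = (\<integral>\<^sup>+y. \<integral>\<^sup>+x. ?\<phi> x * (?\<phi> y * H (c * x - s * y) (s * x + c * y)) \<partial>lborel \<partial>lborel)"
    by (simp add: nn_integral_std_normal nn_integral_cmult[symmetric] mult_ac)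
  also have "\<dots> = (\<integral>\<^sup>+y. \<integral>\<^sup>+u. ennreal \<bar>1 / c\<bar> * (?\<phi> ((u + s * y) / c) * (?\<phi> y * H u ((s * u + y) / c))) \<partial>lborel \<partial>lborel)"
    by (simp only: inner)
  also have "\<dots> = (\<integral>\<^sup>+u. \<integral>\<^sup>+y. ennreal \<bar>1 / c\<bar> * (?\<phi> ((u + s * y) / c) * (?\<phi> y * H u ((s * u + y) / c))) \<partial>lborel \<partial>lborel)"
    by (rule lborel_pair.Fubini') measurable
  also have "\<dots> = (\<integral>\<^sup>+u. \<integral>\<^sup>+v. ?\<phi> u * (?\<phi> v * H u v) \<partial>lborel \<partial>lborel)"
    by (simp only: outer)
  also have "\<dots> = (\<integral>\<^sup>+x. \<integral>\<^sup>+y. H x y \<partial>std_normal \<partial>std_normal)"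
    by (simp add: nn_integral_std_normal nn_integral_cmult)
  finally show ?thesis .
qed

interpretation std_normal_pair: pair_prob_space std_normal std_normal ..

lemma std_normal_rotation:
  fixes H :: "real \<Rightarrow> real \<Rightarrow> ennreal"
  assumes H: "case_prod H \<in> borel_measurable (borel \<Otimes>\<^sub>M borel)" and cs: "c\<^sup>2 + s\<^sup>2 = 1"
  shows "(\<integral>\<^sup>+x. \<integral>\<^sup>+y. H (c * x - s * y) (s * x + c * y) \<partial>std_normal \<partial>std_normal)
    = (\<integral>\<^sup>+x. \<integral>\<^sup>+y. H x y \<partial>std_normal \<partial>std_normal)"
proof -
  have main: "(\<integral>\<^sup>+x. \<integral>\<^sup>+y. H (c * x - s * y) (s * x + c * y) \<partial>std_normal \<partial>std_normal)
      = (\<integral>\<^sup>+x. \<integral>\<^sup>+y. H x y \<partial>std_normal \<partial>std_normal)"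
    if H: "case_prod H \<in> borel_measurable (borel \<Otimes>\<^sub>M borel)" and "c\<^sup>2 + s\<^sup>2 = 1" "c \<noteq> 0" for H :: "real \<Rightarrow> real \<Rightarrow> ennreal" and c s
  proof -
    note [measurable] = borel_measurable_pair_comp[OF H]
    show ?thesis
      unfolding std_normal_rotation_aux[OF that, symmetric]
      by (intro std_normal_pair.Fubini'[symmetric]) measurable
  qed
  show ?thesis
  proof (cases "c = 0")
    case True
    \<comment> \<open>A quarter turn is the composition of two eighth turns, whose cosine
      \<open>?q\<close> does not vanish.\<close>
    let ?q = "1 / sqrt 2 :: real"
    note [measurable] = borel_measurable_pair_comp[OF H]
    have s: "s = 1 \<or> s = - 1"
      using cs True by (simp add: power2_eq_1_iff)
    then have q: "?q\<^sup>2 + (s * ?q)\<^sup>2 = 1"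
      by (auto simp: power_mult_distrib power_divide)
    have q2: "?q * ?q = 1 / 2" "s * s = 1"
      using s by auto
    have e: "?q * (?q * x - s * ?q * y) - s * ?q * (s * ?q * x + ?q * y) = c * x - s * y"
      "s * ?q * (?q * x - s * ?q * y) + ?q * (s * ?q * x + ?q * y) = s * x + c * y" for x y
    proof -
      have "?q * (?q * x - s * ?q * y) - s * ?q * (s * ?q * x + ?q * y)
          = (?q * ?q) * (x - s * y - (s * s) * x - s * y)"
        by (simp add: algebra_simps)
      then show "?q * (?q * x - s * ?q * y) - s * ?q * (s * ?q * x + ?q * y) = c * x - s * y"
        unfolding q2 True by simp
      have "s * ?q * (?q * x - s * ?q * y) + ?q * (s * ?q * x + ?q * y)
          = (?q * ?q) * (s * x - (s * s) * y + s * x + y)"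
        by (simp add: algebra_simps)
      then show "s * ?q * (?q * x - s * ?q * y) + ?q * (s * ?q * x + ?q * y) = s * x + c * y"
        unfolding q2 True by simp
    qed
    have "(\<integral>\<^sup>+x. \<integral>\<^sup>+y. H (?q * (?q * x - s * ?q * y) - s * ?q * (s * ?q * x + ?q * y))
          (s * ?q * (?q * x - s * ?q * y) + ?q * (s * ?q * x + ?q * y)) \<partial>std_normal \<partial>std_normal)
        = (\<integral>\<^sup>+x. \<integral>\<^sup>+y. H (?q * x - s * ?q * y) (s * ?q * x + ?q * y) \<partial>std_normal \<partial>std_normal)"
      by (rule main[OF _ q]) measurable
    also have "\<dots> = (\<integral>\<^sup>+x. \<integral>\<^sup>+y. H x y \<partial>std_normal \<partial>std_normal)"
      by (rule main[OF H q]) simp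
    finally show ?thesis by (simp only: e)
  qed (use main[OF H cs] in auto)
qed

lemma polar_decomp: "\<exists>r c s. 0 \<le> r \<and> c\<^sup>2 + s\<^sup>2 = 1 \<and> p = r * c \<and> q = r * (s::real)"
proof (cases "p\<^sup>2 + q\<^sup>2 = 0")
  case True
  then show ?thesis
    by (intro exI[of _ 0] exI[of _ 1]) (auto simp: sum_power2_eq_zero_iff)
next
  case False
  let ?r = "sqrt (p\<^sup>2 + q\<^sup>2)"
  have "?r \<noteq> 0" "(p / ?r)\<^sup>2 + (q / ?r)\<^sup>2 = 1"
    using False by (auto simp: power_divide add_divide_distrib[symmetric])
  then show ?thesis
    by (intro exI[of _ ?r] exI[of _ "p / ?r"] exI[of _ "q / ?r"]) auto
qed

text \<open>Adding one coordinate to the index set appends a column to the triangular 2 x 2 matrix with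
  entries P, Q, R; a rotation of two independent normals restores its triangular shape.\<close>

lemma gauss_joint:
  fixes a b :: "nat \<Rightarrow> real"
  assumes "finite I"
  shows "\<exists>P Q R. 0 \<le> P \<and> 0 \<le> R \<and> P\<^sup>2 = (\<Sum>i\<in>I. (a i)\<^sup>2) \<and> P * Q = (\<Sum>i\<in>I. a i * b i) \<and> Q\<^sup>2 + R\<^sup>2 = (\<Sum>i\<in>I. (b i)\<^sup>2) \<and>
    (\<forall>H :: real \<Rightarrow> real \<Rightarrow> ennreal. case_prod H \<in> borel_measurable (borel \<Otimes>\<^sub>M borel) \<longrightarrow>
      (\<integral>\<^sup>+w. H (\<Sum>i\<in>I. w i * a i) (\<Sum>i\<in>I. w i * b i) \<partial>(\<Pi>\<^sub>M i\<in>I. std_normal))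
      = (\<integral>\<^sup>+x. \<integral>\<^sup>+y. H (P * x) (Q * x + R * y) \<partial>std_normal \<partial>std_normal))"
  using assms
proof (induction I rule: finite_induct)
  case empty
  show ?case
    by (rule exI[of _ 0], rule exI[of _ 0], rule exI[of _ 0])
       (auto simp: PiM_empty nn_integral_count_space_finite std_normal.emeasure_space_1[simplified])
next
  case (insert i I)
  let ?P = "\<Pi>\<^sub>M i\<in>I. std_normal" and ?Q = "\<Pi>\<^sub>M i\<in>insert i I. std_normal"
  obtain P Q R where PQR: "0 \<le> P" "0 \<le> R" "P\<^sup>2 = (\<Sum>i\<in>I. (a i)\<^sup>2)" "P * Q = (\<Sum>i\<in>I. a i * b i)" "Q\<^sup>2 + R\<^sup>2 = (\<Sum>i\<in>I. (b i)\<^sup>2)"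
    and IH: "\<And>H :: real \<Rightarrow> real \<Rightarrow> ennreal. case_prod H \<in> borel_measurable (borel \<Otimes>\<^sub>M borel) \<Longrightarrow>
      (\<integral>\<^sup>+w. H (\<Sum>i\<in>I. w i * a i) (\<Sum>i\<in>I. w i * b i) \<partial>?P)
      = (\<integral>\<^sup>+x. \<integral>\<^sup>+y. H (P * x) (Q * x + R * y) \<partial>std_normal \<partial>std_normal)"
    using insert.IH by blast
  \<comment> \<open>Polar coordinates of the pair (P, a i). Rotating t and x by this angle
    concentrates the first form on a single variable with coefficient P' and leaves the other one,
    with coefficient S, in the second form only.\<close>
  obtain P' c s where P': "0 \<le> P'" "c\<^sup>2 + s\<^sup>2 = 1" "P = P' * c" "a i = P' * s"
    using polar_decomp by blast
  define Q' S where "Q' = Q * c + b i * s" and "S = b i * c - Q * s"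
  \<comment> \<open>The second rotation merges R y + S t into R' y; the freed variable integrates
    out.\<close>
  obtain R' c' s' where R': "0 \<le> R'" "c'\<^sup>2 + s'\<^sup>2 = 1" "R = R' * c'" "S = R' * s'"
    using polar_decomp by blast
  have "P'\<^sup>2 = P\<^sup>2 + (a i)\<^sup>2"
    using P'(2) unfolding P'(3,4) power_mult_distrib by (metis distrib_left mult.right_neutral)
  moreover have "P' * Q' = P * Q + a i * b i"
    unfolding Q'_def P'(3,4) by (simp add: algebra_simps)
  moreover have "Q'\<^sup>2 + R'\<^sup>2 = Q\<^sup>2 + R\<^sup>2 + (b i)\<^sup>2"
  proof -
    have "R'\<^sup>2 = R\<^sup>2 + S\<^sup>2"
      using R'(2) unfolding R'(3,4) power_mult_distrib by (metis distrib_left mult.right_neutral)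
    moreover have "Q'\<^sup>2 + S\<^sup>2 = (c\<^sup>2 + s\<^sup>2) * (Q\<^sup>2 + (b i)\<^sup>2)"
      unfolding Q'_def S_def by (simp add: power2_eq_square algebra_simps)
    ultimately show ?thesis using P'(2) by simp
  qed
  moreover have "(\<integral>\<^sup>+w. H (\<Sum>i\<in>insert i I. w i * a i) (\<Sum>i\<in>insert i I. w i * b i) \<partial>?Q)
      = (\<integral>\<^sup>+x. \<integral>\<^sup>+y. H (P' * x) (Q' * x + R' * y) \<partial>std_normal \<partial>std_normal)"
    if H: "case_prod H \<in> borel_measurable (borel \<Otimes>\<^sub>M borel)" for H :: "real \<Rightarrow> real \<Rightarrow> ennreal"
  proof -
    note [measurable] = borel_measurable_pair_comp[OF H]
    have upd: "(\<Sum>k\<in>I. (x(i := t)) k * g k) = (\<Sum>k\<in>I. x k * g k)" for x t and g :: "nat \<Rightarrow> real"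
      using insert.hyps by (intro sum.cong) auto
    have "(\<integral>\<^sup>+w. H (\<Sum>i\<in>insert i I. w i * a i) (\<Sum>i\<in>insert i I. w i * b i) \<partial>?Q)
        = (\<integral>\<^sup>+t. \<integral>\<^sup>+x. H (t * a i + (\<Sum>i\<in>I. x i * a i)) (t * b i + (\<Sum>i\<in>I. x i * b i)) \<partial>?P \<partial>std_normal)"
      using insert.hyps by (subst std_normal_prod.product_nn_integral_insert_rev) (auto simp: upd fun_upd_same simp del: fun_upd_apply)
    also have "\<dots> = (\<integral>\<^sup>+t. \<integral>\<^sup>+x. \<integral>\<^sup>+y. H (t * a i + P * x) (t * b i + (Q * x + R * y)) \<partial>std_normal \<partial>std_normal \<partial>std_normal)"
      by (intro nn_integral_cong IH) measurable
    also have "\<dots> = (\<integral>\<^sup>+x. \<integral>\<^sup>+t. \<integral>\<^sup>+y. H (t * a i + P * x) (t * b i + (Q * x + R * y)) \<partial>std_normal \<partial>std_normal \<partial>std_normal)"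
      by (intro std_normal_pair.Fubini') measurable
    also have "\<dots> = (\<integral>\<^sup>+x. \<integral>\<^sup>+y. \<integral>\<^sup>+t. H (t * a i + P * x) (t * b i + (Q * x + R * y)) \<partial>std_normal \<partial>std_normal \<partial>std_normal)"
      by (intro nn_integral_cong std_normal_pair.Fubini') measurable
    also have "\<dots> = (\<integral>\<^sup>+y. \<integral>\<^sup>+x. \<integral>\<^sup>+t. H (t * a i + P * x) (t * b i + (Q * x + R * y)) \<partial>std_normal \<partial>std_normal \<partial>std_normal)"
      by (intro std_normal_pair.Fubini') measurable
    also have "\<dots> = (\<integral>\<^sup>+y. \<integral>\<^sup>+x. \<integral>\<^sup>+t. H ((s * x + c * t) * a i + P * (c * x - s * t)) ((s * x + c * t) * b i + (Q * (c * x - s * t) + R * y)) \<partial>std_normal \<partial>std_normal \<partial>std_normal)"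
      by (intro nn_integral_cong std_normal_rotation[symmetric] P'(2)) measurable
    also have "\<dots> = (\<integral>\<^sup>+y. \<integral>\<^sup>+x. \<integral>\<^sup>+t. H (P' * x) (Q' * x + (R * y + S * t)) \<partial>std_normal \<partial>std_normal \<partial>std_normal)"
    proof -
      have "(s * x + c * t) * a i + P * (c * x - s * t) = (c\<^sup>2 + s\<^sup>2) * (P' * x)" for x t
        unfolding P'(3,4) by (simp add: power2_eq_square algebra_simps)
      moreover have "(s * x + c * t) * b i + (Q * (c * x - s * t) + R * y) = Q' * x + (R * y + S * t)" for x y t
        unfolding Q'_def S_def by (simp add: algebra_simps)
      ultimately show ?thesis by (simp only: P'(2) mult_1)
    qed
    also have "\<dots> = (\<integral>\<^sup>+x. \<integral>\<^sup>+y. \<integral>\<^sup>+t. H (P' * x) (Q' * x + (R * y + S * t)) \<partial>std_normal \<partial>std_normal \<partial>std_normal)"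
      by (intro std_normal_pair.Fubini') measurable
    also have "\<dots> = (\<integral>\<^sup>+x. \<integral>\<^sup>+y. \<integral>\<^sup>+t. H (P' * x) (Q' * x + (R * (c' * y - s' * t) + S * (s' * y + c' * t))) \<partial>std_normal \<partial>std_normal \<partial>std_normal)"
      by (intro nn_integral_cong std_normal_rotation[symmetric] R'(2)) measurable
    also have "\<dots> = (\<integral>\<^sup>+x. \<integral>\<^sup>+y. \<integral>\<^sup>+t. H (P' * x) (Q' * x + R' * y) \<partial>std_normal \<partial>std_normal \<partial>std_normal)"
    proof -
      have "R * (c' * y - s' * t) + S * (s' * y + c' * t) = (c'\<^sup>2 + s'\<^sup>2) * (R' * y)" for y t
        unfolding R'(3,4) by (simp add: power2_eq_square algebra_simps)
      then show ?thesis using R'(2) by simp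
    qed
    finally show ?thesis
      using std_normal.emeasure_space_1 by simp
  qed
  ultimately show ?case
    using insert.hyps PQR P'(1) R'(1)
    by (intro exI[of _ P'] exI[of _ Q'] exI[of _ R']) (auto simp: add_ac)
qed

text \<open>Unit norms force P = 1, Q = r and R = sqrt (1 - r^2), so the joint law depends on the
  coefficient vectors through r alone. Indicators as test functions identify the measures.\<close>

lemma distr_gauss_pair:
  fixes a b :: "nat \<Rightarrow> real"
  assumes "finite I" and a: "(\<Sum>i\<in>I. (a i)\<^sup>2) = 1" and b: "(\<Sum>i\<in>I. (b i)\<^sup>2) = 1" and r: "(\<Sum>i\<in>I. a i * b i) = r"
  shows "distr (\<Pi>\<^sub>M i\<in>I. std_normal) (borel \<Otimes>\<^sub>M borel) (\<lambda>w. (\<Sum>i\<in>I. w i * a i, \<Sum>i\<in>I. w i * b i))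
    = distr (std_normal \<Otimes>\<^sub>M std_normal) (borel \<Otimes>\<^sub>M borel) (\<lambda>(x, y). (x, r * x + sqrt (1 - r\<^sup>2) * y))"
proof -
  obtain P Q R where PQR: "0 \<le> P" "0 \<le> R" "P\<^sup>2 = (\<Sum>i\<in>I. (a i)\<^sup>2)" "P * Q = (\<Sum>i\<in>I. a i * b i)" "Q\<^sup>2 + R\<^sup>2 = (\<Sum>i\<in>I. (b i)\<^sup>2)"
    and main: "\<And>H :: real \<Rightarrow> real \<Rightarrow> ennreal. case_prod H \<in> borel_measurable (borel \<Otimes>\<^sub>M borel) \<Longrightarrow>
      (\<integral>\<^sup>+w. H (\<Sum>i\<in>I. w i * a i) (\<Sum>i\<in>I. w i * b i) \<partial>(\<Pi>\<^sub>M i\<in>I. std_normal))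
      = (\<integral>\<^sup>+x. \<integral>\<^sup>+y. H (P * x) (Q * x + R * y) \<partial>std_normal \<partial>std_normal)"
    using gauss_joint[OF \<open>finite I\<close>, of a b] by blast
  have "P = 1"
    using PQR(1,3) a by (simp add: power2_eq_1_iff)
  moreover have "Q = r"
    using PQR(4) r \<open>P = 1\<close> by simp
  moreover have "R = sqrt (1 - r\<^sup>2)"
    using PQR(2,5) b \<open>Q = r\<close> by (intro real_sqrt_unique[symmetric]) auto
  ultimately have main': "\<And>H :: real \<Rightarrow> real \<Rightarrow> ennreal. case_prod H \<in> borel_measurable (borel \<Otimes>\<^sub>M borel) \<Longrightarrow>
      (\<integral>\<^sup>+w. H (\<Sum>i\<in>I. w i * a i) (\<Sum>i\<in>I. w i * b i) \<partial>(\<Pi>\<^sub>M i\<in>I. std_normal))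
      = (\<integral>\<^sup>+x. \<integral>\<^sup>+y. H x (r * x + sqrt (1 - r\<^sup>2) * y) \<partial>std_normal \<partial>std_normal)"
    using main by simp
  show ?thesis
  proof (rule measure_eqI)
    fix A assume "A \<in> sets (distr (\<Pi>\<^sub>M i\<in>I. std_normal) (borel \<Otimes>\<^sub>M borel) (\<lambda>w. (\<Sum>i\<in>I. w i * a i, \<Sum>i\<in>I. w i * b i)))"
    then have A [measurable]: "A \<in> sets (borel \<Otimes>\<^sub>M borel)" by simp
    have "emeasure (distr (\<Pi>\<^sub>M i\<in>I. std_normal) (borel \<Otimes>\<^sub>M borel) (\<lambda>w. (\<Sum>i\<in>I. w i * a i, \<Sum>i\<in>I. w i * b i))) A
        = (\<integral>\<^sup>+w. (\<lambda>x y. indicator A (x, y)) (\<Sum>i\<in>I. w i * a i) (\<Sum>i\<in>I. w i * b i) \<partial>(\<Pi>\<^sub>M i\<in>I. std_normal))"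
      by (subst nn_integral_indicator[symmetric], simp, subst nn_integral_distr) auto
    also have "\<dots> = (\<integral>\<^sup>+x. \<integral>\<^sup>+y. indicator A (x, r * x + sqrt (1 - r\<^sup>2) * y) \<partial>std_normal \<partial>std_normal)"
      by (rule main') (auto simp: case_prod_beta')
    also have "\<dots> = emeasure (distr (std_normal \<Otimes>\<^sub>M std_normal) (borel \<Otimes>\<^sub>M borel) (\<lambda>(x, y). (x, r * x + sqrt (1 - r\<^sup>2) * y))) A"
      by (subst nn_integral_indicator[symmetric], simp, subst nn_integral_distr)
         (auto simp: std_normal.nn_integral_fst[symmetric] case_prod_beta')
    finally show "emeasure (distr (\<Pi>\<^sub>M i\<in>I. std_normal) (borel \<Otimes>\<^sub>M borel) (\<lambda>w. (\<Sum>i\<in>I. w i * a i, \<Sum>i\<in>I. w i * b i))) A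
      = emeasure (distr (std_normal \<Otimes>\<^sub>M std_normal) (borel \<Otimes>\<^sub>M borel) (\<lambda>(x, y). (x, r * x + sqrt (1 - r\<^sup>2) * y))) A" .
  qed simp
qed

lemma distr_gauss_linear:
  fixes a :: "nat \<Rightarrow> real"
  assumes "finite I"
  shows "distr (\<Pi>\<^sub>M i\<in>I. std_normal) borel (\<lambda>w. \<Sum>i\<in>I. w i * a i)
    = distr std_normal borel (\<lambda>x. sqrt (\<Sum>i\<in>I. (a i)\<^sup>2) * x)"
proof -
  obtain P Q R where PQR: "0 \<le> P" "P\<^sup>2 = (\<Sum>i\<in>I. (a i)\<^sup>2)"
    and main: "\<And>H :: real \<Rightarrow> real \<Rightarrow> ennreal. case_prod H \<in> borel_measurable (borel \<Otimes>\<^sub>M borel) \<Longrightarrow>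
      (\<integral>\<^sup>+w. H (\<Sum>i\<in>I. w i * a i) (\<Sum>i\<in>I. w i * a i) \<partial>(\<Pi>\<^sub>M i\<in>I. std_normal))
      = (\<integral>\<^sup>+x. \<integral>\<^sup>+y. H (P * x) (Q * x + R * y) \<partial>std_normal \<partial>std_normal)"
    using gauss_joint[OF \<open>finite I\<close>, of a a] by blast
  have P: "sqrt (\<Sum>i\<in>I. (a i)\<^sup>2) = P"
    using PQR by (simp add: real_sqrt_unique)
  show ?thesis
    unfolding P
  proof (rule measure_eqI)
    fix A assume "A \<in> sets (distr (\<Pi>\<^sub>M i\<in>I. std_normal) borel (\<lambda>w. \<Sum>i\<in>I. w i * a i))"
    then have A [measurable]: "A \<in> sets borel" by simp
    have "emeasure (distr (\<Pi>\<^sub>M i\<in>I. std_normal) borel (\<lambda>w. \<Sum>i\<in>I. w i * a i)) A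
        = (\<integral>\<^sup>+w. (\<lambda>x y. indicator A x) (\<Sum>i\<in>I. w i * a i) (\<Sum>i\<in>I. w i * a i) \<partial>(\<Pi>\<^sub>M i\<in>I. std_normal))"
      by (subst nn_integral_indicator[symmetric], simp, subst nn_integral_distr) auto
    also have "\<dots> = (\<integral>\<^sup>+x. \<integral>\<^sup>+y. indicator A (P * x) \<partial>std_normal \<partial>std_normal)"
      by (rule main) (auto simp: case_prod_beta')
    also have "\<dots> = (\<integral>\<^sup>+x. indicator A (P * x) \<partial>std_normal)"
      using std_normal.emeasure_space_1 by simp
    also have "\<dots> = emeasure (distr std_normal borel (\<lambda>x. P * x)) A"
      by (subst nn_integral_indicator[symmetric], simp, subst nn_integral_distr) auto
    finally show "emeasure (distr (\<Pi>\<^sub>M i\<in>I. std_normal) borel (\<lambda>w. \<Sum>i\<in>I. w i * a i)) A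
      = emeasure (distr std_normal borel (\<lambda>x. P * x)) A" .
  qed simp
qed

subsection \<open>Fourth moments of Lipschitz features\<close>

lemma exp_growth_const: "exp_growth I (\<lambda>_. a)"
  unfolding exp_growth_def by (intro exI[of _ "\<bar>a\<bar>"] exI[of _ 0]) auto

lemma exp_growth_dominated:
  assumes "exp_growth I G" "\<And>w. \<bar>F w\<bar> \<le> \<bar>G w\<bar>"
  shows "exp_growth I F"
  using assms unfolding exp_growth_def by (meson order.trans)

lemma exp_growth_coord:
  assumes "finite I" "i \<in> I"
  shows "exp_growth I (\<lambda>w. w i)"
  unfolding exp_growth_def
proof (intro exI[of _ 1] conjI allI)
  fix w :: "nat \<Rightarrow> real"
  have "\<bar>w i\<bar> \<le> exp \<bar>w i\<bar> * 1"
    using exp_ge_add_one_self[of "\<bar>w i\<bar>"] by linarith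
  also have "\<dots> \<le> exp \<bar>w i\<bar> * (\<Prod>k\<in>I - {i}. exp \<bar>w k\<bar>)"
    by (intro mult_left_mono prod_ge_1) auto
  also have "\<dots> = (\<Prod>k\<in>I. exp \<bar>w k\<bar>)"
    using assms by (simp add: prod.remove)
  finally show "\<bar>w i\<bar> \<le> 1 * (\<Prod>k\<in>I. exp (1 * \<bar>w k\<bar>))" by simp
qed simp

lemma exp_growth_add:
  assumes "exp_growth I F" "exp_growth I G"
  shows "exp_growth I (\<lambda>w. F w + G w)"
proof -
  obtain C c where F: "0 \<le> c" "\<And>w. \<bar>F w\<bar> \<le> C * (\<Prod>i\<in>I. exp (c * \<bar>w i\<bar>))"
    using assms(1) by (auto simp: exp_growth_def)
  obtain C' c' where G: "0 \<le> c'" "\<And>w. \<bar>G w\<bar> \<le> C' * (\<Prod>i\<in>I. exp (c' * \<bar>w i\<bar>))"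
    using assms(2) by (auto simp: exp_growth_def)
  have "\<bar>F w + G w\<bar> \<le> (\<bar>C\<bar> + \<bar>C'\<bar>) * (\<Prod>i\<in>I. exp ((c + c') * \<bar>w i\<bar>))" for w
  proof -
    let ?p = "\<lambda>c. \<Prod>i\<in>I. exp (c * \<bar>w i\<bar>)"
    have "?p c \<le> ?p (c + c')" "?p c' \<le> ?p (c + c')"
      using F(1) G(1) by (auto intro!: prod_mono mult_right_mono)
    moreover have "0 \<le> ?p c" "0 \<le> ?p c'" by (auto intro: prod_nonneg)
    ultimately have "C * ?p c \<le> \<bar>C\<bar> * ?p (c + c')" "C' * ?p c' \<le> \<bar>C'\<bar> * ?p (c + c')"
      by (auto intro!: mult_mono)
    then show ?thesis
      using F(2)[of w] G(2)[of w] by (simp add: distrib_right)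
  qed
  with F G show ?thesis
    unfolding exp_growth_def by (intro exI[of _ "\<bar>C\<bar> + \<bar>C'\<bar>"] exI[of _ "c + c'"]) auto
qed

lemma exp_growth_sum:
  "(\<And>j. j \<in> J \<Longrightarrow> exp_growth I (F j)) \<Longrightarrow> exp_growth I (\<lambda>w. \<Sum>j\<in>J. F j w)"
  by (induction J rule: infinite_finite_induct) (auto intro: exp_growth_add exp_growth_const)

lemma exp_growth_abs: "exp_growth I F \<Longrightarrow> exp_growth I (\<lambda>w. \<bar>F w\<bar>)"
  by (erule exp_growth_dominated) simp

lemma exp_growth_linear: "finite I \<Longrightarrow> exp_growth I (\<lambda>w. \<Sum>i\<in>I. w i * a i)"
  by (intro exp_growth_sum exp_growth_mult exp_growth_coord exp_growth_const)

lemma exp_growth_power: "exp_growth I F \<Longrightarrow> exp_growth I (\<lambda>w. F w ^ k)"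
  by (induction k) (auto intro: exp_growth_const exp_growth_mult)

definition dotp :: "nat \<Rightarrow> (nat \<Rightarrow> real) \<Rightarrow> (nat \<Rightarrow> real) \<Rightarrow> real" where
  "dotp d w a = (\<Sum>i<d. w i * a i)"

abbreviation gauss :: "nat \<Rightarrow> (nat \<Rightarrow> real) measure" where
  "gauss d \<equiv> \<Pi>\<^sub>M i\<in>{..<d}. std_normal"

lemma dotp_measurable [measurable]: "(\<lambda>w. dotp d w a) \<in> borel_measurable (gauss d)"
  unfolding dotp_def by measurable

lemma exp_growth_dotp: "exp_growth {..<d} (\<lambda>w. dotp d w a)"
  unfolding dotp_def by (intro exp_growth_linear) simp

lemma dotp_upd:
  assumes "i < d"
  shows "dotp d (w(i := t)) a = dotp d w a + (t - w i) * a i"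
proof -
  have "dotp d (w(i := t)) a = t * a i + (\<Sum>k\<in>{..<d} - {i}. w k * a k)"
    using assms unfolding dotp_def by (subst sum.remove[of _ i]) auto
  moreover have "dotp d w a = w i * a i + (\<Sum>k\<in>{..<d} - {i}. w k * a k)"
    using assms unfolding dotp_def by (subst sum.remove[of _ i]) auto
  ultimately show ?thesis by (simp add: algebra_simps)
qed

lemma lipschitz_growth:
  assumes "\<And>x y. \<bar>\<sigma> x - \<sigma> y\<bar> \<le> L * \<bar>x - y\<bar>"
  shows "exp_growth {..<d} (\<lambda>w. \<sigma> (dotp d w a) :: real)"
proof (rule exp_growth_dominated)
  show "exp_growth {..<d} (\<lambda>w. \<bar>\<sigma> 0\<bar> + L * \<bar>dotp d w a\<bar>)"
    by (intro exp_growth_add exp_growth_mult exp_growth_const exp_growth_abs exp_growth_dotp)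
  show "\<bar>\<sigma> (dotp d w a)\<bar> \<le> \<bar>\<bar>\<sigma> 0\<bar> + L * \<bar>dotp d w a\<bar>\<bar>" for w
    using assms[of "dotp d w a" 0] by simp
qed

text \<open>The Poincare inequality is used twice, for F and for its square.\<close>

lemma fourth_moment_smooth:
  fixes X :: "nat \<Rightarrow> nat \<Rightarrow> real"
  assumes \<tau>: "\<And>x. (\<tau> has_real_derivative \<tau>' x) (at x)" and cont: "continuous_on UNIV \<tau>'"
    and L: "\<And>x. \<bar>\<tau>' x\<bar> \<le> L"
    and op: "\<And>v. (\<Sum>i<d. (\<Sum>j<n. X i j * v j)\<^sup>2) \<le> B\<^sup>2 * (\<Sum>j<n. (v j)\<^sup>2)"
    and F_def: "\<And>w. F w = (\<Sum>j<n. u j * \<tau> (dotp d w (\<lambda>i. X i j)))"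
    and V_def: "V = L\<^sup>2 * B\<^sup>2 * (\<Sum>j<n. (u j)\<^sup>2)"
    and mean: "(\<integral>w. F w \<partial>gauss d)\<^sup>2 \<le> m"
  shows "(\<integral>w. F w ^ 4 \<partial>gauss d) \<le> (V + m)\<^sup>2 + 4 * V * (V + m)"
proof -
  interpret prob_space "gauss d" by (rule prob_space_gauss)
  have [measurable]: "\<tau>' \<in> borel_measurable borel"
    using cont by (rule borel_measurable_continuous_onI)
  have "continuous_on UNIV \<tau>"
    using \<tau> by (meson DERIV_isCont continuous_at_imp_continuous_on)
  then have [measurable]: "\<tau> \<in> borel_measurable borel"
    by (rule borel_measurable_continuous_onI)
  have lip: "\<bar>\<tau> x - \<tau> y\<bar> \<le> L * \<bar>x - y\<bar>" for x y
    using field_differentiable_bound[of UNIV \<tau> \<tau>' L x y] \<tau> L by (simp add: has_field_derivative_at_within)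
  have F_meas [measurable]: "F \<in> borel_measurable (gauss d)"
    unfolding F_def[abs_def] by measurable
  have gF: "exp_growth {..<d} F"
    unfolding F_def[abs_def] by (intro exp_growth_sum exp_growth_mult exp_growth_const lipschitz_growth[where L = L] lip)
  have gF2: "exp_growth {..<d} (\<lambda>w. (F w)\<^sup>2)" and gF4: "exp_growth {..<d} (\<lambda>w. F w ^ 4)"
    by (intro exp_growth_power gF)+
  define D where "D i w = (\<Sum>j<n. u j * \<tau>' (dotp d w (\<lambda>i. X i j)) * X i j)" for i w
  have [measurable]: "D i \<in> borel_measurable (gauss d)" for i
    unfolding D_def by measurable
  have derivF: "((\<lambda>t. F (w(i := t))) has_real_derivative D i w) (at (w i))" if "i < d" for i w
    unfolding F_def D_def dotp_upd[OF that]
    by (auto intro!: derivative_eq_intros DERIV_chain2[OF \<tau>] sum.cong simp: mult_ac)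
  have contD: "continuous_on UNIV (\<lambda>t. D i (w(i := t)))" if "i < d" for i w
    unfolding D_def dotp_upd[OF that]
    by (intro continuous_intros continuous_on_compose2[OF cont]) auto
  have contF: "continuous_on UNIV (\<lambda>t. F (w(i := t)))" if "i < d" for i w
    unfolding F_def dotp_upd[OF that]
    by (intro continuous_intros continuous_on_compose2[OF \<open>continuous_on UNIV \<tau>\<close>]) auto
  \<comment> \<open>The gradient of F at w is the data matrix applied to the vector with entries u_j
    \<tau>'(...), so the operator bound \<open>op\<close> controls it pointwise in w.\<close>
  have sumD: "(\<Sum>i<d. (D i w)\<^sup>2) \<le> V" for w
  proof -
    have "(\<Sum>i<d. (D i w)\<^sup>2) \<le> B\<^sup>2 * (\<Sum>j<n. (u j * \<tau>' (dotp d w (\<lambda>i. X i j)))\<^sup>2)"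
      using op[of "\<lambda>j. u j * \<tau>' (dotp d w (\<lambda>i. X i j))"] by (simp add: D_def mult_ac)
    also have "\<dots> \<le> B\<^sup>2 * (\<Sum>j<n. (u j)\<^sup>2 * L\<^sup>2)"
      using L by (intro mult_left_mono sum_mono) (auto simp: power_mult_distrib abs_le_square_iff[symmetric] intro!: mult_left_mono order.trans[OF L abs_ge_self])
    finally show ?thesis
      unfolding V_def by (simp add: sum_distrib_left sum_distrib_right mult_ac)
  qed
  have V0: "0 \<le> V" unfolding V_def by (simp add: sum_nonneg)
  have i1: "integrable (gauss d) F" and i2: "integrable (gauss d) (\<lambda>w. (F w)\<^sup>2)" and i4: "integrable (gauss d) (\<lambda>w. F w ^ 4)"
    by (intro integrable_gauss_exp_growth gF gF2 gF4; measurable)+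
  have "ennreal (expectation (\<lambda>w. (F w)\<^sup>2) - (expectation F)\<^sup>2) \<le> (\<Sum>i<d. \<integral>\<^sup>+w. ennreal ((D i w)\<^sup>2) \<partial>gauss d)"
    by (rule poincare_gauss) (use gF derivF contD in auto)
  also have "\<dots> = (\<integral>\<^sup>+w. ennreal (\<Sum>i<d. (D i w)\<^sup>2) \<partial>gauss d)"
    by (subst nn_integral_sum[symmetric]) (auto simp: sum_ennreal)
  also have "\<dots> \<le> (\<integral>\<^sup>+w. ennreal V \<partial>gauss d)"
    by (intro nn_integral_mono ennreal_leI sumD)
  finally have i2_le: "expectation (\<lambda>w. (F w)\<^sup>2) \<le> V + m"
    using V0 mean emeasure_space_1 by (simp add: ennreal_le_iff)
  \<comment> \<open>The gradient 2 F D of F^2 has square at most 4 V F^2, so the fourth moment is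
    reduced to the second moment just bounded.\<close>
  have "ennreal (expectation (\<lambda>w. ((F w)\<^sup>2)\<^sup>2) - (expectation (\<lambda>w. (F w)\<^sup>2))\<^sup>2)
      \<le> (\<Sum>i<d. \<integral>\<^sup>+w. ennreal ((2 * F w * D i w)\<^sup>2) \<partial>gauss d)"
  proof (rule poincare_gauss)
    fix i w assume "i \<in> {..<d}"
    then have i: "i < d" by simp
    show "((\<lambda>t. (F (w(i := t)))\<^sup>2) has_real_derivative 2 * F w * D i w) (at (w i))"
      using DERIV_power[OF derivF[OF i], of w 2] by (simp add: mult_ac)
    show "continuous_on UNIV (\<lambda>t. 2 * F (w(i := t)) * D i (w(i := t)))"
      by (intro continuous_intros contD contF i)
  qed (use gF2 in auto)
  also have "\<dots> = (\<integral>\<^sup>+w. ennreal (\<Sum>i<d. (2 * F w * D i w)\<^sup>2) \<partial>gauss d)"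
    by (subst nn_integral_sum[symmetric]) (auto simp: sum_ennreal)
  also have "\<dots> \<le> (\<integral>\<^sup>+w. ennreal (4 * V * (F w)\<^sup>2) \<partial>gauss d)"
  proof (intro nn_integral_mono ennreal_leI)
    fix w
    have "(\<Sum>i<d. (2 * F w * D i w)\<^sup>2) = 4 * (F w)\<^sup>2 * (\<Sum>i<d. (D i w)\<^sup>2)"
      by (simp add: power_mult_distrib sum_distrib_left)
    also have "\<dots> \<le> 4 * (F w)\<^sup>2 * V"
      by (intro mult_left_mono sumD) auto
    finally show "(\<Sum>i<d. (2 * F w * D i w)\<^sup>2) \<le> 4 * V * (F w)\<^sup>2" by (simp add: mult_ac)
  qed
  also have "\<dots> = ennreal (4 * V * expectation (\<lambda>w. (F w)\<^sup>2))"
    using V0 i2 by (subst nn_integral_eq_integral) auto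
  finally have "expectation (\<lambda>w. F w ^ 4) \<le> (expectation (\<lambda>w. (F w)\<^sup>2))\<^sup>2 + 4 * V * expectation (\<lambda>w. (F w)\<^sup>2)"
    using V0 by (subst (asm) ennreal_le_iff) (auto simp: power_mult[symmetric])
  moreover have "0 \<le> expectation (\<lambda>w. (F w)\<^sup>2)" by simp
  ultimately show ?thesis
    using V0 power_mono[OF i2_le, of 2] mult_left_mono[OF i2_le, of "4 * V"] by linarith
qed

lemma sum_square_le: "(\<Sum>i\<in>A. a i * b i)\<^sup>2 \<le> (\<Sum>i\<in>A. (a i)\<^sup>2) * (\<Sum>i\<in>A. (b i :: real)\<^sup>2)"
  by (rule Cauchy_Schwarz_ineq_sum)

lemma std_normal_moments:
  "integrable std_normal (\<lambda>x. x ^ k)" "integrable std_normal (\<lambda>x. \<bar>x\<bar> ^ k)"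
  "(\<integral>x. x\<^sup>2 \<partial>std_normal) = 1" "(\<integral>x. x ^ 4 \<partial>std_normal) = 3"
  "(\<integral>x. x \<partial>std_normal) = 0" "(\<integral>x. x ^ 3 \<partial>std_normal) = 0"
proof -
  show "integrable std_normal (\<lambda>x. x ^ k)" "integrable std_normal (\<lambda>x. \<bar>x\<bar> ^ k)"
    unfolding std_normal_def using integrable_std_normal_moment[of k] integrable_std_normal_moment_abs[of k]
    by (simp_all add: integrable_density)
  show "(\<integral>x. x\<^sup>2 \<partial>std_normal) = 1" "(\<integral>x. x ^ 4 \<partial>std_normal) = 3"
    using integral_std_normal_moment_even[of 1] integral_std_normal_moment_even[of 2]
    unfolding std_normal_def by (simp_all add: integral_density fact_numeral)
  show "(\<integral>x. x \<partial>std_normal) = 0" "(\<integral>x. x ^ 3 \<partial>std_normal) = 0"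
    using integral_std_normal_moment_odd[of 0] integral_std_normal_moment_odd[of 1]
    unfolding std_normal_def by (simp_all add: integral_density numeral_3_eq_3)
qed

lemma std_normal_abs_moment: "(\<integral>x. \<bar>x\<bar> \<partial>std_normal) \<le> 1"
proof -
  have "(\<integral>x. \<bar>x\<bar> \<partial>std_normal) \<le> (\<integral>x. (1 + x\<^sup>2) / 2 \<partial>std_normal)"
  proof (rule integral_mono)
    fix x :: real
    have "0 \<le> (\<bar>x\<bar> - 1)\<^sup>2" by simp
    then show "\<bar>x\<bar> \<le> (1 + x\<^sup>2) / 2" by (simp add: power2_diff)
  qed (use std_normal_moments(2)[of 1] std_normal_moments(1)[of 2] in auto)
  also have "\<dots> = 1"
    using std_normal_moments(1)[of 2] std_normal_moments(3) std_normal.prob_space by simp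
  finally show ?thesis .
qed

lemma integral_dotp:
  assumes [measurable]: "f \<in> borel_measurable borel"
  shows "(\<integral>w. f (dotp d w a) \<partial>gauss d) = (\<integral>x. f (sqrt (\<Sum>i<d. (a i)\<^sup>2) * x) \<partial>std_normal :: real)"
proof -
  have "(\<integral>w. f (dotp d w a) \<partial>gauss d) = (\<integral>y. f y \<partial>distr (gauss d) borel (\<lambda>w. \<Sum>i<d. w i * a i))"
    unfolding dotp_def by (subst integral_distr) auto
  also have "\<dots> = (\<integral>x. f (sqrt (\<Sum>i<d. (a i)\<^sup>2) * x) \<partial>std_normal)"
    by (subst distr_gauss_linear, simp, subst integral_distr) auto
  finally show ?thesis .
qed

text \<open>The average of \<sigma> over a window of length h to the right of x, written through an
  antiderivative. Its derivative is a difference quotient of \<sigma>, hence continuous and bounded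
  by the same L. The Poincare inequality asks for continuous derivatives, which a piecewise linear
  activation may lack at the kink.\<close>

lemma smoothing:
  assumes lip: "\<And>x y. \<bar>\<sigma> x - \<sigma> y\<bar> \<le> L * \<bar>x - y :: real\<bar>" and "0 < h"
  obtains \<tau> \<tau>' where "\<And>x. (\<tau> has_real_derivative \<tau>' x) (at x)" "continuous_on UNIV \<tau>'"
    "\<And>x. \<bar>\<tau>' x\<bar> \<le> L" "\<And>x. \<bar>\<tau> x - \<sigma> x\<bar> \<le> L * h"
proof -
  have L: "0 \<le> L" using lip[of 1 0] by simp
  have "L-lipschitz_on UNIV \<sigma>"
    by (rule lipschitz_onI) (use lip L in \<open>auto simp: dist_real_def\<close>)
  then have cont: "continuous_on UNIV \<sigma>" by (rule lipschitz_on_continuous_on)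
  then obtain S where S: "\<And>x. (S has_real_derivative \<sigma> x) (at x)"
    using einterval_antiderivative[of "- \<infinity>" "\<infinity>" \<sigma>]
    by (auto simp: has_real_derivative_iff_has_vector_derivative[symmetric] continuous_on_eq_continuous_at)
  show ?thesis
  proof (rule that[of "\<lambda>x. (S (x + h) - S x) / h" "\<lambda>x. (\<sigma> (x + h) - \<sigma> x) / h"])
    show "((\<lambda>x. (S (x + h) - S x) / h) has_real_derivative (\<sigma> (x + h) - \<sigma> x) / h) (at x)" for x
      using \<open>0 < h\<close> by (auto intro!: derivative_eq_intros DERIV_chain2[OF S] S)
    show "continuous_on UNIV (\<lambda>x. (\<sigma> (x + h) - \<sigma> x) / h)"
      using \<open>0 < h\<close> by (intro continuous_intros continuous_on_compose2[OF cont]) auto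
    show "\<bar>(\<sigma> (x + h) - \<sigma> x) / h\<bar> \<le> L" for x
      using lip[of "x + h" x] \<open>0 < h\<close> by (simp add: field_simps)
    show "\<bar>(S (x + h) - S x) / h - \<sigma> x\<bar> \<le> L * h" for x
    proof -
      obtain z where z: "x < z" "z < x + h" "S (x + h) - S x = (x + h - x) * \<sigma> z"
        using MVT2[of x "x + h" S \<sigma>] S \<open>0 < h\<close> by auto
      then have "\<bar>(S (x + h) - S x) / h - \<sigma> x\<bar> = \<bar>\<sigma> z - \<sigma> x\<bar>"
        using \<open>0 < h\<close> by simp
      also have "\<dots> \<le> L * \<bar>z - x\<bar>" by (rule lip)
      also have "\<dots> \<le> L * h" using z L by (intro mult_left_mono) auto
      finally show ?thesis .
    qed
  qed
qed

lemma lipschitz_borel: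
  assumes "\<And>x y. \<bar>\<sigma> x - \<sigma> y\<bar> \<le> L * \<bar>x - y :: real\<bar>"
  shows "\<sigma> \<in> borel_measurable borel"
proof -
  have "0 \<le> L" using assms[of 1 0] by simp
  then have "L-lipschitz_on UNIV \<sigma>"
    by (intro lipschitz_onI) (use assms in \<open>auto simp: dist_real_def\<close>)
  then show ?thesis
    by (intro borel_measurable_continuous_onI lipschitz_on_continuous_on)
qed

lemma integrable_std_normal_lipschitz:
  assumes lip: "\<And>x y. \<bar>\<sigma> x - \<sigma> y\<bar> \<le> L * \<bar>x - y :: real\<bar>"
  shows "integrable std_normal (\<lambda>x. \<sigma> (a * x))"
proof (rule Bochner_Integration.integrable_bound)
  show "integrable std_normal (\<lambda>x. \<bar>\<sigma> 0\<bar> + L * \<bar>a\<bar> * \<bar>x\<bar>)"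
    using std_normal_moments(2)[of 1] by simp
  have [measurable]: "\<sigma> \<in> borel_measurable borel" by (rule lipschitz_borel[OF lip])
  show "(\<lambda>x. \<sigma> (a * x)) \<in> borel_measurable std_normal" by measurable
  have "\<bar>\<sigma> (a * x)\<bar> \<le> \<bar>\<sigma> 0\<bar> + L * \<bar>a\<bar> * \<bar>x\<bar>" for x
    using lip[of "a * x" 0] by (simp add: abs_mult mult_ac)
  then show "AE x in std_normal. norm (\<sigma> (a * x)) \<le> norm (\<bar>\<sigma> 0\<bar> + L * \<bar>a\<bar> * \<bar>x\<bar>)"
    by (intro AE_I2) (auto intro: order.trans[OF _ abs_ge_self])
qed

lemma square_add_le: "(a + b)\<^sup>2 \<le> 2 * a\<^sup>2 + 2 * (b :: real)\<^sup>2"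
  using zero_le_power2[of "a - b"] by (simp add: power2_diff power2_sum)

lemma power4_add_le: "(a + b) ^ 4 \<le> 8 * a ^ 4 + 8 * b ^ 4" for a b :: real
proof -
  have "((a + b)\<^sup>2)\<^sup>2 \<le> (2 * a\<^sup>2 + 2 * b\<^sup>2)\<^sup>2" by (intro power_mono square_add_le) auto
  also have "\<dots> \<le> 8 * (a\<^sup>2)\<^sup>2 + 8 * (b\<^sup>2)\<^sup>2"
    using zero_le_power2[of "a\<^sup>2 - b\<^sup>2"] by (simp add: power2_diff power2_sum power_mult_distrib)
  finally show ?thesis by simp
qed

text \<open>The shape comes from the smooth bound, applied to a smoothing of the activation with
  V = L^2 B^2 and squared mean at most m; the term L^4 pays for the smoothing error.\<close>

definition moment_const :: "real \<Rightarrow> real \<Rightarrow> real" where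
  "moment_const L B = (let V = L\<^sup>2 * B\<^sup>2; m = 2 * L\<^sup>2 * (1 + B\<^sup>2) in 8 * ((V + m)\<^sup>2 + 4 * V * (V + m) + L ^ 4))"

lemma moment_const_nonneg: "0 \<le> moment_const L B"
  unfolding moment_const_def Let_def by (intro mult_nonneg_nonneg add_nonneg_nonneg) auto

text \<open>The mean of the combination is what needs care. A feature at a column of norm \<rho> has
  mean of order L |\<rho> - 1| because \<sigma> has mean zero at norm 1, and the squares of these
  means sum to order L^2 B^2 by \<open>norms\<close>; Cauchy-Schwarz then keeps the constant free of
  n and d.\<close>

lemma lipschitz_fourth_moment:
  fixes X :: "nat \<Rightarrow> nat \<Rightarrow> real"
  assumes lip: "\<And>x y. \<bar>\<sigma> x - \<sigma> y\<bar> \<le> L * \<bar>x - y :: real\<bar>"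
    and mean: "(\<integral>x. \<sigma> x \<partial>std_normal) = 0"
    and op: "\<And>v. (\<Sum>i<d. (\<Sum>j<n. X i j * v j)\<^sup>2) \<le> B\<^sup>2 * (\<Sum>j<n. (v j)\<^sup>2)"
    and norms: "(\<Sum>j<n. (sqrt (\<Sum>i<d. (X i j)\<^sup>2) - 1)\<^sup>2) \<le> B\<^sup>2"
  shows "integrable (gauss d) (\<lambda>w. (\<Sum>j<n. u j * \<sigma> (dotp d w (\<lambda>i. X i j))) ^ 4)"
    and "(\<integral>w. (\<Sum>j<n. u j * \<sigma> (dotp d w (\<lambda>i. X i j))) ^ 4 \<partial>gauss d) \<le> moment_const L B * (\<Sum>j<n. (u j)\<^sup>2)\<^sup>2"
proof -
  interpret prob_space "gauss d" by (rule prob_space_gauss)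
  have L: "0 \<le> L" using lip[of 1 0] by simp
  have [measurable]: "\<sigma> \<in> borel_measurable borel" by (rule lipschitz_borel[OF lip])
  define S where "S = (\<Sum>j<n. (u j)\<^sup>2)"
  \<comment> \<open>Each of the n features changes by at most L h; n * h^2 \<le> 1 keeps the sum of
    the squared changes at L^2.\<close>
  define h where "h = 1 / (real n + 1)"
  have h: "0 < h" "real n * h\<^sup>2 \<le> 1"
  proof -
    have "real n \<le> (real n + 1)\<^sup>2" by (simp add: power2_eq_square algebra_simps)
    then show "real n * h\<^sup>2 \<le> 1" unfolding h_def by (simp add: power_divide)
  qed (simp add: h_def)
  obtain \<tau> \<tau>' where \<tau>: "\<And>x. (\<tau> has_real_derivative \<tau>' x) (at x)" "continuous_on UNIV \<tau>'"
    "\<And>x. \<bar>\<tau>' x\<bar> \<le> L" "\<And>x. \<bar>\<tau> x - \<sigma> x\<bar> \<le> L * h"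
    using smoothing[OF lip h(1)] by blast
  have lip\<tau>: "\<bar>\<tau> x - \<tau> y\<bar> \<le> L * \<bar>x - y\<bar>" for x y
    using field_differentiable_bound[of UNIV \<tau> \<tau>' L x y] \<tau> by (simp add: has_field_derivative_at_within)
  have [measurable]: "\<tau> \<in> borel_measurable borel" by (rule lipschitz_borel[OF lip\<tau>])
  define F where "F w = (\<Sum>j<n. u j * \<tau> (dotp d w (\<lambda>i. X i j)))" for w
  define G where "G w = (\<Sum>j<n. u j * \<sigma> (dotp d w (\<lambda>i. X i j)))" for w
  have [measurable]: "F \<in> borel_measurable (gauss d)" "G \<in> borel_measurable (gauss d)"
    unfolding F_def[abs_def] G_def[abs_def] by measurable
  have iF: "integrable (gauss d) (\<lambda>w. F w ^ 4)" and iG: "integrable (gauss d) (\<lambda>w. G w ^ 4)"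
    unfolding F_def[abs_def] G_def[abs_def]
    by (intro integrable_gauss_exp_growth exp_growth_power exp_growth_sum exp_growth_mult exp_growth_const
        lipschitz_growth[where L = L] lip lip\<tau>; measurable)+
  have mean_j: "\<bar>\<integral>w. \<tau> (dotp d w (\<lambda>i. X i j)) \<partial>gauss d\<bar> \<le> L * (h + \<bar>sqrt (\<Sum>i<d. (X i j)\<^sup>2) - 1\<bar>)" for j
  proof -
    define r where "r = sqrt (\<Sum>i<d. (X i j)\<^sup>2)"
    have "(\<integral>w. \<tau> (dotp d w (\<lambda>i. X i j)) \<partial>gauss d) = (\<integral>x. \<tau> (r * x) - \<sigma> x \<partial>std_normal)"
      using integrable_std_normal_lipschitz[OF lip\<tau>, of r] integrable_std_normal_lipschitz[OF lip, of 1] mean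
      by (subst integral_dotp) (auto simp: r_def)
    also have "\<bar>\<dots>\<bar> \<le> (\<integral>x. \<bar>\<tau> (r * x) - \<sigma> x\<bar> \<partial>std_normal)"
      by (rule integral_abs_bound)
    also have "\<dots> \<le> (\<integral>x. L * h + L * \<bar>r - 1\<bar> * \<bar>x\<bar> \<partial>std_normal)"
    proof (rule integral_mono)
      fix x
      have "\<bar>\<tau> (r * x) - \<sigma> x\<bar> \<le> L * h + L * \<bar>r * x - x\<bar>"
        using \<tau>(4)[of "r * x"] lip[of "r * x" x] by linarith
      also have "r * x - x = (r - 1) * x" by (simp add: algebra_simps)
      finally show "\<bar>\<tau> (r * x) - \<sigma> x\<bar> \<le> L * h + L * \<bar>r - 1\<bar> * \<bar>x\<bar>" by (simp add: abs_mult mult_ac)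
    qed (use integrable_std_normal_lipschitz[OF lip\<tau>, of r] integrable_std_normal_lipschitz[OF lip, of 1]
        std_normal_moments(2)[of 1] in auto)
    also have "\<dots> \<le> L * h + L * \<bar>r - 1\<bar>"
      using std_normal_moments(2)[of 1] std_normal_abs_moment L std_normal.prob_space
      by (auto intro!: mult_left_le)
    finally show ?thesis by (simp add: r_def algebra_simps)
  qed
  have int_j: "integrable (gauss d) (\<lambda>w. \<tau> (dotp d w (\<lambda>i. X i j)))" for j
    by (intro integrable_gauss_exp_growth lipschitz_growth[where L = L] lip\<tau>; measurable)
  have meanF: "(expectation F)\<^sup>2 \<le> 2 * L\<^sup>2 * (1 + B\<^sup>2) * S"
  proof -
    let ?m = "\<lambda>j. \<integral>w. \<tau> (dotp d w (\<lambda>i. X i j)) \<partial>gauss d"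
    let ?r = "\<lambda>j. sqrt (\<Sum>i<d. (X i j)\<^sup>2) - 1"
    have "(\<Sum>j<n. (?m j)\<^sup>2) \<le> (\<Sum>j<n. 2 * L\<^sup>2 * (h\<^sup>2 + (?r j)\<^sup>2))"
    proof (rule sum_mono)
      fix j
      have "(?m j)\<^sup>2 \<le> (L * (h + \<bar>?r j\<bar>))\<^sup>2"
        using power_mono[OF mean_j[of j], of 2] by simp
      also have "\<dots> = L\<^sup>2 * (h + \<bar>?r j\<bar>)\<^sup>2" by (simp add: power_mult_distrib)
      also have "\<dots> \<le> L\<^sup>2 * (2 * (h\<^sup>2 + (?r j)\<^sup>2))"
        using zero_le_power2[of "h - \<bar>?r j\<bar>"]
        by (intro mult_left_mono) (auto simp: power2_diff power2_sum)
      finally show "(?m j)\<^sup>2 \<le> 2 * L\<^sup>2 * (h\<^sup>2 + (?r j)\<^sup>2)"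
        by (simp add: algebra_simps)
    qed
    also have "\<dots> = 2 * L\<^sup>2 * (real n * h\<^sup>2 + (\<Sum>j<n. (?r j)\<^sup>2))"
      by (simp add: sum_distrib_left[symmetric] sum.distrib)
    also have "\<dots> \<le> 2 * L\<^sup>2 * (1 + B\<^sup>2)"
      using h(2) norms by (intro mult_left_mono add_mono) auto
    finally have m2: "(\<Sum>j<n. (?m j)\<^sup>2) \<le> 2 * L\<^sup>2 * (1 + B\<^sup>2)" .
    have "expectation F = (\<Sum>j<n. u j * ?m j)"
      unfolding F_def using int_j by simp
    then have "(expectation F)\<^sup>2 \<le> S * (\<Sum>j<n. (?m j)\<^sup>2)"
      unfolding S_def by (simp add: sum_square_le)
    also have "\<dots> \<le> S * (2 * L\<^sup>2 * (1 + B\<^sup>2))"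
      using m2 by (intro mult_left_mono) (auto simp: S_def sum_nonneg)
    finally show ?thesis by (simp add: mult_ac)
  qed
  have four: "expectation (\<lambda>w. F w ^ 4) \<le> (L\<^sup>2 * B\<^sup>2 * S + 2 * L\<^sup>2 * (1 + B\<^sup>2) * S)\<^sup>2
      + 4 * (L\<^sup>2 * B\<^sup>2 * S) * (L\<^sup>2 * B\<^sup>2 * S + 2 * L\<^sup>2 * (1 + B\<^sup>2) * S)"
    by (rule fourth_moment_smooth[OF \<tau>(1,2,3) op F_def _ meanF]) (simp_all add: S_def)
  have diff: "(G w - F w) ^ 4 \<le> L ^ 4 * S\<^sup>2" for w
  proof -
    have "(G w - F w)\<^sup>2 = (\<Sum>j<n. u j * (\<sigma> (dotp d w (\<lambda>i. X i j)) - \<tau> (dotp d w (\<lambda>i. X i j))))\<^sup>2"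
      by (simp add: F_def G_def sum_subtractf right_diff_distrib)
    also have "\<dots> \<le> S * (\<Sum>j<n. (\<sigma> (dotp d w (\<lambda>i. X i j)) - \<tau> (dotp d w (\<lambda>i. X i j)))\<^sup>2)"
      unfolding S_def by (rule sum_square_le)
    also have "\<dots> \<le> S * (\<Sum>j<n. (L * h)\<^sup>2)"
    proof (intro mult_left_mono sum_mono)
      fix j
      show "(\<sigma> (dotp d w (\<lambda>i. X i j)) - \<tau> (dotp d w (\<lambda>i. X i j)))\<^sup>2 \<le> (L * h)\<^sup>2"
        using power_mono[OF \<tau>(4)[of "dotp d w (\<lambda>i. X i j)"], of 2] by (simp add: power2_commute)
    qed (simp add: S_def sum_nonneg)
    also have "\<dots> = S * L\<^sup>2 * (real n * h\<^sup>2)" by (simp add: power_mult_distrib)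
    also have "\<dots> \<le> S * L\<^sup>2 * 1"
      using h(2) by (intro mult_left_mono) (auto simp: S_def sum_nonneg)
    finally have "((G w - F w)\<^sup>2)\<^sup>2 \<le> (S * L\<^sup>2)\<^sup>2" by (intro power_mono) auto
    then show ?thesis by (simp add: power_mult_distrib mult_ac flip: power_mult)
  qed
  have "expectation (\<lambda>w. G w ^ 4) \<le> expectation (\<lambda>w. 8 * F w ^ 4 + 8 * (L ^ 4 * S\<^sup>2))"
  proof (rule integral_mono)
    fix w
    show "G w ^ 4 \<le> 8 * F w ^ 4 + 8 * (L ^ 4 * S\<^sup>2)"
      using power4_add_le[of "F w" "G w - F w"] diff[of w] by simp
  qed (use iF iG in auto)
  also have "\<dots> = 8 * expectation (\<lambda>w. F w ^ 4) + 8 * (L ^ 4 * S\<^sup>2)"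
    using iF prob_space by simp
  also have "\<dots> \<le> moment_const L B * S\<^sup>2"
    using four unfolding moment_const_def Let_def by (simp add: power2_eq_square algebra_simps)
  finally show "(\<integral>w. (\<Sum>j<n. u j * \<sigma> (dotp d w (\<lambda>i. X i j))) ^ 4 \<partial>gauss d) \<le> moment_const L B * (\<Sum>j<n. (u j)\<^sup>2)\<^sup>2"
    by (simp add: G_def S_def)
  show "integrable (gauss d) (\<lambda>w. (\<Sum>j<n. u j * \<sigma> (dotp d w (\<lambda>i. X i j))) ^ 4)"
    using iG by (simp add: G_def)
qed

subsection \<open>Correlations of features\<close>

lemma exp_taylor2_bound: "\<bar>exp y - 1 - y - y\<^sup>2 / 2\<bar> \<le> \<bar>y\<bar> ^ 3 * exp \<bar>y\<bar> / 6" for y :: real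
proof -
  obtain t where t: "\<bar>t\<bar> \<le> \<bar>y\<bar>" "exp y = (\<Sum>m<3. y ^ m / fact m) + exp t / fact 3 * y ^ 3"
    using Maclaurin_exp_le[of y 3] by blast
  then have "exp y - 1 - y - y\<^sup>2 / 2 = exp t / 6 * y ^ 3"
    by (simp add: numeral_3_eq_3 power2_eq_square fact_numeral)
  then have "\<bar>exp y - 1 - y - y\<^sup>2 / 2\<bar> = exp t / 6 * \<bar>y\<bar> ^ 3"
    by (simp only: abs_mult power_abs) simp
  also have "\<dots> \<le> exp \<bar>y\<bar> / 6 * \<bar>y\<bar> ^ 3"
    using t(1) by (intro mult_right_mono divide_right_mono) auto
  finally show ?thesis by (simp add: mult_ac)
qed

text \<open>The generating function of the Hermite polynomials minus its terms of degree at most 2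
  in \<theta>; the subtracted coefficients are 1, y and (y^2 - 1) / 2.\<close>

definition shift_rem :: "real \<Rightarrow> real \<Rightarrow> real" where
  "shift_rem \<theta> y = exp (\<theta> * y - \<theta>\<^sup>2 / 2) - (1 + \<theta> * y + \<theta>\<^sup>2 * (y\<^sup>2 - 1) / 2)"

text \<open>With exponent p - q, p of order a and q of order a^2, the quadratic Taylor polynomial of
  exp at p - q exceeds the subtracted Hermite terms by q^2 / 2 - p q, which is again of order |a|^3.
  The bound is a product of a function of x and one of y so that the two can be integrated
  separately; |a| \<le> 1 / 8 limits the exponential factors to rate 1 / 8.\<close>

lemma shift_rem_bound:
  assumes a: "\<bar>a\<bar> \<le> 1 / 8"
  shows "\<bar>shift_rem (a * x) y\<bar> \<le> \<bar>a\<bar> ^ 3 * (((1 + x\<^sup>2) ^ 3 * exp (x\<^sup>2 / 8)) * ((1 + y\<^sup>2) ^ 3 * exp (y\<^sup>2 / 8)))"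
proof -
  define p q T where "p = a * x * y" and "q = (a * x)\<^sup>2 / 2" and "T = (1 + x\<^sup>2) * (1 + y\<^sup>2)"
  have T: "1 \<le> T" "x\<^sup>2 + y\<^sup>2 \<le> T" "x\<^sup>2 \<le> T"
    unfolding T_def by (auto simp: algebra_simps)
  have a1: "\<bar>a\<bar> \<le> 1" using a by simp
  have xy: "\<bar>x * y\<bar> \<le> (x\<^sup>2 + y\<^sup>2) / 2"
    using zero_le_power2[of "\<bar>x\<bar> - \<bar>y\<bar>"] by (simp add: power2_diff abs_mult)
  have a2: "a\<^sup>2 \<le> \<bar>a\<bar>"
    using a1 mult_left_le[of "\<bar>a\<bar>" "\<bar>a\<bar>"] by (simp add: power2_eq_square)
  have q: "0 \<le> q" "q \<le> \<bar>a\<bar> * (x\<^sup>2 / 2)"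
    unfolding q_def using mult_right_mono[OF a2, of "x\<^sup>2 / 2"] by (auto simp: power_mult_distrib)
  have p: "\<bar>p\<bar> \<le> \<bar>a\<bar> * ((x\<^sup>2 + y\<^sup>2) / 2)"
    unfolding p_def using mult_left_mono[OF xy, of "\<bar>a\<bar>"] by (simp add: abs_mult mult_ac)
  have Y: "\<bar>p - q\<bar> \<le> \<bar>a\<bar> * (x\<^sup>2 + y\<^sup>2)"
  proof -
    have "\<bar>p - q\<bar> \<le> \<bar>a\<bar> * ((x\<^sup>2 + y\<^sup>2) / 2) + \<bar>a\<bar> * (x\<^sup>2 / 2)"
      using p q by linarith
    also have "\<dots> = \<bar>a\<bar> * (x\<^sup>2 + y\<^sup>2 / 2)" by (simp add: field_simps)
    also have "\<dots> \<le> \<bar>a\<bar> * (x\<^sup>2 + y\<^sup>2)" by (intro mult_left_mono) auto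
    finally show ?thesis .
  qed
  have "\<bar>a\<bar> * (x\<^sup>2 + y\<^sup>2) \<le> 1 / 8 * (x\<^sup>2 + y\<^sup>2)"
    using a by (intro mult_right_mono) auto
  then have "exp \<bar>p - q\<bar> \<le> exp (x\<^sup>2 / 8 + y\<^sup>2 / 8)"
    using Y by simp
  then have eY: "exp \<bar>p - q\<bar> \<le> exp (x\<^sup>2 / 8) * exp (y\<^sup>2 / 8)" (is "_ \<le> ?E")
    by (simp add: exp_add)
  have E1: "1 \<le> ?E" by (simp add: exp_add[symmetric])
  have Y3: "\<bar>p - q\<bar> ^ 3 \<le> \<bar>a\<bar> ^ 3 * T ^ 3"
  proof -
    have "\<bar>p - q\<bar> ^ 3 \<le> (\<bar>a\<bar> * T) ^ 3"
      using order.trans[OF Y mult_left_mono[OF T(2), of "\<bar>a\<bar>"]] by (intro power_mono) auto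
    then show ?thesis by (simp add: power_mult_distrib)
  qed
  have pq: "\<bar>p * q\<bar> \<le> \<bar>a\<bar> ^ 3 * T ^ 3 / 2"
  proof -
    have "\<bar>p * q\<bar> = \<bar>a\<bar> ^ 3 * (x\<^sup>2 * \<bar>x * y\<bar>) / 2"
    proof -
      have "q = \<bar>a\<bar> * \<bar>a\<bar> * x\<^sup>2 / 2" by (simp add: q_def power_mult_distrib power2_eq_square)
      moreover have "\<bar>p * q\<bar> = \<bar>a\<bar> * \<bar>x * y\<bar> * q"
        using q(1) by (simp add: p_def abs_mult)
      ultimately show ?thesis by (simp add: power3_eq_cube)
    qed
    also have "\<dots> \<le> \<bar>a\<bar> ^ 3 * (T * T) / 2"
      using xy T by (intro divide_right_mono mult_left_mono mult_mono) auto
    also have "\<dots> \<le> \<bar>a\<bar> ^ 3 * (T * T * T) / 2"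
      using T(1) by (intro divide_right_mono mult_left_mono) (auto intro: mult_left_le_one_le simp: mult_le_cancel_left1)
    finally show ?thesis by (simp add: power3_eq_cube)
  qed
  have q2: "q\<^sup>2 / 2 \<le> \<bar>a\<bar> ^ 3 * T ^ 3 / 8"
  proof -
    have "q\<^sup>2 / 2 = \<bar>a\<bar> ^ 3 * (\<bar>a\<bar> * (x\<^sup>2 * x\<^sup>2)) / 8"
      unfolding q_def by (simp add: power2_eq_square power3_eq_cube abs_mult[symmetric] mult_ac)
    also have "\<dots> \<le> \<bar>a\<bar> ^ 3 * (1 * (T * T)) / 8"
      using a1 T by (intro divide_right_mono mult_left_mono mult_mono) auto
    also have "\<dots> \<le> \<bar>a\<bar> ^ 3 * (T * T * T) / 8"
      using T(1) by (intro divide_right_mono mult_left_mono) (auto simp: mult_le_cancel_left1)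
    finally show ?thesis by (simp add: power3_eq_cube)
  qed
  have "shift_rem (a * x) y = (exp (p - q) - 1 - (p - q) - (p - q)\<^sup>2 / 2) + (q\<^sup>2 / 2 - p * q)"
    unfolding shift_rem_def p_def q_def by (simp add: power2_eq_square field_simps)
  then have "\<bar>shift_rem (a * x) y\<bar> \<le> \<bar>p - q\<bar> ^ 3 * exp \<bar>p - q\<bar> / 6 + (q\<^sup>2 / 2 + \<bar>p * q\<bar>)"
    using exp_taylor2_bound[of "p - q"] zero_le_power2[of q] by linarith
  also have "\<dots> \<le> (\<bar>a\<bar> ^ 3 * T ^ 3) * ?E / 6 + (\<bar>a\<bar> ^ 3 * T ^ 3 / 8 + \<bar>a\<bar> ^ 3 * T ^ 3 / 2)"
    using T(1) by (intro add_mono divide_right_mono mult_mono Y3 eY q2 pq) auto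
  also have "\<dots> \<le> (\<bar>a\<bar> ^ 3 * T ^ 3) * ?E"
  proof -
    have "0 \<le> \<bar>a\<bar> ^ 3 * T ^ 3" using T(1) by simp
    from mult_left_mono[OF E1 this] this show ?thesis by linarith
  qed
  finally show ?thesis
    unfolding T_def by (simp add: power_mult_distrib mult_ac)
qed

lemma poly_exp_bound: "(1 + x\<^sup>2) ^ 4 * exp (x\<^sup>2 / 8) \<le> 32 ^ 4 * exp (x\<^sup>2 / 4)" for x :: real
proof -
  \<comment> \<open>Since 32 = 4 * 8, the fourth power of exp (x^2 / 32) has rate 1 / 8 and, with
    the given factor, reaches exactly the rate 1 / 4 known to be integrable.\<close>
  have "(1 + x\<^sup>2) / 32 \<le> 1 + x\<^sup>2 / 32" by simp
  also have "\<dots> \<le> exp (x\<^sup>2 / 32)" by (rule exp_ge_add_one_self)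
  finally have "((1 + x\<^sup>2) / 32) ^ 4 \<le> exp (x\<^sup>2 / 32) ^ 4" by (intro power_mono) auto
  also have "exp (x\<^sup>2 / 32) ^ 4 = exp (x\<^sup>2 / 8)" by (simp add: exp_of_nat_mult[symmetric])
  finally have "(1 + x\<^sup>2) ^ 4 \<le> 32 ^ 4 * exp (x\<^sup>2 / 8)" by (simp add: power_divide field_simps)
  then have "(1 + x\<^sup>2) ^ 4 * exp (x\<^sup>2 / 8) \<le> 32 ^ 4 * exp (x\<^sup>2 / 8) * exp (x\<^sup>2 / 8)"
    by (intro mult_right_mono) auto
  then show ?thesis by (simp add: mult.assoc flip: exp_add)
qed

text \<open>The integral of the common majorant used below: the exponent 4 is 3 from
  \<open>shift_rem_bound\<close> plus 1 from the quadratic growth of the functions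
  correlated.\<close>

definition corr_const :: real where
  "corr_const = (\<integral>x. (1 + x\<^sup>2) ^ 4 * exp (x\<^sup>2 / 8) \<partial>std_normal)"

lemma integrable_corr: "integrable std_normal (\<lambda>x. (1 + x\<^sup>2) ^ 4 * exp (x\<^sup>2 / 8))"
  by (rule integrable_std_normal_dominated[where C = "32 ^ 4"]) (use poly_exp_bound in \<open>auto simp: abs_mult\<close>)

lemma corr_const_nonneg: "0 \<le> corr_const"
  unfolding corr_const_def by (intro integral_nonneg_AE) auto

lemma integrable_corr_dominated:
  fixes f :: "real \<Rightarrow> real"
  assumes [measurable]: "f \<in> borel_measurable borel" and "\<And>x. \<bar>f x\<bar> \<le> C * ((1 + x\<^sup>2) ^ 4 * exp (x\<^sup>2 / 8))"
  shows "integrable std_normal f"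
  by (rule Bochner_Integration.integrable_bound[OF integrable_mult_right[OF integrable_corr, of C]])
     (use assms in \<open>auto intro!: AE_I2 order.trans[OF _ abs_ge_self]\<close>)

lemma corr_growth_le:
  fixes x :: real
  assumes "0 \<le> C" "k \<le> 4" "b \<le> C * (1 + x\<^sup>2) ^ k"
  shows "b \<le> C * ((1 + x\<^sup>2) ^ 4 * exp (x\<^sup>2 / 8))"
proof -
  have "(1 + x\<^sup>2) ^ k \<le> (1 + x\<^sup>2) ^ 4" using assms by (intro power_increasing) auto
  also have "\<dots> \<le> (1 + x\<^sup>2) ^ 4 * exp (x\<^sup>2 / 8)" by (simp add: mult_le_cancel_left1)
  finally show ?thesis using assms by (meson mult_left_mono order.trans)
qed

lemma integrable_mult_quadratic_growth:
  fixes h g :: "real \<Rightarrow> real"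
  assumes [measurable]: "h \<in> borel_measurable borel" "g \<in> borel_measurable borel"
    and h: "\<And>x. \<bar>h x\<bar> \<le> C * (1 + x\<^sup>2)" and g: "\<And>x. \<bar>g x\<bar> \<le> D * (1 + x\<^sup>2)"
  shows "integrable std_normal (\<lambda>x. h x * g x)"
proof (rule integrable_corr_dominated[where C = "C * D"])
  fix x :: real
  have CD: "0 \<le> C" "0 \<le> D" using h[of 0] g[of 0] by auto
  have "\<bar>h x * g x\<bar> \<le> (C * (1 + x\<^sup>2)) * (D * (1 + x\<^sup>2))"
    unfolding abs_mult using CD by (intro mult_mono h g) auto
  then show "\<bar>h x * g x\<bar> \<le> C * D * ((1 + x\<^sup>2) ^ 4 * exp (x\<^sup>2 / 8))"
    using CD by (intro corr_growth_le[of _ 2]) (auto simp: power2_eq_square mult_ac)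
qed measurable

text \<open>Cameron-Martin in one dimension: translating y by a x removes the summand r x = a s x,
  and the quotient of the two densities is the exponential factor.\<close>

lemma gaussian_shift:
  assumes [measurable]: "g \<in> borel_measurable borel" and "0 < s" and r: "r = a * s"
  shows "(\<integral>y. g (r * x + s * y) \<partial>std_normal) = (\<integral>y. g (s * y) * exp (a * x * y - (a * x)\<^sup>2 / 2) \<partial>std_normal :: real)"
proof -
  have "(\<integral>y. g (r * x + s * y) \<partial>std_normal) = (\<integral>y. std_normal_density y * g (r * x + s * y) \<partial>lborel)"
    unfolding std_normal_def by (subst integral_density) auto
  also have "\<dots> = (\<integral>y. std_normal_density (y - a * x) * g (r * x + s * (y - a * x)) \<partial>lborel)"
    by (subst lborel_integral_real_affine[of 1 _ "- a * x"]) auto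
  also have "\<dots> = (\<integral>y. std_normal_density y * (g (s * y) * exp (a * x * y - (a * x)\<^sup>2 / 2)) \<partial>lborel)"
  proof (rule Bochner_Integration.integral_cong[OF refl])
    fix y
    have "- (y - a * x)\<^sup>2 / 2 = - y\<^sup>2 / 2 + (a * x * y - (a * x)\<^sup>2 / 2)"
      by (simp add: power2_diff field_simps)
    then have "std_normal_density (y - a * x) = std_normal_density y * exp (a * x * y - (a * x)\<^sup>2 / 2)"
      unfolding std_normal_density_def by (simp add: exp_add[symmetric])
    moreover have "r * x + s * (y - a * x) = s * y" unfolding r by (simp add: algebra_simps)
    ultimately show "std_normal_density (y - a * x) * g (r * x + s * (y - a * x))
        = std_normal_density y * (g (s * y) * exp (a * x * y - (a * x)\<^sup>2 / 2))" by simp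
  qed
  also have "\<dots> = (\<integral>y. g (s * y) * exp (a * x * y - (a * x)\<^sup>2 / 2) \<partial>std_normal)"
    unfolding std_normal_def by (subst integral_density) auto
  finally show ?thesis .
qed

text \<open>A shift of the second variable turns the correlation into an integral against
  exp(a x y - (a x)^2 / 2); orthogonality to 1, x and x^2 kills its Taylor polynomial of degree 2
  in a, leaving a cubic remainder.\<close>

lemma correlation_bound_iterated:
  fixes f g :: "real \<Rightarrow> real"
  assumes [measurable]: "f \<in> borel_measurable borel" "g \<in> borel_measurable borel"
    and f: "\<And>x. \<bar>f x\<bar> \<le> Cf * (1 + x\<^sup>2)" and g: "\<And>x. \<bar>g x\<bar> \<le> Cg * (1 + x\<^sup>2)"
    and f0: "(\<integral>x. f x \<partial>std_normal) = 0" and f1: "(\<integral>x. f x * x \<partial>std_normal) = 0" and f2: "(\<integral>x. f x * x\<^sup>2 \<partial>std_normal) = 0"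
    and r: "\<bar>r\<bar> \<le> 1 / 16"
  shows "\<bar>\<integral>x. f x * (\<integral>y. g (r * x + sqrt (1 - r\<^sup>2) * y) \<partial>std_normal) \<partial>std_normal\<bar> \<le> 8 * \<bar>r\<bar> ^ 3 * (Cf * Cg * corr_const\<^sup>2)"
proof -
  \<comment> \<open>The summand r x shifts the standard normal y by a x, in units of s. For |r|
    \<le> 1 / 16 one has s \<ge> 1 / 2 and |a| \<le> 2 |r| \<le> 1 / 8, the range of
    \<open>shift_rem_bound\<close>; the final factor 8 is 2^3.\<close>
  define s a where "s = sqrt (1 - r\<^sup>2)" and "a = r / s"
  have Cf: "0 \<le> Cf" and Cg: "0 \<le> Cg" using f[of 0] g[of 0] by auto
  have r2: "r\<^sup>2 \<le> 1 / 4"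
    using power_mono[OF r, of 2] by (simp add: power2_eq_square)
  have s: "1 / 2 \<le> s" "s \<le> 1"
    unfolding s_def by (rule real_le_rsqrt) (use r2 in \<open>simp_all add: power_divide\<close>)
  have a: "\<bar>a\<bar> \<le> 2 * \<bar>r\<bar>"
  proof -
    have "\<bar>r\<bar> * 1 \<le> \<bar>r\<bar> * (2 * s)" using s by (intro mult_left_mono) auto
    then show ?thesis unfolding a_def using s by (simp add: abs_divide field_simps)
  qed
  have a8: "\<bar>a\<bar> \<le> 1 / 8" using a r by linarith
  have ras: "r = a * s" unfolding a_def using s by simp
  have gs: "\<bar>g (s * y)\<bar> \<le> Cg * (1 + y\<^sup>2)" for y
  proof -
    have "(s * y)\<^sup>2 \<le> y\<^sup>2"
      unfolding power_mult_distrib using s by (intro mult_left_le_one_le) (auto simp: power_le_one)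
    then have "Cg * (1 + (s * y)\<^sup>2) \<le> Cg * (1 + y\<^sup>2)" using Cg by (intro mult_left_mono) auto
    with g[of "s * y"] show ?thesis by linarith
  qed
  let ?w = "\<lambda>x::real. (1 + x\<^sup>2) ^ 4 * exp (x\<^sup>2 / 8)"
  let ?v = "\<lambda>x::real. (1 + x\<^sup>2) ^ 3 * exp (x\<^sup>2 / 8)"
  have mom: "integrable std_normal (\<lambda>x. h x * x ^ k)"
    if "h \<in> borel_measurable borel" "\<And>x. \<bar>h x\<bar> \<le> C * (1 + x\<^sup>2)" "k \<le> 2" for h C k
  proof (rule integrable_corr_dominated[where C = C])
    show "(\<lambda>x. h x * x ^ k) \<in> borel_measurable borel" using that(1) by measurable
    fix x :: real
    have C: "0 \<le> C" using that(2)[of 0] by simp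
    have "\<bar>x\<bar> ^ k \<le> 1 + x\<^sup>2"
    proof -
      have "k = 0 \<or> k = 1 \<or> k = 2" using that(3) by auto
      then show ?thesis
        using zero_le_power2[of "\<bar>x\<bar> - 1"] by (auto simp: power2_diff)
    qed
    then have "\<bar>h x * x ^ k\<bar> \<le> C * (1 + x\<^sup>2) * (1 + x\<^sup>2)"
      unfolding abs_mult power_abs using that(2) C by (intro mult_mono) auto
    then show "\<bar>h x * x ^ k\<bar> \<le> C * ?w x"
      by (intro corr_growth_le[OF C, of 2]) (auto simp: power2_eq_square mult_ac)
  qed
  have gRm: "\<bar>g (s * y) * shift_rem (a * x) y\<bar> \<le> (Cg * \<bar>a\<bar> ^ 3 * ?v x) * ?w y" for x y
  proof -
    have "\<bar>g (s * y) * shift_rem (a * x) y\<bar> \<le> (Cg * (1 + y\<^sup>2)) * (\<bar>a\<bar> ^ 3 * (?v x * ?v y))"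
      unfolding abs_mult by (intro mult_mono gs shift_rem_bound a8) (use Cg in auto)
    then show ?thesis by (simp add: mult_ac power_Suc eval_nat_numeral)
  qed
  have [measurable]: "(\<lambda>p. shift_rem (a * fst p) (snd p)) \<in> borel_measurable (borel \<Otimes>\<^sub>M borel)"
    "(\<lambda>y. shift_rem z y) \<in> borel_measurable borel" for z
    unfolding shift_rem_def by measurable
  have iRm: "integrable std_normal (\<lambda>y. g (s * y) * shift_rem (a * x) y)" for x
    by (rule integrable_corr_dominated[OF _ gRm]) measurable
  define R where "R x = (\<integral>y. g (s * y) * shift_rem (a * x) y \<partial>std_normal)" for x
  have [measurable]: "R \<in> borel_measurable borel"
    unfolding R_def by measurable
  have R: "\<bar>R x\<bar> \<le> Cg * \<bar>a\<bar> ^ 3 * ?v x * corr_const" for x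
  proof -
    have "\<bar>R x\<bar> \<le> (\<integral>y. \<bar>g (s * y) * shift_rem (a * x) y\<bar> \<partial>std_normal)"
      unfolding R_def by (rule integral_abs_bound)
    also have "\<dots> \<le> (\<integral>y. (Cg * \<bar>a\<bar> ^ 3 * ?v x) * ?w y \<partial>std_normal)"
      using iRm integrable_corr gRm by (intro integral_mono) auto
    finally show ?thesis by (simp add: corr_const_def)
  qed
  define G where "G k = (\<integral>y. g (s * y) * y ^ k \<partial>std_normal)" for k :: nat
  have iG: "integrable std_normal (\<lambda>y. g (s * y) * y ^ k)" if "k \<le> 2" for k
    by (rule mom[OF _ gs that]) measurable
  \<comment> \<open>The conditional mean of g given x is a quadratic polynomial in x plus the
    remainder R; integration against f annihilates the polynomial.\<close>
  have inner: "(\<integral>y. g (r * x + s * y) \<partial>std_normal) = G 0 - a\<^sup>2 / 2 * G 0 * x\<^sup>2 + a * G 1 * x + a\<^sup>2 / 2 * G 2 * x\<^sup>2 + R x" for x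
  proof -
    have "(\<integral>y. g (r * x + s * y) \<partial>std_normal) = (\<integral>y. g (s * y) * exp (a * x * y - (a * x)\<^sup>2 / 2) \<partial>std_normal)"
      by (rule gaussian_shift) (use s ras in auto)
    also have "\<dots> = (\<integral>y. (1 - a\<^sup>2 / 2 * x\<^sup>2) * (g (s * y) * y ^ 0) + a * x * (g (s * y) * y ^ 1) + a\<^sup>2 / 2 * x\<^sup>2 * (g (s * y) * y ^ 2) + g (s * y) * shift_rem (a * x) y \<partial>std_normal)"
      by (intro Bochner_Integration.integral_cong refl) (simp add: shift_rem_def power2_eq_square field_simps)
    also have "\<dots> = (1 - a\<^sup>2 / 2 * x\<^sup>2) * G 0 + a * x * G 1 + a\<^sup>2 / 2 * x\<^sup>2 * G 2 + R x"
      using iG[of 0] iG[of 1] iG[of 2] iRm[of x] by (simp add: G_def R_def)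
    finally show ?thesis by (simp add: algebra_simps)
  qed
  have fR: "\<bar>f x * R x\<bar> \<le> (Cf * (Cg * \<bar>a\<bar> ^ 3 * corr_const)) * ?w x" for x
  proof -
    have "\<bar>f x * R x\<bar> \<le> (Cf * (1 + x\<^sup>2)) * (Cg * \<bar>a\<bar> ^ 3 * ?v x * corr_const)"
      unfolding abs_mult using Cf by (intro mult_mono f R) auto
    then show ?thesis by (simp add: mult_ac power_Suc eval_nat_numeral)
  qed
  have ifR: "integrable std_normal (\<lambda>x. f x * R x)"
    by (rule integrable_corr_dominated[OF _ fR]) measurable
  have ifk: "integrable std_normal (\<lambda>x. f x * x ^ k)" if "k \<le> 2" for k
    by (rule mom[OF _ f that]) measurable
  have "(\<integral>x. f x * (\<integral>y. g (r * x + s * y) \<partial>std_normal) \<partial>std_normal)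
      = (\<integral>x. G 0 * (f x * x ^ 0) - a\<^sup>2 / 2 * G 0 * (f x * x ^ 2) + a * G 1 * (f x * x ^ 1) + a\<^sup>2 / 2 * G 2 * (f x * x ^ 2) + f x * R x \<partial>std_normal)"
    by (intro Bochner_Integration.integral_cong refl) (simp only: inner, simp add: algebra_simps)
  also have "\<dots> = (\<integral>x. f x * R x \<partial>std_normal)"
    using ifk[of 0] ifk[of 1] ifk[of 2] ifR f0 f1 f2 by simp
  also have "\<bar>\<dots>\<bar> \<le> (\<integral>x. \<bar>f x * R x\<bar> \<partial>std_normal)"
    by (rule integral_abs_bound)
  also have "\<dots> \<le> (\<integral>x. (Cf * (Cg * \<bar>a\<bar> ^ 3 * corr_const)) * ?w x \<partial>std_normal)"
    using ifR integrable_corr fR by (intro integral_mono) auto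
  also have "\<dots> = \<bar>a\<bar> ^ 3 * (Cf * Cg * corr_const\<^sup>2)"
    unfolding integral_mult_right_zero corr_const_def[symmetric] by (simp add: power2_eq_square mult_ac)
  also have "\<dots> \<le> (2 * \<bar>r\<bar>) ^ 3 * (Cf * Cg * corr_const\<^sup>2)"
    using a Cf Cg by (intro mult_right_mono power_mono) auto
  finally show ?thesis by (simp add: s_def power_mult_distrib)
qed

lemma integrable_std_normal_pair_prod:
  fixes u v :: "real \<Rightarrow> real"
  assumes u: "integrable std_normal u" and v: "integrable std_normal v"
  shows "integrable (std_normal \<Otimes>\<^sub>M std_normal) (\<lambda>p. u (fst p) * v (snd p))"
proof -
  have [measurable]: "u \<in> borel_measurable borel" "v \<in> borel_measurable borel"
    using borel_measurable_integrable[OF u] borel_measurable_integrable[OF v] by simp_all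
  have "(\<integral>\<^sup>+p. ennreal \<bar>u (fst p) * v (snd p)\<bar> \<partial>(std_normal \<Otimes>\<^sub>M std_normal))
      = (\<integral>\<^sup>+x. ennreal \<bar>u x\<bar> \<partial>std_normal) * (\<integral>\<^sup>+y. ennreal \<bar>v y\<bar> \<partial>std_normal)"
    by (subst std_normal.nn_integral_fst[symmetric])
       (auto simp: abs_mult ennreal_mult nn_integral_cmult nn_integral_multc)
  also have "\<dots> < \<infinity>"
    using u v by (simp add: integrable_iff_bounded ennreal_mult_less_top)
  finally show ?thesis by (intro integrableI_bounded) auto
qed

text \<open>The joint law of the two forms turns the claim into a double integral in the plane.
  Orthogonality to quadratic polynomials is asked of f alone, so g may be the activation itself,
  rescaled by a column norm different from 1.\<close>

lemma correlation_bound: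
  fixes f g :: "real \<Rightarrow> real"
  assumes [measurable]: "f \<in> borel_measurable borel" "g \<in> borel_measurable borel"
    and f: "\<And>x. \<bar>f x\<bar> \<le> Cf * (1 + x\<^sup>2)" and g: "\<And>x. \<bar>g x\<bar> \<le> Cg * (1 + x\<^sup>2)"
    and "(\<integral>x. f x \<partial>std_normal) = 0" "(\<integral>x. f x * x \<partial>std_normal) = 0" "(\<integral>x. f x * x\<^sup>2 \<partial>std_normal) = 0"
    and a: "(\<Sum>i<d. (a i)\<^sup>2) = 1" and b: "(\<Sum>i<d. (b i)\<^sup>2) = 1"
    and r: "(\<Sum>i<d. a i * b i) = r" "\<bar>r\<bar> \<le> 1 / 16"
  shows "\<bar>\<integral>w. f (dotp d w a) * g (dotp d w b) \<partial>gauss d\<bar> \<le> 8 * \<bar>r\<bar> ^ 3 * (Cf * Cg * corr_const\<^sup>2)"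
proof -
  let ?s = "sqrt (1 - r\<^sup>2)"
  have Cf: "0 \<le> Cf" and Cg: "0 \<le> Cg" using f[of 0] g[of 0] by auto
  have r2: "r\<^sup>2 \<le> 1" using r(2) by (simp add: abs_square_le_1)
  have "(\<integral>w. f (dotp d w a) * g (dotp d w b) \<partial>gauss d)
      = (\<integral>p. f (fst p) * g (snd p) \<partial>distr (gauss d) (borel \<Otimes>\<^sub>M borel) (\<lambda>w. (\<Sum>i<d. w i * a i, \<Sum>i<d. w i * b i)))"
    unfolding dotp_def by (subst integral_distr) auto
  also have "\<dots> = (\<integral>p. f (fst p) * g (r * fst p + ?s * snd p) \<partial>(std_normal \<Otimes>\<^sub>M std_normal))"
    by (subst distr_gauss_pair[OF _ a b r(1)], simp, subst integral_distr) (auto simp: case_prod_beta')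
  also have "\<dots> = (\<integral>x. \<integral>y. f x * g (r * x + ?s * y) \<partial>std_normal \<partial>std_normal)"
  proof (subst std_normal_pair.integral_fst'[symmetric])
    have iw: "integrable std_normal (\<lambda>x. (1 + x\<^sup>2) ^ 2)" for x :: real
      by (rule integrable_corr_dominated[where C = 1]) (auto intro!: corr_growth_le[of 1 2, simplified])
    have b: "\<bar>f x * g (r * x + ?s * y)\<bar> \<le> (2 * Cf * Cg) * ((1 + x\<^sup>2) ^ 2 * (1 + y\<^sup>2) ^ 2)" for x y
    proof -
      have "(r * x + ?s * y)\<^sup>2 \<le> 2 * ((r * x)\<^sup>2 + (?s * y)\<^sup>2)"
        using zero_le_power2[of "r * x - ?s * y"] by (simp add: power2_diff power2_sum)
      also have "\<dots> \<le> 2 * (x\<^sup>2 + y\<^sup>2)"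
        unfolding power_mult_distrib using r2
        by (intro mult_left_mono add_mono mult_left_le_one_le) auto
      finally have "1 + (r * x + ?s * y)\<^sup>2 \<le> 2 * ((1 + x\<^sup>2) * (1 + y\<^sup>2))"
        using mult_nonneg_nonneg[OF zero_le_power2[of x] zero_le_power2[of y]] by (simp only: distrib_left distrib_right)
      then have "Cg * (1 + (r * x + ?s * y)\<^sup>2) \<le> Cg * (2 * ((1 + x\<^sup>2) * (1 + y\<^sup>2)))"
        using Cg by (intro mult_left_mono)
      then have "\<bar>f x * g (r * x + ?s * y)\<bar> \<le> (Cf * (1 + x\<^sup>2)) * (Cg * (2 * ((1 + x\<^sup>2) * (1 + y\<^sup>2))))"
        unfolding abs_mult using Cf g[of "r * x + ?s * y"] by (intro mult_mono f) auto
      also have "\<dots> = (2 * Cf * Cg) * ((1 + x\<^sup>2) ^ 2 * (1 + y\<^sup>2))"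
        by (simp add: power2_eq_square mult_ac)
      also have "\<dots> \<le> (2 * Cf * Cg) * ((1 + x\<^sup>2) ^ 2 * (1 + y\<^sup>2) ^ 2)"
        using Cf Cg power_increasing[of 1 2 "1 + y\<^sup>2"] by (intro mult_left_mono) auto
      finally show ?thesis .
    qed
    show "integrable (std_normal \<Otimes>\<^sub>M std_normal) (\<lambda>p. f (fst p) * g (r * fst p + ?s * snd p))"
    proof (rule Bochner_Integration.integrable_bound)
      show "integrable (std_normal \<Otimes>\<^sub>M std_normal) (\<lambda>p. (2 * Cf * Cg) * ((1 + (fst p)\<^sup>2) ^ 2 * (1 + (snd p)\<^sup>2) ^ 2))"
        by (intro integrable_mult_right integrable_std_normal_pair_prod iw)
      show "AE p in std_normal \<Otimes>\<^sub>M std_normal. norm (f (fst p) * g (r * fst p + ?s * snd p))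
          \<le> norm ((2 * Cf * Cg) * ((1 + (fst p)\<^sup>2) ^ 2 * (1 + (snd p)\<^sup>2) ^ 2))"
        using b by (intro AE_I2) (auto intro: order.trans[OF _ abs_ge_self])
    qed measurable
  qed simp
  also have "\<dots> = (\<integral>x. f x * (\<integral>y. g (r * x + ?s * y) \<partial>std_normal) \<partial>std_normal)"
    by simp
  finally show ?thesis
    using correlation_bound_iterated[OF assms(1-7) r(2)] by simp
qed

section \<open>Coercivity of the limit kernel\<close>

lemma AE_lborel_continuous_eq_zero:
  fixes f :: "real \<Rightarrow> real"
  assumes cont: "continuous_on UNIV f" and ae: "AE x in lborel. f x = 0"
  shows "f x = 0"
proof (rule ccontr)
  assume "f x \<noteq> 0"
  have "open {y. f y \<noteq> 0}"
    by (intro open_Collect_neq cont continuous_on_const)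
  then obtain e where e: "0 < e" "ball x e \<subseteq> {y. f y \<noteq> 0}"
    using \<open>f x \<noteq> 0\<close> by (auto simp: open_contains_ball)
  have "AE y in lborel. y \<notin> {x - e<..<x + e}"
    using ae by eventually_elim (use e(2) in \<open>auto simp: ball_eq_greaterThanLessThan\<close>)
  then have "emeasure lborel {x - e<..<x + e} = 0"
    by (subst (asm) AE_iff_measurable[of "{x - e<..<x + e}"]) auto
  then show False using e(1) by simp
qed

text \<open>The residual f is the activation minus its projections on the Hermite polynomials of degree 1
  and 2. It vanishes only if the activation is a quadratic polynomial, hence, being Lipschitz with
  mean zero, linear.\<close>

lemma residual_exists:
  assumes lip: "\<And>x y. \<bar>\<sigma> x - \<sigma> y\<bar> \<le> L * \<bar>x - y :: real\<bar>"
    and mean: "(\<integral>x. \<sigma> x \<partial>std_normal) = 0" and nonlin: "\<not> linear \<sigma>"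
  obtains f C where "continuous_on UNIV f" "\<And>x. \<bar>f x\<bar> \<le> C * (1 + x\<^sup>2)"
    "(\<integral>x. f x \<partial>std_normal) = 0" "(\<integral>x. f x * x \<partial>std_normal) = 0" "(\<integral>x. f x * x\<^sup>2 \<partial>std_normal) = 0"
    "0 < (\<integral>x. f x * \<sigma> x \<partial>std_normal)"
proof -
  have L: "0 \<le> L" using lip[of 1 0] by simp
  have "L-lipschitz_on UNIV \<sigma>"
    by (rule lipschitz_onI) (use lip L in \<open>auto simp: dist_real_def\<close>)
  then have cont: "continuous_on UNIV \<sigma>" by (rule lipschitz_on_continuous_on)
  have [measurable]: "\<sigma> \<in> borel_measurable borel" by (rule lipschitz_borel[OF lip])
  define Cs where "Cs = \<bar>\<sigma> 0\<bar> + L"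
  have Cs: "0 \<le> Cs" using L by (simp add: Cs_def)
  have abs1: "\<bar>x\<bar> \<le> 1 + x\<^sup>2" for x :: real
    using zero_le_power2[of "\<bar>x\<bar> - 1"] by (simp add: power2_diff)
  have \<sigma>b: "\<bar>\<sigma> x\<bar> \<le> Cs * (1 + x\<^sup>2)" for x
  proof -
    have "\<bar>\<sigma> x\<bar> \<le> \<bar>\<sigma> 0\<bar> * 1 + L * \<bar>x\<bar>" using lip[of x 0] by simp
    also have "\<dots> \<le> \<bar>\<sigma> 0\<bar> * (1 + x\<^sup>2) + L * (1 + x\<^sup>2)"
      using L abs1 by (intro add_mono mult_left_mono) auto
    finally show ?thesis by (simp add: Cs_def algebra_simps)
  qed
  have i0: "integrable std_normal \<sigma>" using integrable_std_normal_lipschitz[OF lip, of 1] by simp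
  have i1: "integrable std_normal (\<lambda>x. \<sigma> x * x)" by (rule integrable_mult_quadratic_growth[OF _ _ \<sigma>b, where D = 1]) (use abs1 in auto)
  have i2: "integrable std_normal (\<lambda>x. \<sigma> x * x\<^sup>2)" by (rule integrable_mult_quadratic_growth[OF _ _ \<sigma>b, where D = 1]) auto
  \<comment> \<open>Hermite coefficients of degrees 1 and 2. The polynomial x^2 - 1 has squared norm
    2, and pairing with x^2 gives the same value as pairing with x^2 - 1 since \<sigma> has mean
    zero.\<close>
  define \<alpha> \<gamma> where "\<alpha> = (\<integral>x. \<sigma> x * x \<partial>std_normal)" and "\<gamma> = (\<integral>x. \<sigma> x * x\<^sup>2 \<partial>std_normal) / 2"
  define f where "f x = \<sigma> x - \<alpha> * x - \<gamma> * (x\<^sup>2 - 1)" for x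
  have contf: "continuous_on UNIV f"
    unfolding f_def by (intro continuous_intros cont)
  then have [measurable]: "f \<in> borel_measurable borel" by (rule borel_measurable_continuous_onI)
  have fb: "\<bar>f x\<bar> \<le> (Cs + \<bar>\<alpha>\<bar> + \<bar>\<gamma>\<bar>) * (1 + x\<^sup>2)" for x
  proof -
    have "\<bar>f x\<bar> \<le> \<bar>\<sigma> x\<bar> + \<bar>\<alpha>\<bar> * \<bar>x\<bar> + \<bar>\<gamma>\<bar> * \<bar>x\<^sup>2 - 1\<bar>"
      unfolding f_def by (simp flip: abs_mult)
    also have "\<dots> \<le> Cs * (1 + x\<^sup>2) + \<bar>\<alpha>\<bar> * (1 + x\<^sup>2) + \<bar>\<gamma>\<bar> * (1 + x\<^sup>2)"
      using abs1 by (intro add_mono \<sigma>b mult_left_mono) (auto simp: abs_le_iff intro: order.trans[of _ 0])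
    finally show ?thesis by (simp add: algebra_simps)
  qed
  note m = std_normal_moments(1)[of 1, simplified] std_normal_moments(1)[of 2] std_normal_moments(1)[of 3] std_normal_moments(1)[of 4]
    std_normal_moments(3-6)
  have f0: "(\<integral>x. f x \<partial>std_normal) = 0"
    using i0 m mean std_normal.prob_space by (simp add: f_def)
  have "(\<integral>x. f x * x \<partial>std_normal) = (\<integral>x. \<sigma> x * x - \<alpha> * x\<^sup>2 - \<gamma> * (x ^ 3 - x) \<partial>std_normal)"
    by (intro Bochner_Integration.integral_cong refl) (simp add: f_def power2_eq_square power3_eq_cube algebra_simps)
  also have "\<dots> = 0"
    using i1 m by (simp add: \<alpha>_def)
  finally have f1: "(\<integral>x. f x * x \<partial>std_normal) = 0" .
  have "(\<integral>x. f x * x\<^sup>2 \<partial>std_normal) = (\<integral>x. \<sigma> x * x\<^sup>2 - \<alpha> * x ^ 3 - \<gamma> * (x ^ 4 - x\<^sup>2) \<partial>std_normal)"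
    by (intro Bochner_Integration.integral_cong refl) (simp add: f_def power2_eq_square power3_eq_cube power4_eq_xxxx algebra_simps)
  also have "\<dots> = 0"
    using i2 m by (simp add: \<gamma>_def)
  finally have f2: "(\<integral>x. f x * x\<^sup>2 \<partial>std_normal) = 0" .
  have iff: "integrable std_normal (\<lambda>x. f x * f x)" by (rule integrable_mult_quadratic_growth[OF _ _ fb fb]) auto
  have if1: "integrable std_normal (\<lambda>x. f x * x)" by (rule integrable_mult_quadratic_growth[OF _ _ fb, where D = 1]) (use abs1 in auto)
  have if2: "integrable std_normal (\<lambda>x. f x * x\<^sup>2)" by (rule integrable_mult_quadratic_growth[OF _ _ fb, where D = 1]) auto
  have if0: "integrable std_normal f" using integrable_mult_quadratic_growth[OF _ _ fb, of "\<lambda>_. 1" 1] by simp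
  \<comment> \<open>\<sigma> - f is a combination of x and x^2 - 1, to which f is orthogonal; the
    pairing with \<sigma> is therefore the squared norm of f.\<close>
  have "(\<integral>x. f x * \<sigma> x \<partial>std_normal) = (\<integral>x. f x * f x + \<alpha> * (f x * x) + \<gamma> * (f x * x\<^sup>2 - f x) \<partial>std_normal)"
    by (intro Bochner_Integration.integral_cong refl) (simp add: f_def algebra_simps)
  also have "\<dots> = (\<integral>x. f x * f x \<partial>std_normal)"
    using iff if0 if1 if2 f0 f1 f2 by simp
  finally have f\<sigma>: "(\<integral>x. f x * \<sigma> x \<partial>std_normal) = (\<integral>x. f x * f x \<partial>std_normal)" .
  have "(\<integral>x. f x * f x \<partial>std_normal) \<noteq> 0"
  proof
    assume "(\<integral>x. f x * f x \<partial>std_normal) = 0"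
    then have "AE x in std_normal. f x * f x = 0"
      using iff by (subst (asm) integral_nonneg_eq_0_iff_AE) auto
    then have "AE x in lborel. f x = 0"
      unfolding std_normal_def by (subst (asm) AE_density) (auto simp: normal_density_pos)
    then have fz: "f x = 0" for x
      by (rule AE_lborel_continuous_eq_zero[OF contf])
    have \<sigma>: "\<sigma> x = \<alpha> * x + \<gamma> * (x\<^sup>2 - 1)" for x
      using fz[of x] by (simp add: f_def)
    have "\<gamma> = 0"
    proof (rule ccontr)
      assume g: "\<gamma> \<noteq> 0"
      \<comment> \<open>The slope of \<sigma> between 0 and t is \<alpha> + \<gamma> t, and t is
        large enough for it to exceed L in absolute value.\<close>
      define t where "t = (L + \<bar>\<alpha>\<bar> + 1) / \<bar>\<gamma>\<bar>"
      have t: "0 < t" "\<bar>\<gamma>\<bar> * t = L + \<bar>\<alpha>\<bar> + 1" using g L by (auto simp: t_def)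
      have "\<sigma> t - \<sigma> 0 = t * (\<alpha> + \<gamma> * t)" unfolding \<sigma> by (simp add: power2_eq_square algebra_simps)
      then have "t * \<bar>\<alpha> + \<gamma> * t\<bar> \<le> t * L"
        using lip[of t 0] t(1) by (simp add: abs_mult mult_ac)
      then have "\<bar>\<alpha> + \<gamma> * t\<bar> \<le> L" using t(1) by simp
      moreover have "\<bar>\<gamma> * t\<bar> = L + \<bar>\<alpha>\<bar> + 1" using t by (simp add: abs_mult)
      ultimately show False by linarith
    qed
    with \<sigma> have "\<sigma> = (\<lambda>x. \<alpha> * x)" by auto
    then have "linear \<sigma>" using bounded_linear_mult_right[of \<alpha>] by (simp add: bounded_linear.linear)
    with nonlin show False ..
  qed
  then have "0 < (\<integral>x. f x * f x \<partial>std_normal)"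
    using integral_nonneg_AE[of "\<lambda>x. f x * f x" std_normal] by (simp add: order_less_le)
  with f\<sigma> have "0 < (\<integral>x. f x * \<sigma> x \<partial>std_normal)" by simp
  with contf fb f0 f1 f2 show ?thesis by (rule that)
qed

text \<open>An operator and its adjoint have the same norm: with v the image of a under the
  transpose, S is the pairing of a with X v, and one factor S cancels. It serves to bound row sums
  of squared inner products.\<close>

lemma transpose_op_bound:
  fixes X :: "nat \<Rightarrow> nat \<Rightarrow> real"
  assumes op: "\<And>v. (\<Sum>i<d. (\<Sum>j<n. X i j * v j)\<^sup>2) \<le> B\<^sup>2 * (\<Sum>j<n. (v j)\<^sup>2)"
  shows "(\<Sum>j<n. (\<Sum>i<d. X i j * a i)\<^sup>2) \<le> B\<^sup>2 * (\<Sum>i<d. (a i)\<^sup>2)"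
proof -
  define v where "v j = (\<Sum>i<d. X i j * a i)" for j
  define S where "S = (\<Sum>j<n. (v j)\<^sup>2)"
  have "S = (\<Sum>j<n. \<Sum>i<d. X i j * a i * v j)"
    unfolding S_def power2_eq_square by (subst (1) v_def) (simp add: sum_distrib_right)
  also have "\<dots> = (\<Sum>i<d. a i * (\<Sum>j<n. X i j * v j))"
    by (subst sum.swap) (simp add: sum_distrib_left mult_ac)
  finally have "S\<^sup>2 \<le> (\<Sum>i<d. (a i)\<^sup>2) * (\<Sum>i<d. (\<Sum>j<n. X i j * v j)\<^sup>2)"
    by (simp add: sum_square_le)
  also have "\<dots> \<le> (\<Sum>i<d. (a i)\<^sup>2) * (B\<^sup>2 * S)"
    unfolding S_def by (intro mult_left_mono op sum_nonneg) auto
  finally have "S * S \<le> (B\<^sup>2 * (\<Sum>i<d. (a i)\<^sup>2)) * S" by (simp add: power2_eq_square mult_ac)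
  moreover have "0 \<le> S" "0 \<le> B\<^sup>2 * (\<Sum>i<d. (a i)\<^sup>2)" unfolding S_def by (auto intro!: sum_nonneg mult_nonneg_nonneg)
  ultimately have "S \<le> B\<^sup>2 * (\<Sum>i<d. (a i)\<^sup>2)"
    by (cases "S = 0") auto
  then show ?thesis by (simp add: S_def v_def)
qed

text \<open>Cauchy-Schwarz over index pairs bounds the form by its Frobenius norm. Of the six powers
  of r in the squared entries, four are bounded by \<rho> and two are summed along rows, which costs
  n R in place of n^2.\<close>

lemma offdiag_form_bound:
  fixes N r :: "nat \<Rightarrow> nat \<Rightarrow> real"
  assumes N: "\<And>j k. j < n \<Longrightarrow> k < n \<Longrightarrow> j \<noteq> k \<Longrightarrow> \<bar>N j k\<bar> \<le> D * \<bar>r j k\<bar> ^ 3"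
    and r: "\<And>j k. j < n \<Longrightarrow> k < n \<Longrightarrow> j \<noteq> k \<Longrightarrow> \<bar>r j k\<bar> \<le> \<rho>" "\<And>j. j < n \<Longrightarrow> (\<Sum>k<n. (r j k)\<^sup>2) \<le> R"
    and D: "0 \<le> D"
  shows "(\<Sum>j<n. \<Sum>k<n. if j = k then 0 else u j * u k * N j k)\<^sup>2 \<le> (D\<^sup>2 * (real n * R * \<rho> ^ 4)) * (\<Sum>j<n. (u j)\<^sup>2)\<^sup>2"
proof -
  let ?N = "\<lambda>j k. if j = k then 0 else N j k"
  have "(\<Sum>j<n. \<Sum>k<n. if j = k then 0 else u j * u k * N j k)\<^sup>2
      = (\<Sum>p\<in>{..<n} \<times> {..<n}. (u (fst p) * u (snd p)) * ?N (fst p) (snd p))\<^sup>2"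
    unfolding sum.cartesian_product by (intro arg_cong[where f = "\<lambda>x. x\<^sup>2"] sum.cong) auto
  also have "\<dots> \<le> (\<Sum>p\<in>{..<n} \<times> {..<n}. (u (fst p) * u (snd p))\<^sup>2) * (\<Sum>p\<in>{..<n} \<times> {..<n}. (?N (fst p) (snd p))\<^sup>2)"
    by (rule sum_square_le)
  also have "(\<Sum>p\<in>{..<n} \<times> {..<n}. (u (fst p) * u (snd p))\<^sup>2) = (\<Sum>j<n. (u j)\<^sup>2)\<^sup>2"
    by (simp add: power2_eq_square[of "sum _ _"] sum_product sum.cartesian_product power_mult_distrib case_prod_beta')
  also have "(\<Sum>p\<in>{..<n} \<times> {..<n}. (?N (fst p) (snd p))\<^sup>2) = (\<Sum>j<n. \<Sum>k<n. (?N j k)\<^sup>2)"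
    by (simp add: sum.cartesian_product case_prod_beta')
  also have "(\<Sum>j<n. (u j)\<^sup>2)\<^sup>2 * (\<Sum>j<n. \<Sum>k<n. (?N j k)\<^sup>2) \<le> (\<Sum>j<n. (u j)\<^sup>2)\<^sup>2 * (D\<^sup>2 * (real n * R * \<rho> ^ 4))"
  proof (rule mult_left_mono)
    have "(?N j k)\<^sup>2 \<le> D\<^sup>2 * \<rho> ^ 4 * (r j k)\<^sup>2" if "j < n" "k < n" for j k
    proof (cases "j = k")
      case False
      have "(N j k)\<^sup>2 \<le> (D * \<bar>r j k\<bar> ^ 3)\<^sup>2"
        using power_mono[OF N[OF that False], of 2] by simp
      also have "\<dots> = D\<^sup>2 * (\<bar>r j k\<bar> ^ 4 * (r j k)\<^sup>2)"
      proof -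
        have "(\<bar>r j k\<bar> ^ 3)\<^sup>2 = \<bar>r j k\<bar> ^ 4 * \<bar>r j k\<bar>\<^sup>2" by (simp add: eval_nat_numeral)
        then show ?thesis by (simp add: power_mult_distrib)
      qed
      also have "\<dots> \<le> D\<^sup>2 * (\<rho> ^ 4 * (r j k)\<^sup>2)"
        using r(1)[OF that False] by (intro mult_left_mono mult_right_mono power_mono) auto
      finally show ?thesis using False by (simp add: mult_ac)
    qed simp
    then have "(\<Sum>j<n. \<Sum>k<n. (?N j k)\<^sup>2) \<le> (\<Sum>j<n. \<Sum>k<n. D\<^sup>2 * \<rho> ^ 4 * (r j k)\<^sup>2)"
      by (intro sum_mono) auto
    also have "\<dots> = (\<Sum>j<n. D\<^sup>2 * \<rho> ^ 4 * (\<Sum>k<n. (r j k)\<^sup>2))"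
      by (simp add: sum_distrib_left)
    also have "\<dots> \<le> (\<Sum>j<n. D\<^sup>2 * \<rho> ^ 4 * R)"
      using r(2) by (intro sum_mono mult_left_mono) auto
    finally show "(\<Sum>j<n. \<Sum>k<n. (?N j k)\<^sup>2) \<le> D\<^sup>2 * (real n * R * \<rho> ^ 4)"
      by (simp add: mult_ac)
  qed simp
  finally show ?thesis by (simp add: mult_ac)
qed

lemma quadratic_growth_exp_growth:
  assumes "\<And>x. \<bar>f x\<bar> \<le> C * (1 + x\<^sup>2)"
  shows "exp_growth {..<d} (\<lambda>w. f (dotp d w a) :: real)"
proof (rule exp_growth_dominated)
  show "exp_growth {..<d} (\<lambda>w. C * (1 + (dotp d w a)\<^sup>2))"
    by (intro exp_growth_add exp_growth_mult exp_growth_const exp_growth_power exp_growth_dotp)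
  show "\<bar>f (dotp d w a)\<bar> \<le> \<bar>C * (1 + (dotp d w a)\<^sup>2)\<bar>" for w
    using assms[of "dotp d w a"] by simp
qed

text \<open>Duality: the combination of residual features correlates with the combination of activations
  by at least a multiple of the squared norm of u. The off-diagonal correlations are of order e^3, and
  their sum of squares is of order n e^4.\<close>

lemma kernel_lower_bound:
  assumes lip: "\<And>x y. \<bar>\<sigma> x - \<sigma> y\<bar> \<le> L * \<bar>x - y :: real\<bar>"
    and mean: "(\<integral>x. \<sigma> x \<partial>std_normal) = 0" and nonlin: "\<not> linear \<sigma>"
  obtains c e1 where "0 < c" "0 < e1"
    "\<And>d n e (X :: nat \<Rightarrow> nat \<Rightarrow> real) u. 0 \<le> e \<Longrightarrow> e \<le> e1 \<Longrightarrow> real n * e ^ 4 \<le> e1 \<Longrightarrow>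
      (\<And>j. j < n \<Longrightarrow> \<bar>sqrt (\<Sum>i<d. (X i j)\<^sup>2) - 1\<bar> \<le> e) \<Longrightarrow>
      (\<And>j k. j < n \<Longrightarrow> k < n \<Longrightarrow> j \<noteq> k \<Longrightarrow> \<bar>\<Sum>i<d. X i j * X i k\<bar> \<le> e) \<Longrightarrow>
      (\<And>v. (\<Sum>i<d. (\<Sum>j<n. X i j * v j)\<^sup>2) \<le> B\<^sup>2 * (\<Sum>j<n. (v j)\<^sup>2)) \<Longrightarrow>
      c * (\<Sum>j<n. (u j)\<^sup>2) \<le> (\<integral>w. (\<Sum>j<n. u j * \<sigma> (dotp d w (\<lambda>i. X i j)))\<^sup>2 \<partial>gauss d)"
proof -
  have L: "0 \<le> L" using lip[of 1 0] by simp
  have [measurable]: "\<sigma> \<in> borel_measurable borel" by (rule lipschitz_borel[OF lip])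
  obtain f Cf where contf: "continuous_on UNIV f" and fb: "\<And>x. \<bar>f x\<bar> \<le> Cf * (1 + x\<^sup>2)"
    and f0: "(\<integral>x. f x \<partial>std_normal) = 0" and f1: "(\<integral>x. f x * x \<partial>std_normal) = 0" and f2: "(\<integral>x. f x * x\<^sup>2 \<partial>std_normal) = 0"
    and f\<sigma>: "0 < (\<integral>x. f x * \<sigma> x \<partial>std_normal)"
    using residual_exists[OF lip mean nonlin] by blast
  have [measurable]: "f \<in> borel_measurable borel" using contf by (rule borel_measurable_continuous_onI)
  have Cf: "0 \<le> Cf" using fb[of 0] by simp
  \<comment> \<open>The factor 2 admits all column norms up to 2.\<close>
  define Cg where "Cg = \<bar>\<sigma> 0\<bar> + 2 * L"
  have Cg: "0 \<le> Cg" using L by (simp add: Cg_def)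
  have abs1: "\<bar>x\<bar> \<le> 1 + x\<^sup>2" for x :: real
    using zero_le_power2[of "\<bar>x\<bar> - 1"] by (simp add: power2_diff)
  have gb: "\<bar>\<sigma> (\<rho> * x)\<bar> \<le> Cg * (1 + x\<^sup>2)" if "\<bar>\<rho>\<bar> \<le> 2" for x \<rho>
  proof -
    have "\<bar>\<sigma> (\<rho> * x)\<bar> \<le> \<bar>\<sigma> 0\<bar> * 1 + L * (\<bar>\<rho>\<bar> * \<bar>x\<bar>)" using lip[of "\<rho> * x" 0] by (simp add: abs_mult)
    also have "\<dots> \<le> \<bar>\<sigma> 0\<bar> * (1 + x\<^sup>2) + L * (2 * (1 + x\<^sup>2))"
      using L abs1 that by (intro add_mono mult_left_mono mult_mono) auto
    finally show ?thesis by (simp add: Cg_def algebra_simps)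
  qed
  define c0 where "c0 = (\<integral>x. f x * \<sigma> x \<partial>std_normal)"
  define A where "A = (\<integral>x. (f x)\<^sup>2 \<partial>std_normal) + 1"
  define M where "M = (\<integral>x. \<bar>f x\<bar> * \<bar>x\<bar> \<partial>std_normal)"
  define D where "D = 8 * (Cf * (Cf + Cg) * corr_const\<^sup>2)"
  have c0: "0 < c0" using f\<sigma> by (simp add: c0_def)
  have A: "1 \<le> A" unfolding A_def by simp
  have D: "0 \<le> D" using Cf Cg corr_const_nonneg by (simp add: D_def)
  have M: "0 \<le> M" unfolding M_def by (intro integral_nonneg_AE) auto
  \<comment> \<open>b is the share of S allowed to the off-diagonal terms: at most 1 for the square
    of F and c0 / 4 for the pairing of F with P. The three bounds in \<open>e1\<close> ensure |r|
    \<le> 4 e \<le> 1 / 16 for the correlation bound, a change of the diagonal pairing by at most c0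
    / 2 due to the column norms, and the off-diagonal bound b S, where 1024 = 4 * 4^4 comes from R =
    4 B^2 and |r| \<le> 4 e.\<close>
  define b where "b = min 1 (c0 / 4)"
  define c where "c = c0\<^sup>2 / (16 * A)"
  define e1 where "e1 = min (1 / 64) (min (c0 / (2 * (L * M + 1))) (b\<^sup>2 / (1024 * B\<^sup>2 * D\<^sup>2 + 1)))"
  have b: "0 < b" "b \<le> 1" "b \<le> c0 / 4" using c0 by (auto simp: b_def)
  have c: "0 < c" using c0 A by (simp add: c_def)
  have e1: "0 < e1"
  proof -
    have "0 < L * M + 1" "0 < 1024 * B\<^sup>2 * D\<^sup>2 + 1" using L M by (simp_all add: add_nonneg_pos)
    then show ?thesis using c0 b by (simp add: e1_def)
  qed
  have main: "c * (\<Sum>j<n. (u j)\<^sup>2) \<le> (\<integral>w. (\<Sum>j<n. u j * \<sigma> (dotp d w (\<lambda>i. X i j)))\<^sup>2 \<partial>gauss d)"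
    if e: "0 \<le> e" "e \<le> e1" "real n * e ^ 4 \<le> e1"
      and norms: "\<And>j. j < n \<Longrightarrow> \<bar>sqrt (\<Sum>i<d. (X i j)\<^sup>2) - 1\<bar> \<le> e"
      and inner: "\<And>j k. j < n \<Longrightarrow> k < n \<Longrightarrow> j \<noteq> k \<Longrightarrow> \<bar>\<Sum>i<d. X i j * X i k\<bar> \<le> e"
      and op: "\<And>v. (\<Sum>i<d. (\<Sum>j<n. X i j * v j)\<^sup>2) \<le> B\<^sup>2 * (\<Sum>j<n. (v j)\<^sup>2)"
    for d n e u and X :: "nat \<Rightarrow> nat \<Rightarrow> real"
  proof -
    define S where "S = (\<Sum>j<n. (u j)\<^sup>2)"
    have S: "0 \<le> S" unfolding S_def by (rule sum_nonneg) simp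
    have e64: "e \<le> 1 / 64" and e2: "e \<le> c0 / (2 * (L * M + 1))" and e3: "real n * e ^ 4 \<le> b\<^sup>2 / (1024 * B\<^sup>2 * D\<^sup>2 + 1)"
      using e by (auto simp: e1_def)
    define \<rho> where "\<rho> j = sqrt (\<Sum>i<d. (X i j)\<^sup>2)" for j
    have \<rho>: "1 / 2 \<le> \<rho> j" "\<rho> j \<le> 2" "\<bar>\<rho> j - 1\<bar> \<le> e" if "j < n" for j
      using norms[OF that] e64 by (auto simp: \<rho>_def)
    have \<rho>sq: "(\<rho> j)\<^sup>2 = (\<Sum>i<d. (X i j)\<^sup>2)" for j
      unfolding \<rho>_def by (simp add: sum_nonneg)
    \<comment> \<open>The residual f is evaluated along unit directions, where its orthogonality
      relations are exact; the column norm is moved inside the activation.\<close>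
    define E where "E j i = X i j / \<rho> j" for j i
    have unit: "(\<Sum>i<d. (E j i)\<^sup>2) = 1" if "j < n" for j
      using \<rho>(1)[OF that] by (simp add: E_def power_divide sum_divide_distrib[symmetric] \<rho>sq[symmetric])
    have dE: "dotp d w (\<lambda>i. X i j) = \<rho> j * dotp d w (E j)" if "j < n" for j w
      using \<rho>(1)[OF that] by (simp add: dotp_def E_def sum_distrib_left)
    define r where "r j k = (\<Sum>i<d. E j i * E k i)" for j k
    have r_eq: "r j k = (\<Sum>i<d. X i j * X i k) / (\<rho> j * \<rho> k)" for j k
      by (simp add: r_def E_def sum_divide_distrib)
    have \<rho>\<rho>: "1 / 4 \<le> \<rho> j * \<rho> k" if "j < n" "k < n" for j k
      using mult_mono[OF \<rho>(1)[OF that(1)] \<rho>(1)[OF that(2)]] \<rho>(1)[OF that(1)] by simp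
    have r_le: "\<bar>r j k\<bar> \<le> 4 * e" if "j < n" "k < n" "j \<noteq> k" for j k
    proof -
      have "\<bar>r j k\<bar> = \<bar>\<Sum>i<d. X i j * X i k\<bar> / (\<rho> j * \<rho> k)"
        using \<rho>\<rho>[OF that(1,2)] by (simp add: r_eq abs_divide)
      also have "\<dots> \<le> e / (1 / 4)"
        using \<rho>\<rho>[OF that(1,2)] inner[OF that] e(1) by (intro frac_le) auto
      finally show ?thesis by simp
    qed
    have r_sum: "(\<Sum>k<n. (r j k)\<^sup>2) \<le> 4 * B\<^sup>2" if "j < n" for j
    proof -
      have "(\<Sum>k<n. (r j k)\<^sup>2) \<le> (\<Sum>k<n. 4 / (\<rho> j)\<^sup>2 * (\<Sum>i<d. X i k * X i j)\<^sup>2)"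
      proof (rule sum_mono)
        fix k assume "k \<in> {..<n}"
        then have "(1 / 2)\<^sup>2 \<le> (\<rho> k)\<^sup>2" using \<rho>(1)[of k] by (intro power_mono) auto
        then have "1 / (\<rho> k)\<^sup>2 \<le> 4"
          by (simp add: power2_eq_square field_simps split: if_splits)
        then have "1 / (\<rho> k)\<^sup>2 * ((\<Sum>i<d. X i j * X i k)\<^sup>2 / (\<rho> j)\<^sup>2) \<le> 4 * ((\<Sum>i<d. X i j * X i k)\<^sup>2 / (\<rho> j)\<^sup>2)"
          by (rule mult_right_mono) simp
        then show "(r j k)\<^sup>2 \<le> 4 / (\<rho> j)\<^sup>2 * (\<Sum>i<d. X i k * X i j)\<^sup>2"
          by (simp add: r_eq power_divide power_mult_distrib mult_ac)
      qed
      also have "\<dots> = 4 / (\<rho> j)\<^sup>2 * (\<Sum>k<n. (\<Sum>i<d. X i k * X i j)\<^sup>2)"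
        by (simp add: sum_distrib_left)
      also have "\<dots> \<le> 4 / (\<rho> j)\<^sup>2 * (B\<^sup>2 * (\<rho> j)\<^sup>2)"
      proof (rule mult_left_mono)
        show "(\<Sum>k<n. (\<Sum>i<d. X i k * X i j)\<^sup>2) \<le> B\<^sup>2 * (\<rho> j)\<^sup>2"
          unfolding \<rho>sq by (rule transpose_op_bound[OF op])
      qed simp
      also have "\<dots> = 4 * B\<^sup>2" using \<rho>(1)[OF that] by simp
      finally show ?thesis .
    qed
    have off: "\<bar>\<Sum>j<n. \<Sum>k<n. if j = k then 0 else u j * u k * N j k\<bar> \<le> b * S"
      if N: "\<And>j k. j < n \<Longrightarrow> k < n \<Longrightarrow> j \<noteq> k \<Longrightarrow> \<bar>N j k\<bar> \<le> D * \<bar>r j k\<bar> ^ 3" for N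
    proof -
      have "(\<Sum>j<n. \<Sum>k<n. if j = k then 0 else u j * u k * N j k)\<^sup>2 \<le> (D\<^sup>2 * (real n * (4 * B\<^sup>2) * (4 * e) ^ 4)) * S\<^sup>2"
        unfolding S_def by (rule offdiag_form_bound[OF N r_le r_sum D])
      also have "\<dots> \<le> b\<^sup>2 * S\<^sup>2"
      proof (rule mult_right_mono)
        have "D\<^sup>2 * (real n * (4 * B\<^sup>2) * (4 * e) ^ 4) = (1024 * B\<^sup>2 * D\<^sup>2) * (real n * e ^ 4)"
          by (simp add: power_mult_distrib)
        also have "\<dots> \<le> (1024 * B\<^sup>2 * D\<^sup>2) * (b\<^sup>2 / (1024 * B\<^sup>2 * D\<^sup>2 + 1))"
          by (intro mult_left_mono e3) auto
        also have "\<dots> \<le> b\<^sup>2"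
        proof -
          let ?q = "1024 * B\<^sup>2 * D\<^sup>2"
          have "0 \<le> ?q" by simp
          then have "?q * b\<^sup>2 \<le> b\<^sup>2 * (?q + 1)" "0 < ?q + 1" by (simp_all add: distrib_left mult.commute add_nonneg_pos)
          then show ?thesis by (simp only: times_divide_eq_right pos_divide_le_eq)
        qed
        finally show "D\<^sup>2 * (real n * (4 * B\<^sup>2) * (4 * e) ^ 4) \<le> b\<^sup>2" .
      qed simp
      also have "\<dots> = (b * S)\<^sup>2" by (simp add: power_mult_distrib)
      finally show ?thesis
        using b S by (simp add: abs_le_square_iff[symmetric])
    qed
    have split: "(\<Sum>j<n. \<Sum>k<n. u j * u k * N j k) = (\<Sum>j<n. (u j)\<^sup>2 * N j j) + (\<Sum>j<n. \<Sum>k<n. if j = k then 0 else u j * u k * N j k)"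
      for N :: "nat \<Rightarrow> nat \<Rightarrow> real"
    proof -
      have "(\<Sum>j<n. \<Sum>k<n. u j * u k * N j k) = (\<Sum>j<n. \<Sum>k<n. (if k = j then u j * u j * N j j else 0) + (if j = k then 0 else u j * u k * N j k))"
        by (intro sum.cong) auto
      then show ?thesis by (simp add: sum.distrib power2_eq_square)
    qed
    define F where "F w = (\<Sum>j<n. u j * f (dotp d w (E j)))" for w
    define P where "P w = (\<Sum>j<n. u j * \<sigma> (\<rho> j * dotp d w (E j)))" for w
    have [measurable]: "F \<in> borel_measurable (gauss d)" "P \<in> borel_measurable (gauss d)"
      unfolding F_def[abs_def] P_def[abs_def] by measurable
    have gf: "exp_growth {..<d} (\<lambda>w. f (dotp d w a))" for a
      by (rule quadratic_growth_exp_growth[OF fb])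
    have g\<sigma>: "exp_growth {..<d} (\<lambda>w. \<sigma> (\<rho> k * dotp d w a))" if "k < n" for k a
    proof (rule quadratic_growth_exp_growth[where f = "\<lambda>x. \<sigma> (\<rho> k * x)"])
      show "\<bar>\<sigma> (\<rho> k * x)\<bar> \<le> Cg * (1 + x\<^sup>2)" for x
        using \<rho>(1,2)[OF that] by (intro gb) simp
    qed
    have gF: "exp_growth {..<d} F"
      unfolding F_def[abs_def] by (intro exp_growth_sum exp_growth_mult exp_growth_const gf)
    have gP: "exp_growth {..<d} P"
      unfolding P_def[abs_def] by (intro exp_growth_sum exp_growth_mult exp_growth_const g\<sigma>) simp
    have iFF: "integrable (gauss d) (\<lambda>w. F w * F w)" and iFP: "integrable (gauss d) (\<lambda>w. F w * P w)" and iPP: "integrable (gauss d) (\<lambda>w. P w * P w)"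
      by (intro integrable_gauss_exp_growth exp_growth_mult gF gP; measurable)+
    have EFF: "(\<integral>w. F w * F w \<partial>gauss d) \<le> A * S"
    proof -
      define N where "N j k = (\<integral>w. f (dotp d w (E j)) * f (dotp d w (E k)) \<partial>gauss d)" for j k
      have int: "integrable (gauss d) (\<lambda>w. f (dotp d w (E j)) * f (dotp d w (E k)))" for j k
        by (intro integrable_gauss_exp_growth exp_growth_mult gf; measurable)
      have "(\<integral>w. F w * F w \<partial>gauss d) = (\<integral>w. (\<Sum>j<n. \<Sum>k<n. u j * u k * (f (dotp d w (E j)) * f (dotp d w (E k)))) \<partial>gauss d)"
        unfolding F_def sum_product by (intro Bochner_Integration.integral_cong refl sum.cong) (auto simp: mult_ac)
      also have "\<dots> = (\<Sum>j<n. \<Sum>k<n. u j * u k * N j k)"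
        using int by (simp add: N_def)
      also have "\<dots> = (\<Sum>j<n. (u j)\<^sup>2 * N j j) + (\<Sum>j<n. \<Sum>k<n. if j = k then 0 else u j * u k * N j k)"
        by (rule split)
      also have "(\<Sum>j<n. (u j)\<^sup>2 * N j j) = (\<Sum>j<n. (u j)\<^sup>2 * (A - 1))"
      proof (rule sum.cong)
        fix j assume "j \<in> {..<n}"
        then show "(u j)\<^sup>2 * N j j = (u j)\<^sup>2 * (A - 1)"
          unfolding N_def using integral_dotp[of "\<lambda>x. f x * f x" d "E j"]
          by (simp add: unit A_def power2_eq_square[of "f _"])
      qed simp
      also have "\<dots> = (A - 1) * S" by (simp add: S_def sum_distrib_left mult_ac)
      also have "\<bar>\<Sum>j<n. \<Sum>k<n. if j = k then 0 else u j * u k * N j k\<bar> \<le> b * S"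
      proof (rule off)
        fix j k assume jk: "j < n" "k < n" "j \<noteq> k"
        have "\<bar>N j k\<bar> \<le> 8 * \<bar>r j k\<bar> ^ 3 * (Cf * Cf * corr_const\<^sup>2)"
          unfolding N_def using r_le[OF jk] e64
          by (intro correlation_bound fb f0 f1 f2 unit jk) (auto simp: r_def)
        also have "\<dots> \<le> 8 * \<bar>r j k\<bar> ^ 3 * (Cf * (Cf + Cg) * corr_const\<^sup>2)"
          using Cf Cg by (intro mult_left_mono mult_right_mono) auto
        finally show "\<bar>N j k\<bar> \<le> D * \<bar>r j k\<bar> ^ 3" by (simp add: D_def mult_ac)
      qed
      then have "(\<Sum>j<n. \<Sum>k<n. if j = k then 0 else u j * u k * N j k) \<le> 1 * S"
        using mult_right_mono[OF b(2) S] by linarith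
      finally show ?thesis by (simp add: algebra_simps)
    qed
    have EFP: "c0 / 4 * S \<le> (\<integral>w. F w * P w \<partial>gauss d)"
    proof -
      define N where "N j k = (\<integral>w. f (dotp d w (E j)) * \<sigma> (\<rho> k * dotp d w (E k)) \<partial>gauss d)" for j k
      have int: "integrable (gauss d) (\<lambda>w. f (dotp d w (E j)) * \<sigma> (\<rho> k * dotp d w (E k)))" if "k < n" for j k
        by (rule integrable_gauss_exp_growth[OF _ _ exp_growth_mult[OF gf g\<sigma>[OF that]]]; measurable)
      have diag: "c0 / 2 \<le> N j j" if "j < n" for j
      proof -
        have if\<sigma>: "integrable std_normal (\<lambda>x. f x * \<sigma> (\<rho> j * x))"
          by (rule integrable_mult_quadratic_growth[OF _ _ fb gb]) (use \<rho>[OF that] in auto)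
        have if\<sigma>1: "integrable std_normal (\<lambda>x. f x * \<sigma> x)"
          using integrable_mult_quadratic_growth[OF _ _ fb gb[of 1]] by simp
        have ifx: "integrable std_normal (\<lambda>x. \<bar>f x\<bar> * \<bar>x\<bar>)"
          by (rule integrable_mult_quadratic_growth[where C = Cf and D = 1]) (use fb abs1 in auto)
        have "N j j = (\<integral>x. f x * \<sigma> (\<rho> j * x) \<partial>std_normal)"
          unfolding N_def using integral_dotp[of "\<lambda>x. f x * \<sigma> (\<rho> j * x)" d "E j"] by (simp add: unit[OF that])
        then have "\<bar>N j j - c0\<bar> = \<bar>\<integral>x. f x * (\<sigma> (\<rho> j * x) - \<sigma> x) \<partial>std_normal\<bar>"
          using if\<sigma> if\<sigma>1 by (simp add: c0_def right_diff_distrib)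
        also have "\<dots> \<le> (\<integral>x. \<bar>f x * (\<sigma> (\<rho> j * x) - \<sigma> x)\<bar> \<partial>std_normal)"
          by (rule integral_abs_bound)
        also have "\<dots> \<le> (\<integral>x. (L * e) * (\<bar>f x\<bar> * \<bar>x\<bar>) \<partial>std_normal)"
        proof (rule integral_mono)
          fix x
          have "\<bar>\<sigma> (\<rho> j * x) - \<sigma> x\<bar> \<le> L * \<bar>\<rho> j * x - x\<bar>" by (rule lip)
          also have "\<rho> j * x - x = (\<rho> j - 1) * x" by (simp add: algebra_simps)
          also have "L * \<bar>(\<rho> j - 1) * x\<bar> \<le> L * (e * \<bar>x\<bar>)"
            unfolding abs_mult using \<rho>(3)[OF that] L by (intro mult_left_mono mult_right_mono) auto
          finally have "\<bar>f x\<bar> * \<bar>\<sigma> (\<rho> j * x) - \<sigma> x\<bar> \<le> \<bar>f x\<bar> * (L * (e * \<bar>x\<bar>))"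
            by (intro mult_left_mono) auto
          then show "\<bar>f x * (\<sigma> (\<rho> j * x) - \<sigma> x)\<bar> \<le> (L * e) * (\<bar>f x\<bar> * \<bar>x\<bar>)"
            by (simp add: abs_mult mult_ac)
        qed (use if\<sigma> if\<sigma>1 ifx in \<open>auto simp: right_diff_distrib\<close>)
        also have "\<dots> = L * M * e" by (simp add: M_def)
        also have "\<dots> \<le> L * M * (c0 / (2 * (L * M + 1)))"
          using L M by (intro mult_left_mono e2) auto
        also have "\<dots> \<le> c0 / 2"
        proof -
          have "0 \<le> L * M" using L M by simp
          then have "L * M * c0 \<le> c0 / 2 * (2 * (L * M + 1))" "0 < 2 * (L * M + 1)"
            using c0 by (simp_all add: algebra_simps add_nonneg_pos)
          then show ?thesis by (simp only: times_divide_eq_right pos_divide_le_eq)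
        qed
        finally show ?thesis by linarith
      qed
      have "\<bar>\<Sum>j<n. \<Sum>k<n. if j = k then 0 else u j * u k * N j k\<bar> \<le> b * S"
      proof (rule off)
        fix j k assume jk: "j < n" "k < n" "j \<noteq> k"
        have "\<bar>N j k\<bar> \<le> 8 * \<bar>r j k\<bar> ^ 3 * (Cf * Cg * corr_const\<^sup>2)"
          unfolding N_def using r_le[OF jk] e64 \<rho>[OF jk(2)]
          by (intro correlation_bound[where g = "\<lambda>y. \<sigma> (\<rho> k * y)"] fb gb f0 f1 f2 unit jk) (auto simp: r_def)
        also have "\<dots> \<le> 8 * \<bar>r j k\<bar> ^ 3 * (Cf * (Cf + Cg) * corr_const\<^sup>2)"
          using Cf Cg by (intro mult_left_mono mult_right_mono) auto
        finally show "\<bar>N j k\<bar> \<le> D * \<bar>r j k\<bar> ^ 3" by (simp add: D_def mult_ac)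
      qed
      then have o: "- (c0 / 4 * S) \<le> (\<Sum>j<n. \<Sum>k<n. if j = k then 0 else u j * u k * N j k)"
        using mult_right_mono[OF b(3) S] by linarith
      have "c0 / 2 * S \<le> (\<Sum>j<n. (u j)\<^sup>2 * N j j)"
        unfolding S_def sum_distrib_left by (intro sum_mono, subst mult.commute, intro mult_left_mono) (use diag in auto)
      with o have "c0 / 4 * S \<le> (\<Sum>j<n. \<Sum>k<n. u j * u k * N j k)"
        unfolding split[of N] by linarith
      also have "\<dots> = (\<integral>w. (\<Sum>j<n. \<Sum>k<n. u j * u k * (f (dotp d w (E j)) * \<sigma> (\<rho> k * dotp d w (E k)))) \<partial>gauss d)"
        unfolding N_def using int
        by (subst Bochner_Integration.integral_sum, force,
            intro sum.cong refl, subst Bochner_Integration.integral_sum) auto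
      also have "\<dots> = (\<integral>w. F w * P w \<partial>gauss d)"
        unfolding F_def P_def sum_product by (intro Bochner_Integration.integral_cong refl sum.cong) (auto simp: mult_ac)
      finally show ?thesis .
    qed
    \<comment> \<open>The maximizer of 2 t c0 / 4 - t^2 A, with value c0^2 / (16 A) = c.\<close>
    define t where "t = c0 / (4 * A)"
    have "0 \<le> (\<integral>w. (P w - t * F w)\<^sup>2 \<partial>gauss d)" by simp
    also have "\<dots> = (\<integral>w. P w * P w - 2 * t * (F w * P w) + t\<^sup>2 * (F w * F w) \<partial>gauss d)"
      by (intro Bochner_Integration.integral_cong refl) (simp add: power2_eq_square algebra_simps)
    also have "\<dots> = (\<integral>w. P w * P w \<partial>gauss d) - 2 * t * (\<integral>w. F w * P w \<partial>gauss d) + t\<^sup>2 * (\<integral>w. F w * F w \<partial>gauss d)"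
      using iFF iFP iPP by simp
    finally have "2 * t * (\<integral>w. F w * P w \<partial>gauss d) - t\<^sup>2 * (\<integral>w. F w * F w \<partial>gauss d) \<le> (\<integral>w. P w * P w \<partial>gauss d)" by simp
    moreover have "2 * t * (c0 / 4 * S) \<le> 2 * t * (\<integral>w. F w * P w \<partial>gauss d)"
      using c0 A by (intro mult_left_mono EFP) (auto simp: t_def)
    moreover have "t\<^sup>2 * (\<integral>w. F w * F w \<partial>gauss d) \<le> t\<^sup>2 * (A * S)"
      by (intro mult_left_mono EFF) simp
    moreover have "2 * t * (c0 / 4 * S) - t\<^sup>2 * (A * S) = c * S"
      using A by (simp add: t_def c_def power2_eq_square field_simps)
    ultimately have "c * S \<le> (\<integral>w. P w * P w \<partial>gauss d)" by linarith
    moreover have "P w = (\<Sum>j<n. u j * \<sigma> (dotp d w (\<lambda>i. X i j)))" for w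
      unfolding P_def by (intro sum.cong) (auto simp: dE)
    ultimately show ?thesis by (simp add: S_def power2_eq_square)
  qed
  show ?thesis
  proof (rule that[OF c e1])
    fix d n e u and X :: "nat \<Rightarrow> nat \<Rightarrow> real"
    assume a: "0 \<le> e" "e \<le> e1" "real n * e ^ 4 \<le> e1"
      and n: "\<And>j. j < n \<Longrightarrow> \<bar>sqrt (\<Sum>i<d. (X i j)\<^sup>2) - 1\<bar> \<le> e"
      and i: "\<And>j k. j < n \<Longrightarrow> k < n \<Longrightarrow> j \<noteq> k \<Longrightarrow> \<bar>\<Sum>i<d. X i j * X i k\<bar> \<le> e"
      and o: "\<And>v. (\<Sum>i<d. (\<Sum>j<n. X i j * v j)\<^sup>2) \<le> B\<^sup>2 * (\<Sum>j<n. (v j)\<^sup>2)"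
    show "c * (\<Sum>j<n. (u j)\<^sup>2) \<le> (\<integral>w. (\<Sum>j<n. u j * \<sigma> (dotp d w (\<lambda>i. X i j)))\<^sup>2 \<partial>gauss d)"
      using a n i o by (rule main)
  qed
qed

subsection \<open>Sample covariance of heavy-tailed features\<close>

text \<open>The sample is left abstract: in the application the V i are the rows of the weight
  matrix, as functions on the product space of its entries.\<close>

locale iid_sample = prob_space M for M :: "'w measure" +
  fixes Q :: "'q measure" and V :: "nat \<Rightarrow> 'w \<Rightarrow> 'q" and m :: nat
  assumes Q: "prob_space Q" and indep: "indep_vars (\<lambda>_. Q) V {..<m}"
    and law: "\<And>i. i < m \<Longrightarrow> distr M Q (V i) = Q" and m_pos: "0 < m"
begin

lemma V_measurable: "i < m \<Longrightarrow> V i \<in> M \<rightarrow>\<^sub>M Q"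
  using indep by (auto simp: indep_vars_def)

lemma integral_V:
  fixes g :: "'q \<Rightarrow> real"
  assumes "g \<in> borel_measurable Q" "i < m"
  shows "(\<integral>\<omega>. g (V i \<omega>) \<partial>M) = (\<integral>w. g w \<partial>Q)"
  using integral_distr[OF V_measurable[OF assms(2)] assms(1)] law[OF assms(2)] by simp

lemma integrable_V:
  fixes g :: "'q \<Rightarrow> real"
  assumes "integrable Q g" "i < m"
  shows "integrable M (\<lambda>\<omega>. g (V i \<omega>))"
  using integrable_distr[OF V_measurable[OF assms(2)], of g] assms(1) law[OF assms(2)] by simp

text \<open>Products of two different centred terms have mean zero, so only m of the m^2 terms
  survive; the variance of each is bounded by the raw second moment.\<close>

lemma mean_square_deviation:
  fixes \<psi> :: "'q \<Rightarrow> real"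
  assumes meas: "\<psi> \<in> borel_measurable Q" and sq: "integrable Q (\<lambda>w. (\<psi> w)\<^sup>2)"
  shows "integrable M (\<lambda>\<omega>. ((\<Sum>i<m. \<psi> (V i \<omega>)) / m - (\<integral>w. \<psi> w \<partial>Q))\<^sup>2)"
    and "(\<integral>\<omega>. ((\<Sum>i<m. \<psi> (V i \<omega>)) / m - (\<integral>w. \<psi> w \<partial>Q))\<^sup>2 \<partial>M) \<le> (\<integral>w. (\<psi> w)\<^sup>2 \<partial>Q) / m"
proof -
  interpret Q: prob_space Q by (rule Q)
  note [measurable] = meas V_measurable
  have int: "integrable Q \<psi>" by (rule Q.square_integrable_imp_integrable[OF meas sq])
  define \<mu> where "\<mu> = (\<integral>w. \<psi> w \<partial>Q)"
  define Y where "Y i \<omega> = \<psi> (V i \<omega>) - \<mu>" for i \<omega>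
  have eq2: "(\<psi> w - \<mu>)\<^sup>2 = (\<psi> w)\<^sup>2 - 2 * \<mu> * \<psi> w + \<mu>\<^sup>2" for w
    by (simp add: power2_eq_square algebra_simps)
  have iq: "integrable Q (\<lambda>w. (\<psi> w - \<mu>)\<^sup>2)" unfolding eq2 using int sq by simp
  have iY: "integrable M (Y i)" "(\<integral>\<omega>. Y i \<omega> \<partial>M) = 0" if "i < m" for i
    unfolding Y_def using integrable_V[OF int that] integral_V[OF meas that] prob_space
    by (simp_all add: \<mu>_def)
  have iYY: "integrable M (\<lambda>\<omega>. (Y i \<omega>)\<^sup>2)" "(\<integral>\<omega>. (Y i \<omega>)\<^sup>2 \<partial>M) \<le> (\<integral>w. (\<psi> w)\<^sup>2 \<partial>Q)" if "i < m" for i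
  proof -
    show "integrable M (\<lambda>\<omega>. (Y i \<omega>)\<^sup>2)" unfolding Y_def by (rule integrable_V[OF iq that])
    have "(\<integral>\<omega>. (Y i \<omega>)\<^sup>2 \<partial>M) = (\<integral>w. (\<psi> w - \<mu>)\<^sup>2 \<partial>Q)"
      unfolding Y_def using that by (intro integral_V) auto
    also have "\<dots> = (\<integral>w. (\<psi> w)\<^sup>2 \<partial>Q) - \<mu>\<^sup>2"
      unfolding eq2 using int sq Q.prob_space by (simp add: \<mu>_def power2_eq_square)
    finally show "(\<integral>\<omega>. (Y i \<omega>)\<^sup>2 \<partial>M) \<le> (\<integral>w. (\<psi> w)\<^sup>2 \<partial>Q)" by simp
  qed
  have indY: "indep_vars (\<lambda>_. borel) Y {..<m}"
    unfolding Y_def by (rule indep_vars_compose2[OF indep]) measurable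
  have cross: "integrable M (\<lambda>\<omega>. Y i \<omega> * Y k \<omega>)" "(\<integral>\<omega>. Y i \<omega> * Y k \<omega> \<partial>M) = 0" if "i < m" "k < m" "i \<noteq> k" for i k
  proof -
    have "indep_vars (\<lambda>_. borel) Y {i, k}" using that by (intro indep_vars_subset[OF indY]) auto
    from indep_vars_integrable[OF _ this] indep_vars_lebesgue_integral[OF _ this]
    show "integrable M (\<lambda>\<omega>. Y i \<omega> * Y k \<omega>)" "(\<integral>\<omega>. Y i \<omega> * Y k \<omega> \<partial>M) = 0"
      using that iY by auto
  qed
  have all: "integrable M (\<lambda>\<omega>. Y i \<omega> * Y k \<omega>)" if "i < m" "k < m" for i k
    using cross(1)[OF that] iYY(1)[OF that(1)] by (cases "i = k") (auto simp: power2_eq_square)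
  have eq: "((\<Sum>i<m. \<psi> (V i \<omega>)) / m - (\<integral>w. \<psi> w \<partial>Q))\<^sup>2 = (\<Sum>i<m. \<Sum>k<m. Y i \<omega> * Y k \<omega>) / (real m)\<^sup>2" for \<omega>
  proof -
    have "(\<Sum>i<m. \<psi> (V i \<omega>)) / m - (\<integral>w. \<psi> w \<partial>Q) = (\<Sum>i<m. Y i \<omega>) / m"
      using m_pos by (simp add: Y_def \<mu>_def sum_subtractf diff_divide_distrib)
    then show ?thesis by (simp add: power_divide power2_eq_square[of "sum _ _"] sum_product)
  qed
  show "integrable M (\<lambda>\<omega>. ((\<Sum>i<m. \<psi> (V i \<omega>)) / m - (\<integral>w. \<psi> w \<partial>Q))\<^sup>2)"
    unfolding eq using all by (intro integrable_divide Bochner_Integration.integrable_sum) auto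
  have "(\<integral>\<omega>. ((\<Sum>i<m. \<psi> (V i \<omega>)) / m - (\<integral>w. \<psi> w \<partial>Q))\<^sup>2 \<partial>M) = (\<Sum>i<m. \<Sum>k<m. \<integral>\<omega>. Y i \<omega> * Y k \<omega> \<partial>M) / (real m)\<^sup>2"
  proof -
    have "(\<integral>\<omega>. (\<Sum>i<m. \<Sum>k<m. Y i \<omega> * Y k \<omega>) \<partial>M) = (\<Sum>i<m. \<Sum>k<m. \<integral>\<omega>. Y i \<omega> * Y k \<omega> \<partial>M)"
      using all by (subst Bochner_Integration.integral_sum, force, intro sum.cong refl,
          subst Bochner_Integration.integral_sum) auto
    then show ?thesis unfolding eq by simp
  qed
  also have "(\<Sum>i<m. \<Sum>k<m. \<integral>\<omega>. Y i \<omega> * Y k \<omega> \<partial>M) = (\<Sum>i<m. \<Sum>k<m. if k = i then (\<integral>\<omega>. (Y i \<omega>)\<^sup>2 \<partial>M) else 0)"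
    using cross(2) by (intro sum.cong) (auto simp: power2_eq_square)
  also have "\<dots> = (\<Sum>i<m. \<integral>\<omega>. (Y i \<omega>)\<^sup>2 \<partial>M)" by simp
  also have "\<dots> / (real m)\<^sup>2 \<le> (\<Sum>i<m. \<integral>w. (\<psi> w)\<^sup>2 \<partial>Q) / (real m)\<^sup>2"
    using iYY(2) by (intro divide_right_mono sum_mono) auto
  also have "\<dots> = (\<integral>w. (\<psi> w)\<^sup>2 \<partial>Q) / m" using m_pos by (simp add: power2_eq_square)
  finally show "(\<integral>\<omega>. ((\<Sum>i<m. \<psi> (V i \<omega>)) / m - (\<integral>w. \<psi> w \<partial>Q))\<^sup>2 \<partial>M) \<le> (\<integral>w. (\<psi> w)\<^sup>2 \<partial>Q) / m" .
qed

text \<open>Since Z is nonnegative, a second moment suffices for an exponential lower tail: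
  exp (- t Z) is at most 1 - t Z + (t Z)^2 / 2.\<close>

lemma lower_tail:
  fixes Z :: "'q \<Rightarrow> real"
  assumes [measurable]: "Z \<in> borel_measurable Q" and nn: "\<And>w. 0 \<le> Z w"
    and sq: "integrable Q (\<lambda>w. (Z w)\<^sup>2)" and mean: "a \<le> (\<integral>w. Z w \<partial>Q)" and b: "(\<integral>w. (Z w)\<^sup>2 \<partial>Q) \<le> b"
    and a: "0 < a" "0 < b"
  shows "prob {\<omega>\<in>space M. (\<Sum>i<m. Z (V i \<omega>)) \<le> real m * a / 4} \<le> exp (- (real m * a\<^sup>2 / (4 * b)))"
proof -
  interpret Q: prob_space Q by (rule Q)
  note [measurable] = V_measurable
  \<comment> \<open>The minimizer of 1 - t a + t^2 b / 2.\<close>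
  define t where "t = a / b"
  have t: "0 < t" using a by (simp add: t_def)
  have int: "integrable Q Z" by (rule Q.square_integrable_imp_integrable[OF _ sq]) simp
  have ie: "integrable Q (\<lambda>w. exp (- t * Z w))"
    by (rule Q.integrable_const_bound[where B = 1]) (use nn t in auto)
  have one: "(\<integral>w. exp (- t * Z w) \<partial>Q) \<le> exp (- (a\<^sup>2 / (2 * b)))"
  proof -
    have taylor: "exp (- y) \<le> 1 - y + y\<^sup>2 / 2" if "0 \<le> y" for y :: real
    proof -
      obtain s where s: "exp (- y) = (\<Sum>k<3. (- y) ^ k / fact k) + exp s / fact 3 * (- y) ^ 3"
        using Maclaurin_exp_le[of "- y" 3] by blast
      have "exp s / fact 3 * (- y) ^ 3 \<le> 0"
        using that by (intro mult_nonneg_nonpos) auto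
      with s show ?thesis by (simp add: numeral_3_eq_3 power2_eq_square)
    qed
    have "(\<integral>w. exp (- t * Z w) \<partial>Q) \<le> (\<integral>w. 1 - t * Z w + t\<^sup>2 / 2 * (Z w)\<^sup>2 \<partial>Q)"
      using taylor[of "t * Z _"] nn t ie int sq by (intro integral_mono) (auto simp: power_mult_distrib)
    also have "\<dots> = 1 - t * (\<integral>w. Z w \<partial>Q) + t\<^sup>2 / 2 * (\<integral>w. (Z w)\<^sup>2 \<partial>Q)"
      using int sq Q.prob_space by simp
    also have "\<dots> \<le> 1 - t * a + t\<^sup>2 / 2 * b"
      using mean b t by (intro add_mono diff_mono mult_left_mono) auto
    also have "\<dots> = 1 + (- (a\<^sup>2 / (2 * b)))"
      using a by (simp add: t_def power2_eq_square field_simps)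
    also have "\<dots> \<le> exp (- (a\<^sup>2 / (2 * b)))" by (rule exp_ge_add_one_self)
    finally show ?thesis .
  qed
  have ind: "indep_vars (\<lambda>_. borel) (\<lambda>i \<omega>. exp (- t * Z (V i \<omega>))) {..<m}"
    by (rule indep_vars_compose2[OF indep]) measurable
  have prod: "(\<Prod>i<m. exp (- t * Z (V i \<omega>))) = exp (- t * (\<Sum>i<m. Z (V i \<omega>)))" for \<omega>
    by (simp add: exp_sum[symmetric] sum_distrib_left)
  have ii: "integrable M (\<lambda>\<omega>. exp (- t * Z (V i \<omega>)))" if "i < m" for i
    by (rule integrable_V[OF ie that])
  have iE: "integrable M (\<lambda>\<omega>. exp (- t * (\<Sum>i<m. Z (V i \<omega>))))"
    using indep_vars_integrable[OF finite_lessThan ind ii] by (simp only: prod lessThan_iff)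
  have "(\<integral>\<omega>. exp (- t * (\<Sum>i<m. Z (V i \<omega>))) \<partial>M) = (\<Prod>i<m. \<integral>\<omega>. exp (- t * Z (V i \<omega>)) \<partial>M)"
    using indep_vars_lebesgue_integral[OF finite_lessThan ind ii] by (simp only: prod lessThan_iff)
  also have "\<dots> = (\<Prod>i<m. \<integral>w. exp (- t * Z w) \<partial>Q)"
    by (intro prod.cong refl integral_V) auto
  also have "\<dots> \<le> (\<Prod>i<m. exp (- (a\<^sup>2 / (2 * b))))"
    using one by (intro prod_mono) auto
  also have "\<dots> = exp (- (real m * (a\<^sup>2 / (2 * b))))" by (simp add: exp_of_nat_mult[symmetric])
  finally have E: "(\<integral>\<omega>. exp (- t * (\<Sum>i<m. Z (V i \<omega>))) \<partial>M) \<le> exp (- (real m * (a\<^sup>2 / (2 * b))))" .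
  have "prob {\<omega>\<in>space M. (\<Sum>i<m. Z (V i \<omega>)) \<le> real m * a / 4}
      = prob {\<omega>\<in>space M. exp (- t * (real m * a / 4)) \<le> exp (- t * (\<Sum>i<m. Z (V i \<omega>)))}"
    using t by simp
  \<comment> \<open>Markov's inequality at the threshold m a / 4 gives up half of the exponent m a^2
    / (2 b).\<close>
  also have "\<dots> \<le> (\<integral>\<omega>. exp (- t * (\<Sum>i<m. Z (V i \<omega>))) \<partial>M) / exp (- t * (real m * a / 4))"
    by (rule integral_Markov_inequality_measure[where A = "{}", simplified]) (use iE in auto)
  also have "\<dots> \<le> exp (- (real m * (a\<^sup>2 / (2 * b)))) / exp (- t * (real m * a / 4))"
    by (rule divide_right_mono[OF E]) simp
  also have "\<dots> = exp (- (real m * a\<^sup>2 / (4 * b)))"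
    using a by (simp add: t_def power2_eq_square field_simps flip: exp_diff)
  finally show ?thesis .
qed

end

text \<open>Rounding one coordinate at a time, in the direction in which the first-order term of the form is
  not positive, costs only h^2 times the diagonal, so no bound on the operator norm is needed.\<close>

lemma quadratic_form_rounding:
  fixes A :: "nat \<Rightarrow> nat \<Rightarrow> real" and u :: "nat \<Rightarrow> real"
  assumes h: "0 < h"
  shows "\<exists>z :: nat \<Rightarrow> int. (\<forall>j<n. \<bar>h * z j - u j\<bar> \<le> h) \<and>
    (\<Sum>i<m. (\<Sum>j<n. A i j * (h * z j))\<^sup>2) \<le> (\<Sum>i<m. (\<Sum>j<n. A i j * u j)\<^sup>2) + h\<^sup>2 * (\<Sum>j<n. \<Sum>i<m. (A i j)\<^sup>2)"
proof -
  let ?q = "\<lambda>v. \<Sum>i<m. (\<Sum>j<n. A i j * v j)\<^sup>2"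
  have "\<exists>v :: nat \<Rightarrow> real. (\<forall>j<k. \<bar>v j - u j\<bar> \<le> h \<and> (\<exists>z :: int. v j = h * z)) \<and> (\<forall>j\<ge>k. v j = u j) \<and>
      ?q v \<le> ?q u + h\<^sup>2 * (\<Sum>j<k. \<Sum>i<m. (A i j)\<^sup>2)" if "k \<le> n" for k
    using that
  proof (induction k)
    case 0
    show ?case by (rule exI[of _ u]) simp
  next
    case (Suc k)
    then obtain v where v: "\<And>j. j < k \<Longrightarrow> \<bar>v j - u j\<bar> \<le> h \<and> (\<exists>z :: int. v j = h * z)" "\<And>j. k \<le> j \<Longrightarrow> v j = u j"
      "?q v \<le> ?q u + h\<^sup>2 * (\<Sum>j<k. \<Sum>i<m. (A i j)\<^sup>2)" by auto
    \<comment> \<open>Along coordinate k the form is quadratic with leading coefficient \<alpha> and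
      derivative 2 \<beta> at v.\<close>
    define \<alpha> \<beta> where "\<alpha> = (\<Sum>i<m. (A i k)\<^sup>2)" and "\<beta> = (\<Sum>i<m. A i k * (\<Sum>j<n. A i j * v j))"
    have \<alpha>: "0 \<le> \<alpha>" unfolding \<alpha>_def by (rule sum_nonneg) simp
    have lin: "(\<Sum>j<n. A i j * (v(k := u k + s)) j) = (\<Sum>j<n. A i j * v j) + A i k * s" for i s
    proof -
      have "(\<Sum>j<n. A i j * (v(k := u k + s)) j) = (\<Sum>j<n. A i j * v j + (if j = k then A i k * s else 0))"
        using v(2)[of k] by (intro sum.cong) (auto simp: algebra_simps)
      then show ?thesis using Suc.prems by (simp add: sum.distrib)
    qed
    have quad: "?q (v(k := u k + s)) = ?q v + 2 * s * \<beta> + s\<^sup>2 * \<alpha>" for s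
    proof -
      have "(x + a * s)\<^sup>2 = x\<^sup>2 + 2 * s * (a * x) + s\<^sup>2 * a\<^sup>2" for x a :: real
        by (simp add: power2_eq_square algebra_simps)
      then show ?thesis
        unfolding lin by (simp only: \<alpha>_def \<beta>_def sum.distrib sum_distrib_left[of "2 * s"] sum_distrib_left[of "s\<^sup>2"])
    qed
    define l where "l = of_int \<lfloor>u k / h\<rfloor> * h"
    have l: "l \<le> u k" "u k \<le> l + h"
    proof -
      have "of_int \<lfloor>u k / h\<rfloor> * h \<le> u k / h * h" using h by (intro mult_right_mono) auto
      then show "l \<le> u k" using h by (simp add: l_def)
      have "u k / h * h \<le> (of_int \<lfloor>u k / h\<rfloor> + 1) * h" using h by (intro mult_right_mono) auto
      then show "u k \<le> l + h" using h by (simp add: l_def algebra_simps)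
    qed
    obtain s where s: "s * \<beta> \<le> 0" "\<bar>s\<bar> \<le> h" "\<exists>z :: int. u k + s = h * z"
    proof (cases "0 \<le> \<beta>")
      case True
      show ?thesis
      proof (rule that[of "l - u k"])
        show "(l - u k) * \<beta> \<le> 0" using True l by (intro mult_nonpos_nonneg) auto
        show "\<exists>z :: int. u k + (l - u k) = h * z" by (rule exI[of _ "\<lfloor>u k / h\<rfloor>"]) (simp add: l_def)
      qed (use l in auto)
    next
      case False
      show ?thesis
      proof (rule that[of "l + h - u k"])
        show "(l + h - u k) * \<beta> \<le> 0" using False l by (intro mult_nonneg_nonpos) auto
        show "\<exists>z :: int. u k + (l + h - u k) = h * z"
          by (rule exI[of _ "\<lfloor>u k / h\<rfloor> + 1"]) (simp add: l_def algebra_simps)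
      qed (use l in auto)
    qed
    have "s\<^sup>2 \<le> h\<^sup>2" using s(2) h by (simp add: abs_le_square_iff[symmetric])
    then have "s\<^sup>2 * \<alpha> \<le> h\<^sup>2 * \<alpha>" using \<alpha> by (rule mult_right_mono)
    then have "?q (v(k := u k + s)) \<le> ?q u + h\<^sup>2 * (\<Sum>j<Suc k. \<Sum>i<m. (A i j)\<^sup>2)"
      using quad[of s] s(1) v(3) by (simp add: \<alpha>_def[symmetric] algebra_simps)
    then show ?case
      using v(1,2) s(2,3) by (intro exI[of _ "v(k := u k + s)"]) (auto simp: less_Suc_eq)
  qed
  from this[of n] obtain v where v: "\<forall>j<n. \<bar>v j - u j\<bar> \<le> h \<and> (\<exists>z :: int. v j = h * z)"
      "?q v \<le> ?q u + h\<^sup>2 * (\<Sum>j<n. \<Sum>i<m. (A i j)\<^sup>2)" by auto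
  then obtain z :: "nat \<Rightarrow> int" where z: "\<And>j. j < n \<Longrightarrow> v j = h * z j" by metis
  have "?q v = ?q (\<lambda>j. h * z j)"
    using z by (intro sum.cong arg_cong[where f = "\<lambda>x. x\<^sup>2"]) auto
  with v z show ?thesis by (intro exI[of _ z]) auto
qed

text \<open>Extensional functions into a box form a finite set; the l1 constraint keeps the
  cardinality exponential in n when N is a fixed multiple of n, which is what the union bound can
  afford.\<close>

definition lattice_points :: "nat \<Rightarrow> nat \<Rightarrow> (nat \<Rightarrow> int) set" where
  "lattice_points n N = {z \<in> {..<n} \<rightarrow>\<^sub>E {- int N..int N}. (\<Sum>j<n. \<bar>z j\<bar>) \<le> int N}"

lemma finite_lattice_points: "finite (lattice_points n N)"
  unfolding lattice_points_def by (rule finite_subset[where B = "{..<n} \<rightarrow>\<^sub>E {- int N..int N}"]) (blast, rule finite_PiE, auto)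

text \<open>The sum of 2^(-|z_j|) over all integers is 3, so the weight 2^(-|z|_1) has total mass at most
  4^n while it is at least 2^(-N) on each point counted.\<close>

lemma card_lattice_points: "real (card (lattice_points n N)) \<le> 4 ^ n * 2 ^ N"
proof -
  let ?I = "{- int N..int N}"
  have half: "(\<Sum>z\<in>?I. (1 / 2) ^ nat \<bar>z\<bar>) \<le> (4 :: real)"
  proof -
    have "?I = int ` {..N} \<union> (\<lambda>k. - int k) ` {..N}"
    proof -
      have "z \<in> int ` {..N} \<union> (\<lambda>k. - int k) ` {..N}" if "z \<in> ?I" for z
        using that by (cases "0 \<le> z") (auto intro!: image_eqI[of z int "nat z"] image_eqI[of z "\<lambda>k. - int k" "nat (- z)"])
      then show ?thesis by (intro equalityI subsetI) auto
    qed
    then have "(\<Sum>z\<in>?I. (1 / 2 :: real) ^ nat \<bar>z\<bar>)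
        \<le> (\<Sum>z\<in>int ` {..N}. (1 / 2) ^ nat \<bar>z\<bar>) + (\<Sum>z\<in>(\<lambda>k. - int k) ` {..N}. (1 / 2) ^ nat \<bar>z\<bar>)"
      by (simp add: sum_Un sum_nonneg)
    also have "\<dots> = 2 * (\<Sum>k\<le>N. (1 / 2) ^ k)"
      by (subst (1 2) sum.reindex) (auto simp: inj_on_def)
    also have "\<dots> \<le> 2 * 2"
    proof -
      have "(\<Sum>k<Suc N. (1 / 2 :: real) ^ k) \<le> 2"
        by (subst geometric_sum) (auto simp: field_simps)
      then show ?thesis by (simp only: lessThan_Suc_atMost mult_left_mono)
    qed
    finally show ?thesis by simp
  qed
  have "real (card (lattice_points n N)) = (\<Sum>z\<in>lattice_points n N. 1)" by simp
  also have "\<dots> \<le> (\<Sum>z\<in>lattice_points n N. 2 ^ N * (\<Prod>j<n. (1 / 2 :: real) ^ nat \<bar>z j\<bar>))"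
  proof (rule sum_mono)
    fix z assume "z \<in> lattice_points n N"
    then have "(\<Sum>j<n. \<bar>z j\<bar>) \<le> int N" by (simp add: lattice_points_def)
    moreover have "int (\<Sum>j<n. nat \<bar>z j\<bar>) = (\<Sum>j<n. \<bar>z j\<bar>)" by (simp only: of_nat_sum) simp
    ultimately have "(\<Sum>j<n. nat \<bar>z j\<bar>) \<le> N" by linarith
    then have "(1 / 2 :: real) ^ N \<le> (1 / 2) ^ (\<Sum>j<n. nat \<bar>z j\<bar>)"
      by (intro power_decreasing) auto
    then have "2 ^ N * (1 / 2 :: real) ^ N \<le> 2 ^ N * (1 / 2) ^ (\<Sum>j<n. nat \<bar>z j\<bar>)"
      by (intro mult_left_mono) auto
    then show "1 \<le> 2 ^ N * (\<Prod>j<n. (1 / 2 :: real) ^ nat \<bar>z j\<bar>)"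
      by (simp add: power_sum power_one_over)
  qed
  also have "\<dots> \<le> (\<Sum>z\<in>{..<n} \<rightarrow>\<^sub>E ?I. 2 ^ N * (\<Prod>j<n. (1 / 2 :: real) ^ nat \<bar>z j\<bar>))"
  proof (rule sum_mono2)
    show "finite ({..<n} \<rightarrow>\<^sub>E ?I)" by (rule finite_PiE) auto
    show "lattice_points n N \<subseteq> {..<n} \<rightarrow>\<^sub>E ?I" unfolding lattice_points_def by blast
    show "0 \<le> 2 ^ N * (\<Prod>j<n. (1 / 2 :: real) ^ nat \<bar>z j\<bar>)" for z :: "nat \<Rightarrow> int"
      by (simp add: prod_nonneg)
  qed
  also have "\<dots> = 2 ^ N * (\<Prod>j<n. \<Sum>z\<in>?I. (1 / 2) ^ nat \<bar>z\<bar>)"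
    by (subst prod_sum_PiE) (auto simp: sum_distrib_left)
  also have "\<dots> \<le> 2 ^ N * (\<Prod>j<n. 4)"
    using half by (intro mult_left_mono prod_mono) (auto intro: sum_nonneg)
  finally show ?thesis by (simp add: mult.commute)
qed

text \<open>The mesh 1 / (k sqrt n) is tuned to a unit vector: rounding moves it by at most 1 / k
  \<le> 1 / 2 in norm and raises the form by at most m T / k^2 \<le> m c / 32. A unit vector with
  form below m c / 32 would thus round to a lattice point of squared norm at least 1 / 4 with form
  below m c / 16, against \<open>lattice\<close>. Homogeneity gives the other vectors.\<close>

lemma form_lower_bound_from_lattice:
  fixes A :: "nat \<Rightarrow> nat \<Rightarrow> real"
  assumes n: "0 < n" and k: "2 \<le> k" and c: "0 < c" "T / (real k)\<^sup>2 \<le> c / 32"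
    and trace: "(\<Sum>j<n. \<Sum>i<m. (A i j)\<^sup>2) \<le> real m * real n * T"
    and lattice: "\<And>z. z \<in> lattice_points n (n * (k + 1)) \<Longrightarrow> 1 / 4 \<le> (\<Sum>j<n. (z j / (k * sqrt n))\<^sup>2) \<Longrightarrow>
      real m * (c * (\<Sum>j<n. (z j / (k * sqrt n))\<^sup>2)) / 4 \<le> (\<Sum>i<m. (\<Sum>j<n. A i j * (z j / (k * sqrt n)))\<^sup>2)"
  shows "real m * (c / 32 * (\<Sum>j<n. (u j)\<^sup>2)) \<le> (\<Sum>i<m. (\<Sum>j<n. A i j * u j)\<^sup>2)"
proof -
  define h where "h = 1 / (k * sqrt n)"
  have h: "0 < h" using n k by (simp add: h_def)
  have nh: "real n * h\<^sup>2 = 1 / (real k)\<^sup>2" using n k by (simp add: h_def power_divide power_mult_distrib)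
  have unit: "real m * (c / 32) \<le> (\<Sum>i<m. (\<Sum>j<n. A i j * u j)\<^sup>2)" if u: "(\<Sum>j<n. (u j)\<^sup>2) = 1" for u
  proof (rule ccontr)
    assume "\<not> ?thesis"
    then have small: "(\<Sum>i<m. (\<Sum>j<n. A i j * u j)\<^sup>2) < real m * (c / 32)" by simp
    obtain z :: "nat \<Rightarrow> int" where z: "\<And>j. j < n \<Longrightarrow> \<bar>h * z j - u j\<bar> \<le> h"
      "(\<Sum>i<m. (\<Sum>j<n. A i j * (h * z j))\<^sup>2) \<le> (\<Sum>i<m. (\<Sum>j<n. A i j * u j)\<^sup>2) + h\<^sup>2 * (\<Sum>j<n. \<Sum>i<m. (A i j)\<^sup>2)"
      using quadratic_form_rounding[OF h, where n = n and u = u and m = m and A = A] by blast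
    \<comment> \<open>Restriction makes the point extensional, as membership in
      \<open>lattice_points\<close> demands; the sums see only j < n.\<close>
    define z' where "z' = restrict z {..<n}"
    have z': "h * z' j = z' j / (k * sqrt n)" "j < n \<Longrightarrow> z' j = z j" for j by (simp_all add: h_def z'_def)
    define v where "v j = h * z' j" for j
    have Qv: "(\<Sum>i<m. (\<Sum>j<n. A i j * v j)\<^sup>2) < real m * (c / 16)"
    proof -
      have "h\<^sup>2 * (\<Sum>j<n. \<Sum>i<m. (A i j)\<^sup>2) \<le> h\<^sup>2 * (real m * real n * T)"
        by (intro mult_left_mono trace) simp
      also have "\<dots> = real m * T * (real n * h\<^sup>2)" by (simp only: mult_ac)
      also have "\<dots> = real m * (T / (real k)\<^sup>2)" unfolding nh by simp
      also have "\<dots> \<le> real m * (c / 32)" by (intro mult_left_mono c) simp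
      finally have "(\<Sum>i<m. (\<Sum>j<n. A i j * (h * z j))\<^sup>2) < real m * (c / 32) + real m * (c / 32)"
        using z(2) small by linarith
      moreover have "(\<Sum>i<m. (\<Sum>j<n. A i j * (h * z j))\<^sup>2) = (\<Sum>i<m. (\<Sum>j<n. A i j * v j)\<^sup>2)"
        by (intro sum.cong arg_cong[where f = "\<lambda>x. x\<^sup>2"]) (auto simp: v_def z')
      ultimately show ?thesis by (simp add: mult.commute)
    qed
    have norm: "1 / 4 \<le> (\<Sum>j<n. (v j)\<^sup>2)"
    proof -
      have "1 \<le> (\<Sum>j<n. 2 * (v j)\<^sup>2 + 2 * h\<^sup>2)"
        unfolding u[symmetric]
      proof (rule sum_mono)
        fix j assume "j \<in> {..<n}"
        then have "\<bar>v j - u j\<bar> \<le> h" using z(1)[of j] by (simp add: v_def z')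
        then have "(v j - u j)\<^sup>2 \<le> h\<^sup>2" using h by (simp add: abs_le_square_iff[symmetric])
        moreover have "(u j)\<^sup>2 \<le> 2 * (v j)\<^sup>2 + 2 * (v j - u j)\<^sup>2"
          using zero_le_power2[of "2 * v j - u j"] by (simp add: power2_eq_square algebra_simps)
        ultimately show "(u j)\<^sup>2 \<le> 2 * (v j)\<^sup>2 + 2 * h\<^sup>2" by linarith
      qed
      also have "\<dots> = 2 * (\<Sum>j<n. (v j)\<^sup>2) + 2 / (real k)\<^sup>2"
        using nh by (simp add: sum.distrib sum_distrib_left[symmetric])
      also have "2 / (real k)\<^sup>2 \<le> 2 / 2\<^sup>2"
        using k by (intro divide_left_mono power_mono) auto
      finally show ?thesis by simp
    qed
    have zL: "z' \<in> lattice_points n (n * (k + 1))"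
    proof -
      \<comment> \<open>A unit vector has l1 norm at most sqrt n; after division by h and with an
        error of 1 per coordinate this becomes n (k + 1).\<close>
      have "(\<Sum>j<n. 1 * \<bar>u j\<bar>)\<^sup>2 \<le> (\<Sum>j<n. 1\<^sup>2) * (\<Sum>j<n. \<bar>u j\<bar>\<^sup>2)" by (rule sum_square_le)
      then have "(\<Sum>j<n. \<bar>u j\<bar>) \<le> sqrt n" using u by (intro real_le_rsqrt) simp
      moreover have "h * (\<Sum>j<n. \<bar>real_of_int (z j)\<bar>) \<le> (\<Sum>j<n. \<bar>u j\<bar> + h)"
        unfolding sum_distrib_left
      proof (rule sum_mono)
        fix j assume "j \<in> {..<n}"
        then show "h * \<bar>real_of_int (z j)\<bar> \<le> \<bar>u j\<bar> + h"
          using z(1)[of j] h abs_mult[of h "real_of_int (z j)"] unfolding lessThan_iff by linarith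
      qed
      ultimately have "h * (\<Sum>j<n. \<bar>real_of_int (z j)\<bar>) \<le> sqrt n + n * h" by (simp add: sum.distrib)
      also have "\<dots> = h * (n * (k + 1))"
      proof -
        have "sqrt n = h * (n * k)" using real_div_sqrt[of "real n"] k by (simp add: h_def)
        then show ?thesis by (simp add: algebra_simps)
      qed
      finally have "(\<Sum>j<n. \<bar>real_of_int (z j)\<bar>) \<le> real (n * (k + 1))"
        using h by simp
      then have "real_of_int (\<Sum>j<n. \<bar>z j\<bar>) \<le> real_of_int (int (n * (k + 1)))" by simp
      then have le: "(\<Sum>j<n. \<bar>z j\<bar>) \<le> int (n * (k + 1))" by (simp only: of_int_le_iff)
      have "z j \<in> {- int (n * (k + 1))..int (n * (k + 1))}" if "j < n" for j
        using member_le_sum[of j "{..<n}" "\<lambda>j. \<bar>z j\<bar>"] that le unfolding atLeastAtMost_iff by auto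
      then show ?thesis
        using le unfolding lattice_points_def z'_def
        by (intro CollectI conjI PiE_I) (auto simp del: of_nat_mult of_nat_add atLeastAtMost_iff)
    qed
    have "real m * (c * (\<Sum>j<n. (v j)\<^sup>2)) / 4 \<le> (\<Sum>i<m. (\<Sum>j<n. A i j * v j)\<^sup>2)"
      using lattice[OF zL] norm by (simp add: v_def z'(1))
    moreover have "real m * c * (1 / 4) \<le> real m * c * (\<Sum>j<n. (v j)\<^sup>2)"
      using norm c by (intro mult_left_mono) auto
    ultimately show False using Qv by (simp add: algebra_simps)
  qed
  define S where "S = (\<Sum>j<n. (u j)\<^sup>2)"
  show ?thesis
  proof (cases "S = 0")
    case False
    then have S: "0 < S" unfolding S_def by (simp add: order_less_le sum_nonneg)
    have "(\<Sum>j<n. (u j / sqrt S)\<^sup>2) = 1"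
      using S by (simp add: power_divide S_def[symmetric] sum_divide_distrib[symmetric])
    note u1 = unit[OF this]
    have "real m * (c / 32) \<le> (\<Sum>i<m. (\<Sum>j<n. A i j * u j)\<^sup>2) / S"
    proof -
      have "(\<Sum>j<n. A i j * (u j / sqrt S)) = (\<Sum>j<n. A i j * u j) / sqrt S" for i
        by (simp add: sum_divide_distrib)
      then have "(\<Sum>j<n. A i j * (u j / sqrt S))\<^sup>2 = (\<Sum>j<n. A i j * u j)\<^sup>2 / S" for i
        using S by (simp only: power_divide) simp
      then show ?thesis using u1 by (simp only: sum_divide_distrib)
    qed
    then have "real m * (c / 32) * S \<le> (\<Sum>i<m. (\<Sum>j<n. A i j * u j)\<^sup>2)"
      using S by (simp only: pos_le_divide_eq)
    then show ?thesis by (simp add: S_def mult_ac)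
  qed (auto simp: S_def intro: sum_nonneg)
qed

context iid_sample
begin

text \<open>The event excludes a large trace, by Chebyshev for the mean squared feature, and a small
  form at some lattice point, by \<open>lower_tail\<close> and a union bound. The count, exponential
  in n, is harmless against exp (- m c^2 / (4 C)) once m exceeds a large multiple of n.\<close>

lemma good_event:
  fixes \<phi> :: "'q \<Rightarrow> nat \<Rightarrow> real"
  assumes meas: "\<And>j. j < n \<Longrightarrow> (\<lambda>w. \<phi> w j) \<in> borel_measurable Q"
    and i4: "\<And>u. integrable Q (\<lambda>w. (\<Sum>j<n. u j * \<phi> w j) ^ 4)"
    and m4: "\<And>u. (\<integral>w. (\<Sum>j<n. u j * \<phi> w j) ^ 4 \<partial>Q) \<le> C * (\<Sum>j<n. (u j)\<^sup>2)\<^sup>2"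
    and lb: "\<And>u. c * (\<Sum>j<n. (u j)\<^sup>2) \<le> (\<integral>w. (\<Sum>j<n. u j * \<phi> w j)\<^sup>2 \<partial>Q)"
    and pos: "0 < c" "0 < C" "0 < n" and k: "2 \<le> k" "((1 + C) / 2 + 1) / (real k)\<^sup>2 \<le> c / 32"
  obtains G where "G \<in> sets M" "prob (space M - G) \<le> C / m + (4 * 2 ^ (k + 1)) ^ n * exp (- (real m * c\<^sup>2 / (4 * C)))"
    "\<And>\<omega> u. \<omega> \<in> G \<Longrightarrow> real m * (c / 32 * (\<Sum>j<n. (u j)\<^sup>2)) \<le> (\<Sum>i<m. (\<Sum>j<n. \<phi> (V i \<omega>) j * u j)\<^sup>2)"
proof -
  interpret Q: prob_space Q by (rule Q)
  note [measurable] = V_measurable meas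
  have single: "integrable Q (\<lambda>w. \<phi> w j ^ 4)" "(\<integral>w. \<phi> w j ^ 4 \<partial>Q) \<le> C" if "j < n" for j
  proof -
    have "(\<Sum>l<n. (if l = j then 1 else 0) * \<phi> w l) = \<phi> w j" for w
      using that by (simp add: if_distrib[where f = "\<lambda>x. x * _"] cong: if_cong)
    moreover have "(\<Sum>l<n. (if l = j then 1 else 0 :: real)\<^sup>2) = 1"
      using that by (simp add: if_distrib[where f = "\<lambda>x. x\<^sup>2"] cong: if_cong)
    ultimately show "integrable Q (\<lambda>w. \<phi> w j ^ 4)" "(\<integral>w. \<phi> w j ^ 4 \<partial>Q) \<le> C"
      using i4[of "\<lambda>l. if l = j then 1 else 0"] m4[of "\<lambda>l. if l = j then 1 else 0"] by simp_all
  qed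
  \<comment> \<open>(1 + C) / 2 bounds the mean of \<open>\<psi>\<close> through y \<le> (1 + y^2) /
    2, and 1 is the deviation allowed in \<open>B1\<close>.\<close>
  define T where "T = (1 + C) / 2 + 1"
  define \<psi> where "\<psi> w = (\<Sum>j<n. (\<phi> w j)\<^sup>2) / n" for w
  have [measurable]: "\<psi> \<in> borel_measurable Q" unfolding \<psi>_def[abs_def] by measurable
  have \<psi>2: "(\<psi> w)\<^sup>2 \<le> (\<Sum>j<n. \<phi> w j ^ 4) / n" for w
  proof -
    have "(\<Sum>j<n. 1 * (\<phi> w j)\<^sup>2)\<^sup>2 \<le> (\<Sum>j<n. 1\<^sup>2) * (\<Sum>j<n. ((\<phi> w j)\<^sup>2)\<^sup>2)" by (rule sum_square_le)
    then have "(\<Sum>j<n. (\<phi> w j)\<^sup>2)\<^sup>2 \<le> real n * (\<Sum>j<n. \<phi> w j ^ 4)" by simp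
    then show ?thesis
      using pos(3) by (simp add: \<psi>_def power_divide divide_simps power2_eq_square mult_ac)
  qed
  have i\<psi>2: "integrable Q (\<lambda>w. (\<psi> w)\<^sup>2)"
  proof (rule Bochner_Integration.integrable_bound)
    show "integrable Q (\<lambda>w. (\<Sum>j<n. \<phi> w j ^ 4) / n)"
      using single(1) by (intro integrable_divide Bochner_Integration.integrable_sum) auto
    show "AE w in Q. norm ((\<psi> w)\<^sup>2) \<le> norm ((\<Sum>j<n. \<phi> w j ^ 4) / n)"
      using order.trans[OF \<psi>2 abs_ge_self] by (intro AE_I2) simp
  qed measurable
  have i\<psi>: "integrable Q \<psi>" by (rule Q.square_integrable_imp_integrable[OF _ i\<psi>2]) simp
  have sumC: "(\<Sum>j<n. \<integral>w. \<phi> w j ^ 4 \<partial>Q) / n \<le> C"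
  proof -
    have "(\<Sum>j<n. \<integral>w. \<phi> w j ^ 4 \<partial>Q) \<le> (\<Sum>j<n. C)" using single(2) by (intro sum_mono) auto
    then show ?thesis using pos(3) by (simp add: divide_simps mult_ac)
  qed
  have int4: "(\<integral>w. (\<Sum>j<n. \<phi> w j ^ 4) / n \<partial>Q) = (\<Sum>j<n. \<integral>w. \<phi> w j ^ 4 \<partial>Q) / n"
    using single(1) by (subst integral_divide_zero, subst Bochner_Integration.integral_sum) auto
  have i4s: "integrable Q (\<lambda>w. (\<Sum>j<n. \<phi> w j ^ 4) / n)"
    using single(1) by (intro integrable_divide Bochner_Integration.integrable_sum) auto
  have E\<psi>2: "(\<integral>w. (\<psi> w)\<^sup>2 \<partial>Q) \<le> C"
    using integral_mono[OF i\<psi>2 i4s \<psi>2] unfolding int4 using sumC by linarith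
  have E\<psi>: "(\<integral>w. \<psi> w \<partial>Q) \<le> T - 1"
  proof -
    have "(\<integral>w. \<psi> w \<partial>Q) \<le> (\<integral>w. (1 + (\<psi> w)\<^sup>2) / 2 \<partial>Q)"
    proof (rule integral_mono)
      fix w
      show "\<psi> w \<le> (1 + (\<psi> w)\<^sup>2) / 2"
        using zero_le_power2[of "\<psi> w - 1"] by (simp add: power2_diff)
    qed (use i\<psi> i\<psi>2 in auto)
    also have "\<dots> = (1 + (\<integral>w. (\<psi> w)\<^sup>2 \<partial>Q)) / 2" using i\<psi>2 Q.prob_space by simp
    finally show ?thesis using E\<psi>2 by (simp add: T_def)
  qed
  define v :: "(nat \<Rightarrow> int) \<Rightarrow> nat \<Rightarrow> real" where "v z j = z j / (k * sqrt n)" for z j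
  define sq where "sq z = (\<Sum>j<n. (v z j)\<^sup>2)" for z
  define Z where "Z z w = (\<Sum>j<n. \<phi> w j * v z j)\<^sup>2" for z w
  define L where "L = {z \<in> lattice_points n (n * (k + 1)). 1 / 4 \<le> sq z}"
  have finL: "finite L" unfolding L_def using finite_lattice_points by simp
  have [measurable]: "Z z \<in> borel_measurable Q" for z unfolding Z_def[abs_def] by measurable
  define B1 where "B1 = {\<omega>\<in>space M. 1 \<le> ((\<Sum>i<m. \<psi> (V i \<omega>)) / m - (\<integral>w. \<psi> w \<partial>Q))\<^sup>2}"
  define B2 where "B2 z = {\<omega>\<in>space M. (\<Sum>i<m. Z z (V i \<omega>)) \<le> real m * (c * sq z) / 4}" for z
  have [measurable]: "B1 \<in> sets M" "B2 z \<in> sets M" for z unfolding B1_def B2_def by measurable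
  have PB1: "prob B1 \<le> C / m"
  proof -
    have "prob B1 \<le> (\<integral>\<omega>. ((\<Sum>i<m. \<psi> (V i \<omega>)) / m - (\<integral>w. \<psi> w \<partial>Q))\<^sup>2 \<partial>M) / 1"
      unfolding B1_def
      by (rule integral_Markov_inequality_measure[where A = "{}"]) (use mean_square_deviation(1)[OF _ i\<psi>2] in auto)
    also have "\<dots> \<le> (\<integral>w. (\<psi> w)\<^sup>2 \<partial>Q) / m" using mean_square_deviation(2)[OF _ i\<psi>2] by simp
    also have "\<dots> \<le> C / m" by (rule divide_right_mono[OF E\<psi>2]) simp
    finally show ?thesis .
  qed
  have PB2: "prob (B2 z) \<le> exp (- (real m * c\<^sup>2 / (4 * C)))" if "z \<in> L" for z
  proof -
    have s: "0 < sq z" using that by (simp add: L_def)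
    have eq: "(\<Sum>j<n. \<phi> w j * v z j) = (\<Sum>j<n. v z j * \<phi> w j)" for w by (simp add: mult.commute)
    have Z2: "(Z z w)\<^sup>2 = (\<Sum>j<n. v z j * \<phi> w j) ^ 4" for w by (simp add: Z_def eq flip: power_mult)
    \<comment> \<open>The bound on the mean scales with \<open>sq z\<close> and that on the second
      moment with its square, so the exponent is the same for every lattice point.\<close>
    have "prob (B2 z) \<le> exp (- (real m * (c * sq z)\<^sup>2 / (4 * (C * (sq z)\<^sup>2))))"
      unfolding B2_def
    proof (rule lower_tail)
      show "c * sq z \<le> (\<integral>w. Z z w \<partial>Q)" using lb[of "v z"] by (simp add: Z_def eq sq_def)
      show "(\<integral>w. (Z z w)\<^sup>2 \<partial>Q) \<le> C * (sq z)\<^sup>2" unfolding Z2 using m4[of "v z"] by (simp add: sq_def)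
      show "integrable Q (\<lambda>w. (Z z w)\<^sup>2)" unfolding Z2 by (rule i4)
    qed (use s pos in \<open>auto simp: Z_def\<close>)
    also have "real m * (c * sq z)\<^sup>2 / (4 * (C * (sq z)\<^sup>2)) = real m * c\<^sup>2 / (4 * C)"
      using s pos by (simp add: power_mult_distrib)
    finally show ?thesis .
  qed
  define G where "G = space M - (B1 \<union> (\<Union>z\<in>L. B2 z))"
  have G: "G \<in> sets M" unfolding G_def using finL by (intro sets.Diff sets.Un sets.finite_UN) auto
  have "space M - G = B1 \<union> (\<Union>z\<in>L. B2 z)"
    unfolding G_def by (auto simp: B1_def B2_def)
  then have "prob (space M - G) \<le> prob B1 + prob (\<Union>z\<in>L. B2 z)"
    using finL by (simp add: measure_Un_le sets.finite_UN)
  also have "prob (\<Union>z\<in>L. B2 z) \<le> (\<Sum>z\<in>L. prob (B2 z))"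
    using finL by (intro measure_UNION_le) auto
  also have "\<dots> \<le> (\<Sum>z\<in>L. exp (- (real m * c\<^sup>2 / (4 * C))))"
    by (intro sum_mono PB2)
  also have "\<dots> = real (card L) * exp (- (real m * c\<^sup>2 / (4 * C)))" by simp
  also have "\<dots> \<le> (4 * 2 ^ (k + 1)) ^ n * exp (- (real m * c\<^sup>2 / (4 * C)))"
  proof (rule mult_right_mono)
    have "real (card L) \<le> real (card (lattice_points n (n * (k + 1))))"
      unfolding L_def using finite_lattice_points by (intro of_nat_mono card_mono) auto
    also have "\<dots> \<le> 4 ^ n * 2 ^ (n * (k + 1))" by (rule card_lattice_points)
    also have "\<dots> = (4 * 2 ^ (k + 1)) ^ n"
      by (simp only: power_mult_distrib power_mult[symmetric] mult.commute)
    finally show "real (card L) \<le> (4 * 2 ^ (k + 1)) ^ n" .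
  qed simp
  finally have PG: "prob (space M - G) \<le> C / m + (4 * 2 ^ (k + 1)) ^ n * exp (- (real m * c\<^sup>2 / (4 * C)))"
    using PB1 by simp
  have lower: "real m * (c / 32 * (\<Sum>j<n. (u j)\<^sup>2)) \<le> (\<Sum>i<m. (\<Sum>j<n. \<phi> (V i \<omega>) j * u j)\<^sup>2)" if \<omega>: "\<omega> \<in> G" for \<omega> u
  proof (rule form_lower_bound_from_lattice[OF pos(3) k(1) pos(1) k(2)])
    have "(\<Sum>i<m. \<psi> (V i \<omega>)) / m \<le> T"
    proof (rule ccontr)
      assume "\<not> ?thesis"
      then have "1\<^sup>2 \<le> ((\<Sum>i<m. \<psi> (V i \<omega>)) / m - (\<integral>w. \<psi> w \<partial>Q))\<^sup>2"
        using E\<psi> by (intro power_mono) auto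
      then show False using \<omega> by (auto simp: G_def B1_def)
    qed
    then have "(\<Sum>i<m. \<psi> (V i \<omega>)) \<le> real m * T" using m_pos by (simp add: divide_simps mult_ac)
    moreover have "(\<Sum>i<m. \<psi> (V i \<omega>)) = (\<Sum>j<n. \<Sum>i<m. (\<phi> (V i \<omega>) j)\<^sup>2) / n"
      unfolding \<psi>_def by (subst sum.swap) (simp add: sum_divide_distrib)
    ultimately show "(\<Sum>j<n. \<Sum>i<m. (\<phi> (V i \<omega>) j)\<^sup>2) \<le> real m * real n * ((1 + C) / 2 + 1)"
      using pos(3) by (simp add: T_def divide_simps mult_ac)
  next
    fix z assume z: "z \<in> lattice_points n (n * (k + 1))" "1 / 4 \<le> (\<Sum>j<n. (z j / (k * sqrt n))\<^sup>2)"
    then have "z \<in> L" by (simp add: L_def sq_def v_def)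
    with \<omega> have "\<not> (\<Sum>i<m. Z z (V i \<omega>)) \<le> real m * (c * sq z) / 4"
      by (auto simp: G_def B2_def)
    then show "real m * (c * (\<Sum>j<n. (z j / (k * sqrt n))\<^sup>2)) / 4 \<le> (\<Sum>i<m. (\<Sum>j<n. \<phi> (V i \<omega>) j * (z j / (k * sqrt n)))\<^sup>2)"
      by (simp add: Z_def sq_def v_def)
  qed
  show ?thesis by (rule that[OF G PG lower])
qed

end

subsection \<open>Matrices and ridge predictors\<close>

lemma scalar_prod_sum: "w \<in> carrier_vec d \<Longrightarrow> v \<bullet> w = (\<Sum>i<d. v $ i * w $ i)"
  by (auto simp: scalar_prod_def atLeast0LessThan)

lemma enorm_power2: "v \<in> carrier_vec d \<Longrightarrow> (enorm v)\<^sup>2 = (\<Sum>i<d. (v $ i)\<^sup>2)"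
  unfolding enorm_def by (simp add: scalar_prod_sum power2_eq_square sum_nonneg)

lemma enorm_eq: "v \<in> carrier_vec d \<Longrightarrow> enorm v = sqrt (\<Sum>i<d. (v $ i)\<^sup>2)"
  unfolding enorm_def by (simp add: scalar_prod_sum power2_eq_square)

lemma mult_mat_vec_sum:
  "A \<in> carrier_mat r c \<Longrightarrow> v \<in> carrier_vec c \<Longrightarrow> i < r \<Longrightarrow> (A *\<^sub>v v) $ i = (\<Sum>j<c. A $$ (i, j) * v $ j)"
  by (simp add: scalar_prod_sum[of v c])

lemma spectral_norm_bound:
  assumes A: "A \<in> carrier_mat r c" and B: "spectral_norm A \<le> B"
  shows "(\<Sum>i<r. (\<Sum>j<c. A $$ (i, j) * v j)\<^sup>2) \<le> B\<^sup>2 * (\<Sum>j<c. (v j)\<^sup>2)"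
proof -
  let ?S = "{v \<in> carrier_vec (dim_col A). enorm v \<le> 1}"
  have Av: "(enorm (A *\<^sub>v w))\<^sup>2 = (\<Sum>i<r. (\<Sum>j<c. A $$ (i, j) * w $ j)\<^sup>2)" if "w \<in> carrier_vec c" for w
    using A that by (subst enorm_power2[of _ r]) (auto simp: mult_mat_vec_sum[OF A that] intro!: sum.cong simp del: index_mult_mat_vec)
  define F where "F = (\<Sum>i<r. \<Sum>j<c. (A $$ (i, j))\<^sup>2)"
  have F0: "0 \<le> F" unfolding F_def by (intro sum_nonneg) simp
  \<comment> \<open>The real supremum defining the spectral norm is known to dominate its members
    only for a bounded set; the Frobenius norm bounds it.\<close>
  have bdd: "bdd_above ((\<lambda>v. enorm (A *\<^sub>v v)) ` ?S)"
  proof (rule bdd_aboveI2)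
    fix w assume "w \<in> ?S"
    then have w: "w \<in> carrier_vec c" "enorm w \<le> 1" using A by auto
    have "0 \<le> enorm w" by (simp add: enorm_eq[OF w(1)] sum_nonneg)
    then have w1: "(\<Sum>j<c. (w $ j)\<^sup>2) \<le> 1"
      using power_le_one[OF \<open>0 \<le> enorm w\<close> w(2), of 2] enorm_power2[OF w(1)] by simp
    have "(enorm (A *\<^sub>v w))\<^sup>2 \<le> (\<Sum>i<r. (\<Sum>j<c. (A $$ (i, j))\<^sup>2) * (\<Sum>j<c. (w $ j)\<^sup>2))"
      unfolding Av[OF w(1)] by (intro sum_mono sum_square_le)
    also have "\<dots> \<le> F * 1"
      unfolding sum_distrib_right[symmetric] F_def[symmetric] by (intro mult_left_mono w1 F0)
    finally show "enorm (A *\<^sub>v w) \<le> sqrt F" using real_le_rsqrt by simp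
  qed
  have le: "enorm (A *\<^sub>v w) \<le> B" if "w \<in> carrier_vec c" "enorm w \<le> 1" for w
    using cSUP_upper[OF _ bdd, of w] that A B unfolding spectral_norm_def by auto
  define S where "S = (\<Sum>j<c. (v j)\<^sup>2)"
  show ?thesis
  proof (cases "S = 0")
    case True
    then have "v j = 0" if "j < c" for j
      using that unfolding S_def by (subst (asm) sum_nonneg_eq_0_iff) auto
    then show ?thesis by simp
  next
    case False
    then have S: "0 < S" unfolding S_def by (simp add: order_less_le sum_nonneg)
    define w where "w = Matrix.vec c (\<lambda>j. v j / sqrt S)"
    have w: "w \<in> carrier_vec c" "w $ j = v j / sqrt S" if "j < c" for j using that by (simp_all add: w_def)
    have wc: "w \<in> carrier_vec c" by (simp add: w_def)
    have "(enorm w)\<^sup>2 = 1"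
      unfolding enorm_power2[OF wc] using S
      by (simp add: w_def power_divide sum_divide_distrib[symmetric] S_def[symmetric])
    then have "enorm w \<le> 1" by (simp add: power2_eq_1_iff abs_le_iff enorm_def power2_eq_square)
    from le[OF wc this] have e: "enorm (A *\<^sub>v w) \<le> B" .
    have "0 \<le> enorm (A *\<^sub>v w)" using A wc enorm_eq[of "A *\<^sub>v w" r] by (simp add: sum_nonneg)
    with e have "(enorm (A *\<^sub>v w))\<^sup>2 \<le> B\<^sup>2" by (intro power_mono)
    moreover have "(enorm (A *\<^sub>v w))\<^sup>2 = (\<Sum>i<r. (\<Sum>j<c. A $$ (i, j) * v j)\<^sup>2) / S"
    proof -
      have "(\<Sum>j<c. A $$ (i, j) * w $ j) = (\<Sum>j<c. A $$ (i, j) * v j) / sqrt S" for i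
        by (simp add: w_def sum_divide_distrib)
      then have "(\<Sum>j<c. A $$ (i, j) * w $ j)\<^sup>2 = (\<Sum>j<c. A $$ (i, j) * v j)\<^sup>2 / S" for i
        using S by (simp only: power_divide) simp
      then show ?thesis unfolding Av[OF wc] by (simp only: sum_divide_distrib)
    qed
    ultimately show ?thesis using S by (simp add: pos_divide_le_eq S_def)
  qed
qed

section \<open>Inverse matrices and their measurability\<close>

lemma minv_carrier:
  assumes A: "A \<in> carrier_mat n n"
  shows "minv A \<in> carrier_mat n n"
  using mat_inverse(2)[OF A] A unfolding minv_def by (auto split: option.splits)

lemma minv_inverse:
  assumes A: "A \<in> carrier_mat n n" and det: "Determinant.det A \<noteq> 0"
  shows "A * minv A = 1\<^sub>m n" "minv A * A = 1\<^sub>m n"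
proof -
  have "mat_inverse A \<noteq> None"
    using mat_inverse(1)[OF A, of "()"] det_non_zero_imp_unit[OF A det, of "()"] by auto
  then obtain C where C: "mat_inverse A = Some C" by auto
  with mat_inverse(2)[OF A C] show "A * minv A = 1\<^sub>m n" "minv A * A = 1\<^sub>m n"
    by (simp_all add: minv_def)
qed

text \<open>The adjugate formula makes the inverse a measurable function of the entries.\<close>

lemma minv_eq:
  assumes A: "A \<in> carrier_mat n n"
  shows "minv A = (if Determinant.det A = 0 then 0\<^sub>m n n else (1 / Determinant.det A) \<cdot>\<^sub>m adj_mat A)"
proof (cases "Determinant.det A = 0")
  case True
  have "mat_inverse A = None"
  proof (rule ccontr)
    assume "mat_inverse A \<noteq> None"
    then obtain C where "mat_inverse A = Some C" by auto
    from mat_inverse(2)[OF A this] have C: "A * C = 1\<^sub>m n" "C \<in> carrier_mat n n" by auto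
    from arg_cong[OF C(1), of Determinant.det] show False
      using True by (simp add: det_mult[OF A C(2)])
  qed
  then show ?thesis using True A by (simp add: minv_def)
next
  case False
  note inv = minv_inverse[OF A False] and adj = adj_mat[OF A]
  have "(1 / Determinant.det A) \<cdot>\<^sub>m adj_mat A = minv A * A * ((1 / Determinant.det A) \<cdot>\<^sub>m adj_mat A)"
    using adj(1) by (simp add: inv)
  also have "\<dots> = minv A * (A * ((1 / Determinant.det A) \<cdot>\<^sub>m adj_mat A))"
    using adj(1) A minv_carrier[OF A] by (intro assoc_mult_mat) auto
  also have "A * ((1 / Determinant.det A) \<cdot>\<^sub>m adj_mat A) = 1\<^sub>m n"
  proof -
    have "A * ((1 / Determinant.det A) \<cdot>\<^sub>m adj_mat A) = (1 / Determinant.det A) \<cdot>\<^sub>m (A * adj_mat A)"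
      using adj(1) A by (intro mult_smult_distrib) auto
    then show ?thesis using False by (intro eq_matI) (auto simp: adj(2))
  qed
  also have "minv A * 1\<^sub>m n = minv A" using minv_carrier[OF A] by simp
  finally show ?thesis using False by simp
qed

text \<open>The Leibniz formula is a polynomial in the entries.\<close>

lemma det_measurable:
  assumes A: "\<And>\<omega>. \<omega> \<in> space N \<Longrightarrow> A \<omega> \<in> carrier_mat n n"
    and meas: "\<And>i j. i < n \<Longrightarrow> j < n \<Longrightarrow> (\<lambda>\<omega>. A \<omega> $$ (i, j) :: real) \<in> borel_measurable N"
  shows "(\<lambda>\<omega>. Determinant.det (A \<omega>)) \<in> borel_measurable N"
proof -
  have "(\<lambda>\<omega>. Determinant.det (A \<omega>)) \<in> borel_measurable N \<longleftrightarrow>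
      (\<lambda>\<omega>. \<Sum>p\<in>{p. p permutes {0..<n}}. signof p * (\<Prod>i = 0..<n. A \<omega> $$ (i, p i))) \<in> borel_measurable N"
    by (intro measurable_cong det_def' A)
  also have "\<dots>"
  proof (intro borel_measurable_sum borel_measurable_times borel_measurable_const borel_measurable_prod meas)
    fix p i assume "p \<in> {p. p permutes {0..<n}}" "i \<in> {0..<n}"
    then show "i < n" "p i < n" using permutes_in_image[of p "{0..<n}" i] by auto
  qed
  finally show ?thesis .
qed

lemma minv_measurable:
  assumes A: "\<And>\<omega>. \<omega> \<in> space N \<Longrightarrow> A \<omega> \<in> carrier_mat n n"
    and meas: "\<And>i j. i < n \<Longrightarrow> j < n \<Longrightarrow> (\<lambda>\<omega>. A \<omega> $$ (i, j) :: real) \<in> borel_measurable N"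
    and ij: "i < n" "j < n"
  shows "(\<lambda>\<omega>. minv (A \<omega>) $$ (i, j)) \<in> borel_measurable N"
proof -
  let ?D = "\<lambda>\<omega>. Determinant.det (mat_delete (A \<omega>) j i)"
  have del: "?D \<in> borel_measurable N"
  proof (rule det_measurable[where n = "n - 1"])
    fix \<omega> assume "\<omega> \<in> space N"
    then show "mat_delete (A \<omega>) j i \<in> carrier_mat (n - 1) (n - 1)"
      using A by (intro mat_delete_carrier)
  next
    fix k l assume kl: "k < n - 1" "l < n - 1"
    have "(\<lambda>\<omega>. mat_delete (A \<omega>) j i $$ (k, l)) \<in> borel_measurable N \<longleftrightarrow>
        (\<lambda>\<omega>. A \<omega> $$ (if k < j then k else Suc k, if l < i then l else Suc l)) \<in> borel_measurable N"
    proof (rule measurable_cong)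
      fix \<omega> assume "\<omega> \<in> space N"
      from A[OF this] kl show "mat_delete (A \<omega>) j i $$ (k, l) = A \<omega> $$ (if k < j then k else Suc k, if l < i then l else Suc l)"
        by (auto simp: mat_delete_def)
    qed
    also have "\<dots>" using kl by (intro meas) auto
    finally show "(\<lambda>\<omega>. mat_delete (A \<omega>) j i $$ (k, l)) \<in> borel_measurable N" .
  qed
  note [measurable] = del det_measurable[OF A meas]
  have "(\<lambda>\<omega>. minv (A \<omega>) $$ (i, j)) \<in> borel_measurable N \<longleftrightarrow>
      (\<lambda>\<omega>. if Determinant.det (A \<omega>) = 0 then 0 else 1 / Determinant.det (A \<omega>) * ((-1) ^ (j + i) * ?D \<omega>)) \<in> borel_measurable N"
  proof (rule measurable_cong)
    fix \<omega> assume "\<omega> \<in> space N"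
    from A[OF this] show "minv (A \<omega>) $$ (i, j) =
        (if Determinant.det (A \<omega>) = 0 then 0 else 1 / Determinant.det (A \<omega>) * ((-1) ^ (j + i) * ?D \<omega>))"
      using ij by (auto simp: minv_eq adj_mat_def cofactor_def)
  qed
  also have "\<dots>" by measurable
  finally show ?thesis .
qed

section \<open>Ridge predictors as linear forms in the labels\<close>

definition gram :: "(rvec \<Rightarrow> rvec \<Rightarrow> real) \<Rightarrow> real \<Rightarrow> rmat \<Rightarrow> rmat" where
  "gram k lam X = kernel_matrix k X + lam \<cdot>\<^sub>m 1\<^sub>m (dim_col X)"

lemma gram_carrier: "X \<in> carrier_mat d n \<Longrightarrow> gram k lam X \<in> carrier_mat n n"
  unfolding gram_def kernel_matrix_def by auto

lemma gram_index:
  "X \<in> carrier_mat d n \<Longrightarrow> i < n \<Longrightarrow> j < n \<Longrightarrow> gram k lam X $$ (i, j) = k (col X i) (col X j) + (if i = j then lam else 0)"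
  unfolding gram_def kernel_matrix_def by auto

lemma ridge_predictor_sum:
  assumes X: "X \<in> carrier_mat d n" and y: "y \<in> carrier_vec n"
  shows "ridge_predictor k lam X y z = (\<Sum>a<n. k z (col X a) * (\<Sum>b<n. minv (gram k lam X) $$ (a, b) * y $ b))"
proof -
  note C = minv_carrier[OF gram_carrier[OF X], of k lam]
  have "ridge_predictor k lam X y z = kernel_row k z X \<bullet> (minv (gram k lam X) *\<^sub>v y)"
    unfolding ridge_predictor_def gram_def ..
  also have "\<dots> = (\<Sum>a<n. kernel_row k z X $ a * (minv (gram k lam X) *\<^sub>v y) $ a)"
    using C y by (intro scalar_prod_sum mult_mat_vec_carrier)
  also have "\<dots> = (\<Sum>a<n. k z (col X a) * (\<Sum>b<n. minv (gram k lam X) $$ (a, b) * y $ b))"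
    using X by (intro sum.cong refl) (simp add: kernel_row_def mult_mat_vec_sum[OF C y] del: index_mult_mat_vec)
  finally show ?thesis .
qed

lemma ridge_predictor_measurable:
  assumes X: "X \<in> carrier_mat d n"
    and y: "\<And>\<omega>. \<omega> \<in> space N \<Longrightarrow> y \<omega> \<in> carrier_vec n" "\<And>j. j < n \<Longrightarrow> (\<lambda>\<omega>. y \<omega> $ j) \<in> borel_measurable N"
    and k: "\<And>i j. i < n \<Longrightarrow> j < n \<Longrightarrow> (\<lambda>\<omega>. k \<omega> (col X i) (col X j)) \<in> borel_measurable N"
      "\<And>j. j < n \<Longrightarrow> (\<lambda>\<omega>. k \<omega> (z \<omega>) (col X j)) \<in> borel_measurable N"
  shows "(\<lambda>\<omega>. ridge_predictor (k \<omega>) lam X (y \<omega>) (z \<omega>)) \<in> borel_measurable N"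
proof -
  have "(\<lambda>\<omega>. gram (k \<omega>) lam X $$ (i, j)) \<in> borel_measurable N" if "i < n" "j < n" for i j
    using k(1)[OF that] by (simp add: gram_index[OF X that])
  then have m: "(\<lambda>\<omega>. minv (gram (k \<omega>) lam X) $$ (i, j)) \<in> borel_measurable N" if "i < n" "j < n" for i j
    using that by (intro minv_measurable[OF gram_carrier[OF X]])
  have "(\<lambda>\<omega>. ridge_predictor (k \<omega>) lam X (y \<omega>) (z \<omega>)) \<in> borel_measurable N \<longleftrightarrow>
      (\<lambda>\<omega>. \<Sum>a<n. k \<omega> (z \<omega>) (col X a) * (\<Sum>b<n. minv (gram (k \<omega>) lam X) $$ (a, b) * y \<omega> $ b)) \<in> borel_measurable N"
    by (intro measurable_cong ridge_predictor_sum[OF X] y)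
  also have "\<dots>"
    by (intro borel_measurable_sum borel_measurable_times) (use k m y(2) in auto)
  finally show ?thesis .
qed

text \<open>Coercivity rules out a null vector, so \<open>minv\<close> is a genuine inverse even for
  ridge parameter 0. By symmetry the transposed inverse applied to the kernel values at z solves the
  same linear system, and this solution p is the coefficient vector of the labels; the comparison of
  predictors works with the system instead of the inverse.\<close>

lemma ridge_predictor_solution:
  assumes X: "X \<in> carrier_mat d n"
    and sym: "\<And>i j. i < n \<Longrightarrow> j < n \<Longrightarrow> k (col X i) (col X j) = k (col X j) (col X i)"
    and c: "0 < c" and pd: "\<And>u. c * (\<Sum>i<n. (u i)\<^sup>2) \<le> (\<Sum>i<n. \<Sum>j<n. u i * (k (col X i) (col X j) + (if i = j then lam else 0)) * u j)"
  obtains p where "\<And>i. i < n \<Longrightarrow> (\<Sum>j<n. (k (col X i) (col X j) + (if i = j then lam else 0)) * p j) = k z (col X i)"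
    "\<And>y. y \<in> carrier_vec n \<Longrightarrow> ridge_predictor k lam X y z = (\<Sum>j<n. p j * y $ j)"
proof -
  define A where "A = gram k lam X"
  have A: "A \<in> carrier_mat n n" unfolding A_def by (rule gram_carrier[OF X])
  have Aij: "A $$ (i, j) = k (col X i) (col X j) + (if i = j then lam else 0)" if "i < n" "j < n" for i j
    unfolding A_def by (rule gram_index[OF X that])
  have "Determinant.det A \<noteq> 0"
  proof
    assume "Determinant.det A = 0"
    then obtain v where v: "v \<in> carrier_vec n" "v \<noteq> 0\<^sub>v n" "A *\<^sub>v v = 0\<^sub>v n"
      using det_0_iff_vec_prod_zero_field[OF A] by auto
    have "(\<Sum>i<n. \<Sum>j<n. v $ i * (k (col X i) (col X j) + (if i = j then lam else 0)) * v $ j)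
        = (\<Sum>i<n. v $ i * (A *\<^sub>v v) $ i)"
      by (intro sum.cong refl) (simp add: mult_mat_vec_sum[OF A v(1)] Aij sum_distrib_left mult_ac del: index_mult_mat_vec)
    also have "\<dots> = 0" using v(3) by simp
    finally have "c * (\<Sum>i<n. (v $ i)\<^sup>2) \<le> 0" using pd[of "\<lambda>i. v $ i"] by simp
    then have "(\<Sum>i<n. (v $ i)\<^sup>2) \<le> 0" using c by (simp add: mult_le_0_iff)
    then have "(\<Sum>i<n. (v $ i)\<^sup>2) = 0" by (intro antisym sum_nonneg) auto
    then have "v $ i = 0" if "i < n" for i
      using that by (subst (asm) sum_nonneg_eq_0_iff) auto
    then have "v = 0\<^sub>v n" using v(1) by (intro eq_vecI) auto
    with v(2) show False ..
  qed
  note inv = minv_inverse(2)[OF A this]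
  define C where "C = minv A"
  have C: "C \<in> carrier_mat n n" unfolding C_def by (rule minv_carrier[OF A])
  have CA: "(\<Sum>j<n. C $$ (a, j) * A $$ (j, i)) = (if a = i then 1 else 0)" if "a < n" "i < n" for a i
  proof -
    have "(C * A) $$ (a, i) = (\<Sum>j<n. C $$ (a, j) * A $$ (j, i))"
      using A C that by (simp add: scalar_prod_def atLeast0LessThan)
    then show ?thesis using inv that by (simp add: C_def)
  qed
  define p where "p j = (\<Sum>a<n. C $$ (a, j) * k z (col X a))" for j
  show ?thesis
  proof (rule that)
    fix i assume i: "i < n"
    have "(\<Sum>j<n. (k (col X i) (col X j) + (if i = j then lam else 0)) * p j) = (\<Sum>j<n. \<Sum>a<n. A $$ (j, i) * (C $$ (a, j) * k z (col X a)))"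
      using i sym unfolding p_def sum_distrib_left by (intro sum.cong refl) (auto simp: Aij)
    also have "\<dots> = (\<Sum>a<n. (\<Sum>j<n. C $$ (a, j) * A $$ (j, i)) * k z (col X a))"
      unfolding sum_distrib_right by (subst sum.swap) (simp add: mult_ac)
    also have "\<dots> = (\<Sum>a<n. if a = i then k z (col X a) else 0)"
      using i by (intro sum.cong refl) (auto simp: CA)
    also have "\<dots> = k z (col X i)" using i by simp
    finally show "(\<Sum>j<n. (k (col X i) (col X j) + (if i = j then lam else 0)) * p j) = k z (col X i)" .
  next
    fix y :: "real Matrix.vec" assume y: "y \<in> carrier_vec n"
    show "ridge_predictor k lam X y z = (\<Sum>j<n. p j * y $ j)"
      unfolding ridge_predictor_sum[OF X y] A_def[symmetric] C_def[symmetric] p_def sum_distrib_left sum_distrib_right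
      by (subst sum.swap) (simp add: mult_ac)
  qed
qed

section \<open>Independence, Gaussian moments and measurability\<close>

lemma nn_integral_indep_pair:
  assumes M: "prob_space M" and ind: "indep_pair M S f T g"
    and H: "case_prod H \<in> borel_measurable (S \<Otimes>\<^sub>M T)"
  shows "(\<integral>\<^sup>+\<omega>. H (f \<omega>) (g \<omega>) \<partial>M) = (\<integral>\<^sup>+s. \<integral>\<^sup>+\<omega>. H s (g \<omega>) \<partial>M \<partial>distr M S f)"
proof -
  interpret prob_space M by (rule M)
  have [measurable]: "f \<in> M \<rightarrow>\<^sub>M S" "g \<in> M \<rightarrow>\<^sub>M T" using ind by (auto simp: indep_pair_def)
  interpret F: prob_space "distr M S f" by (rule prob_space_distr) simp
  interpret G: prob_space "distr M T g" by (rule prob_space_distr) simp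
  interpret FG: pair_prob_space "distr M S f" "distr M T g" ..
  \<comment> \<open>Independence of the generated \<sigma>-algebras makes the joint law a product;
    Tonelli then freezes the first variable under its law.\<close>
  have "distr M S f \<Otimes>\<^sub>M distr M T g = distr M (S \<Otimes>\<^sub>M T) (\<lambda>\<omega>. (f \<omega>, g \<omega>))"
  proof (rule pair_measure_eqI)
    show "sigma_finite_measure (distr M S f)" "sigma_finite_measure (distr M T g)" by unfold_locales
    fix A B assume "A \<in> sets (distr M S f)" "B \<in> sets (distr M T g)"
    then have A [measurable]: "A \<in> sets S" and B [measurable]: "B \<in> sets T" by auto
    have "prob ((f -` A \<inter> space M) \<inter> (g -` B \<inter> space M)) = prob (f -` A \<inter> space M) * prob (g -` B \<inter> space M)"
      using ind A B unfolding indep_pair_def by (intro indep_setD) (auto simp: in_vimage_algebra)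
    moreover have "(\<lambda>\<omega>. (f \<omega>, g \<omega>)) -` (A \<times> B) \<inter> space M = (f -` A \<inter> space M) \<inter> (g -` B \<inter> space M)" by auto
    ultimately show "emeasure (distr M S f) A * emeasure (distr M T g) B = emeasure (distr M (S \<Otimes>\<^sub>M T) (\<lambda>\<omega>. (f \<omega>, g \<omega>))) (A \<times> B)"
      by (simp add: emeasure_distr emeasure_eq_measure ennreal_mult)
  qed simp
  note eq = this
  have Hp [measurable]: "(\<lambda>p. H (fst p) (snd p)) \<in> borel_measurable (S \<Otimes>\<^sub>M T)"
    using H by (simp add: case_prod_beta')
  have "(\<integral>\<^sup>+\<omega>. H (f \<omega>) (g \<omega>) \<partial>M) = (\<integral>\<^sup>+p. H (fst p) (snd p) \<partial>distr M (S \<Otimes>\<^sub>M T) (\<lambda>\<omega>. (f \<omega>, g \<omega>)))"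
    by (subst nn_integral_distr) auto
  also have "\<dots> = (\<integral>\<^sup>+s. \<integral>\<^sup>+t. H s t \<partial>distr M T g \<partial>distr M S f)"
    unfolding eq[symmetric] by (subst G.nn_integral_fst[symmetric]) (auto cong: measurable_cong_sets)
  also have "\<dots> = (\<integral>\<^sup>+s. \<integral>\<^sup>+\<omega>. H s (g \<omega>) \<partial>M \<partial>distr M S f)"
  proof (intro nn_integral_cong)
    fix s assume "s \<in> space (distr M S f)"
    then have s: "s \<in> space S" by simp
    have "H s \<in> borel_measurable T"
      using measurable_compose[OF measurable_Pair1'[OF s] Hp] by simp
    then show "(\<integral>\<^sup>+t. H s t \<partial>distr M T g) = (\<integral>\<^sup>+\<omega>. H s (g \<omega>) \<partial>M)"
      by (intro nn_integral_distr) simp_all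
  qed
  finally show ?thesis .
qed

text \<open>Moments are pulled back along the scaling of z by s rather than computed from a density,
  so that s = 0 is included; independence and mean zero remove the cross terms.\<close>

lemma gaussian_vec_linear:
  assumes M: "prob_space M" and g: "gaussian_vec M d s v"
  shows "(\<integral>\<^sup>+\<omega>. ennreal ((\<Sum>i<d. a i * v \<omega> $ i)\<^sup>2) \<partial>M) = ennreal (s\<^sup>2 * (\<Sum>i<d. (a i)\<^sup>2))"
proof -
  interpret prob_space M by (rule M)
  have meas [measurable]: "(\<lambda>\<omega>. v \<omega> $ i) \<in> borel_measurable M" if "i < d" for i
    using g that by (auto simp: gaussian_vec_def random_vec_def)
  have law: "distr M borel (\<lambda>\<omega>. v \<omega> $ i) = distr std_normal borel (\<lambda>z. s * z)" if "i < d" for i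
    using g that by (auto simp: gaussian_vec_def centered_normal_def)
  have ind: "indep_vars (\<lambda>_. borel) (\<lambda>i \<omega>. v \<omega> $ i) {..<d}" using g by (simp add: gaussian_vec_def)
  have moment: "integrable M (\<lambda>\<omega>. f (v \<omega> $ i))" "(\<integral>\<omega>. f (v \<omega> $ i) \<partial>M) = (\<integral>z. f (s * z) \<partial>std_normal)"
    if "i < d" and f: "f \<in> borel_measurable borel" and int: "integrable std_normal (\<lambda>z. f (s * z))" for i and f :: "real \<Rightarrow> real"
  proof -
    have sm: "(\<lambda>z. s * z) \<in> std_normal \<rightarrow>\<^sub>M borel" by measurable
    show "integrable M (\<lambda>\<omega>. f (v \<omega> $ i))"
      using int unfolding integrable_distr_eq[OF sm f, symmetric] law[OF that(1), symmetric]
        integrable_distr_eq[OF meas[OF that(1)] f] .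
    show "(\<integral>\<omega>. f (v \<omega> $ i) \<partial>M) = (\<integral>z. f (s * z) \<partial>std_normal)"
      unfolding integral_distr[OF sm f, symmetric] law[OF that(1), symmetric]
        integral_distr[OF meas[OF that(1)] f] ..
  qed
  have i1: "integrable M (\<lambda>\<omega>. v \<omega> $ i)" "(\<integral>\<omega>. v \<omega> $ i \<partial>M) = 0" if "i < d" for i
    using moment[OF that, of "\<lambda>x. x"] std_normal_moments(1)[of 1] std_normal_moments(5) by simp_all
  have sq: "(s * x)\<^sup>2 = s\<^sup>2 * x\<^sup>2" for x by (rule power_mult_distrib)
  have i2: "integrable M (\<lambda>\<omega>. v \<omega> $ i * v \<omega> $ i)" "(\<integral>\<omega>. v \<omega> $ i * v \<omega> $ i \<partial>M) = s\<^sup>2" if "i < d" for i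
    using moment[OF that, of "\<lambda>x. x\<^sup>2"] std_normal_moments(1)[of 2] std_normal_moments(3)
    unfolding power2_eq_square[of "v _ $ i", symmetric] by (simp_all add: sq)
  have cross: "integrable M (\<lambda>\<omega>. v \<omega> $ i * v \<omega> $ k)" "(\<integral>\<omega>. v \<omega> $ i * v \<omega> $ k \<partial>M) = 0" if "i < d" "k < d" "i \<noteq> k" for i k
  proof -
    have "indep_vars (\<lambda>_. borel) (\<lambda>i \<omega>. v \<omega> $ i) {i, k}" using that by (intro indep_vars_subset[OF ind]) auto
    from indep_vars_integrable[OF _ this] indep_vars_lebesgue_integral[OF _ this]
    show "integrable M (\<lambda>\<omega>. v \<omega> $ i * v \<omega> $ k)" "(\<integral>\<omega>. v \<omega> $ i * v \<omega> $ k \<partial>M) = 0"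
      using that i1 by auto
  qed
  have all: "integrable M (\<lambda>\<omega>. v \<omega> $ i * v \<omega> $ k)" if "i < d" "k < d" for i k
    using cross(1)[OF that] i2(1)[OF that(1)] by (cases "i = k") auto
  have eq: "(\<Sum>i<d. a i * v \<omega> $ i)\<^sup>2 = (\<Sum>i<d. \<Sum>k<d. a i * a k * (v \<omega> $ i * v \<omega> $ k))" for \<omega>
    unfolding power2_eq_square sum_product by (intro sum.cong refl) (simp add: mult_ac)
  have int: "integrable M (\<lambda>\<omega>. (\<Sum>i<d. a i * v \<omega> $ i)\<^sup>2)"
    unfolding eq using all by (intro Bochner_Integration.integrable_sum integrable_mult_right) auto
  have "(\<integral>\<omega>. (\<Sum>i<d. a i * v \<omega> $ i)\<^sup>2 \<partial>M) = (\<Sum>i<d. \<Sum>k<d. a i * a k * (\<integral>\<omega>. v \<omega> $ i * v \<omega> $ k \<partial>M))"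
    unfolding eq using all
    by (subst Bochner_Integration.integral_sum, force, intro sum.cong refl,
        subst Bochner_Integration.integral_sum) auto
  also have "\<dots> = (\<Sum>i<d. \<Sum>k<d. if k = i then a i * a i * s\<^sup>2 else 0)"
    using cross(2) i2(2) by (intro sum.cong refl) auto
  also have "\<dots> = s\<^sup>2 * (\<Sum>i<d. (a i)\<^sup>2)"
    by (simp add: sum_distrib_left power2_eq_square mult_ac)
  finally show ?thesis using int by (subst nn_integral_eq_integral) auto
qed

lemma labels_carrier:
  assumes "X \<in> carrier_mat d n" "\<eta> \<in> carrier_vec n"
  shows "labels X \<beta> \<eta> \<in> carrier_vec n"
  using assms unfolding labels_def carrier_vec_def by simp

lemma labels_index:
  assumes "X \<in> carrier_mat d n" "\<beta> \<in> carrier_vec d" "\<eta> \<in> carrier_vec n" "b < n"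
  shows "labels X \<beta> \<eta> $ b = (\<Sum>l<d. X $$ (l, b) * \<beta> $ l) + \<eta> $ b"
  using assms unfolding labels_def by (simp add: scalar_prod_sum[of \<beta> d])

lemma rf_kernel_sum:
  assumes "W \<in> carrier_mat m d" "a \<in> carrier_vec d" "b \<in> carrier_vec d"
  shows "rf_kernel \<sigma> W a b = (\<Sum>i<m. \<sigma> (dotp d (\<lambda>l. W $$ (i, l)) (\<lambda>l. a $ l)) * \<sigma> (dotp d (\<lambda>l. W $$ (i, l)) (\<lambda>l. b $ l))) / m"
  using assms unfolding rf_kernel_def dotp_def by (simp add: scalar_prod_sum[of _ d])

lemma limit_kernel_eq:
  assumes "a \<in> carrier_vec d" "b \<in> carrier_vec d"
  shows "limit_kernel \<sigma> d a b = (\<integral>w. \<sigma> (dotp d w (\<lambda>l. a $ l)) * \<sigma> (dotp d w (\<lambda>l. b $ l)) \<partial>gauss d)"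
  using assms unfolding limit_kernel_def dotp_def by (simp add: scalar_prod_sum[of _ d])

lemma rf_kernel_measurable:
  assumes [measurable]: "\<sigma> \<in> borel_measurable borel"
    and W: "\<And>\<omega>. \<omega> \<in> space N \<Longrightarrow> W \<omega> \<in> carrier_mat m d" "\<And>i l. i < m \<Longrightarrow> l < d \<Longrightarrow> (\<lambda>\<omega>. W \<omega> $$ (i, l)) \<in> borel_measurable N"
    and a: "\<And>\<omega>. \<omega> \<in> space N \<Longrightarrow> a \<omega> \<in> carrier_vec d" "\<And>l. l < d \<Longrightarrow> (\<lambda>\<omega>. a \<omega> $ l) \<in> borel_measurable N"
    and b: "\<And>\<omega>. \<omega> \<in> space N \<Longrightarrow> b \<omega> \<in> carrier_vec d" "\<And>l. l < d \<Longrightarrow> (\<lambda>\<omega>. b \<omega> $ l) \<in> borel_measurable N"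
  shows "(\<lambda>\<omega>. rf_kernel \<sigma> (W \<omega>) (a \<omega>) (b \<omega>)) \<in> borel_measurable N"
proof -
  note [measurable] = W(2) a(2) b(2)
  have "(\<lambda>\<omega>. rf_kernel \<sigma> (W \<omega>) (a \<omega>) (b \<omega>)) \<in> borel_measurable N \<longleftrightarrow>
    (\<lambda>\<omega>. (\<Sum>i<m. \<sigma> (\<Sum>l<d. W \<omega> $$ (i, l) * a \<omega> $ l) * \<sigma> (\<Sum>l<d. W \<omega> $$ (i, l) * b \<omega> $ l)) / m) \<in> borel_measurable N"
  proof (rule measurable_cong)
    fix \<omega> assume \<omega>: "\<omega> \<in> space N"
    show "rf_kernel \<sigma> (W \<omega>) (a \<omega>) (b \<omega>)
        = (\<Sum>i<m. \<sigma> (\<Sum>l<d. W \<omega> $$ (i, l) * a \<omega> $ l) * \<sigma> (\<Sum>l<d. W \<omega> $$ (i, l) * b \<omega> $ l)) / m"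
      unfolding rf_kernel_sum[OF W(1)[OF \<omega>] a(1)[OF \<omega>] b(1)[OF \<omega>]] dotp_def ..
  qed
  also have "\<dots>" by measurable
  finally show ?thesis .
qed

lemma limit_kernel_measurable:
  assumes [measurable]: "\<sigma> \<in> borel_measurable borel"
    and a: "\<And>\<omega>. \<omega> \<in> space N \<Longrightarrow> a \<omega> \<in> carrier_vec d" "\<And>l. l < d \<Longrightarrow> (\<lambda>\<omega>. a \<omega> $ l) \<in> borel_measurable N"
    and b: "b \<in> carrier_vec d"
  shows "(\<lambda>\<omega>. limit_kernel \<sigma> d (a \<omega>) b) \<in> borel_measurable N"
proof -
  note [measurable] = a(2)
  interpret G: prob_space "gauss d" by (rule prob_space_gauss)
  have "(\<lambda>\<omega>. limit_kernel \<sigma> d (a \<omega>) b) \<in> borel_measurable N \<longleftrightarrow>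
    (\<lambda>\<omega>. \<integral>w. \<sigma> (\<Sum>l<d. w l * a \<omega> $ l) * \<sigma> (\<Sum>l<d. w l * b $ l) \<partial>gauss d) \<in> borel_measurable N"
    using a(1) b by (intro measurable_cong) (simp add: limit_kernel_eq dotp_def)
  also have "\<dots>"
  proof (rule G.borel_measurable_lebesgue_integral)
    have 1: "(\<lambda>p. \<Sum>l<d. snd p l * a (fst p) $ l) \<in> borel_measurable (N \<Otimes>\<^sub>M gauss d)"
    proof (rule borel_measurable_sum, rule borel_measurable_times)
      fix l assume l: "l \<in> {..<d}"
      show "(\<lambda>p. snd p l) \<in> borel_measurable (N \<Otimes>\<^sub>M gauss d)"
        using l measurable_compose[OF measurable_snd measurable_component_singleton[of l "{..<d}" "\<lambda>_. std_normal"]] by simp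
      show "(\<lambda>p. a (fst p) $ l) \<in> borel_measurable (N \<Otimes>\<^sub>M gauss d)"
        using l by (intro measurable_compose[OF measurable_fst a(2)]) auto
    qed
    have 2: "(\<lambda>p. \<Sum>l<d. snd p l * b $ l) \<in> borel_measurable (N \<Otimes>\<^sub>M gauss d)"
      by (rule measurable_compose[OF measurable_snd]) measurable
    have "(\<lambda>p. \<sigma> (\<Sum>l<d. snd p l * a (fst p) $ l) * \<sigma> (\<Sum>l<d. snd p l * b $ l)) \<in> borel_measurable (N \<Otimes>\<^sub>M gauss d)"
      by (intro borel_measurable_times measurable_compose[OF 1 assms(1)] measurable_compose[OF 2 assms(1)])
    then show "(\<lambda>(\<omega>, w). \<sigma> (\<Sum>l<d. w l * a \<omega> $ l) * \<sigma> (\<Sum>l<d. w l * b $ l)) \<in> borel_measurable (N \<Otimes>\<^sub>M gauss d)"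
      by (simp add: case_prod_beta')
  qed
  finally show ?thesis .
qed

lemma labels_measurable:
  assumes X: "X \<in> carrier_mat d n"
    and \<beta>: "\<And>\<omega>. \<omega> \<in> space N \<Longrightarrow> \<beta> \<omega> \<in> carrier_vec d" "\<And>l. l < d \<Longrightarrow> (\<lambda>\<omega>. \<beta> \<omega> $ l) \<in> borel_measurable N"
    and \<eta>: "\<And>\<omega>. \<omega> \<in> space N \<Longrightarrow> \<eta> \<omega> \<in> carrier_vec n" "\<And>j. j < n \<Longrightarrow> (\<lambda>\<omega>. \<eta> \<omega> $ j) \<in> borel_measurable N"
    and b: "b < n"
  shows "(\<lambda>\<omega>. labels X (\<beta> \<omega>) (\<eta> \<omega>) $ b) \<in> borel_measurable N"
proof -
  note [measurable] = \<beta>(2) \<eta>(2)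
  have "(\<lambda>\<omega>. labels X (\<beta> \<omega>) (\<eta> \<omega>) $ b) \<in> borel_measurable N \<longleftrightarrow>
      (\<lambda>\<omega>. (\<Sum>l<d. X $$ (l, b) * \<beta> \<omega> $ l) + \<eta> \<omega> $ b) \<in> borel_measurable N"
    using X \<beta>(1) \<eta>(1) b by (intro measurable_cong labels_index)
  also have "\<dots>" using b by measurable
  finally show ?thesis .
qed

subsection \<open>Deterministic data with Gaussian features\<close>

text \<open>One fixed data matrix with the properties the estimates rely on. The constants defined
  inside are functions of L, B and c, which makes them uniform over sample sizes and
  dimensions.\<close>

locale gaussian_features =
  fixes n d :: nat and X :: rmat and \<sigma> :: "real \<Rightarrow> real" and L B c lam :: real
  assumes X: "X \<in> carrier_mat d n"
    and op: "\<And>v. (\<Sum>i<d. (\<Sum>j<n. X $$ (i, j) * v j)\<^sup>2) \<le> B\<^sup>2 * (\<Sum>j<n. (v j)\<^sup>2)"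
    and norms: "(\<Sum>j<n. (enorm (col X j) - 1)\<^sup>2) \<le> B\<^sup>2"
    and lip: "\<And>x y. \<bar>\<sigma> x - \<sigma> y\<bar> \<le> L * \<bar>x - y\<bar>"
    and mean: "(\<integral>x. \<sigma> x \<partial>std_normal) = 0"
    and c: "0 < c"
    and lower: "\<And>u. c * (\<Sum>j<n. (u j)\<^sup>2) \<le> (\<integral>w. (\<Sum>j<n. u j * \<sigma> (dotp d w (\<lambda>i. X $$ (i, j))))\<^sup>2 \<partial>gauss d)"
    and lam: "0 \<le> lam"
begin

text \<open>\<open>R\<close> dominates both |B| and the norm of any good point. \<open>C\<close> is
  kept at least 1, so that one constant serves for fourth and for second moments.\<close>

definition "R = 1 + \<bar>B\<bar>"
definition "C = 1 + moment_const L R"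
definition "feat z w = \<sigma> (dotp d w (\<lambda>l. z $ l))"
abbreviation "\<phi> j w \<equiv> feat (col X j) w"
text \<open>What orthonormality of the data with the test point appended says about the test point
  alone.\<close>

definition "good z \<longleftrightarrow> z \<in> carrier_vec d \<and> (enorm z - 1)\<^sup>2 \<le> B\<^sup>2"
abbreviation "K \<equiv> limit_kernel \<sigma> d"

lemma R: "1 \<le> R" "B\<^sup>2 \<le> R\<^sup>2"
  unfolding R_def by (auto simp: abs_le_square_iff[symmetric])

lemma C: "1 \<le> C"
  unfolding C_def using moment_const_nonneg by simp

lemma col_index: "j < n \<Longrightarrow> i < d \<Longrightarrow> col X j $ i = X $$ (i, j)"
  using X by auto

lemma col_carrier: "j < n \<Longrightarrow> col X j \<in> carrier_vec d"
  using X by auto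

lemma \<phi>_eq: "j < n \<Longrightarrow> \<phi> j w = \<sigma> (dotp d w (\<lambda>i. X $$ (i, j)))"
  unfolding feat_def dotp_def by (intro arg_cong[where f = \<sigma>] sum.cong refl) (simp add: col_index)

lemma \<sigma>_measurable [measurable]: "\<sigma> \<in> borel_measurable borel"
  by (rule lipschitz_borel[OF lip])

lemma feat_measurable [measurable]: "feat z \<in> borel_measurable (gauss d)"
  unfolding feat_def[abs_def] by measurable

lemma feat_growth: "exp_growth {..<d} (feat z)"
  unfolding feat_def[abs_def] by (rule lipschitz_growth[OF lip])

lemma features_fourth:
  "integrable (gauss d) (\<lambda>w. (\<Sum>j<n. u j * \<phi> j w) ^ 4)"
  "(\<integral>w. (\<Sum>j<n. u j * \<phi> j w) ^ 4 \<partial>gauss d) \<le> C * (\<Sum>j<n. (u j)\<^sup>2)\<^sup>2"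
proof -
  have o: "(\<Sum>i<d. (\<Sum>j<n. X $$ (i, j) * v j)\<^sup>2) \<le> R\<^sup>2 * (\<Sum>j<n. (v j)\<^sup>2)" for v
    using op[of v] mult_right_mono[OF R(2), of "\<Sum>j<n. (v j)\<^sup>2"] by (simp add: sum_nonneg)
  have "(\<Sum>j<n. (sqrt (\<Sum>i<d. (X $$ (i, j))\<^sup>2) - 1)\<^sup>2) = (\<Sum>j<n. (enorm (col X j) - 1)\<^sup>2)"
    using col_carrier by (intro sum.cong refl) (simp add: enorm_eq[of _ d] col_index)
  then have nn: "(\<Sum>j<n. (sqrt (\<Sum>i<d. (X $$ (i, j))\<^sup>2) - 1)\<^sup>2) \<le> R\<^sup>2"
    using norms R(2) by linarith
  have eq: "(\<Sum>j<n. u j * \<phi> j w) = (\<Sum>j<n. u j * \<sigma> (dotp d w (\<lambda>i. X $$ (i, j))))" for w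
    by (intro sum.cong refl) (simp add: \<phi>_eq)
  show "integrable (gauss d) (\<lambda>w. (\<Sum>j<n. u j * \<phi> j w) ^ 4)"
    unfolding eq by (rule lipschitz_fourth_moment(1)[OF lip mean o nn])
  have "(\<integral>w. (\<Sum>j<n. u j * \<phi> j w) ^ 4 \<partial>gauss d) \<le> moment_const L R * (\<Sum>j<n. (u j)\<^sup>2)\<^sup>2"
    unfolding eq by (rule lipschitz_fourth_moment(2)[OF lip mean o nn])
  also have "\<dots> \<le> C * (\<Sum>j<n. (u j)\<^sup>2)\<^sup>2" by (intro mult_right_mono) (auto simp: C_def)
  finally show "(\<integral>w. (\<Sum>j<n. u j * \<phi> j w) ^ 4 \<partial>gauss d) \<le> C * (\<Sum>j<n. (u j)\<^sup>2)\<^sup>2" .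
qed

lemma good_norm:
  assumes "good z"
  shows "(\<Sum>l<d. (z $ l)\<^sup>2) \<le> R\<^sup>2"
proof -
  have z: "z \<in> carrier_vec d" "\<bar>enorm z - 1\<bar> \<le> \<bar>B\<bar>"
    using assms by (auto simp: good_def abs_le_square_iff)
  then have "enorm z \<le> R" by (simp add: R_def)
  moreover have "0 \<le> enorm z" unfolding enorm_eq[OF z(1)] by (simp add: sum_nonneg)
  ultimately have "(enorm z)\<^sup>2 \<le> R\<^sup>2" by (intro power_mono)
  then show ?thesis by (simp add: enorm_power2[OF z(1)])
qed

text \<open>The point z is treated as a data matrix with a single column, whose operator norm is the
  norm of z.\<close>

lemma feat_fourth:
  assumes "good z"
  shows "integrable (gauss d) (\<lambda>w. feat z w ^ 4)" "(\<integral>w. feat z w ^ 4 \<partial>gauss d) \<le> C"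
proof -
  have z: "z \<in> carrier_vec d" "(enorm z - 1)\<^sup>2 \<le> B\<^sup>2" using assms by (auto simp: good_def)
  have o: "(\<Sum>i<d. (\<Sum>j<1::nat. z $ i * v j)\<^sup>2) \<le> R\<^sup>2 * (\<Sum>j<1::nat. (v j)\<^sup>2)" for v
    using mult_right_mono[OF good_norm[OF assms], of "(v 0)\<^sup>2"]
    by (simp add: power_mult_distrib sum_distrib_right[symmetric])
  have nn: "(\<Sum>j<1::nat. (sqrt (\<Sum>i<d. (z $ i)\<^sup>2) - 1)\<^sup>2) \<le> R\<^sup>2"
    using z(2) R(2) by (simp add: enorm_eq[OF z(1)])
  show "integrable (gauss d) (\<lambda>w. feat z w ^ 4)" "(\<integral>w. feat z w ^ 4 \<partial>gauss d) \<le> C"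
    using lipschitz_fourth_moment[OF lip mean o nn, of "\<lambda>_. 1"] by (simp_all add: feat_def C_def)
qed

lemma \<phi>_fourth:
  assumes "j < n"
  shows "integrable (gauss d) (\<lambda>w. \<phi> j w ^ 4)" "(\<integral>w. \<phi> j w ^ 4 \<partial>gauss d) \<le> C"
proof -
  have "(\<Sum>l<n. (if l = j then 1 else 0) * \<phi> l w) = \<phi> j w" for w
    using assms by (simp add: if_distrib[where f = "\<lambda>x. x * _"] cong: if_cong)
  moreover have "(\<Sum>l<n. (if l = j then 1 else 0 :: real)\<^sup>2) = 1"
    using assms by (simp add: if_distrib[where f = "\<lambda>x. x\<^sup>2"] cong: if_cong)
  ultimately show "integrable (gauss d) (\<lambda>w. \<phi> j w ^ 4)" "(\<integral>w. \<phi> j w ^ 4 \<partial>gauss d) \<le> C"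
    using features_fourth[of "\<lambda>l. if l = j then 1 else 0"] by simp_all
qed

text \<open>Nonnegative variance of F^2 bounds the second moment by the root of C times S, and C
  \<ge> 1 lets the root be replaced by C.\<close>

lemma second_from_fourth:
  assumes [measurable]: "F \<in> borel_measurable (gauss d)" and g: "exp_growth {..<d} F"
    and four: "(\<integral>w. F w ^ 4 \<partial>gauss d) \<le> C * S\<^sup>2" and S: "0 \<le> S"
  shows "(\<integral>w. (F w)\<^sup>2 \<partial>gauss d) \<le> C * S"
proof -
  interpret G: prob_space "gauss d" by (rule prob_space_gauss)
  have i2: "integrable (gauss d) (\<lambda>w. (F w)\<^sup>2)" and i4: "integrable (gauss d) (\<lambda>w. ((F w)\<^sup>2)\<^sup>2)"
    by (intro integrable_gauss_exp_growth exp_growth_power g; measurable)+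
  have "(\<integral>w. (F w)\<^sup>2 \<partial>gauss d)\<^sup>2 \<le> (\<integral>w. ((F w)\<^sup>2)\<^sup>2 \<partial>gauss d)"
    using G.variance_positive[of "\<lambda>w. (F w)\<^sup>2"] G.variance_eq[OF i2 i4] by simp
  also have "\<dots> \<le> C * S\<^sup>2" using four by simp
  also have "\<dots> \<le> (C * C) * S\<^sup>2" using C by (intro mult_right_mono) (auto simp: mult_le_cancel_left1)
  also have "\<dots> = (C * S)\<^sup>2" by (simp add: power2_eq_square mult_ac)
  finally show ?thesis using C S by (simp add: abs_le_square_iff[symmetric])
qed

lemma features_growth: "exp_growth {..<d} (\<lambda>w. \<Sum>j<n. u j * \<phi> j w)"
  by (intro exp_growth_sum exp_growth_mult exp_growth_const feat_growth)

lemma features_second: "(\<integral>w. (\<Sum>j<n. u j * \<phi> j w)\<^sup>2 \<partial>gauss d) \<le> C * (\<Sum>j<n. (u j)\<^sup>2)"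
  by (rule second_from_fourth[OF _ features_growth features_fourth(2)]) (auto intro: sum_nonneg)

lemma feat_second: "good z \<Longrightarrow> (\<integral>w. (feat z w)\<^sup>2 \<partial>gauss d) \<le> C"
  using second_from_fourth[OF _ feat_growth, of z 1] feat_fourth(2)[of z] by simp

lemma \<phi>_second: "j < n \<Longrightarrow> (\<integral>w. (\<phi> j w)\<^sup>2 \<partial>gauss d) \<le> C"
  using second_from_fourth[OF _ feat_growth, of "col X j" 1] \<phi>_fourth(2)[of j] by simp

lemma K_eq: "a \<in> carrier_vec d \<Longrightarrow> b \<in> carrier_vec d \<Longrightarrow> K a b = (\<integral>w. feat a w * feat b w \<partial>gauss d)"
  unfolding feat_def by (rule limit_kernel_eq)

lemma integrable_feat_mult: "integrable (gauss d) (\<lambda>w. feat a w * feat b w)"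
  by (intro integrable_gauss_exp_growth exp_growth_mult feat_growth; measurable)

lemma features_lower: "c * (\<Sum>j<n. (u j)\<^sup>2) \<le> (\<integral>w. (\<Sum>j<n. u j * \<phi> j w)\<^sup>2 \<partial>gauss d)"
proof -
  have eq: "(\<Sum>j<n. u j * \<phi> j w) = (\<Sum>j<n. u j * \<sigma> (dotp d w (\<lambda>i. X $$ (i, j))))" for w
    by (intro sum.cong refl) (simp add: \<phi>_eq)
  show ?thesis unfolding eq by (rule lower)
qed

lemma K_form: "(\<Sum>i<n. \<Sum>j<n. u i * (K (col X i) (col X j)) * u j) = (\<integral>w. (\<Sum>j<n. u j * \<phi> j w)\<^sup>2 \<partial>gauss d)"
proof -
  have "(\<integral>w. (\<Sum>j<n. u j * \<phi> j w)\<^sup>2 \<partial>gauss d) = (\<integral>w. (\<Sum>i<n. \<Sum>j<n. u i * u j * (\<phi> i w * \<phi> j w)) \<partial>gauss d)"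
    unfolding power2_eq_square sum_product by (intro Bochner_Integration.integral_cong sum.cong refl) (simp add: mult_ac)
  also have "\<dots> = (\<Sum>i<n. \<Sum>j<n. u i * u j * (\<integral>w. \<phi> i w * \<phi> j w \<partial>gauss d))"
    using integrable_feat_mult
    by (subst Bochner_Integration.integral_sum, force, intro sum.cong refl,
        subst Bochner_Integration.integral_sum) auto
  finally show ?thesis by (simp add: K_eq col_carrier mult_ac)
qed

lemma ridge_form:
  "(\<Sum>i<n. \<Sum>j<n. u i * (k i j + (if i = j then lam else 0)) * u j) = (\<Sum>i<n. \<Sum>j<n. u i * k i j * u j) + lam * (\<Sum>j<n. (u j)\<^sup>2)"
proof -
  have "(\<Sum>i<n. \<Sum>j<n. u i * (k i j + (if i = j then lam else 0)) * u j)
      = (\<Sum>i<n. \<Sum>j<n. u i * k i j * u j + (if j = i then lam * (u i)\<^sup>2 else 0))"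
    by (intro sum.cong refl) (auto simp: algebra_simps power2_eq_square)
  then show ?thesis by (simp add: sum.distrib sum_distrib_left)
qed

text \<open>Testing the system with its solution p gives c |p|^2 \<le> E[F * feat z], where F is the
  feature combination with coefficients p. The second moments of F and of \<open>feat z\<close>
  bound the right-hand side, so |p| stays bounded although the vector of kernel values at z has n
  entries.\<close>

lemma limit_solution:
  assumes z: "good z"
  obtains p where "\<And>i. i < n \<Longrightarrow> (\<Sum>j<n. (K (col X i) (col X j) + (if i = j then lam else 0)) * p j) = K z (col X i)"
    "\<And>y. y \<in> carrier_vec n \<Longrightarrow> ridge_predictor K lam X y z = (\<Sum>j<n. p j * y $ j)"
    "(\<Sum>j<n. (p j)\<^sup>2) \<le> C\<^sup>2 / c\<^sup>2"
proof -
  have pd: "c * (\<Sum>i<n. (u i)\<^sup>2) \<le> (\<Sum>i<n. \<Sum>j<n. u i * (K (col X i) (col X j) + (if i = j then lam else 0)) * u j)" for u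
    unfolding ridge_form K_form using features_lower[of u] lam by (simp add: sum_nonneg add_increasing2)
  have sym: "K (col X i) (col X j) = K (col X j) (col X i)" if "i < n" "j < n" for i j
    using that by (simp add: K_eq col_carrier mult.commute)
  obtain p where p: "\<And>i. i < n \<Longrightarrow> (\<Sum>j<n. (K (col X i) (col X j) + (if i = j then lam else 0)) * p j) = K z (col X i)"
    "\<And>y. y \<in> carrier_vec n \<Longrightarrow> ridge_predictor K lam X y z = (\<Sum>j<n. p j * y $ j)"
    using ridge_predictor_solution[OF X sym c pd, of z] by blast
  define S where "S = (\<Sum>j<n. (p j)\<^sup>2)"
  define F where "F w = (\<Sum>j<n. p j * \<phi> j w)" for w
  have [measurable]: "F \<in> borel_measurable (gauss d)" unfolding F_def[abs_def] by measurable
  have gF: "exp_growth {..<d} F" unfolding F_def[abs_def] by (rule features_growth)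
  have int: "integrable (gauss d) (\<lambda>w. F w * feat z w)" "integrable (gauss d) (\<lambda>w. (F w)\<^sup>2)" "integrable (gauss d) (\<lambda>w. (feat z w)\<^sup>2)"
    by (intro integrable_gauss_exp_growth exp_growth_mult exp_growth_power feat_growth gF; measurable)+
  have zc: "z \<in> carrier_vec d" using z by (simp add: good_def)
  have "c * S \<le> (\<Sum>i<n. p i * (\<Sum>j<n. (K (col X i) (col X j) + (if i = j then lam else 0)) * p j))"
    using pd[of p] by (simp add: S_def sum_distrib_left mult_ac)
  also have "\<dots> = (\<Sum>i<n. p i * (\<integral>w. \<phi> i w * feat z w \<partial>gauss d))"
  proof (intro sum.cong refl)
    fix i assume "i \<in> {..<n}"
    then have i: "i < n" by simp
    have "K z (col X i) = (\<integral>w. \<phi> i w * feat z w \<partial>gauss d)"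
      unfolding K_eq[OF zc col_carrier[OF i]] by (simp add: mult.commute)
    then show "p i * (\<Sum>j<n. (K (col X i) (col X j) + (if i = j then lam else 0)) * p j) = p i * (\<integral>w. \<phi> i w * feat z w \<partial>gauss d)"
      by (simp only: p(1)[OF i])
  qed
  also have "\<dots> = (\<integral>w. F w * feat z w \<partial>gauss d)"
    unfolding F_def sum_distrib_right using integrable_feat_mult
    by (subst Bochner_Integration.integral_sum) (auto simp: mult.assoc)
  \<comment> \<open>Young's inequality with weight c / C: the second moment of F is at most C S, so
    its term is at most c S / 2 and is absorbed on the left.\<close>
  also have "\<dots> \<le> (\<integral>w. (c / C) / 2 * (F w)\<^sup>2 + (C / c) / 2 * (feat z w)\<^sup>2 \<partial>gauss d)"
  proof (rule integral_mono)
    fix w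
    have "0 \<le> (c / C) / 2 * (F w - (C / c) * feat z w)\<^sup>2" using c C by simp
    also have "\<dots> = (c / C) / 2 * (F w)\<^sup>2 + (C / c) / 2 * (feat z w)\<^sup>2 - F w * feat z w"
      using c C by (simp add: power2_eq_square field_simps)
    finally show "F w * feat z w \<le> (c / C) / 2 * (F w)\<^sup>2 + (C / c) / 2 * (feat z w)\<^sup>2" by simp
  qed (use int in auto)
  also have "\<dots> = (c / C) / 2 * (\<integral>w. (F w)\<^sup>2 \<partial>gauss d) + (C / c) / 2 * (\<integral>w. (feat z w)\<^sup>2 \<partial>gauss d)"
    using int by simp
  also have "\<dots> \<le> (c / C) / 2 * (C * S) + (C / c) / 2 * C"
    using c C features_second[of p] feat_second[OF z] unfolding F_def S_def
    by (intro add_mono mult_left_mono) auto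
  also have "\<dots> = c * S / 2 + C\<^sup>2 / (2 * c)" using C by (simp add: power2_eq_square)
  finally have "c * S \<le> C\<^sup>2 / c" by (simp add: field_simps)
  then have "S \<le> C\<^sup>2 / c\<^sup>2" using c by (simp add: power2_eq_square field_simps)
  with p show ?thesis by (intro that[of p]) (auto simp: S_def)
qed

text \<open>Bound on the mean square of a product: (u v)^2 \<le> (u^4 + v^4) / 2 and (s - t)^4 \<le>
  8 (s^4 + t^4), with fourth moments at most C for each of the two features and at most C (C^2 /
  c^2)^2 for the combination F.\<close>

definition "K0 = (C + 8 * (C + C * (C\<^sup>2 / c\<^sup>2)\<^sup>2)) / 2"

text \<open>\<open>\<psi>\<close> is a feature times the residual of \<open>feat z\<close> after
  subtraction of the combination with coefficients p. Its empirical mean minus its mean is one entry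
  of the right-hand side in the system for the difference of the coefficient vectors. The bound sees
  p through its norm, hence does not grow with n.\<close>

lemma deviation_second:
  assumes z: "good z" and p: "(\<Sum>j<n. (p j)\<^sup>2) \<le> C\<^sup>2 / c\<^sup>2" and a: "a < n"
  defines "\<psi> \<equiv> \<lambda>w. \<phi> a w * (feat z w - (\<Sum>b<n. p b * \<phi> b w))"
  shows "\<psi> \<in> borel_measurable (gauss d)" "integrable (gauss d) (\<lambda>w. (\<psi> w)\<^sup>2)" "(\<integral>w. (\<psi> w)\<^sup>2 \<partial>gauss d) \<le> K0"
    "(\<integral>w. \<psi> w \<partial>gauss d) = K z (col X a) - (\<Sum>b<n. K (col X a) (col X b) * p b)"
proof -
  define F where "F w = (\<Sum>b<n. p b * \<phi> b w)" for w
  have zc: "z \<in> carrier_vec d" using z by (simp add: good_def)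
  have [measurable]: "F \<in> borel_measurable (gauss d)" unfolding F_def[abs_def] by measurable
  have gF: "exp_growth {..<d} F" unfolding F_def[abs_def] by (rule features_growth)
  have \<psi>: "\<psi> w = \<phi> a w * (feat z w + (- 1) * F w)" for w by (simp add: \<psi>_def F_def)
  show m [measurable]: "\<psi> \<in> borel_measurable (gauss d)" unfolding \<psi>[abs_def] by measurable
  have g: "exp_growth {..<d} \<psi>"
    unfolding \<psi>[abs_def] by (intro exp_growth_mult exp_growth_add exp_growth_const feat_growth gF)
  show i: "integrable (gauss d) (\<lambda>w. (\<psi> w)\<^sup>2)"
    by (intro integrable_gauss_exp_growth exp_growth_power g; measurable)
  have i4: "integrable (gauss d) (\<lambda>w. F w ^ 4)" "(\<integral>w. F w ^ 4 \<partial>gauss d) \<le> C * (\<Sum>j<n. (p j)\<^sup>2)\<^sup>2"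
    using features_fourth[of p] by (simp_all add: F_def)
  have "C * (\<Sum>j<n. (p j)\<^sup>2)\<^sup>2 \<le> C * (C\<^sup>2 / c\<^sup>2)\<^sup>2"
    using p C by (intro mult_left_mono power_mono) (auto intro: sum_nonneg)
  with i4(2) have F4: "(\<integral>w. F w ^ 4 \<partial>gauss d) \<le> C * (C\<^sup>2 / c\<^sup>2)\<^sup>2" by linarith
  have "(\<integral>w. (\<psi> w)\<^sup>2 \<partial>gauss d) \<le> (\<integral>w. (\<phi> a w ^ 4 + 8 * (feat z w ^ 4 + F w ^ 4)) / 2 \<partial>gauss d)"
  proof (rule integral_mono)
    fix w
    have "(\<psi> w)\<^sup>2 = (\<phi> a w)\<^sup>2 * (feat z w - F w)\<^sup>2" unfolding \<psi> by (simp add: power_mult_distrib)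
    also have "\<dots> \<le> ((\<phi> a w)\<^sup>2)\<^sup>2 / 2 + ((feat z w - F w)\<^sup>2)\<^sup>2 / 2"
      using zero_le_power2[of "(\<phi> a w)\<^sup>2 - (feat z w - F w)\<^sup>2"]
      unfolding power2_diff[of "(\<phi> a w)\<^sup>2"] by simp
    also have "((feat z w - F w)\<^sup>2)\<^sup>2 \<le> 8 * (feat z w ^ 4 + F w ^ 4)"
      using power4_add_le[of "feat z w" "- F w"] by simp
    finally show "(\<psi> w)\<^sup>2 \<le> (\<phi> a w ^ 4 + 8 * (feat z w ^ 4 + F w ^ 4)) / 2" by (simp add: add_divide_distrib)
  qed (use i i4 \<phi>_fourth[OF a] feat_fourth[OF z] in auto)
  also have "\<dots> = ((\<integral>w. \<phi> a w ^ 4 \<partial>gauss d) + 8 * ((\<integral>w. feat z w ^ 4 \<partial>gauss d) + (\<integral>w. F w ^ 4 \<partial>gauss d))) / 2"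
    using i4 \<phi>_fourth[OF a] feat_fourth[OF z] by simp
  also have "\<dots> \<le> K0"
    unfolding K0_def using \<phi>_fourth(2)[OF a] feat_fourth(2)[OF z] F4 by simp
  finally show "(\<integral>w. (\<psi> w)\<^sup>2 \<partial>gauss d) \<le> K0" .
  have "(\<integral>w. \<psi> w \<partial>gauss d) = (\<integral>w. feat z w * \<phi> a w - (\<Sum>b<n. p b * (\<phi> a w * \<phi> b w)) \<partial>gauss d)"
    unfolding \<psi>_def by (intro Bochner_Integration.integral_cong refl) (simp add: algebra_simps sum_distrib_left)
  also have "\<dots> = K z (col X a) - (\<Sum>b<n. K (col X a) (col X b) * p b)"
    using integrable_feat_mult a
    by (subst Bochner_Integration.integral_diff)
       (auto simp: K_eq zc col_carrier mult_ac intro!: Bochner_Integration.integrable_sum)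
  finally show "(\<integral>w. \<psi> w \<partial>gauss d) = K z (col X a) - (\<Sum>b<n. K (col X a) (col X b) * p b)" .
qed

text \<open>The coefficient vectors p1 and p of the two predictors solve (k + lam) p1 = k z and
  (K + lam) p = K z, with k the empirical kernel. Their difference q solves (k + lam) q = r, where r
  collects centred empirical means of the n functions \<psi> of deviation_second.\<close>

lemma empirical_solution:
  assumes z: "good z" and Wc: "W \<in> carrier_mat m d" and m: "0 < m" and c1: "0 < c1"
    and lowW: "\<And>u. real m * (c1 * (\<Sum>j<n. (u j)\<^sup>2)) \<le> (\<Sum>i<m. (\<Sum>j<n. \<phi> j (\<lambda>l. W $$ (i, l)) * u j)\<^sup>2)"
    and p: "\<And>i. i < n \<Longrightarrow> (\<Sum>j<n. (K (col X i) (col X j) + (if i = j then lam else 0)) * p j) = K z (col X i)"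
    and pred: "\<And>y. y \<in> carrier_vec n \<Longrightarrow> ridge_predictor K lam X y z = (\<Sum>j<n. p j * y $ j)"
  obtains q where
    "\<And>y. y \<in> carrier_vec n \<Longrightarrow> ridge_predictor (rf_kernel \<sigma> W) lam X y z - ridge_predictor K lam X y z = (\<Sum>j<n. q j * y $ j)"
    "c1\<^sup>2 * (\<Sum>j<n. (q j)\<^sup>2) \<le> (\<Sum>a<n. ((\<Sum>i<m. \<phi> a (\<lambda>l. W $$ (i, l)) * (feat z (\<lambda>l. W $$ (i, l)) - (\<Sum>b<n. p b * \<phi> b (\<lambda>l. W $$ (i, l))))) / m
        - (K z (col X a) - (\<Sum>b<n. K (col X a) (col X b) * p b)))\<^sup>2)"
proof -
  let ?w = "\<lambda>i l. W $$ (i, l)"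
  let ?k = "rf_kernel \<sigma> W"
  have zc: "z \<in> carrier_vec d" using z by (simp add: good_def)
  have k_eq: "?k a b = (\<Sum>i<m. feat a (?w i) * feat b (?w i)) / m" if "a \<in> carrier_vec d" "b \<in> carrier_vec d" for a b
    unfolding feat_def by (rule rf_kernel_sum[OF Wc that])
  have sym: "?k (col X i) (col X j) = ?k (col X j) (col X i)" if "i < n" "j < n" for i j
    using that by (simp add: k_eq col_carrier mult.commute)
  have form: "(\<Sum>a<n. \<Sum>b<n. u a * ?k (col X a) (col X b) * u b) = (\<Sum>i<m. (\<Sum>j<n. \<phi> j (?w i) * u j)\<^sup>2) / m" for u
  proof -
    have "(\<Sum>i<m. (\<Sum>j<n. \<phi> j (?w i) * u j)\<^sup>2) = (\<Sum>i<m. \<Sum>a<n. \<Sum>b<n. u a * (\<phi> a (?w i) * \<phi> b (?w i)) * u b)"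
      unfolding power2_eq_square sum_product by (intro sum.cong refl) (simp add: mult_ac)
    also have "\<dots> = (\<Sum>a<n. \<Sum>b<n. \<Sum>i<m. u a * (\<phi> a (?w i) * \<phi> b (?w i)) * u b)"
      by (subst sum.swap) (intro sum.cong refl sum.swap)
    finally show ?thesis
      by (simp add: k_eq col_carrier sum_distrib_left sum_distrib_right sum_divide_distrib)
  qed
  have pd: "c1 * (\<Sum>i<n. (u i)\<^sup>2) \<le> (\<Sum>i<n. \<Sum>j<n. u i * (?k (col X i) (col X j) + (if i = j then lam else 0)) * u j)" for u
  proof -
    have "c1 * (\<Sum>i<n. (u i)\<^sup>2) \<le> (\<Sum>i<m. (\<Sum>j<n. \<phi> j (?w i) * u j)\<^sup>2) / m"
      using lowW[of u] m by (simp add: pos_le_divide_eq mult.commute)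
    moreover have "0 \<le> lam * (\<Sum>j<n. (u j)\<^sup>2)" using lam by (intro mult_nonneg_nonneg sum_nonneg) auto
    ultimately show ?thesis unfolding ridge_form form by linarith
  qed
  obtain p1 where p1: "\<And>i. i < n \<Longrightarrow> (\<Sum>j<n. (?k (col X i) (col X j) + (if i = j then lam else 0)) * p1 j) = ?k z (col X i)"
    "\<And>y. y \<in> carrier_vec n \<Longrightarrow> ridge_predictor ?k lam X y z = (\<Sum>j<n. p1 j * y $ j)"
    using ridge_predictor_solution[OF X sym c1 pd, of z] by blast
  define q where "q j = p1 j - p j" for j
  define r where "r a = (\<Sum>i<m. \<phi> a (?w i) * (feat z (?w i) - (\<Sum>b<n. p b * \<phi> b (?w i)))) / m
        - (K z (col X a) - (\<Sum>b<n. K (col X a) (col X b) * p b))" for a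
  \<comment> \<open>The summands lam * p a of the two systems cancel; what remains is an empirical
    mean minus its expectation.\<close>
  have r: "(\<Sum>j<n. (?k (col X a) (col X j) + (if a = j then lam else 0)) * q j) = r a" if a: "a < n" for a
  proof -
    have 1: "(\<Sum>j<n. (?k (col X a) (col X j) + (if a = j then lam else 0)) * p j)
        = (\<Sum>j<n. (K (col X a) (col X j) + (if a = j then lam else 0)) * p j)
          + (\<Sum>j<n. ?k (col X a) (col X j) * p j) - (\<Sum>j<n. K (col X a) (col X j) * p j)"
      by (simp add: sum.distrib[symmetric] sum_subtractf[symmetric] algebra_simps)
    have 2: "(\<Sum>i<m. \<phi> a (?w i) * (feat z (?w i) - (\<Sum>b<n. p b * \<phi> b (?w i)))) / m
        = ?k z (col X a) - (\<Sum>j<n. ?k (col X a) (col X j) * p j)"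
    proof -
      have "(\<Sum>j<n. ?k (col X a) (col X j) * p j) = (\<Sum>j<n. \<Sum>i<m. \<phi> a (?w i) * \<phi> j (?w i) * p j / m)"
        using a by (simp add: k_eq col_carrier sum_distrib_right sum_divide_distrib)
      also have "\<dots> = (\<Sum>i<m. \<phi> a (?w i) * (\<Sum>b<n. p b * \<phi> b (?w i))) / m"
        by (subst sum.swap) (simp add: sum_distrib_left sum_divide_distrib mult_ac)
      finally show ?thesis
        using a by (simp add: k_eq zc col_carrier right_diff_distrib sum_subtractf diff_divide_distrib mult.commute)
    qed
    have "(\<Sum>j<n. (?k (col X a) (col X j) + (if a = j then lam else 0)) * q j)
        = ?k z (col X a) - (\<Sum>j<n. (?k (col X a) (col X j) + (if a = j then lam else 0)) * p j)"
      unfolding q_def by (simp only: right_diff_distrib sum_subtractf p1(1)[OF a])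
    then show ?thesis unfolding r_def 1 2 p[OF a] by simp
  qed
  define S where "S = (\<Sum>j<n. (q j)\<^sup>2)"
  have S: "0 \<le> S" unfolding S_def by (simp add: sum_nonneg)
  \<comment> \<open>The system tested with its own solution: c1 |q|^2 \<le> <q, r> \<le> |q|
    |r|.\<close>
  have "c1 * S \<le> (\<Sum>a<n. q a * (\<Sum>j<n. (?k (col X a) (col X j) + (if a = j then lam else 0)) * q j))"
    using pd[of q] by (simp add: S_def sum_distrib_left mult.assoc)
  also have "\<dots> = (\<Sum>a<n. q a * r a)" by (intro sum.cong refl) (simp add: r)
  finally have "(c1 * S)\<^sup>2 \<le> (\<Sum>a<n. q a * r a)\<^sup>2" using c1 S by (intro power_mono) auto
  also have "\<dots> \<le> S * (\<Sum>a<n. (r a)\<^sup>2)" unfolding S_def by (rule sum_square_le)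
  finally have "S * (c1\<^sup>2 * S) \<le> S * (\<Sum>a<n. (r a)\<^sup>2)" by (simp add: power2_eq_square mult_ac)
  then have "c1\<^sup>2 * S \<le> (\<Sum>a<n. (r a)\<^sup>2)"
    using S by (cases "S = 0") (auto intro: sum_nonneg)
  then show ?thesis
    using pred p1(2) by (intro that[of q]) (auto simp: S_def r_def q_def sum_subtractf left_diff_distrib)
qed

end

lemma ennreal_double_add: "0 \<le> a \<Longrightarrow> 0 \<le> b \<Longrightarrow> 2 * ennreal a + 2 * ennreal b = ennreal (2 * a + 2 * b)"
  by (simp add: ennreal_mult' ennreal_plus)

subsection \<open>Comparison of the test errors\<close>

locale rf_model = gaussian_features n d X \<sigma> L B c lam
  for n d X \<sigma> L B c lam +
  fixes M :: "'w measure" and m :: nat and sb se :: real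
    and W :: "'w \<Rightarrow> rmat" and \<beta> \<eta> x :: "'w \<Rightarrow> rvec"
  assumes rand: "randomness_assumption M n d m sb se X W \<beta> \<eta> x"
    and x_good: "AE \<omega> in M. good (x \<omega>)"
    and dims: "0 < n" "0 < d" "0 < m"
begin

sublocale prob_space M
  using rand by (simp add: randomness_assumption_def)

text \<open>Matrices carry no \<sigma>-algebra, so the weights are transported to the product space
  \<open>WM\<close> of their entries: \<open>Wv\<close> is the passage to entries, \<open>Wm\<close>
  leads back to matrices, and \<open>V i\<close> reads off row i as a point of the space on which
  the features live.\<close>

definition "I = {..<m} \<times> {..<d}"
definition "WM = (\<Pi>\<^sub>M p\<in>I. std_normal)"
definition "Wv \<omega> = mat_entries m d (W \<omega>)"
definition "V i W' = (\<lambda>l\<in>{..<d}. W' (i, l) :: real)" for i :: nat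
definition "Wm W' = Matrix.mat m d W'" for W' :: "nat \<times> nat \<Rightarrow> real"

lemma I: "finite I" "I \<noteq> {}"
  using dims by (auto simp: I_def)

lemma W_carrier: "\<omega> \<in> space M \<Longrightarrow> W \<omega> \<in> carrier_mat m d"
  and \<beta>_gauss: "gaussian_vec M d sb \<beta>" and \<eta>_gauss: "gaussian_vec M n se \<eta>" and x_vec: "random_vec M d x"
  using rand by (simp_all add: randomness_assumption_def gaussian_weights_def)

lemma W_indep: "indep_vars (\<lambda>_. borel) (\<lambda>p \<omega>. W \<omega> $$ p) I"
  and W_law: "p \<in> I \<Longrightarrow> distr M borel (\<lambda>\<omega>. W \<omega> $$ p) = std_normal"
  using rand unfolding randomness_assumption_def gaussian_weights_def I_def by blast+

lemma \<beta>_vec: "\<omega> \<in> space M \<Longrightarrow> \<beta> \<omega> \<in> carrier_vec d" "l < d \<Longrightarrow> (\<lambda>\<omega>. \<beta> \<omega> $ l) \<in> borel_measurable M"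
  and \<eta>_vec: "\<omega> \<in> space M \<Longrightarrow> \<eta> \<omega> \<in> carrier_vec n" "j < n \<Longrightarrow> (\<lambda>\<omega>. \<eta> \<omega> $ j) \<in> borel_measurable M"
  and x_vec': "\<omega> \<in> space M \<Longrightarrow> x \<omega> \<in> carrier_vec d" "l < d \<Longrightarrow> (\<lambda>\<omega>. x \<omega> $ l) \<in> borel_measurable M"
  using \<beta>_gauss \<eta>_gauss x_vec by (auto simp: gaussian_vec_def random_vec_def)

lemma W_entry: "i < m \<Longrightarrow> l < d \<Longrightarrow> (\<lambda>\<omega>. W \<omega> $$ (i, l)) \<in> borel_measurable M"
  using W_indep by (auto simp: indep_vars_def I_def)

lemma mat_algebra_eq: "sets (mat_algebra m d) = sets WM"
  unfolding mat_algebra_def WM_def I_def by (intro sets_PiM_cong) auto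

lemma WM_law: "distr M (mat_algebra m d) Wv = WM"
proof -
  have rv: "random_variable borel (\<lambda>\<omega>. W \<omega> $$ p)" if "p \<in> I" for p
    using W_indep that unfolding indep_vars_def by blast
  have "distr M (\<Pi>\<^sub>M p\<in>I. borel) (\<lambda>\<omega>. \<lambda>p\<in>I. W \<omega> $$ p) = (\<Pi>\<^sub>M p\<in>I. distr M borel (\<lambda>\<omega>. W \<omega> $$ p))"
    using W_indep indep_vars_iff_distr_eq_PiM'[OF I(2), where M' = "\<lambda>_. borel" and X = "\<lambda>p \<omega>. W \<omega> $$ p"] rv by blast
  also have "\<dots> = WM"
    unfolding WM_def by (intro PiM_cong refl W_law)
  finally show ?thesis
    unfolding mat_algebra_def Wv_def mat_entries_def I_def .
qed

lemma prob_space_WM: "prob_space WM"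
  unfolding WM_def by (rule prob_space_gauss)

lemma Wm_Wv: "\<omega> \<in> space M \<Longrightarrow> Wm (Wv \<omega>) = W \<omega>"
  unfolding Wm_def Wv_def mat_entries_def using W_carrier[of \<omega>] by (intro eq_matI) auto

lemma Wm_carrier: "Wm W' \<in> carrier_mat m d"
  by (simp add: Wm_def)

lemma Wm_row: "i < m \<Longrightarrow> feat z (\<lambda>l. Wm W' $$ (i, l)) = feat z (V i W')"
  unfolding feat_def dotp_def V_def by (intro arg_cong[where f = \<sigma>] sum.cong refl) (simp add: Wm_def)

text \<open>Rows are disjoint blocks of independent coordinates; forgetting the row index carries
  each block to the same Gaussian product.\<close>

lemma WM_iid: "iid_sample WM (gauss d) V m"
proof -
  interpret WM: prob_space WM by (rule prob_space_WM)
  have comp: "(\<lambda>W'. W' p) \<in> WM \<rightarrow>\<^sub>M std_normal" if "p \<in> I" for p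
    unfolding WM_def using that by (rule measurable_component_singleton)
  have "WM.indep_vars (\<lambda>_. std_normal) (\<lambda>p W'. W' p) I"
  proof (subst WM.indep_vars_iff_distr_eq_PiM'[OF I(2) comp])
    have "distr WM WM (\<lambda>W'. \<lambda>p\<in>I. W' p) = distr WM WM (\<lambda>W'. W')"
      by (intro distr_cong refl) (auto simp: WM_def space_PiM PiE_iff extensional_restrict)
    also have "\<dots> = WM" by (rule distr_id)
    also have "WM = (\<Pi>\<^sub>M p\<in>I. distr WM std_normal (\<lambda>W'. W' p))"
      unfolding WM_def
    proof (intro PiM_cong refl)
      fix p assume "p \<in> I"
      then show "std_normal = distr (\<Pi>\<^sub>M p\<in>I. std_normal) std_normal (\<lambda>W'. W' p)"
        using distr_PiM_component[of I "\<lambda>_. std_normal" p] I(1) prob_space_std_normal by simp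
    qed
    finally show "distr WM (\<Pi>\<^sub>M p\<in>I. std_normal) (\<lambda>W'. \<lambda>p\<in>I. W' p) = (\<Pi>\<^sub>M p\<in>I. distr WM std_normal (\<lambda>W'. W' p))"
      by (simp add: WM_def)
  qed auto
  then have rows: "WM.indep_vars (\<lambda>i. \<Pi>\<^sub>M p\<in>{i} \<times> {..<d}. std_normal) (\<lambda>i W'. restrict (\<lambda>p. W' p) ({i} \<times> {..<d})) {..<m}"
    by (rule WM.indep_vars_restrict) (auto simp: I_def disjoint_family_on_def)
  have "WM.indep_vars (\<lambda>_. gauss d) (\<lambda>i W'. (\<lambda>g. \<lambda>l\<in>{..<d}. g (i, l)) (restrict (\<lambda>p. W' p) ({i} \<times> {..<d}))) {..<m}"
    by (rule WM.indep_vars_compose2[OF rows]) (intro measurable_restrict measurable_component_singleton, simp)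
  also have "(\<lambda>i W'. (\<lambda>g. \<lambda>l\<in>{..<d}. g (i, l)) (restrict (\<lambda>p. W' p) ({i} \<times> {..<d}))) = V"
    by (auto simp: V_def fun_eq_iff restrict_def)
  finally have ind: "WM.indep_vars (\<lambda>_. gauss d) V {..<m}" .
  have "distr WM (gauss d) (V i) = gauss d" if "i < m" for i
    unfolding WM_def V_def[abs_def]
    using distr_PiM_reindex[of I "\<lambda>_. std_normal" "\<lambda>l. (i, l)" "{..<d}"] prob_space_std_normal that
    by (auto simp: inj_on_def I_def)
  then show ?thesis
    using ind prob_space_gauss dims prob_space_WM by (intro iid_sample.intro iid_sample_axioms.intro) auto
qed

lemma indep: "indep_pair M (mat_algebra m d) Wv (vec_algebra d \<Otimes>\<^sub>M vec_algebra n \<Otimes>\<^sub>M vec_algebra d)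
    (\<lambda>\<omega>. (vec_entries d (\<beta> \<omega>), vec_entries n (\<eta> \<omega>), vec_entries d (x \<omega>)))"
  using rand unfolding randomness_assumption_def Wv_def[abs_def] by simp

abbreviation "y \<omega> \<equiv> labels X (\<beta> \<omega>) (\<eta> \<omega>)"

lemma y_carrier: "\<omega> \<in> space M \<Longrightarrow> y \<omega> \<in> carrier_vec n"
  by (rule labels_carrier[OF X \<eta>_vec(1)])

definition "Cy = 2 * sb\<^sup>2 * R\<^sup>2 + 2 * se\<^sup>2"

lemma Cy: "0 \<le> Cy"
  unfolding Cy_def by simp

text \<open>The pairing of q with the labels is the pairing of X q with \<beta> plus that of q with
  the noise, and |X q| \<le> R |q|; the factors 2 in \<open>Cy\<close> stem from (u + v)^2 \<le> 2
  u^2 + 2 v^2.\<close>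

lemma label_second_moment:
  "(\<integral>\<^sup>+\<omega>. ennreal ((\<Sum>b<n. q b * y \<omega> $ b)\<^sup>2) \<partial>M) \<le> ennreal (Cy * (\<Sum>b<n. (q b)\<^sup>2))"
proof -
  note [measurable] = \<beta>_vec(2) \<eta>_vec(2)
  define a where "a l = (\<Sum>b<n. X $$ (l, b) * q b)" for l
  have a: "(\<Sum>l<d. (a l)\<^sup>2) \<le> R\<^sup>2 * (\<Sum>b<n. (q b)\<^sup>2)"
    unfolding a_def using op[of q] mult_right_mono[OF R(2), of "\<Sum>b<n. (q b)\<^sup>2"] by (simp add: sum_nonneg)
  have eq: "(\<Sum>b<n. q b * y \<omega> $ b) = (\<Sum>l<d. a l * \<beta> \<omega> $ l) + (\<Sum>b<n. q b * \<eta> \<omega> $ b)" if \<omega>: "\<omega> \<in> space M" for \<omega>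
  proof -
    have "(\<Sum>b<n. q b * y \<omega> $ b) = (\<Sum>b<n. (\<Sum>l<d. q b * (X $$ (l, b) * \<beta> \<omega> $ l)) + q b * \<eta> \<omega> $ b)"
      by (intro sum.cong refl) (simp add: labels_index[OF X \<beta>_vec(1)[OF \<omega>] \<eta>_vec(1)[OF \<omega>]] distrib_left sum_distrib_left)
    also have "\<dots> = (\<Sum>l<d. \<Sum>b<n. q b * (X $$ (l, b) * \<beta> \<omega> $ l)) + (\<Sum>b<n. q b * \<eta> \<omega> $ b)"
      unfolding sum.distrib by (subst sum.swap) (rule refl)
    also have "(\<Sum>l<d. \<Sum>b<n. q b * (X $$ (l, b) * \<beta> \<omega> $ l)) = (\<Sum>l<d. a l * \<beta> \<omega> $ l)"
      unfolding a_def sum_distrib_right by (intro sum.cong refl) (simp add: mult_ac)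
    finally show ?thesis .
  qed
  have "(\<integral>\<^sup>+\<omega>. ennreal ((\<Sum>b<n. q b * y \<omega> $ b)\<^sup>2) \<partial>M)
      \<le> (\<integral>\<^sup>+\<omega>. 2 * ennreal ((\<Sum>l<d. a l * \<beta> \<omega> $ l)\<^sup>2) + 2 * ennreal ((\<Sum>b<n. q b * \<eta> \<omega> $ b)\<^sup>2) \<partial>M)"
  proof (rule nn_integral_mono)
    fix \<omega> assume \<omega>: "\<omega> \<in> space M"
    have "ennreal ((\<Sum>b<n. q b * y \<omega> $ b)\<^sup>2) \<le> ennreal (2 * (\<Sum>l<d. a l * \<beta> \<omega> $ l)\<^sup>2 + 2 * (\<Sum>b<n. q b * \<eta> \<omega> $ b)\<^sup>2)"
      unfolding eq[OF \<omega>] by (intro ennreal_leI square_add_le)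
    then show "ennreal ((\<Sum>b<n. q b * y \<omega> $ b)\<^sup>2) \<le> 2 * ennreal ((\<Sum>l<d. a l * \<beta> \<omega> $ l)\<^sup>2) + 2 * ennreal ((\<Sum>b<n. q b * \<eta> \<omega> $ b)\<^sup>2)"
      by (simp add: ennreal_mult')
  qed
  also have "\<dots> = 2 * ennreal (sb\<^sup>2 * (\<Sum>l<d. (a l)\<^sup>2)) + 2 * ennreal (se\<^sup>2 * (\<Sum>b<n. (q b)\<^sup>2))"
    by (simp add: nn_integral_add nn_integral_cmult gaussian_vec_linear[OF prob_space_axioms \<beta>_gauss]
        gaussian_vec_linear[OF prob_space_axioms \<eta>_gauss])
  also have "\<dots> = ennreal (2 * (sb\<^sup>2 * (\<Sum>l<d. (a l)\<^sup>2)) + 2 * (se\<^sup>2 * (\<Sum>b<n. (q b)\<^sup>2)))"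
    by (simp add: ennreal_mult' ennreal_plus sum_nonneg)
  also have "\<dots> \<le> ennreal (Cy * (\<Sum>b<n. (q b)\<^sup>2))"
  proof (rule ennreal_leI)
    have "sb\<^sup>2 * (\<Sum>l<d. (a l)\<^sup>2) \<le> sb\<^sup>2 * (R\<^sup>2 * (\<Sum>b<n. (q b)\<^sup>2))" by (intro mult_left_mono a) simp
    then show "2 * (sb\<^sup>2 * (\<Sum>l<d. (a l)\<^sup>2)) + 2 * (se\<^sup>2 * (\<Sum>b<n. (q b)\<^sup>2)) \<le> Cy * (\<Sum>b<n. (q b)\<^sup>2)"
      unfolding Cy_def by (simp add: algebra_simps)
  qed
  finally show ?thesis .
qed

definition "F1 W' yv z = ridge_predictor (rf_kernel \<sigma> (Wm W')) lam X yv z"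
definition "F2 yv z = ridge_predictor K lam X yv z"

text \<open>With the weights frozen in G the labels are averaged first, which leaves a multiple of
  |q|^2 and so of the sum of the squares of \<open>r a\<close>. Averaging over the weights then
  gives at most K0 / m for each of the n terms. Outside G no lower bound on the empirical kernel is
  available, hence the indicator.\<close>

lemma diff_bound:
  assumes G: "G \<in> sets WM" and c1: "0 < c1"
    and low: "\<And>W' u. W' \<in> G \<Longrightarrow> real m * (c1 * (\<Sum>j<n. (u j)\<^sup>2)) \<le> (\<Sum>i<m. (\<Sum>j<n. \<phi> j (V i W') * u j)\<^sup>2)"
    and z: "good z"
  shows "(\<integral>\<^sup>+W'. indicator G W' * (\<integral>\<^sup>+\<omega>. ennreal ((F1 W' (y \<omega>) z - F2 (y \<omega>) z)\<^sup>2) \<partial>M) \<partial>WM)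
    \<le> ennreal (Cy * K0 / c1\<^sup>2 * (real n / real m))"
proof -
  interpret S: iid_sample WM "gauss d" V m by (rule WM_iid)
  obtain p where p: "\<And>i. i < n \<Longrightarrow> (\<Sum>j<n. (K (col X i) (col X j) + (if i = j then lam else 0)) * p j) = K z (col X i)"
    "\<And>y. y \<in> carrier_vec n \<Longrightarrow> ridge_predictor K lam X y z = (\<Sum>j<n. p j * y $ j)"
    "(\<Sum>j<n. (p j)\<^sup>2) \<le> C\<^sup>2 / c\<^sup>2"
    using limit_solution[OF z] by blast
  define \<psi> where "\<psi> a w = \<phi> a w * (feat z w - (\<Sum>b<n. p b * \<phi> b w))" for a w
  have \<psi>: "\<psi> a \<in> borel_measurable (gauss d)" "integrable (gauss d) (\<lambda>w. (\<psi> a w)\<^sup>2)" "(\<integral>w. (\<psi> a w)\<^sup>2 \<partial>gauss d) \<le> K0"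
    "(\<integral>w. \<psi> a w \<partial>gauss d) = K z (col X a) - (\<Sum>b<n. K (col X a) (col X b) * p b)" if "a < n" for a
    using deviation_second[OF z p(3) that] by (simp_all add: \<psi>_def[abs_def])
  define r where "r a W' = (\<Sum>i<m. \<psi> a (V i W')) / m - (\<integral>w. \<psi> a w \<partial>gauss d)" for a W'
  have [measurable]: "r a \<in> borel_measurable WM" if "a < n" for a
    unfolding r_def using measurable_compose[OF S.V_measurable \<psi>(1)[OF that]] by measurable
  have "indicator G W' * (\<integral>\<^sup>+\<omega>. ennreal ((F1 W' (y \<omega>) z - F2 (y \<omega>) z)\<^sup>2) \<partial>M)
      \<le> ennreal (Cy / c1\<^sup>2 * (\<Sum>a<n. (r a W')\<^sup>2))" for W'
  proof (cases "W' \<in> G")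
    case True
    have low': "real m * (c1 * (\<Sum>j<n. (u j)\<^sup>2)) \<le> (\<Sum>i<m. (\<Sum>j<n. \<phi> j (\<lambda>l. Wm W' $$ (i, l)) * u j)\<^sup>2)" for u
    proof -
      have "(\<Sum>i<m. (\<Sum>j<n. \<phi> j (\<lambda>l. Wm W' $$ (i, l)) * u j)\<^sup>2) = (\<Sum>i<m. (\<Sum>j<n. \<phi> j (V i W') * u j)\<^sup>2)"
        by (intro sum.cong refl) (simp add: Wm_row)
      then show ?thesis using low[OF True, of u] by simp
    qed
    obtain q where q: "\<And>y. y \<in> carrier_vec n \<Longrightarrow> F1 W' y z - F2 y z = (\<Sum>j<n. q j * y $ j)"
      and qr: "c1\<^sup>2 * (\<Sum>j<n. (q j)\<^sup>2) \<le> (\<Sum>a<n. ((\<Sum>i<m. \<phi> a (\<lambda>l. Wm W' $$ (i, l)) * (feat z (\<lambda>l. Wm W' $$ (i, l)) - (\<Sum>b<n. p b * \<phi> b (\<lambda>l. Wm W' $$ (i, l))))) / m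
        - (K z (col X a) - (\<Sum>b<n. K (col X a) (col X b) * p b)))\<^sup>2)"
      unfolding F1_def F2_def using empirical_solution[OF z Wm_carrier dims(3) c1 low' p(1,2)] by blast
    have "(\<Sum>a<n. ((\<Sum>i<m. \<phi> a (\<lambda>l. Wm W' $$ (i, l)) * (feat z (\<lambda>l. Wm W' $$ (i, l)) - (\<Sum>b<n. p b * \<phi> b (\<lambda>l. Wm W' $$ (i, l))))) / m
        - (K z (col X a) - (\<Sum>b<n. K (col X a) (col X b) * p b)))\<^sup>2) = (\<Sum>a<n. (r a W')\<^sup>2)"
    proof (intro sum.cong refl)
      fix a assume "a \<in> {..<n}"
      then have a: "a < n" by simp
      show "((\<Sum>i<m. \<phi> a (\<lambda>l. Wm W' $$ (i, l)) * (feat z (\<lambda>l. Wm W' $$ (i, l)) - (\<Sum>b<n. p b * \<phi> b (\<lambda>l. Wm W' $$ (i, l))))) / m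
        - (K z (col X a) - (\<Sum>b<n. K (col X a) (col X b) * p b)))\<^sup>2 = (r a W')\<^sup>2"
        unfolding r_def \<psi>(4)[OF a] by (simp add: \<psi>_def Wm_row)
    qed
    with qr have "(\<Sum>j<n. (q j)\<^sup>2) \<le> (\<Sum>a<n. (r a W')\<^sup>2) / c1\<^sup>2"
      using c1 by (simp add: pos_le_divide_eq mult.commute)
    then have "Cy * (\<Sum>j<n. (q j)\<^sup>2) \<le> Cy * ((\<Sum>a<n. (r a W')\<^sup>2) / c1\<^sup>2)"
      by (rule mult_left_mono[OF _ Cy])
    moreover have "(\<integral>\<^sup>+\<omega>. ennreal ((F1 W' (y \<omega>) z - F2 (y \<omega>) z)\<^sup>2) \<partial>M) = (\<integral>\<^sup>+\<omega>. ennreal ((\<Sum>b<n. q b * y \<omega> $ b)\<^sup>2) \<partial>M)"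
      by (intro nn_integral_cong) (simp add: q y_carrier)
    ultimately show ?thesis
      using True order.trans[OF label_second_moment[of q] ennreal_leI] by simp
  qed simp
  then have "(\<integral>\<^sup>+W'. indicator G W' * (\<integral>\<^sup>+\<omega>. ennreal ((F1 W' (y \<omega>) z - F2 (y \<omega>) z)\<^sup>2) \<partial>M) \<partial>WM)
      \<le> (\<integral>\<^sup>+W'. ennreal (Cy / c1\<^sup>2 * (\<Sum>a<n. (r a W')\<^sup>2)) \<partial>WM)"
    by (intro nn_integral_mono)
  also have "\<dots> = ennreal (\<integral>W'. Cy / c1\<^sup>2 * (\<Sum>a<n. (r a W')\<^sup>2) \<partial>WM)"
  proof (intro nn_integral_eq_integral integrable_mult_right Bochner_Integration.integrable_sum)
    show "integrable WM (\<lambda>W'. (r a W')\<^sup>2)" if "a \<in> {..<n}" for a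
      unfolding r_def using that by (intro S.mean_square_deviation(1) \<psi>(1,2)) auto
    show "AE W' in WM. 0 \<le> Cy / c1\<^sup>2 * (\<Sum>a<n. (r a W')\<^sup>2)"
      using Cy by (intro AE_I2 mult_nonneg_nonneg sum_nonneg divide_nonneg_nonneg) auto
  qed
  also have "\<dots> \<le> ennreal (Cy * K0 / c1\<^sup>2 * (real n / real m))"
  proof (rule ennreal_leI)
    have "(\<integral>W'. (\<Sum>a<n. (r a W')\<^sup>2) \<partial>WM) = (\<Sum>a<n. \<integral>W'. (r a W')\<^sup>2 \<partial>WM)"
      using S.mean_square_deviation(1)[OF \<psi>(1,2)] by (subst Bochner_Integration.integral_sum) (auto simp: r_def)
    also have "\<dots> \<le> (\<Sum>a<n. K0 / m)"
    proof (rule sum_mono)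
      fix a assume "a \<in> {..<n}"
      then have a: "a < n" by simp
      have "(\<integral>W'. (r a W')\<^sup>2 \<partial>WM) \<le> (\<integral>w. (\<psi> a w)\<^sup>2 \<partial>gauss d) / m"
        unfolding r_def by (rule S.mean_square_deviation(2)[OF \<psi>(1)[OF a] \<psi>(2)[OF a]])
      also have "\<dots> \<le> K0 / m" by (intro divide_right_mono \<psi>(3) a) simp
      finally show "(\<integral>W'. (r a W')\<^sup>2 \<partial>WM) \<le> K0 / m" .
    qed
    finally have "(\<integral>W'. (\<Sum>a<n. (r a W')\<^sup>2) \<partial>WM) \<le> n * (K0 / m)" by simp
    then have "Cy / c1\<^sup>2 * (\<integral>W'. (\<Sum>a<n. (r a W')\<^sup>2) \<partial>WM) \<le> Cy / c1\<^sup>2 * (n * (K0 / m))"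
      using Cy by (intro mult_left_mono) auto
    then show "(\<integral>W'. Cy / c1\<^sup>2 * (\<Sum>a<n. (r a W')\<^sup>2) \<partial>WM) \<le> Cy * K0 / c1\<^sup>2 * (real n / real m)"
      by (simp add: mult_ac)
  qed
  finally show ?thesis .
qed

definition "K2 = 2 * Cy * (C\<^sup>2 / c\<^sup>2) + 2 * sb\<^sup>2 * R\<^sup>2"

text \<open>Boundedness of the coefficient vector p makes the error of the limit predictor bounded
  in mean square; this error multiplies the difference of the predictors in the cross term of the
  risks.\<close>

lemma kernel_risk_bound:
  assumes z: "good z"
  shows "(\<integral>\<^sup>+\<omega>. ennreal ((F2 (y \<omega>) z - \<beta> \<omega> \<bullet> z)\<^sup>2) \<partial>M) \<le> ennreal K2"
proof -
  note [measurable] = \<beta>_vec(2) labels_measurable[OF X \<beta>_vec \<eta>_vec]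
  have zc: "z \<in> carrier_vec d" using z by (simp add: good_def)
  obtain p where p: "\<And>y. y \<in> carrier_vec n \<Longrightarrow> ridge_predictor K lam X y z = (\<Sum>j<n. p j * y $ j)"
    "(\<Sum>j<n. (p j)\<^sup>2) \<le> C\<^sup>2 / c\<^sup>2"
    using limit_solution[OF z] by blast
  have "(\<integral>\<^sup>+\<omega>. ennreal ((F2 (y \<omega>) z - \<beta> \<omega> \<bullet> z)\<^sup>2) \<partial>M)
      \<le> (\<integral>\<^sup>+\<omega>. 2 * ennreal ((\<Sum>b<n. p b * y \<omega> $ b)\<^sup>2) + 2 * ennreal ((\<Sum>l<d. z $ l * \<beta> \<omega> $ l)\<^sup>2) \<partial>M)"
  proof (rule nn_integral_mono)
    fix \<omega> assume \<omega>: "\<omega> \<in> space M"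
    have "F2 (y \<omega>) z - \<beta> \<omega> \<bullet> z = (\<Sum>b<n. p b * y \<omega> $ b) + - (\<Sum>l<d. z $ l * \<beta> \<omega> $ l)"
      unfolding F2_def by (simp add: p(1) y_carrier[OF \<omega>] scalar_prod_sum[OF zc] mult.commute)
    then have "(F2 (y \<omega>) z - \<beta> \<omega> \<bullet> z)\<^sup>2 \<le> 2 * (\<Sum>b<n. p b * y \<omega> $ b)\<^sup>2 + 2 * (\<Sum>l<d. z $ l * \<beta> \<omega> $ l)\<^sup>2"
      using square_add_le[of "\<Sum>b<n. p b * y \<omega> $ b" "- (\<Sum>l<d. z $ l * \<beta> \<omega> $ l)"] by simp
    then have "ennreal ((F2 (y \<omega>) z - \<beta> \<omega> \<bullet> z)\<^sup>2) \<le> ennreal (2 * (\<Sum>b<n. p b * y \<omega> $ b)\<^sup>2 + 2 * (\<Sum>l<d. z $ l * \<beta> \<omega> $ l)\<^sup>2)"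
      by (rule ennreal_leI)
    then show "ennreal ((F2 (y \<omega>) z - \<beta> \<omega> \<bullet> z)\<^sup>2) \<le> 2 * ennreal ((\<Sum>b<n. p b * y \<omega> $ b)\<^sup>2) + 2 * ennreal ((\<Sum>l<d. z $ l * \<beta> \<omega> $ l)\<^sup>2)"
      by (simp add: ennreal_mult')
  qed
  also have "\<dots> = 2 * (\<integral>\<^sup>+\<omega>. ennreal ((\<Sum>b<n. p b * y \<omega> $ b)\<^sup>2) \<partial>M) + 2 * ennreal (sb\<^sup>2 * (\<Sum>l<d. (z $ l)\<^sup>2))"
    by (simp add: nn_integral_add nn_integral_cmult gaussian_vec_linear[OF prob_space_axioms \<beta>_gauss])
  also have "\<dots> \<le> 2 * ennreal (Cy * (C\<^sup>2 / c\<^sup>2)) + 2 * ennreal (sb\<^sup>2 * R\<^sup>2)"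
  proof (intro add_mono mult_left_mono)
    show "(\<integral>\<^sup>+\<omega>. ennreal ((\<Sum>b<n. p b * y \<omega> $ b)\<^sup>2) \<partial>M) \<le> ennreal (Cy * (C\<^sup>2 / c\<^sup>2))"
      using order.trans[OF label_second_moment ennreal_leI[OF mult_left_mono[OF p(2) Cy]]] .
    show "ennreal (sb\<^sup>2 * (\<Sum>l<d. (z $ l)\<^sup>2)) \<le> ennreal (sb\<^sup>2 * R\<^sup>2)"
      by (intro ennreal_leI mult_left_mono good_norm z) simp
  qed auto
  also have "\<dots> = ennreal K2"
    unfolding K2_def using Cy by (subst ennreal_double_add) (auto simp: mult.assoc)
  finally show ?thesis .
qed

section \<open>Boundedness and measurability of the test errors\<close>

lemma dotp_abs_le: "\<bar>dotp d v z\<bar> \<le> sqrt (\<Sum>l<d. (v l)\<^sup>2) * sqrt (\<Sum>l<d. (z l)\<^sup>2)"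
proof -
  have "(dotp d v z)\<^sup>2 \<le> (\<Sum>l<d. (v l)\<^sup>2) * (\<Sum>l<d. (z l)\<^sup>2)"
    unfolding dotp_def by (rule sum_square_le)
  then have "sqrt ((dotp d v z)\<^sup>2) \<le> sqrt ((\<Sum>l<d. (v l)\<^sup>2) * (\<Sum>l<d. (z l)\<^sup>2))"
    by (rule real_sqrt_le_mono)
  then show ?thesis by (simp add: real_sqrt_mult)
qed

text \<open>A qualitative bound, depending on the weights and labels: almost every test point is
  good, so the squared errors are integrable over it and the Bochner integrals in the test errors
  are genuine.\<close>

lemma predictor_bounded:
  assumes y: "yv \<in> carrier_vec n" and k: "\<And>j. j < n \<Longrightarrow> \<exists>b. \<forall>z. good z \<longrightarrow> \<bar>k z (col X j)\<bar> \<le> b"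
  shows "\<exists>b. \<forall>z. good z \<longrightarrow> \<bar>ridge_predictor k lam X yv z\<bar> \<le> b"
proof -
  obtain b where b: "\<And>j z. j < n \<Longrightarrow> good z \<Longrightarrow> \<bar>k z (col X j)\<bar> \<le> b j"
    using k by metis
  let ?q = "\<lambda>a. \<Sum>j<n. minv (gram k lam X) $$ (a, j) * yv $ j"
  have "\<bar>ridge_predictor k lam X yv z\<bar> \<le> (\<Sum>a<n. b a * \<bar>?q a\<bar>)" if "good z" for z
    unfolding ridge_predictor_sum[OF X y] using b that
    by (intro order.trans[OF sum_abs] sum_mono) (auto simp: abs_mult intro!: mult_right_mono)
  then show ?thesis by blast
qed

lemma rf_kernel_bounded:
  assumes Wc: "W' \<in> carrier_mat m d" and j: "j < n"
  shows "\<exists>b. \<forall>z. good z \<longrightarrow> \<bar>rf_kernel \<sigma> W' z (col X j)\<bar> \<le> b"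
proof -
  have L: "0 \<le> L" using lip[of 1 0] by simp
  let ?w = "\<lambda>i l. W' $$ (i, l)"
  let ?h = "\<lambda>i. (\<bar>\<sigma> 0\<bar> + L * (sqrt (\<Sum>l<d. (?w i l)\<^sup>2) * R)) * \<bar>\<sigma> (dotp d (?w i) (\<lambda>l. col X j $ l))\<bar>"
  have "\<bar>rf_kernel \<sigma> W' z (col X j)\<bar> \<le> (\<Sum>i<m. ?h i) / m" if z: "good z" for z
  proof -
    have zc: "z \<in> carrier_vec d" using z by (simp add: good_def)
    have "\<bar>\<sigma> (dotp d (?w i) (\<lambda>l. z $ l))\<bar> \<le> \<bar>\<sigma> 0\<bar> + L * (sqrt (\<Sum>l<d. (?w i l)\<^sup>2) * R)" for i
    proof -
      have "sqrt (\<Sum>l<d. (z $ l)\<^sup>2) \<le> R"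
        using good_norm[OF z] R(1) by (intro real_le_lsqrt) (auto intro: sum_nonneg)
      then have "\<bar>dotp d (?w i) (\<lambda>l. z $ l)\<bar> \<le> sqrt (\<Sum>l<d. (?w i l)\<^sup>2) * R"
        by (intro order.trans[OF dotp_abs_le] mult_left_mono) (auto intro: sum_nonneg)
      then have "L * \<bar>dotp d (?w i) (\<lambda>l. z $ l)\<bar> \<le> L * (sqrt (\<Sum>l<d. (?w i l)\<^sup>2) * R)"
        using L by (rule mult_left_mono)
      then show ?thesis using lip[of "dotp d (?w i) (\<lambda>l. z $ l)" 0] by simp
    qed
    then show ?thesis
      unfolding rf_kernel_sum[OF Wc zc col_carrier[OF j]] abs_divide
      by (simp, intro divide_right_mono order.trans[OF sum_abs] sum_mono) (auto simp: abs_mult intro!: mult_right_mono)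
  qed
  then show ?thesis by blast
qed

lemma limit_kernel_bounded:
  assumes j: "j < n"
  shows "\<exists>b. \<forall>z. good z \<longrightarrow> \<bar>K z (col X j)\<bar> \<le> b"
proof (intro exI[of _ C] allI impI)
  fix z assume z: "good z"
  then have zc: "z \<in> carrier_vec d" by (simp add: good_def)
  have sq: "integrable (gauss d) (\<lambda>w. (feat a w)\<^sup>2)" for a
    by (intro integrable_gauss_exp_growth exp_growth_power feat_growth; measurable)
  have "\<bar>K z (col X j)\<bar> \<le> (\<integral>w. \<bar>feat z w * \<phi> j w\<bar> \<partial>gauss d)"
    unfolding K_eq[OF zc col_carrier[OF j]] by (rule integral_abs_bound)
  also have "\<dots> \<le> (\<integral>w. (feat z w)\<^sup>2 / 2 + (\<phi> j w)\<^sup>2 / 2 \<partial>gauss d)"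
  proof (rule integral_mono)
    fix w
    show "\<bar>feat z w * \<phi> j w\<bar> \<le> (feat z w)\<^sup>2 / 2 + (\<phi> j w)\<^sup>2 / 2"
      using zero_le_power2[of "\<bar>feat z w\<bar> - \<bar>\<phi> j w\<bar>"] by (simp add: power2_diff abs_mult)
  qed (use sq integrable_feat_mult in auto)
  also have "\<dots> \<le> C"
    using sq feat_second[OF z] \<phi>_second[OF j] by simp
  finally show "\<bar>K z (col X j)\<bar> \<le> C" .
qed

lemma target_bounded: "\<beta>v \<in> carrier_vec d \<Longrightarrow> \<exists>b. \<forall>z. good z \<longrightarrow> \<bar>\<beta>v \<bullet> z\<bar> \<le> b"
proof (intro exI allI impI)
  fix z assume z: "good z"
  then have zc: "z \<in> carrier_vec d" by (simp add: good_def)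
  have "sqrt (\<Sum>l<d. (z $ l)\<^sup>2) \<le> R"
    using good_norm[OF z] R(1) by (intro real_le_lsqrt) (auto intro: sum_nonneg)
  then have "sqrt (\<Sum>l<d. (\<beta>v $ l)\<^sup>2) * sqrt (\<Sum>l<d. (z $ l)\<^sup>2) \<le> sqrt (\<Sum>l<d. (\<beta>v $ l)\<^sup>2) * R"
    by (intro mult_left_mono) (auto intro: sum_nonneg)
  then show "\<bar>\<beta>v \<bullet> z\<bar> \<le> sqrt (\<Sum>l<d. (\<beta>v $ l)\<^sup>2) * R"
    using dotp_abs_le[of "\<lambda>l. \<beta>v $ l" "\<lambda>l. z $ l"] unfolding scalar_prod_sum[OF zc] dotp_def by linarith
qed

lemma F1_measurable:
  assumes Wf: "\<And>i l. i < m \<Longrightarrow> l < d \<Longrightarrow> (\<lambda>\<omega>. Wf \<omega> (i, l)) \<in> borel_measurable N"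
    and yf: "\<And>\<omega>. \<omega> \<in> space N \<Longrightarrow> yf \<omega> \<in> carrier_vec n" "\<And>j. j < n \<Longrightarrow> (\<lambda>\<omega>. yf \<omega> $ j) \<in> borel_measurable N"
    and zf: "\<And>\<omega>. \<omega> \<in> space N \<Longrightarrow> zf \<omega> \<in> carrier_vec d" "\<And>l. l < d \<Longrightarrow> (\<lambda>\<omega>. zf \<omega> $ l) \<in> borel_measurable N"
  shows "(\<lambda>\<omega>. F1 (Wf \<omega>) (yf \<omega>) (zf \<omega>)) \<in> borel_measurable N"
    and "(\<lambda>\<omega>. F2 (yf \<omega>) (zf \<omega>)) \<in> borel_measurable N"
proof -
  have We: "(\<lambda>\<omega>. Wm (Wf \<omega>) $$ (i, l)) \<in> borel_measurable N" if "i < m" "l < d" for i l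
    using Wf[OF that] that by (simp add: Wm_def)
  show "(\<lambda>\<omega>. F1 (Wf \<omega>) (yf \<omega>) (zf \<omega>)) \<in> borel_measurable N"
    unfolding F1_def using zf
    by (intro ridge_predictor_measurable[OF X yf] rf_kernel_measurable[OF \<sigma>_measurable Wm_carrier We])
       (auto intro: col_carrier)
  show "(\<lambda>\<omega>. F2 (yf \<omega>) (zf \<omega>)) \<in> borel_measurable N"
    unfolding F2_def using zf
    by (intro ridge_predictor_measurable[OF X yf] limit_kernel_measurable[OF \<sigma>_measurable] borel_measurable_const)
       (auto intro: col_carrier)
qed

definition "L1 \<omega> = rf_test_error M x \<sigma> lam X (W \<omega>) (\<beta> \<omega>) (\<eta> \<omega>)"
definition "L2 \<omega> = kernel_test_error M x \<sigma> lam X (\<beta> \<omega>) (\<eta> \<omega>)"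

lemma measurable_fst_comp: "f \<in> borel_measurable M \<Longrightarrow> (\<lambda>p. f (fst p)) \<in> borel_measurable (M \<Otimes>\<^sub>M M)"
  and measurable_snd_comp: "f \<in> borel_measurable M \<Longrightarrow> (\<lambda>p. f (snd p)) \<in> borel_measurable (M \<Otimes>\<^sub>M M)"
  for f :: "'w \<Rightarrow> real"
  by (rule measurable_compose[OF measurable_fst], assumption)
    (rule measurable_compose[OF measurable_snd], assumption)

text \<open>The first outcome of a pair supplies weights, target and labels, the second the test
  point; the test error freezes the first and integrates over the second.\<close>

lemma joint_measurable:
  "(\<lambda>p. F1 (Wv (fst p)) (y (fst p)) (x (snd p))) \<in> borel_measurable (M \<Otimes>\<^sub>M M)"
  "(\<lambda>p. F2 (y (fst p)) (x (snd p))) \<in> borel_measurable (M \<Otimes>\<^sub>M M)"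
  "(\<lambda>p. \<beta> (fst p) \<bullet> x (snd p)) \<in> borel_measurable (M \<Otimes>\<^sub>M M)"
proof -
  have We: "(\<lambda>\<omega>. Wv \<omega> (i, l)) \<in> borel_measurable M" if "i < m" "l < d" for i l
    using W_entry[OF that] that by (simp add: Wv_def mat_entries_def)
  note yl = labels_measurable[OF X \<beta>_vec \<eta>_vec]
  have yc: "y (fst p) \<in> carrier_vec n" and xc: "x (snd p) \<in> carrier_vec d" if "p \<in> space (M \<Otimes>\<^sub>M M)" for p
    using that y_carrier x_vec'(1) by (auto simp: space_pair_measure)
  note parts = measurable_fst_comp[OF We] yc measurable_fst_comp[OF yl] xc measurable_snd_comp[OF x_vec'(2)]
  show "(\<lambda>p. F1 (Wv (fst p)) (y (fst p)) (x (snd p))) \<in> borel_measurable (M \<Otimes>\<^sub>M M)"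
    by (rule F1_measurable(1)) (simp_all only: parts)
  show "(\<lambda>p. F2 (y (fst p)) (x (snd p))) \<in> borel_measurable (M \<Otimes>\<^sub>M M)"
    by (rule F1_measurable(2)[where Wf = "\<lambda>p. Wv (fst p)"]) (simp_all only: parts)
  have "(\<lambda>p. \<beta> (fst p) \<bullet> x (snd p)) \<in> borel_measurable (M \<Otimes>\<^sub>M M) \<longleftrightarrow>
      (\<lambda>p. \<Sum>l<d. \<beta> (fst p) $ l * x (snd p) $ l) \<in> borel_measurable (M \<Otimes>\<^sub>M M)"
    by (intro measurable_cong scalar_prod_sum) (auto simp: space_pair_measure intro: x_vec')
  also have "\<dots>"
    by (intro borel_measurable_sum borel_measurable_times measurable_fst_comp measurable_snd_comp \<beta>_vec x_vec') auto
  finally show "(\<lambda>p. \<beta> (fst p) \<bullet> x (snd p)) \<in> borel_measurable (M \<Otimes>\<^sub>M M)" .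
qed

lemma L1_eq: "\<omega> \<in> space M \<Longrightarrow> L1 \<omega> = (\<integral>\<omega>'. (F1 (Wv \<omega>) (y \<omega>) (x \<omega>') - \<beta> \<omega> \<bullet> x \<omega>')\<^sup>2 \<partial>M)"
  unfolding L1_def rf_test_error_def test_error_def F1_def by (simp add: Wm_Wv)

lemma L2_eq: "L2 \<omega> = (\<integral>\<omega>'. (F2 (y \<omega>) (x \<omega>') - \<beta> \<omega> \<bullet> x \<omega>')\<^sup>2 \<partial>M)"
  unfolding L2_def kernel_test_error_def test_error_def F2_def using X by simp

lemma L_measurable: "L1 \<in> borel_measurable M" "L2 \<in> borel_measurable M"
proof -
  note [measurable] = joint_measurable
  have "(\<lambda>\<omega>. \<integral>\<omega>'. (F1 (Wv \<omega>) (y \<omega>) (x \<omega>') - \<beta> \<omega> \<bullet> x \<omega>')\<^sup>2 \<partial>M) \<in> borel_measurable M"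
    by (intro borel_measurable_lebesgue_integral) (simp add: case_prod_beta')
  then show "L1 \<in> borel_measurable M"
    by (subst measurable_cong[OF L1_eq]) auto
  show "L2 \<in> borel_measurable M"
    unfolding L2_eq[abs_def] by (intro borel_measurable_lebesgue_integral) (simp add: case_prod_beta')
qed

text \<open>With a the difference of the predictors and b the error of the limit predictor, the
  squared errors differ by a^2 + 2 a b, and Young's inequality with a free t separates the two. The
  later choice t = sqrt (n / m) balances a mean square of order n / m against a bounded one.\<close>

lemma risk_difference_le:
  assumes \<omega>: "\<omega> \<in> space M" and t: "0 < t"
  shows "ennreal \<bar>L1 \<omega> - L2 \<omega>\<bar> \<le> ennreal (1 + 1 / t) * (\<integral>\<^sup>+\<omega>'. ennreal ((F1 (Wv \<omega>) (y \<omega>) (x \<omega>') - F2 (y \<omega>) (x \<omega>'))\<^sup>2) \<partial>M)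
      + ennreal t * (\<integral>\<^sup>+\<omega>'. ennreal ((F2 (y \<omega>) (x \<omega>') - \<beta> \<omega> \<bullet> x \<omega>')\<^sup>2) \<partial>M)"
proof -
  define f1 f2 g where "f1 \<omega>' = F1 (Wv \<omega>) (y \<omega>) (x \<omega>')" and "f2 \<omega>' = F2 (y \<omega>) (x \<omega>')" and "g \<omega>' = \<beta> \<omega> \<bullet> x \<omega>'" for \<omega>'
  have sec: "(\<lambda>\<omega>'. (\<omega>, \<omega>')) \<in> M \<rightarrow>\<^sub>M M \<Otimes>\<^sub>M M" using \<omega> by (rule measurable_Pair1')
  have [measurable]: "f1 \<in> borel_measurable M" "f2 \<in> borel_measurable M" "g \<in> borel_measurable M"
    using measurable_compose[OF sec joint_measurable(1)] measurable_compose[OF sec joint_measurable(2)]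
      measurable_compose[OF sec joint_measurable(3)]
    by (simp_all add: f1_def[abs_def] f2_def[abs_def] g_def[abs_def])
  obtain b1 where b1: "\<And>z. good z \<Longrightarrow> \<bar>F1 (Wv \<omega>) (y \<omega>) z\<bar> \<le> b1"
    using predictor_bounded[OF y_carrier[OF \<omega>], of "rf_kernel \<sigma> (Wm (Wv \<omega>))"] rf_kernel_bounded[OF Wm_carrier]
    unfolding F1_def by blast
  obtain b2 where b2: "\<And>z. good z \<Longrightarrow> \<bar>F2 (y \<omega>) z\<bar> \<le> b2"
    using predictor_bounded[OF y_carrier[OF \<omega>], of K] limit_kernel_bounded unfolding F2_def by blast
  obtain b3 where b3: "\<And>z. good z \<Longrightarrow> \<bar>\<beta> \<omega> \<bullet> z\<bar> \<le> b3"
    using target_bounded[OF \<beta>_vec(1)[OF \<omega>]] by blast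
  have ae: "AE \<omega>' in M. \<bar>f1 \<omega>'\<bar> \<le> b1 \<and> \<bar>f2 \<omega>'\<bar> \<le> b2 \<and> \<bar>g \<omega>'\<bar> \<le> b3"
    using x_good by eventually_elim (simp add: f1_def f2_def g_def b1 b2 b3)
  have sq: "integrable M (\<lambda>\<omega>'. (h \<omega>')\<^sup>2)" if [measurable]: "h \<in> borel_measurable M" and "AE \<omega>' in M. \<bar>h \<omega>'\<bar> \<le> b" for h :: "'w \<Rightarrow> real" and b
  proof (rule integrable_const_bound)
    show "AE \<omega>' in M. norm ((h \<omega>')\<^sup>2) \<le> b\<^sup>2"
      using that(2)
    proof eventually_elim
      case (elim \<omega>')
      then show ?case using power_mono[OF elim, of 2] by simp
    qed
  qed measurable
  have i1: "integrable M (\<lambda>\<omega>'. (f1 \<omega>' - g \<omega>')\<^sup>2)"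
  proof (rule sq)
    show "AE \<omega>' in M. \<bar>f1 \<omega>' - g \<omega>'\<bar> \<le> b1 + b3" using ae by eventually_elim linarith
  qed measurable
  have i2: "integrable M (\<lambda>\<omega>'. (f2 \<omega>' - g \<omega>')\<^sup>2)"
  proof (rule sq)
    show "AE \<omega>' in M. \<bar>f2 \<omega>' - g \<omega>'\<bar> \<le> b2 + b3" using ae by eventually_elim linarith
  qed measurable
  have i12: "integrable M (\<lambda>\<omega>'. (f1 \<omega>' - f2 \<omega>')\<^sup>2)"
  proof (rule sq)
    show "AE \<omega>' in M. \<bar>f1 \<omega>' - f2 \<omega>'\<bar> \<le> b1 + b2" using ae by eventually_elim linarith
  qed measurable
  have pw: "\<bar>(f1 \<omega>' - g \<omega>')\<^sup>2 - (f2 \<omega>' - g \<omega>')\<^sup>2\<bar> \<le> (1 + 1 / t) * (f1 \<omega>' - f2 \<omega>')\<^sup>2 + t * (f2 \<omega>' - g \<omega>')\<^sup>2" for \<omega>'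
  proof -
    define a b where "a = f1 \<omega>' - f2 \<omega>'" and "b = f2 \<omega>' - g \<omega>'"
    have "0 \<le> t * (\<bar>b\<bar> - \<bar>a\<bar> / t)\<^sup>2" using t by simp
    also have "\<dots> = t * b\<^sup>2 - 2 * \<bar>a * b\<bar> + a\<^sup>2 / t"
      using t by (simp add: power2_eq_square field_simps abs_mult)
    finally have ab: "2 * \<bar>a * b\<bar> \<le> t * b\<^sup>2 + a\<^sup>2 / t" by simp
    have "(f1 \<omega>' - g \<omega>')\<^sup>2 - (f2 \<omega>' - g \<omega>')\<^sup>2 = a\<^sup>2 + 2 * (a * b)"
      unfolding a_def b_def by (simp add: power2_eq_square algebra_simps)
    then have "\<bar>(f1 \<omega>' - g \<omega>')\<^sup>2 - (f2 \<omega>' - g \<omega>')\<^sup>2\<bar> \<le> a\<^sup>2 + 2 * \<bar>a * b\<bar>"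
      using zero_le_power2[of a] by linarith
    also have "\<dots> \<le> a\<^sup>2 + (t * b\<^sup>2 + a\<^sup>2 / t)" using ab by simp
    also have "\<dots> = (1 + 1 / t) * a\<^sup>2 + t * b\<^sup>2" by (simp add: algebra_simps)
    finally show ?thesis by (simp add: a_def b_def)
  qed
  have "\<bar>L1 \<omega> - L2 \<omega>\<bar> = \<bar>\<integral>\<omega>'. (f1 \<omega>' - g \<omega>')\<^sup>2 - (f2 \<omega>' - g \<omega>')\<^sup>2 \<partial>M\<bar>"
    using i1 i2 by (simp add: L1_eq[OF \<omega>] L2_eq f1_def f2_def g_def)
  also have "\<dots> \<le> (\<integral>\<omega>'. \<bar>(f1 \<omega>' - g \<omega>')\<^sup>2 - (f2 \<omega>' - g \<omega>')\<^sup>2\<bar> \<partial>M)" by (rule integral_abs_bound)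
  also have "\<dots> \<le> (\<integral>\<omega>'. (1 + 1 / t) * (f1 \<omega>' - f2 \<omega>')\<^sup>2 + t * (f2 \<omega>' - g \<omega>')\<^sup>2 \<partial>M)"
    using i1 i2 i12 pw by (intro integral_mono) auto
  also have "\<dots> = (1 + 1 / t) * (\<integral>\<omega>'. (f1 \<omega>' - f2 \<omega>')\<^sup>2 \<partial>M) + t * (\<integral>\<omega>'. (f2 \<omega>' - g \<omega>')\<^sup>2 \<partial>M)"
    using i2 i12 by simp
  finally have "ennreal \<bar>L1 \<omega> - L2 \<omega>\<bar> \<le> ennreal ((1 + 1 / t) * (\<integral>\<omega>'. (f1 \<omega>' - f2 \<omega>')\<^sup>2 \<partial>M) + t * (\<integral>\<omega>'. (f2 \<omega>' - g \<omega>')\<^sup>2 \<partial>M))"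
    by (rule ennreal_leI)
  also have "\<dots> = ennreal (1 + 1 / t) * (\<integral>\<^sup>+\<omega>'. ennreal ((f1 \<omega>' - f2 \<omega>')\<^sup>2) \<partial>M) + ennreal t * (\<integral>\<^sup>+\<omega>'. ennreal ((f2 \<omega>' - g \<omega>')\<^sup>2) \<partial>M)"
    using t i12 i2 by (subst (1 2) nn_integral_eq_integral) (auto simp: ennreal_mult[symmetric] ennreal_plus[symmetric] simp del: ennreal_plus)
  finally show ?thesis by (simp add: f1_def f2_def g_def)
qed

text \<open>The test point lives on its own copy of the outcome space, so Tonelli exchanges the
  integrals and a bound at each good point suffices.\<close>

lemma nn_integral_test_point:
  assumes h: "case_prod h \<in> borel_measurable (M \<Otimes>\<^sub>M M)" and b: "\<And>\<omega>'. good (x \<omega>') \<Longrightarrow> (\<integral>\<^sup>+\<omega>. h \<omega> \<omega>' \<partial>M) \<le> b"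
  shows "(\<integral>\<^sup>+\<omega>. \<integral>\<^sup>+\<omega>'. h \<omega> \<omega>' \<partial>M \<partial>M) \<le> b"
proof -
  interpret P: pair_sigma_finite M M ..
  have "(\<integral>\<^sup>+\<omega>. \<integral>\<^sup>+\<omega>'. h \<omega> \<omega>' \<partial>M \<partial>M) = (\<integral>\<^sup>+\<omega>'. \<integral>\<^sup>+\<omega>. h \<omega> \<omega>' \<partial>M \<partial>M)"
    using P.Fubini'[OF h] by simp
  also have "\<dots> \<le> (\<integral>\<^sup>+\<omega>'. b \<partial>M)"
    using x_good by (intro nn_integral_mono_AE) (auto elim!: eventually_mono intro: b)
  finally show ?thesis by (simp add: emeasure_space_1)
qed

text \<open>Independence of the weights from the joint vector of the other variables replaces them
  by a separate integration variable over \<open>WM\<close>, the situation of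
  \<open>diff_bound\<close>.\<close>

lemma weighted_difference:
  assumes G: "G \<in> sets WM" and c1: "0 < c1"
    and low: "\<And>W' u. W' \<in> G \<Longrightarrow> real m * (c1 * (\<Sum>j<n. (u j)\<^sup>2)) \<le> (\<Sum>i<m. (\<Sum>j<n. \<phi> j (V i W') * u j)\<^sup>2)"
    and z: "good z"
  shows "(\<integral>\<^sup>+\<omega>. indicator G (Wv \<omega>) * ennreal ((F1 (Wv \<omega>) (y \<omega>) z - F2 (y \<omega>) z)\<^sup>2) \<partial>M)
    \<le> ennreal (Cy * K0 / c1\<^sup>2 * (real n / real m))"
proof -
  let ?S = "mat_algebra m d" and ?T = "vec_algebra d \<Otimes>\<^sub>M vec_algebra n \<Otimes>\<^sub>M vec_algebra d"
  define g where "g \<omega> = (vec_entries d (\<beta> \<omega>), vec_entries n (\<eta> \<omega>), vec_entries d (x \<omega>))" for \<omega>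
  \<comment> \<open>Labels rebuilt from entries, as a measurable function on the product space where
    independence is stated.\<close>
  define Y where "Y t = labels X (Matrix.vec d (fst t)) (Matrix.vec n (fst (snd t)))" for t :: "(nat \<Rightarrow> real) \<times> (nat \<Rightarrow> real) \<times> (nat \<Rightarrow> real)"
  define H :: "(nat \<times> nat \<Rightarrow> real) \<Rightarrow> (nat \<Rightarrow> real) \<times> (nat \<Rightarrow> real) \<times> (nat \<Rightarrow> real) \<Rightarrow> ennreal"
    where "H W' t = indicator G W' * ennreal ((F1 W' (Y t) z - F2 (Y t) z)\<^sup>2)" for W' t
  have zc: "z \<in> carrier_vec d" using z by (simp add: good_def)
  have Yg: "Y (g \<omega>) = y \<omega>" if "\<omega> \<in> space M" for \<omega>
  proof -
    have "Matrix.vec d (vec_entries d (\<beta> \<omega>)) = \<beta> \<omega>" "Matrix.vec n (vec_entries n (\<eta> \<omega>)) = \<eta> \<omega>"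
      using \<beta>_vec(1)[OF that] \<eta>_vec(1)[OF that] by (auto simp: vec_entries_def)
    then show ?thesis by (simp add: Y_def g_def)
  qed
  have e1: "(\<lambda>p. fst p (i, l)) \<in> borel_measurable (?S \<Otimes>\<^sub>M ?T)" if "i < m" "l < d" for i l
    unfolding mat_algebra_def by (rule measurable_compose[OF measurable_fst measurable_component_singleton]) (use that in simp)
  have e2: "(\<lambda>p. Matrix.vec d (fst (snd p)) $ l) \<in> borel_measurable (?S \<Otimes>\<^sub>M ?T)" if "l < d" for l
  proof -
    have "(\<lambda>p. fst (snd p) l) \<in> borel_measurable (?S \<Otimes>\<^sub>M ?T)"
      by (rule measurable_compose[OF measurable_snd measurable_compose[OF measurable_fst]])
         (unfold vec_algebra_def, rule measurable_component_singleton, use that in simp)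
    then show ?thesis using that by simp
  qed
  have e3: "(\<lambda>p. Matrix.vec n (fst (snd (snd p))) $ j) \<in> borel_measurable (?S \<Otimes>\<^sub>M ?T)" if "j < n" for j
  proof -
    have "(\<lambda>p. fst (snd (snd p)) j) \<in> borel_measurable (?S \<Otimes>\<^sub>M ?T)"
      by (rule measurable_compose[OF measurable_snd measurable_compose[OF measurable_snd measurable_compose[OF measurable_fst]]])
         (unfold vec_algebra_def, rule measurable_component_singleton, use that in simp)
    then show ?thesis using that by simp
  qed
  have Ym: "(\<lambda>p. Y (snd p) $ j) \<in> borel_measurable (?S \<Otimes>\<^sub>M ?T)" if "j < n" for j
    unfolding Y_def by (rule labels_measurable[OF X _ e2 _ e3 that]) auto
  have Yc: "Y t \<in> carrier_vec n" for t unfolding Y_def by (rule labels_carrier[OF X]) simp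
  have F1m: "(\<lambda>p. F1 (fst p) (Y (snd p)) z) \<in> borel_measurable (?S \<Otimes>\<^sub>M ?T)"
    by (rule F1_measurable(1)[where Wf = fst]) (auto simp: zc Yc intro: e1 Ym)
  have F2m: "(\<lambda>p. F2 (Y (snd p)) z) \<in> borel_measurable (?S \<Otimes>\<^sub>M ?T)"
    by (rule F1_measurable(2)[where Wf = fst]) (auto simp: zc Yc intro: e1 Ym)
  have Gm: "(\<lambda>p. indicator G (fst p) :: ennreal) \<in> borel_measurable (?S \<Otimes>\<^sub>M ?T)"
    using G mat_algebra_eq by (intro measurable_compose[OF measurable_fst]) auto
  have Hm: "case_prod H \<in> borel_measurable (?S \<Otimes>\<^sub>M ?T)"
    unfolding case_prod_beta' H_def
    by (intro borel_measurable_times_ennreal Gm measurable_compose[OF _ measurable_ennreal] borel_measurable_power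
        borel_measurable_diff F1m F2m)
  have ym: "(\<lambda>\<omega>. y \<omega> $ j) \<in> borel_measurable M" if "j < n" for j
    by (rule labels_measurable[OF X \<beta>_vec \<eta>_vec that])
  have inner: "(\<lambda>\<omega>. ennreal ((F1 W' (y \<omega>) z - F2 (y \<omega>) z)\<^sup>2)) \<in> borel_measurable M" for W'
  proof (intro measurable_compose[OF _ measurable_ennreal] borel_measurable_power borel_measurable_diff)
    show "(\<lambda>\<omega>. F1 W' (y \<omega>) z) \<in> borel_measurable M"
      by (rule F1_measurable(1)[OF _ y_carrier ym, where Wf = "\<lambda>_. W'"]) (auto simp: zc)
    show "(\<lambda>\<omega>. F2 (y \<omega>) z) \<in> borel_measurable M"
      by (rule F1_measurable(2)[OF _ y_carrier ym, where Wf = "\<lambda>_. W'"]) (auto simp: zc)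
  qed
  have ind: "indep_pair M ?S Wv ?T g"
    using indep unfolding g_def[abs_def] .
  have "(\<integral>\<^sup>+\<omega>. indicator G (Wv \<omega>) * ennreal ((F1 (Wv \<omega>) (y \<omega>) z - F2 (y \<omega>) z)\<^sup>2) \<partial>M) = (\<integral>\<^sup>+\<omega>. H (Wv \<omega>) (g \<omega>) \<partial>M)"
    by (intro nn_integral_cong) (simp add: H_def Yg)
  also have "\<dots> = (\<integral>\<^sup>+W'. \<integral>\<^sup>+\<omega>. H W' (g \<omega>) \<partial>M \<partial>WM)"
    using nn_integral_indep_pair[OF prob_space_axioms ind Hm] unfolding WM_law .
  also have "\<dots> = (\<integral>\<^sup>+W'. indicator G W' * (\<integral>\<^sup>+\<omega>. ennreal ((F1 W' (y \<omega>) z - F2 (y \<omega>) z)\<^sup>2) \<partial>M) \<partial>WM)"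
  proof (rule nn_integral_cong)
    fix W'
    have "(\<integral>\<^sup>+\<omega>. H W' (g \<omega>) \<partial>M) = (\<integral>\<^sup>+\<omega>. indicator G W' * ennreal ((F1 W' (y \<omega>) z - F2 (y \<omega>) z)\<^sup>2) \<partial>M)"
      by (intro nn_integral_cong) (simp add: H_def Yg)
    then show "(\<integral>\<^sup>+\<omega>. H W' (g \<omega>) \<partial>M) = indicator G W' * (\<integral>\<^sup>+\<omega>. ennreal ((F1 W' (y \<omega>) z - F2 (y \<omega>) z)\<^sup>2) \<partial>M)"
      by (simp only: nn_integral_cmult[OF inner])
  qed
  also have "\<dots> \<le> ennreal (Cy * K0 / c1\<^sup>2 * (real n / real m))"
    by (rule diff_bound[OF G c1 low z])
  finally show ?thesis .
qed

lemma K0: "0 \<le> K0" and K2: "0 \<le> K2"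
  using C Cy by (simp_all add: K0_def K2_def)

text \<open>Markov's inequality is applied to the risk difference multiplied by the indicator of G,
  whose mean the previous bounds control; the complement of G is paid for separately.\<close>

lemma risk_concentration:
  assumes G: "G \<in> sets WM" and c1: "0 < c1"
    and low: "\<And>W' u. W' \<in> G \<Longrightarrow> real m * (c1 * (\<Sum>j<n. (u j)\<^sup>2)) \<le> (\<Sum>i<m. (\<Sum>j<n. \<phi> j (V i W') * u j)\<^sup>2)"
    and t: "0 < t" and \<gamma>: "0 < \<gamma>"
  shows "prob {\<omega> \<in> space M. \<gamma> < \<bar>L1 \<omega> - L2 \<omega>\<bar>}
    \<le> measure WM (space WM - G) + ((1 + 1 / t) * (Cy * K0 / c1\<^sup>2 * (real n / real m)) + t * K2) / \<gamma>"
proof -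
  note [measurable] = joint_measurable L_measurable
  define b where "b = (1 + 1 / t) * (Cy * K0 / c1\<^sup>2 * (real n / real m)) + t * K2"
  have b: "0 \<le> b" unfolding b_def using t Cy K0 K2 by simp
  have Wvm [measurable]: "Wv \<in> M \<rightarrow>\<^sub>M WM"
    using indep mat_algebra_eq unfolding indep_pair_def by (auto cong: measurable_cong_sets)
  note [measurable] = G
  define D where "D \<omega> \<omega>' = ennreal ((F1 (Wv \<omega>) (y \<omega>) (x \<omega>') - F2 (y \<omega>) (x \<omega>'))\<^sup>2)" for \<omega> \<omega>'
  define E where "E \<omega> \<omega>' = ennreal ((F2 (y \<omega>) (x \<omega>') - \<beta> \<omega> \<bullet> x \<omega>')\<^sup>2)" for \<omega> \<omega>'
  have Dm: "case_prod D \<in> borel_measurable (M \<Otimes>\<^sub>M M)"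
    unfolding D_def case_prod_beta' by measurable
  have Em: "case_prod E \<in> borel_measurable (M \<Otimes>\<^sub>M M)"
    unfolding E_def case_prod_beta' by measurable
  have GDm: "(\<lambda>(\<omega>, \<omega>'). indicator G (Wv \<omega>) * D \<omega> \<omega>') \<in> borel_measurable (M \<Otimes>\<^sub>M M)"
    unfolding D_def case_prod_beta' by measurable
  have sec: "D \<omega> \<in> borel_measurable M" if "\<omega> \<in> space M" for \<omega>
    using measurable_compose[OF measurable_Pair1'[OF that] Dm] by simp
  have iD [measurable]: "(\<lambda>\<omega>. \<integral>\<^sup>+\<omega>'. D \<omega> \<omega>' \<partial>M) \<in> borel_measurable M"
    and iE [measurable]: "(\<lambda>\<omega>. \<integral>\<^sup>+\<omega>'. E \<omega> \<omega>' \<partial>M) \<in> borel_measurable M"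
    using Dm Em by (auto intro!: borel_measurable_nn_integral)
  define U where "U \<omega> = indicator G (Wv \<omega>) * ennreal \<bar>L1 \<omega> - L2 \<omega>\<bar>" for \<omega>
  have Um [measurable]: "U \<in> borel_measurable M" unfolding U_def[abs_def] by measurable
  have "(\<integral>\<^sup>+\<omega>. U \<omega> \<partial>M) \<le> (\<integral>\<^sup>+\<omega>. ennreal (1 + 1 / t) * (\<integral>\<^sup>+\<omega>'. indicator G (Wv \<omega>) * D \<omega> \<omega>' \<partial>M) + ennreal t * (\<integral>\<^sup>+\<omega>'. E \<omega> \<omega>' \<partial>M) \<partial>M)"
  proof (rule nn_integral_mono)
    fix \<omega> assume \<omega>: "\<omega> \<in> space M"
    show "U \<omega> \<le> ennreal (1 + 1 / t) * (\<integral>\<^sup>+\<omega>'. indicator G (Wv \<omega>) * D \<omega> \<omega>' \<partial>M) + ennreal t * (\<integral>\<^sup>+\<omega>'. E \<omega> \<omega>' \<partial>M)"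
      using risk_difference_le[OF \<omega> t] unfolding U_def D_def E_def
      by (cases "Wv \<omega> \<in> G") simp_all
  qed
  also have "\<dots> = ennreal (1 + 1 / t) * (\<integral>\<^sup>+\<omega>. \<integral>\<^sup>+\<omega>'. indicator G (Wv \<omega>) * D \<omega> \<omega>' \<partial>M \<partial>M) + ennreal t * (\<integral>\<^sup>+\<omega>. \<integral>\<^sup>+\<omega>'. E \<omega> \<omega>' \<partial>M \<partial>M)"
  proof -
    have [measurable]: "(\<lambda>\<omega>. \<integral>\<^sup>+\<omega>'. indicator G (Wv \<omega>) * D \<omega> \<omega>' \<partial>M) \<in> borel_measurable M"
      using GDm by (rule borel_measurable_nn_integral)
    show ?thesis by (simp add: nn_integral_add nn_integral_cmult)
  qed
  also have "\<dots> \<le> ennreal (1 + 1 / t) * ennreal (Cy * K0 / c1\<^sup>2 * (real n / real m)) + ennreal t * ennreal K2"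
  proof (intro add_mono mult_left_mono nn_integral_test_point GDm Em)
    show "(\<integral>\<^sup>+\<omega>. indicator G (Wv \<omega>) * D \<omega> \<omega>' \<partial>M) \<le> ennreal (Cy * K0 / c1\<^sup>2 * (real n / real m))" if "good (x \<omega>')" for \<omega>'
      unfolding D_def by (rule weighted_difference[OF G c1 low that])
    show "(\<integral>\<^sup>+\<omega>. E \<omega> \<omega>' \<partial>M) \<le> ennreal K2" if "good (x \<omega>')" for \<omega>'
      unfolding E_def by (rule kernel_risk_bound[OF that])
  qed auto
  also have "\<dots> = ennreal b"
  proof -
    have "0 \<le> Cy * K0 / c1\<^sup>2 * (real n / real m)" using Cy K0 by simp
    then show ?thesis
      unfolding b_def using t K2 by (simp only: ennreal_plus ennreal_mult mult_nonneg_nonneg add_nonneg_nonneg divide_nonneg_nonneg zero_le_one less_imp_le)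
  qed
  finally have Ub: "(\<integral>\<^sup>+\<omega>. U \<omega> \<partial>M) \<le> ennreal b" .
  define A1 A2 where "A1 = {\<omega> \<in> space M. Wv \<omega> \<notin> G}" and "A2 = {\<omega> \<in> space M. ennreal \<gamma> \<le> U \<omega>}"
  have [measurable]: "A1 \<in> sets M" "A2 \<in> sets M" unfolding A1_def A2_def by measurable
  have "emeasure M A2 \<le> ennreal (1 / \<gamma>) * (\<integral>\<^sup>+\<omega>. U \<omega> * indicator (space M) \<omega> \<partial>M)"
  proof -
    have "A2 = {\<omega> \<in> space M. 1 \<le> ennreal (1 / \<gamma>) * U \<omega>}"
    proof -
      have "ennreal \<gamma> \<le> v \<longleftrightarrow> 1 \<le> ennreal (1 / \<gamma>) * v" for v
      proof (cases v)
        case (real r)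
        then show ?thesis using \<gamma> by (simp add: ennreal_mult[symmetric] ennreal_1[symmetric] field_simps del: ennreal_1)
      next
        case top
        then show ?thesis using \<gamma> by (simp add: ennreal_mult_top)
      qed
      then show ?thesis by (simp add: A2_def)
    qed
    then show ?thesis by (simp only:) (rule nn_integral_Markov_inequality; measurable)
  qed
  also have "\<dots> \<le> ennreal (1 / \<gamma>) * ennreal b"
    using Ub by (intro mult_left_mono) (auto cong: nn_integral_cong)
  also have "\<dots> = ennreal (b / \<gamma>)"
    using \<gamma> b by (simp add: ennreal_mult[symmetric])
  finally have p2: "prob A2 \<le> b / \<gamma>"
    using \<gamma> b by (simp add: emeasure_eq_measure)
  have "prob A1 = measure (distr M WM Wv) (space WM - G)"
    by (subst measure_distr[OF Wvm]) (auto simp: A1_def intro!: arg_cong[where f = prob] dest: measurable_space[OF Wvm])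
  also have "distr M WM Wv = WM"
    unfolding WM_law[symmetric] by (intro distr_cong refl) (simp add: mat_algebra_eq WM_law)
  finally have p1: "prob A1 = measure WM (space WM - G)" .
  have "{\<omega> \<in> space M. \<gamma> < \<bar>L1 \<omega> - L2 \<omega>\<bar>} \<subseteq> A1 \<union> A2"
    by (auto simp: A1_def A2_def U_def indicator_def intro: ennreal_leI)
  then have "prob {\<omega> \<in> space M. \<gamma> < \<bar>L1 \<omega> - L2 \<omega>\<bar>} \<le> prob (A1 \<union> A2)"
    by (intro finite_measure_mono) auto
  also have "\<dots> \<le> prob A1 + prob A2" by (rule measure_Un_le) auto
  finally show ?thesis using p1 p2 by (simp add: b_def)
qed

lemma risk_difference_tail:
  assumes k: "2 \<le> k" "((1 + C) / 2 + 1) / (real k)\<^sup>2 \<le> c / 32" and t: "0 < t" and \<gamma>: "0 < \<gamma>"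
  shows "prob {\<omega> \<in> space M. \<gamma> < \<bar>L1 \<omega> - L2 \<omega>\<bar>}
    \<le> C / m + (4 * 2 ^ (k + 1)) ^ n * exp (- (real m * c\<^sup>2 / (4 * C)))
      + ((1 + 1 / t) * (Cy * K0 / (c / 32)\<^sup>2 * (real n / real m)) + t * K2) / \<gamma>"
proof -
  interpret S: iid_sample WM "gauss d" V m by (rule WM_iid)
  have C0: "0 < C" using C by simp
  obtain G where G: "G \<in> sets WM" "measure WM (space WM - G) \<le> C / m + (4 * 2 ^ (k + 1)) ^ n * exp (- (real m * c\<^sup>2 / (4 * C)))"
    "\<And>W' u. W' \<in> G \<Longrightarrow> real m * (c / 32 * (\<Sum>j<n. (u j)\<^sup>2)) \<le> (\<Sum>i<m. (\<Sum>j<n. \<phi> j (V i W') * u j)\<^sup>2)"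
    using S.good_event[OF feat_measurable features_fourth features_lower c C0 dims(1) k] by blast
  have c1: "0 < c / 32" using c by simp
  show ?thesis
    using risk_concentration[OF G(1) c1 G(3) t \<gamma>] G(2) by linarith
qed

end

subsection \<open>Ultra-wide limit\<close>

lemma col_append_column:
  assumes X: "X \<in> carrier_mat d n" and v: "v \<in> carrier_vec d"
  shows "dim_col (append_column X v) = Suc n" "col (append_column X v) n = v"
  using X v unfolding append_column_def by (auto simp: cols_length nth_append intro!: col_mat_of_cols[THEN trans])

text \<open>Orthonormality bounds norm deviations by e only through pairs of distinct columns, so n
  \<ge> 2 is what yields the bound for every column and e \<ge> 0; e < 1 excludes dimension 0, where
  every norm deviates by 1. The test point is the last column of the extended matrix, and its norm
  deviation is one term of the sum bounded by B^2.\<close>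

lemma rf_model_of_data:
  assumes low: "\<And>d n e (X :: nat \<Rightarrow> nat \<Rightarrow> real) u. 0 \<le> e \<Longrightarrow> e \<le> e1 \<Longrightarrow> real n * e ^ 4 \<le> e1 \<Longrightarrow>
      (\<And>j. j < n \<Longrightarrow> \<bar>sqrt (\<Sum>i<d. (X i j)\<^sup>2) - 1\<bar> \<le> e) \<Longrightarrow>
      (\<And>j k. j < n \<Longrightarrow> k < n \<Longrightarrow> j \<noteq> k \<Longrightarrow> \<bar>\<Sum>i<d. X i j * X i k\<bar> \<le> e) \<Longrightarrow>
      (\<And>v. (\<Sum>i<d. (\<Sum>j<n. X i j * v j)\<^sup>2) \<le> B\<^sup>2 * (\<Sum>j<n. (v j)\<^sup>2)) \<Longrightarrow>
      c * (\<Sum>j<n. (u j)\<^sup>2) \<le> (\<integral>w. (\<Sum>j<n. u j * \<sigma> (dotp d w (\<lambda>i. X i j)))\<^sup>2 \<partial>gauss d)"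
    and c: "0 < c" and lip: "\<And>x y. \<bar>\<sigma> x - \<sigma> y\<bar> \<le> L * \<bar>x - y\<bar>" and mean: "(\<integral>x. \<sigma> x \<partial>std_normal) = 0"
    and lam: "0 \<le> lam" and m: "1 \<le> m" and n: "2 \<le> n"
    and e: "e < 1" "e \<le> e1" "real n * e ^ 4 \<le> e1"
    and rand: "randomness_assumption M n d m sb se X W \<beta> \<eta> x"
    and data: "data_assumption M n d e B X x"
  shows "rf_model n d X \<sigma> L B c lam M m sb se W \<beta> \<eta> x"
proof -
  have X: "X \<in> carrier_mat d n" and on: "orthonormal_within e B X"
    and on': "AE \<omega> in M. orthonormal_within e B (append_column X (x \<omega>))"
    using data by (auto simp: data_assumption_def)
  have ortho: "\<bar>enorm (col X a) - 1\<bar> \<le> e" "\<bar>col X a \<bullet> col X b\<bar> \<le> e" if "a < n" "b < n" "a \<noteq> b" for a b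
    using on that X unfolding orthonormal_within_def by auto
  have nrm: "\<bar>enorm (col X a) - 1\<bar> \<le> e" if "a < n" for a
    using that n ortho(1)[of a "if a = 0 then 1 else 0"] by (auto split: if_splits)
  have col: "col X a \<in> carrier_vec d" "l < d \<Longrightarrow> col X a $ l = X $$ (l, a)" if "a < n" for a l
    using X that by auto
  have nrm': "\<bar>sqrt (\<Sum>i<d. (X $$ (i, a))\<^sup>2) - 1\<bar> \<le> e" if "a < n" for a
    using nrm[OF that] col[OF that] by (simp add: enorm_eq[of _ d])
  have e0: "0 \<le> e" using nrm[of 0] n by simp
  have op: "(\<Sum>i<d. (\<Sum>j<n. X $$ (i, j) * v j)\<^sup>2) \<le> B\<^sup>2 * (\<Sum>j<n. (v j)\<^sup>2)" for v
    using on by (intro spectral_norm_bound[OF X]) (simp add: orthonormal_within_def)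
  have inner: "\<bar>\<Sum>i<d. X $$ (i, a) * X $$ (i, b)\<bar> \<le> e" if "a < n" "b < n" "a \<noteq> b" for a b
    using ortho(2)[OF that] col that by (simp add: scalar_prod_sum[of _ d])
  have d: "0 < d"
  proof (rule ccontr)
    assume "\<not> 0 < d"
    then show False using nrm'[of 0] n e(1) by simp
  qed
  have features: "gaussian_features n d X \<sigma> L B c lam"
  proof
    show "(\<Sum>j<n. (enorm (col X j) - 1)\<^sup>2) \<le> B\<^sup>2"
      using on X by (simp add: orthonormal_within_def)
    show "c * (\<Sum>j<n. (u j)\<^sup>2) \<le> (\<integral>w. (\<Sum>j<n. u j * \<sigma> (dotp d w (\<lambda>i. X $$ (i, j))))\<^sup>2 \<partial>gauss d)" for u
      by (rule low[where X = "\<lambda>i j. X $$ (i, j)", OF e0 e(2,3) nrm' inner op])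
  qed (fact X op lip mean c lam)+
  interpret gaussian_features n d X \<sigma> L B c lam by (rule features)
  have xc: "x \<omega> \<in> carrier_vec d" if "\<omega> \<in> space M" for \<omega>
    using rand that by (auto simp: randomness_assumption_def random_vec_def)
  have "AE \<omega> in M. good (x \<omega>)"
    using on' AE_space
  proof eventually_elim
    case (elim \<omega>)
    note ap = col_append_column[OF X xc[OF elim(2)]]
    have "(enorm (x \<omega>) - 1)\<^sup>2 \<le> (\<Sum>a<Suc n. (enorm (col (append_column X (x \<omega>)) a) - 1)\<^sup>2)"
      unfolding sum.lessThan_Suc ap(2) by (simp add: sum_nonneg)
    also have "\<dots> \<le> B\<^sup>2" using elim(1) ap(1) by (simp add: orthonormal_within_def)
    finally show ?case using xc[OF elim(2)] by (simp add: good_def)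
  qed
  then show ?thesis
    using rand d n m by unfold_locales auto
qed

text \<open>With r = n / d1 and t = sqrt r the mean bound is of order sqrt r; division by r powr
  (1/2 - \<epsilon>/2) leaves r powr (\<epsilon>/2). The other two terms vanish because d1 outgrows
  every multiple of n.\<close>

lemma tail_bound_tendsto:
  fixes d1 :: "nat \<Rightarrow> nat" and \<epsilon> C q \<kappa> a b :: real
  assumes width: "\<forall>n\<ge>1. 1 \<le> d1 n" and ratio: "(\<lambda>n. real n / real (d1 n)) \<longlonglongrightarrow> 0"
    and \<epsilon>: "0 < \<epsilon>" and C: "0 \<le> C" and q: "1 \<le> q" and \<kappa>: "0 < \<kappa>" and ab: "0 \<le> a" "0 \<le> b"
  shows "(\<lambda>n. C / d1 n + q ^ n * exp (- (d1 n * \<kappa>))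
      + ((1 + 1 / sqrt (n / d1 n)) * (a * (n / d1 n)) + sqrt (n / d1 n) * b) / (n / d1 n) powr (1 / 2 - \<epsilon> / 2)) \<longlonglongrightarrow> 0"
proof -
  define r where "r n = real n / real (d1 n)" for n
  have r: "r \<longlonglongrightarrow> 0" using ratio by (simp add: r_def[abs_def])
  have r0: "0 \<le> r n" for n by (simp add: r_def)
  have rpos: "0 < r n" if "1 \<le> n" for n
    using width that by (auto simp: r_def Suc_le_eq intro!: divide_pos_pos)
  have pw: "(\<lambda>n. r n powr s) \<longlonglongrightarrow> 0" if "0 < s" for s
    using tendsto_powr2[OF r tendsto_const[of s] _ that] r0 by simp
  have 1: "(\<lambda>n. C / d1 n) \<longlonglongrightarrow> 0"
  proof (rule tendsto_sandwich[OF _ _ tendsto_const])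
    show "\<forall>\<^sub>F n in sequentially. 0 \<le> C / d1 n" using C by simp
    show "\<forall>\<^sub>F n in sequentially. C / d1 n \<le> C * r n"
      using eventually_ge_at_top[of 1]
    proof eventually_elim
      case (elim n)
      then have "C * 1 \<le> C * real n" using C by (intro mult_left_mono) auto
      then show ?case by (simp add: r_def divide_right_mono)
    qed
    show "(\<lambda>n. C * r n) \<longlonglongrightarrow> 0" using tendsto_mult_left[OF r, of C] by simp
  qed
  have lnq: "0 \<le> ln q" using q by simp
  have 2: "(\<lambda>n. q ^ n * exp (- (d1 n * \<kappa>))) \<longlonglongrightarrow> 0"
  proof (rule tendsto_sandwich[OF _ _ tendsto_const])
    show "\<forall>\<^sub>F n in sequentially. 0 \<le> q ^ n * exp (- (d1 n * \<kappa>))" using q by simp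
    \<comment> \<open>The extra 1 beside ln q gives d1 \<kappa> \<ge> n (ln q + 1), so the product
      is at most exp (- n).\<close>
    have "\<forall>\<^sub>F n in sequentially. r n < \<kappa> / (ln q + 1)"
      using order_tendstoD(2)[OF r] \<kappa> lnq by simp
    then show "\<forall>\<^sub>F n in sequentially. q ^ n * exp (- (d1 n * \<kappa>)) \<le> (exp (-1)) ^ n"
      using eventually_ge_at_top[of 1]
    proof eventually_elim
      case (elim n)
      have d: "0 < real (d1 n)" using width elim(2) by fastforce
      have "real n * (ln q + 1) \<le> d1 n * \<kappa>"
        using elim(1) d lnq unfolding r_def by (simp add: divide_less_eq less_divide_eq field_simps)
      then have "exp (real n * ln q + - (d1 n * \<kappa>)) \<le> exp (real n * (-1))" by (simp add: algebra_simps)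
      moreover have "exp (real n * ln q) = q ^ n" using q by (simp add: exp_of_nat_mult)
      ultimately show ?case unfolding exp_add exp_of_nat_mult by simp
    qed
    show "(\<lambda>n. exp (-1 :: real) ^ n) \<longlonglongrightarrow> 0" by (rule LIMSEQ_power_zero) simp
  qed
  have 3: "(\<lambda>n. ((1 + 1 / sqrt (r n)) * (a * r n) + sqrt (r n) * b) / r n powr (1 / 2 - \<epsilon> / 2)) \<longlonglongrightarrow> 0"
  proof (rule Lim_transform_eventually)
    show "\<forall>\<^sub>F n in sequentially. a * r n powr (1 / 2 + \<epsilon> / 2) + (a + b) * r n powr (\<epsilon> / 2)
        = ((1 + 1 / sqrt (r n)) * (a * r n) + sqrt (r n) * b) / r n powr (1 / 2 - \<epsilon> / 2)"
      using eventually_ge_at_top[of 1]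
    proof eventually_elim
      case (elim n)
      define v where "v = r n"
      have v: "0 < v" using rpos[OF elim] by (simp add: v_def)
      have s: "sqrt v * sqrt v = v" using v by simp
      have "(1 + 1 / sqrt v) * (a * v) + sqrt v * b = a * v + (a + b) * sqrt v"
        using v s by (simp add: field_simps)
      also have "\<dots> = a * v powr 1 + (a + b) * v powr (1 / 2)"
        using v by (simp add: powr_half_sqrt)
      finally have "((1 + 1 / sqrt v) * (a * v) + sqrt v * b) / v powr (1 / 2 - \<epsilon> / 2)
          = a * (v powr 1 / v powr (1 / 2 - \<epsilon> / 2)) + (a + b) * (v powr (1 / 2) / v powr (1 / 2 - \<epsilon> / 2))"
        by (simp only: add_divide_distrib times_divide_eq_right)
      also have "\<dots> = a * v powr (1 / 2 + \<epsilon> / 2) + (a + b) * v powr (\<epsilon> / 2)"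
        by (simp only: powr_diff[symmetric]) (simp add: add.commute)
      finally show ?case by (simp add: v_def)
    qed
    have "(\<lambda>n. a * r n powr (1 / 2 + \<epsilon> / 2) + (a + b) * r n powr (\<epsilon> / 2)) \<longlonglongrightarrow> a * 0 + (a + b) * 0"
      using \<epsilon> by (intro tendsto_intros pw) auto
    then show "(\<lambda>n. a * r n powr (1 / 2 + \<epsilon> / 2) + (a + b) * r n powr (\<epsilon> / 2)) \<longlonglongrightarrow> 0" by simp
  qed
  show ?thesis
    using tendsto_add[OF tendsto_add[OF 1 2] 3] by (simp add: r_def)
qed

theorem theorem2p16:
  fixes M :: "nat \<Rightarrow> 'w measure"
    and d0 d1 :: "nat \<Rightarrow> nat"
    and X :: "nat \<Rightarrow> real Matrix.mat"
    and W :: "nat \<Rightarrow> 'w \<Rightarrow> real Matrix.mat"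
    and \<beta> \<eta> x :: "nat \<Rightarrow> 'w \<Rightarrow> real Matrix.vec"
    and \<sigma> :: "real \<Rightarrow> real"
    and e :: "nat \<Rightarrow> real"
    and lip s\<^sub>\<beta> s\<^sub>\<epsilon> B lam \<epsilon> :: real
  assumes activation: "activation_assumption lip \<sigma>"
    and nonlinear: "\<not> linear \<sigma>"
    and variances: "0 \<le> s\<^sub>\<beta>" "0 \<le> s\<^sub>\<epsilon>"
    and ridge: "0 \<le> lam"
    and width: "\<forall>n\<ge>1. 1 \<le> d1 n"
    and randomness:
      "\<forall>n\<ge>1. randomness_assumption (M n) n (d0 n) (d1 n) s\<^sub>\<beta> s\<^sub>\<epsilon> (X n) (W n) (\<beta> n) (\<eta> n) (x n)"
    and data: "\<forall>n\<ge>1. data_assumption (M n) n (d0 n) (e n) B (X n) (x n)"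
    and e_small: "(\<lambda>n. real n * e n ^ 4) \<longlonglongrightarrow> 0"
    and ultra_wide: "(\<lambda>n. real n / real (d1 n)) \<longlonglongrightarrow> 0"
    and \<epsilon>: "0 < \<epsilon>" "\<epsilon> < 1 / 2"
  shows "\<exists>g \<in> o(\<lambda>n. (real n / real (d1 n)) powr (1 / 2 - \<epsilon>)).
    (\<lambda>n. measure (M n) {\<omega> \<in> space (M n).
        \<bar>rf_test_error (M n) (x n) \<sigma> lam (X n) (W n \<omega>) (\<beta> n \<omega>) (\<eta> n \<omega>)
          - kernel_test_error (M n) (x n) \<sigma> lam (X n) (\<beta> n \<omega>) (\<eta> n \<omega>)\<bar> \<le> g n}) \<longlonglongrightarrow> 1"
proof -
  have lips: "lip-lipschitz_on UNIV \<sigma>" and mean: "(\<integral>z. \<sigma> z \<partial>std_normal) = 0"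
    using activation by (auto simp: activation_assumption_def)
  have lip: "\<bar>\<sigma> u - \<sigma> v\<bar> \<le> lip * \<bar>u - v\<bar>" for u v
    using lipschitz_onD[OF lips, of u v] by (simp add: dist_real_def)
  obtain c e1 where c: "0 < c" and e1: "0 < e1"
    and low: "\<And>d n e (X :: nat \<Rightarrow> nat \<Rightarrow> real) u. 0 \<le> e \<Longrightarrow> e \<le> e1 \<Longrightarrow> real n * e ^ 4 \<le> e1 \<Longrightarrow>
      (\<And>j. j < n \<Longrightarrow> \<bar>sqrt (\<Sum>i<d. (X i j)\<^sup>2) - 1\<bar> \<le> e) \<Longrightarrow>
      (\<And>j k. j < n \<Longrightarrow> k < n \<Longrightarrow> j \<noteq> k \<Longrightarrow> \<bar>\<Sum>i<d. X i j * X i k\<bar> \<le> e) \<Longrightarrow>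
      (\<And>v. (\<Sum>i<d. (\<Sum>j<n. X i j * v j)\<^sup>2) \<le> B\<^sup>2 * (\<Sum>j<n. (v j)\<^sup>2)) \<Longrightarrow>
      c * (\<Sum>j<n. (u j)\<^sup>2) \<le> (\<integral>w. (\<Sum>j<n. u j * \<sigma> (dotp d w (\<lambda>i. X i j)))\<^sup>2 \<partial>gauss d)"
    using kernel_lower_bound[OF lip mean nonlinear, where B = B] by blast
  \<comment> \<open>The sequence e itself is eventually small because \<open>e n ^ 4\<close> is at
    most n times itself; 1 / 2 keeps it below 1 for \<open>rf_model_of_data\<close>.\<close>
  define \<delta> where "\<delta> = min e1 (1 / 2)"
  have \<delta>: "0 < \<delta>" using e1 by (simp add: \<delta>_def)
  have model: "\<forall>\<^sub>F n in sequentially. rf_model n (d0 n) (X n) \<sigma> lip B c lam (M n) (d1 n) s\<^sub>\<beta> s\<^sub>\<epsilon> (W n) (\<beta> n) (\<eta> n) (x n)"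
    using order_tendstoD(2)[OF e_small zero_less_power[OF \<delta>], of 4] order_tendstoD(2)[OF e_small e1] eventually_ge_at_top[of 2]
  proof eventually_elim
    case (elim n)
    have "1 * e n ^ 4 \<le> real n * e n ^ 4" using elim(3) by (intro mult_right_mono) auto
    then have "e n ^ 4 < \<delta> ^ 4" using elim(1) by linarith
    then have "e n < \<delta>" using \<delta> by (intro power_less_imp_less_base[of "e n" 4]) auto
    then show ?case
      using elim(2,3) width randomness data lip mean ridge c
      by (intro rf_model_of_data[where e = "e n" and ?e1.0 = e1] low) (auto simp: \<delta>_def)
  qed
  \<comment> \<open>The exported locale constants take only lip, B, c and the standard deviations as
    arguments: they are the same for all n.\<close>
  define C1 where "C1 = gaussian_features.C lip B"
  define a where "a = rf_model.Cy B s\<^sub>\<beta> s\<^sub>\<epsilon> * gaussian_features.K0 lip B c / (c / 32)\<^sup>2"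
  define b where "b = rf_model.K2 lip B c s\<^sub>\<beta> s\<^sub>\<epsilon>"
  \<comment> \<open>The signs are facts of the locale, so any single n with an instance provides
    them.\<close>
  have const_bounds: "1 \<le> C1" "0 \<le> a" "0 \<le> b"
  proof -
    obtain n where "rf_model n (d0 n) (X n) \<sigma> lip B c lam (M n) (d1 n) s\<^sub>\<beta> s\<^sub>\<epsilon> (W n) (\<beta> n) (\<eta> n) (x n)"
      using eventually_happens'[OF sequentially_bot model] by blast
    then interpret rf_model n "d0 n" "X n" \<sigma> lip B c lam "M n" "d1 n" s\<^sub>\<beta> s\<^sub>\<epsilon> "W n" "\<beta> n" "\<eta> n" "x n" .
    show "1 \<le> C1" "0 \<le> a" "0 \<le> b"
      using C Cy K0 K2 unfolding C1_def a_def b_def by auto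
  qed
  obtain k :: nat where k: "2 \<le> k" "((1 + C1) / 2 + 1) / (real k)\<^sup>2 \<le> c / 32"
  proof -
    obtain j :: nat where j: "((1 + C1) / 2 + 1) / (c / 32) \<le> real j" using real_arch_simple by blast
    have "real j \<le> (real (j + 2))\<^sup>2" by (simp add: power2_eq_square algebra_simps)
    then have "((1 + C1) / 2 + 1) / (c / 32) \<le> (real (j + 2))\<^sup>2" using j by linarith
    then have "((1 + C1) / 2 + 1) / (real (j + 2))\<^sup>2 \<le> c / 32" using c by (simp add: divide_le_eq mult.commute)
    then show ?thesis using that[of "j + 2"] by simp
  qed
  define r where "r n = real n / real (d1 n)" for n
  \<comment> \<open>Halfway between the exponents 1/2 and 1/2 - \<epsilon>: above the mean bound by
    a factor r powr (- \<epsilon>/2) for Markov's inequality, below the target by r powr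
    (\<epsilon>/2) for the little-o.\<close>
  define g where "g n = r n powr (1 / 2 - \<epsilon> / 2)" for n
  define err where "err n = C1 / d1 n + (4 * 2 ^ (k + 1)) ^ n * exp (- (d1 n * (c\<^sup>2 / (4 * C1))))
      + ((1 + 1 / sqrt (r n)) * (a * r n) + sqrt (r n) * b) / g n" for n
  define D where "D n \<omega> = \<bar>rf_test_error (M n) (x n) \<sigma> lam (X n) (W n \<omega>) (\<beta> n \<omega>) (\<eta> n \<omega>)
      - kernel_test_error (M n) (x n) \<sigma> lam (X n) (\<beta> n \<omega>) (\<eta> n \<omega>)\<bar>" for n \<omega>
  have rpos: "0 < r n" if "1 \<le> n" for n
    using width that by (auto simp: r_def Suc_le_eq intro!: divide_pos_pos)
  have q: "(1 :: real) \<le> 4 * 2 ^ (k + 1)" using one_le_power[of "2 :: real" "k + 1"] by linarith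
  have err: "err \<longlonglongrightarrow> 0"
    unfolding err_def r_def g_def
    by (rule tail_bound_tendsto[OF width ultra_wide \<epsilon>(1)]) (use const_bounds c q in auto)
  have bounds: "\<forall>\<^sub>F n in sequentially. 1 - err n \<le> measure (M n) {\<omega> \<in> space (M n). D n \<omega> \<le> g n} \<and>
      measure (M n) {\<omega> \<in> space (M n). D n \<omega> \<le> g n} \<le> 1"
    using model eventually_ge_at_top[of 1]
  proof eventually_elim
    case (elim n)
    interpret R: rf_model n "d0 n" "X n" \<sigma> lip B c lam "M n" "d1 n" s\<^sub>\<beta> s\<^sub>\<epsilon> "W n" "\<beta> n" "\<eta> n" "x n"
      by (rule elim(1))
    have D: "D n \<omega> = \<bar>R.L1 \<omega> - R.L2 \<omega>\<bar>" for \<omega> by (simp add: D_def R.L1_def R.L2_def)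
    have sq: "0 < sqrt (r n)" "0 < g n" using rpos[OF elim(2)] by (simp_all add: g_def)
    have "R.prob {\<omega> \<in> space (M n). g n < D n \<omega>} \<le> err n"
      using R.risk_difference_tail[OF k[unfolded C1_def] sq]
      unfolding D err_def r_def a_def b_def C1_def by (simp add: mult_ac)
    \<comment> \<open>Passing to the complement needs the event to be measurable, hence
      \<open>L_measurable\<close>.\<close>
    moreover have "R.prob {\<omega> \<in> space (M n). \<not> D n \<omega> \<le> g n} = 1 - R.prob {\<omega> \<in> space (M n). D n \<omega> \<le> g n}"
      by (rule R.prob_neg) (use R.L_measurable in \<open>simp add: D\<close>)
    ultimately show ?case by (simp add: not_le)
  qed
  have "(\<lambda>n. measure (M n) {\<omega> \<in> space (M n). D n \<omega> \<le> g n}) \<longlonglongrightarrow> 1"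
  proof (rule tendsto_sandwich[OF _ _ _ tendsto_const])
    show "(\<lambda>n. 1 - err n) \<longlonglongrightarrow> 1" using tendsto_diff[OF tendsto_const[of 1] err] by simp
  qed (use bounds in \<open>auto elim: eventually_mono\<close>)
  moreover have "g \<in> o(\<lambda>n. (real n / real (d1 n)) powr (1 / 2 - \<epsilon>))"
  proof (rule smalloI_tendsto)
    have "(\<lambda>n. r n powr (\<epsilon> / 2)) \<longlonglongrightarrow> 0"
      using tendsto_powr2[OF ultra_wide tendsto_const[of "\<epsilon> / 2"]] \<epsilon> by (simp add: r_def)
    then show "(\<lambda>n. g n / (real n / real (d1 n)) powr (1 / 2 - \<epsilon>)) \<longlonglongrightarrow> 0"
      unfolding g_def r_def by (simp add: powr_diff[symmetric])
    show "\<forall>\<^sub>F n in sequentially. (real n / real (d1 n)) powr (1 / 2 - \<epsilon>) \<noteq> 0"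
      using eventually_ge_at_top[of 1] 
    proof eventually_elim
      case (elim n)
      then show ?case using rpos[OF elim] by (simp add: r_def zero_less_divide_iff)
    qed
  qed
  ultimately show ?thesis unfolding D_def by blast
qed

end
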